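(* Let $k$ be a number field, $\mathcal C:y^2=f(x)$ a genus $2$ curve over $k$ ($f$ square-free of degree $6$) with Jacobian $\mathcal J$, and let $\varepsilon,\eta\in S^{(2)}(\mathcal J/k)$. Let $\varepsilon,\eta,\varepsilon+\eta$ be represented by models, and let $P_\varepsilon=\alpha_\varepsilon Q_\varepsilon^2$, $P_\eta=\alpha_\eta Q_\eta^2$, $P_{\varepsilon+\eta}=\alpha_{\varepsilon+\eta}Q_{\varepsilon+\eta}^2$ be the associated factorisations, with $\alpha_\varepsilon,\alpha_\eta,\alpha_{\varepsilon+\eta}\in L_{10}^\times$ and $Q_\varepsilon,Q_\eta,Q_{\varepsilon+\eta}$ quadratic forms in $L_{10}[x_1,\dots,x_4]$. Then the twisted $(2,2,2)$-form (defined up to multiplication by elements of $k^\times$) is given by $$\Phi_{\varepsilon,\eta}(\mathbf x,\mathbf y,\mathbf z)=\operatorname{Tr}_{L_{10}/k}\big(\mu\,Q_\varepsilon(\mathbf x)\,Q_\eta(\mathbf y)\,Q^*_{\varepsilon+\eta}(\mathbf z)\big)$$ for some $s\in k^\times$ and $\mu\in L_{10}^\times$ satisfying $\alpha_\varepsilon\alpha_\eta/\alpha_{\varepsilon+\eta}=s\mu^2$.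
   Context: Here $\mu$ in the formula is an element of $L_{10}^\times$ (not the group law, which is called $m$ below). Kummer surface. Write $f=f_6x^6+\dots+f_0$, $L=k[\theta]=k[x]/(f)$, $\theta_1,\dots,\theta_6$ the roots of $f$. $\mathcal K=\mathcal J/[-1]\subset\mathbb P^3$ is the quartic $F=P_2x_4^2-P_3x_4+P_4=0$, where $P_2=x_2^2-4x_1x_3$, $P_3=2(2f_0x_1^3+f_1x_1^2x_2+2f_2x_1^2x_3+f_3x_1x_2x_3+2f_4x_1x_3^2+f_5x_2x_3^2+2f_6x_3^3)$, $P_3^2-4P_2P_4=16\operatorname{Res}_t(x_1t^2-x_2t+x_3,f(t))$. A general point $[(x,y)+(x',y')-\kappa]$ of $\mathcal J$ ($\kappa$ canonical) maps to $(1:x+x':xx':x_4)$ with $x_4=(\tfrac12P_3(1,x+x',xx')-2yy')/(x-x')^2$. Selmer group. $S^{(2)}(\mathcal J/k)=\ker(H^1(k,\mathcal J[2])\to\prod_vH^1(k_v,\mathcal J))$. Its elements are represented by pairs $(\xi,m)\in L^\times\times k^\times$ with $N_{L/k}(\xi)=m^2$, modulo the pairs $(r\nu^2,r^3N_{L/k}(\nu))$, $r\in k^\times,\nu\in L^\times$: choose $\sqrt\xi\in(L\otimes_k\bar k)^\times$ with square $\xi$ and norm $m$; then $\sigma(\sqrt\xi)/\sqrt\xi$ is a function from the set of roots to $\mu_2$ with product $1$, and the class is given by mapping a function $x$ to $\sum_{x(\theta_i)=-1}[(\theta_i,0)]-\frac{d}{2}\kappa\in\mathcal J[2]$, where $d=\#\{i:x(\theta_i)=-1\}$.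 Models. A model is a pair $(G,H)$ of quadratic forms over $k$ in $\mathbf u=(u_0,\dots,u_5)^T$ with $G=u_0u_5+u_1u_4+u_2u_3$ and $\det(x\mathbf G-\mathbf H)=-f_6^{-1}f(x)$, where $\mathbf G,\mathbf H$ are the symmetric matrices with $G=\frac12\mathbf u^T\mathbf G\mathbf u$, $H=\frac12\mathbf u^T\mathbf H\mathbf u$. Identify $\mathbf u$ with the skew-symmetric $4\times4$ matrix $Z=(z_{ij})$ with $z_{12}=u_0,z_{13}=u_1,z_{14}=u_3,z_{23}=u_2,z_{24}=-u_4,z_{34}=u_5$, so $G=\operatorname{Pf}(Z)$; for $R\in\mathrm{GL}_4$ let $\wedge^2R\in \mathrm{GL}_6$ describe $Z\mapsto RZR^T$. $\mathrm{PGL}_4(k)$ acts on models by $H\mapsto(\det R)^{-1}H\circ\wedge^2R$; orbits are $k$-equivalence classes. Given $(\xi,m)$, define quadratic forms $Q^\xi_j$ by $\xi(u_0+u_1\theta+\dots+u_5\theta^5)^2=\sum_{j=0}^5Q^\xi_j\theta^j$, and put $G_\xi=Q^\xi_5/2$, $H_\xi=(f_6Q^\xi_4-f_5Q^\xi_5)/(2f_6)$. A model represents $\varepsilon$ (the class of $(\xi,m)$) if it is $k$-equivalent to a model $(G,H)$ for which there is $A\in\mathrm{GL}_6(k)$ with $\det A=m$, $G_\xi(\mathbf u)=G(A\mathbf u)$, $H_\xi(\mathbf u)=H(A\mathbf u)$. Every Selmer element is represented by a model, unique up to $k$-equivalence. Quartics $F_0,\dots,F_4$ of a model. Let $$\Lambda=\begin{pmatrix}0&0&x_4&0&x_3&x_2\\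 0&-x_4&0&x_3&0&-x_1\\ x_4&0&0&-x_2&-x_1&0\\ -x_3&x_2&-x_1&0&0&0\end{pmatrix},\qquad B=\Lambda\mathbf H\Lambda^T,$$ $Q_j=f_6^{-1}\sum_{i=j+1}^6f_i\,\mathbf u^T\mathbf G(\mathbf G^{-1}\mathbf H)^{i-j-1}\mathbf u$ for $0\le j\le5$. For a quadratic form $Q=\sum c_{ijkl}z_{ij}z_{kl}$ put $Q\star H=\sum c_{ijkl}(B_{ik}B_{jl}-B_{il}B_{jk})$. Put $E_r=\operatorname{adj}(\Lambda\mathbf G(\mathbf G^{-1}\mathbf H)^r\Lambda^T)_{44}/x_4^2$ and $F_0=(2f_6)^{-1}E_1$, $F_1=Q_2\star H-2f_4F_0$, $F_2=-Q_1\star H+f_3F_0$, $F_3=Q_0\star H$, $F_4=f_6E_3-(f_2Q_2-f_3Q_1+f_4Q_0)\star H-(f_1f_5-4f_2f_4+2f_3^2)F_0$. The twisted Kummer surface attached to the model is $\mathcal K_\varepsilon=\{F_0=0\}\subset\mathbb P^3$. $L_{10}$ and $P_\varepsilon$. $L_{10}=\operatorname{Map}_{\mathrm{Gal}(\bar k/k)}(\Gamma,\bar k)$ is the étale algebra of the set $\Gamma$ of the $10$ partitions of the roots of $f$ into two sets of $3$. Define $\lambda_i\in L_{10}$ by: at a partition corresponding to $f=f_6(x^3+r_2x^2+r_1x+r_0)(x^3+s_2x^2+s_1x+s_0)$, $(\lambda_1,\lambda_2,\lambda_3,\lambda_4)=(f_6(r_0s_2+r_2s_0),f_6(r_0+s_0),f_6(r_1+s_1),1)$.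 Put $P_\varepsilon=(\lambda_2^2-\lambda_1\lambda_3)F_0+\sum_{i=1}^4\lambda_iF_i$; it factors as $\alpha_\varepsilon Q_\varepsilon^2$ with $\alpha_\varepsilon\in L_{10}^\times$, $Q_\varepsilon\in L_{10}[x_1,\dots,x_4]$ quadratic. The dual of a nondegenerate quadratic form $Q(\mathbf x)=\frac12\mathbf x^TS\mathbf x$ ($S$ symmetric) is $Q^*(\mathbf z)=\frac12\mathbf z^TS^{-1}\mathbf z$. Twisted objects. $(\mathcal J_\varepsilon,\pi_\varepsilon)$ is a $2$-covering of class $\varepsilon$, with $\phi_\varepsilon:\mathcal J_\varepsilon\to\mathcal J$ an isomorphism over $\bar k$ such that $\pi_\varepsilon=[2]\circ\phi_\varepsilon$ and $\sigma(\phi_\varepsilon)\phi_\varepsilon^{-1}$ is translation by $\varepsilon_\sigma$, for a cocycle $(\varepsilon_\sigma)$ representing $\varepsilon$; $\iota_\varepsilon=\phi_\varepsilon^{-1}[-1]\phi_\varepsilon$, and $\mathcal J_\varepsilon/\iota_\varepsilon\cong\mathcal K_\varepsilon$. There is $\psi_\varepsilon\in\mathrm{GL}_4(\bar k)$ carrying $\mathcal K_\varepsilon$ to $\mathcal K$ compatibly with $\phi_\varepsilon$. Concretely, let $H_0$ be the model form $H_0=u_0u_4+u_1u_3-f_0u_5^2-f_1u_4u_5-f_2u_4^2-f_3u_3u_4-f_4u_3^2+\frac1{4f_6}(u_2-f_5u_3)^2$ (representing the identity); writing $H=(\det R)^{-1}H_0\circ\wedge^2R$ with $R\in\mathrm{GL}_4(\bar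 k)$, one takes $\psi_\varepsilon:\mathbf x\mapsto R^{-T}\mathbf x$ (up to scalars, the choices of $R$ correspond to composing $\phi_\varepsilon$ with translations by $\mathcal J[2]$). The twisted group law is a morphism $m:\mathcal J_\varepsilon\times\mathcal J_\eta\to\mathcal J_{\varepsilon+\eta}$ with $\phi_{\varepsilon+\eta}(m(P,Q))=\phi_\varepsilon(P)+\phi_\eta(Q)$, where $\phi_{\varepsilon+\eta}$ is chosen so that $m$ is defined over $k$. $(2,2,2)$-forms. Flynn's biquadratic forms $\Phi_{ij}(\mathbf x,\mathbf y)=\Phi_{ji}(\mathbf x,\mathbf y)$ (bidegree $(2,2)$, coefficients in $\mathbb Z[f_0,\dots,f_6]$) satisfy $\Phi_{ij}(x(P),x(Q))\propto x_i(P+Q)x_j(P-Q)+x_i(P-Q)x_j(P+Q)$ for $P,Q\in\mathcal J$, with constant independent of $i,j$. With $\Phi(\mathbf x,\mathbf y,\mathbf z)=\sum_{i,j}\Phi_{ij}(\mathbf x,\mathbf y)z_iz_j$, the twisted form $\Phi_{\varepsilon,\eta}$ is the scalar multiple with coefficients in $k$ of $\Phi(\psi_\varepsilon\mathbf x,\psi_\eta\mathbf y,\psi_{\varepsilon+\eta}^{-T}\mathbf z)$, where $\psi_\varepsilon,\psi_\eta,\psi_{\varepsilon+\eta}$ are compatible with $\phi_\varepsilon,\phi_\eta,\phi_{\varepsilon+\eta}$ as in the definition of $m$. It is characterised (up to $k^\times$) by $\Phi_{\varepsilon,\eta}(x(P);x(Q);\mathbf c)\propto(\sum_ic_ix_i(m(P,Q)))(\sum_jc_jx_j(m(P,\iota_\eta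 Q)))$. *)

theory Defs
  imports
    "HOL-Analysis.Analysis"
    "HOL-Computational_Algebra.Computational_Algebra"
    "HOL-Algebra.Free_Abelian_Groups"
begin

(* $ is vector indexing below *)
no_notation fps_nth (infixl \<open>$\<close> 75)

section \<open>Fields\<close>

text \<open>All fields live inside the complex numbers: a number field is a subfield of finite
  degree over the rationals, its algebraic closure is taken inside \<^typ>\<open>complex\<close>, and Galois
  automorphisms are extensional functions on that closure.\<close>

definition is_subfield :: "complex set \<Rightarrow> bool" where
  "is_subfield K \<longleftrightarrow> 0 \<in> K \<and> 1 \<in> K \<and>
     (\<forall>x\<in>K. \<forall>y\<in>K. x + y \<in> K \<and> x * y \<in> K) \<and> (\<forall>x\<in>K. - x \<in> K \<and> inverse x \<in> K)"

definition number_field :: "complex set \<Rightarrow> bool" where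
  "number_field K \<longleftrightarrow> is_subfield K \<and>
     (\<exists>B\<subseteq>K. finite B \<and> (\<forall>x\<in>K. \<exists>c :: complex \<Rightarrow> rat. x = (\<Sum>b\<in>B. of_rat (c b) * b)))"

definition poly_over :: "complex set \<Rightarrow> complex poly \<Rightarrow> bool" where
  "poly_over K p \<longleftrightarrow> (\<forall>i. coeff p i \<in> K)"

definition alg_cl :: "complex set \<Rightarrow> complex set" where
  "alg_cl K = {z. \<exists>p. p \<noteq> 0 \<and> poly_over K p \<and> poly p z = 0}"

definition gal :: "complex set \<Rightarrow> (complex \<Rightarrow> complex) set" where
  "gal K = {\<sigma> \<in> extensional (alg_cl K). bij_betw \<sigma> (alg_cl K) (alg_cl K) \<and>
     (\<forall>x\<in>alg_cl K. \<forall>y\<in>alg_cl K. \<sigma> (x + y) = \<sigma> x + \<sigma> y \<and> \<sigma> (x * y) = \<sigma> x * \<sigma> y) \<and>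
     (\<forall>x\<in>K. \<sigma> x = x)}"

text \<open>The pair \<open>(E, v)\<close> is a completion of \<open>K\<close> at a place: a field \<open>E\<close> containing \<open>K\<close>, with an
  absolute value \<open>v\<close> (archimedean or not, nontrivial on \<open>K\<close>) for which \<open>E\<close> is complete and \<open>K\<close> is
  dense.  The field \<open>E\<close> is again a subset of \<^typ>\<open>complex\<close>, but \<open>v\<close> is unrelated to the usual
  absolute value.  Nothing is lost for number fields: an algebraic closure of any completion of
  \<open>K\<close> has characteristic 0 and the cardinality of the continuum, so the inclusion of \<open>K\<close> in
  \<^typ>\<open>complex\<close> extends to an isomorphism of that algebraic closure with \<^typ>\<open>complex\<close>.\<close>

definition completion :: "complex set \<Rightarrow> complex set \<Rightarrow> (complex \<Rightarrow> real) \<Rightarrow> bool" where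
  "completion K E v \<longleftrightarrow> is_subfield E \<and> K \<subseteq> E \<and>
     (\<forall>x\<in>E. v x \<ge> 0 \<and> (v x = 0 \<longleftrightarrow> x = 0)) \<and>
     (\<forall>x\<in>E. \<forall>y\<in>E. v (x * y) = v x * v y \<and> v (x + y) \<le> v x + v y) \<and>
     (\<exists>x\<in>K. x \<noteq> 0 \<and> v x \<noteq> 1) \<and>
     (\<forall>x\<in>E. \<forall>r>0. \<exists>y\<in>K. v (x - y) < r) \<and>
     (\<forall>a :: nat \<Rightarrow> complex. range a \<subseteq> E \<and> (\<forall>r>0. \<exists>N. \<forall>m\<ge>N. \<forall>n\<ge>N. v (a m - a n) < r) \<longrightarrow>
        (\<exists>x\<in>E. (\<lambda>n. v (a n - x)) \<longlonglongrightarrow> 0))"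

section \<open>The curve and its Jacobian\<close>

text \<open>Points of the smooth projective model of \<open>y\<^sup>2 = f(x)\<close>, \<open>deg f = 6\<close>.  The point \<open>Inf s\<close>
  at infinity is the one where \<open>y/x\<^sup>3\<close> takes the value \<open>s\<close>, \<open>s\<^sup>2 = f\<^sub>6\<close>.\<close>

datatype curve_pt = Aff complex complex | Inf complex

primrec on_curve :: "complex poly \<Rightarrow> curve_pt \<Rightarrow> bool" where
  "on_curve f (Aff x y) \<longleftrightarrow> y^2 = poly f x"
| "on_curve f (Inf s) \<longleftrightarrow> s^2 = coeff f 6"

primrec coords :: "curve_pt \<Rightarrow> complex set" where
  "coords (Aff x y) = {x, y}"
| "coords (Inf s) = {s}"

primrec gal_pt :: "(complex \<Rightarrow> complex) \<Rightarrow> curve_pt \<Rightarrow> curve_pt" where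
  "gal_pt \<sigma> (Aff x y) = Aff (\<sigma> x) (\<sigma> y)"
| "gal_pt \<sigma> (Inf s) = Inf (\<sigma> s)"

definition curve_pts :: "complex poly \<Rightarrow> complex set \<Rightarrow> curve_pt set" where
  "curve_pts f K = {p. on_curve f p \<and> coords p \<subseteq> K}"

type_synonym divisor = "curve_pt \<Rightarrow>\<^sub>0 int"

definition div_deg :: "divisor \<Rightarrow> int" where
  "div_deg D = (\<Sum>p\<in>Poly_Mapping.keys D. Poly_Mapping.lookup D p)"

definition Div0 :: "complex poly \<Rightarrow> complex set \<Rightarrow> divisor set" where
  "Div0 f K = {D. Poly_Mapping.keys D \<subseteq> curve_pts f K \<and> div_deg D = 0}"

definition Div0_group :: "complex poly \<Rightarrow> divisor monoid" where
  "Div0_group f = (free_Abelian_group (curve_pts f UNIV))\<lparr>carrier := Div0 f UNIV\<rparr>"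

abbreviation poly_fls :: "complex poly \<Rightarrow> complex fls \<Rightarrow> complex fls" where
  "poly_fls p X \<equiv> poly (map_poly fls_const p) X"

text \<open>\<open>local_param f P X Y\<close>: the pair \<open>(X(t), Y(t))\<close> of Laurent series parametrises the curve near
  \<open>P\<close> by a uniformiser \<open>t\<close>.  At infinity the affine chart is \<open>(1/x, y/x\<^sup>3)\<close>.\<close>

primrec local_param :: "complex poly \<Rightarrow> curve_pt \<Rightarrow> complex fls \<Rightarrow> complex fls \<Rightarrow> bool" where
  "local_param f (Aff x y) X Y \<longleftrightarrow> Y^2 = poly_fls f X \<and>
     (\<exists>U V :: complex fps. X = fps_to_fls U \<and> Y = fps_to_fls V \<and>
        fps_nth U 0 = x \<and> fps_nth V 0 = y \<and> (fps_nth U 1 \<noteq> 0 \<or> fps_nth V 1 \<noteq> 0))"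
| "local_param f (Inf s) X Y \<longleftrightarrow> Y^2 = poly_fls f X \<and>
     (\<exists>U V :: complex fps. X = inverse (fps_to_fls U) \<and> Y = fps_to_fls V / fps_to_fls U ^ 3 \<and>
        fps_nth U 0 = 0 \<and> fps_nth V 0 = s \<and> fps_nth U 1 \<noteq> 0)"

text \<open>Divisors of the nonzero rational functions \<open>(a(x) + b(x) y)/c(x)\<close>.\<close>

definition principal_divs :: "complex poly \<Rightarrow> divisor set" where
  "principal_divs f = {D \<in> Div0 f UNIV. \<exists>a b c. c \<noteq> 0 \<and> (a \<noteq> 0 \<or> b \<noteq> 0) \<and>
     (\<forall>P\<in>curve_pts f UNIV. \<forall>X Y. local_param f P X Y \<longrightarrow>
        Poly_Mapping.lookup D P = fls_subdegree ((poly_fls a X + poly_fls b X * Y) / poly_fls c X))}"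

text \<open>\<open>jac f\<close> is the group of complex points.  For an algebraically closed field \<open>K\<close>, the points
  over \<open>K\<close> are the classes of the divisors supported on \<open>K\<close>-rational points.\<close>

definition jac :: "complex poly \<Rightarrow> divisor set monoid" where
  "jac f = Div0_group f Mod principal_divs f"

definition jac_class :: "complex poly \<Rightarrow> divisor \<Rightarrow> divisor set" where
  "jac_class f D = principal_divs f #>\<^bsub>Div0_group f\<^esub> D"

definition jac_pts :: "complex poly \<Rightarrow> complex set \<Rightarrow> divisor set set" where
  "jac_pts f K = jac_class f ` Div0 f K"

definition jac_two :: "complex poly \<Rightarrow> complex set \<Rightarrow> divisor set set" where
  "jac_two f K = {T \<in> jac_pts f K. T \<otimes>\<^bsub>jac f\<^esub> T = \<one>\<^bsub>jac f\<^esub>}"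

text \<open>The canonical class, represented by the sum of the two points at infinity.\<close>

definition canonical_div :: "complex poly \<Rightarrow> divisor" where
  "canonical_div f = frag_of (Inf (csqrt (coeff f 6))) + frag_of (Inf (- csqrt (coeff f 6)))"

text \<open>Action of \<open>\<sigma> \<in> gal K\<close> on the points over the algebraic closure of \<open>K\<close>; representing divisors
  outside the domain of \<open>\<sigma>\<close> are ignored.\<close>

definition gal_jac ::
  "complex poly \<Rightarrow> complex set \<Rightarrow> (complex \<Rightarrow> complex) \<Rightarrow> divisor set \<Rightarrow> divisor set" where
  "gal_jac f K \<sigma> c =
     (\<Union>D \<in> c \<inter> Div0 f (alg_cl K). jac_class f (frag_extend (\<lambda>p. frag_of (gal_pt \<sigma> p)) D))"

section \<open>Galois cohomology and the Selmer group\<close>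

text \<open>Continuity of a cocycle means that \<open>e \<sigma>\<close> depends only on the restriction of \<open>\<sigma>\<close> to some
  finite extension of \<open>k\<close>, i.e.\ to a finite set of algebraic numbers.\<close>

definition Z1 :: "complex set \<Rightarrow> complex poly \<Rightarrow> ((complex \<Rightarrow> complex) \<Rightarrow> divisor set) monoid" where
  "Z1 k f = \<lparr>carrier = {e \<in> gal k \<rightarrow>\<^sub>E jac_two f (alg_cl k).
       (\<forall>\<sigma>\<in>gal k. \<forall>\<tau>\<in>gal k.
          e (compose (alg_cl k) \<sigma> \<tau>) = e \<sigma> \<otimes>\<^bsub>jac f\<^esub> gal_jac f k \<sigma> (e \<tau>)) \<and>
       (\<exists>S \<subseteq> alg_cl k. finite S \<and>
          (\<forall>\<sigma>\<in>gal k. \<forall>\<tau>\<in>gal k. (\<forall>x\<in>S. \<sigma> x = \<tau> x) \<longrightarrow> e \<sigma> = e \<tau>))},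
     monoid.mult = (\<lambda>e h. \<lambda>\<sigma>\<in>gal k. e \<sigma> \<otimes>\<^bsub>jac f\<^esub> h \<sigma>),
     one = (\<lambda>\<sigma>\<in>gal k. \<one>\<^bsub>jac f\<^esub>)\<rparr>"

definition B1 :: "complex set \<Rightarrow> complex poly \<Rightarrow> ((complex \<Rightarrow> complex) \<Rightarrow> divisor set) set" where
  "B1 k f = {\<lambda>\<sigma>\<in>gal k. gal_jac f k \<sigma> T \<otimes>\<^bsub>jac f\<^esub> inv\<^bsub>jac f\<^esub> T | T. T \<in> jac_two f (alg_cl k)}"

definition H1 :: "complex set \<Rightarrow> complex poly \<Rightarrow> ((complex \<Rightarrow> complex) \<Rightarrow> divisor set) set monoid" where
  "H1 k f = Z1 k f Mod B1 k f"

text \<open>Local triviality: the restriction of the cocycle to the Galois group of the completion \<open>E\<close> is a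
  coboundary with values in the Jacobian over the algebraic closure of \<open>E\<close>.\<close>

definition selmer2 :: "complex set \<Rightarrow> complex poly \<Rightarrow> ((complex \<Rightarrow> complex) \<Rightarrow> divisor set) set set" where
  "selmer2 k f = {\<epsilon> \<in> carrier (H1 k f). \<forall>E v. completion k E v \<longrightarrow>
     (\<forall>e\<in>\<epsilon>. \<exists>P\<in>jac_pts f (alg_cl E). \<forall>\<sigma>\<in>gal E.
        e (restrict \<sigma> (alg_cl k)) = gal_jac f E \<sigma> P \<otimes>\<^bsub>jac f\<^esub> inv\<^bsub>jac f\<^esub> P)}"

text \<open>Elements of \<open>L = k[x]/(f)\<close> are given by polynomial representatives, and
  \<open>L \<otimes>\<^sub>k alg_cl k\<close> is identified with the functions on the roots of \<open>f\<close>.\<close>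

definition roots :: "complex poly \<Rightarrow> complex set" where
  "roots f = {\<theta>. poly f \<theta> = 0}"

definition sign_class :: "complex poly \<Rightarrow> (complex \<Rightarrow> complex) \<Rightarrow> divisor set" where
  "sign_class f x = (let S = {\<theta> \<in> roots f. x \<theta> = -1} in
     jac_class f ((\<Sum>\<theta>\<in>S. frag_of (Aff \<theta> 0)) - frag_cmul (int (card S) div 2) (canonical_div f)))"

definition pair_cocycle ::
  "complex set \<Rightarrow> complex poly \<Rightarrow> (complex \<Rightarrow> complex) \<Rightarrow> (complex \<Rightarrow> complex) \<Rightarrow> divisor set" where
  "pair_cocycle k f r =
     (\<lambda>\<sigma>\<in>gal k. sign_class f (\<lambda>\<theta>. \<sigma> (r (inv_into (alg_cl k) \<sigma> \<theta>)) / r \<theta>))"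

definition pair_represents ::
  "complex set \<Rightarrow> complex poly \<Rightarrow> complex poly \<Rightarrow> complex \<Rightarrow> ((complex \<Rightarrow> complex) \<Rightarrow> divisor set) set \<Rightarrow> bool"
where
  "pair_represents k f \<xi> m \<epsilon> \<longleftrightarrow>
     poly_over k \<xi> \<and> coprime \<xi> f \<and> m \<in> k - {0} \<and> (\<Prod>\<theta>\<in>roots f. poly \<xi> \<theta>) = m^2 \<and>
     (\<exists>r. (\<forall>\<theta>\<in>roots f. (r \<theta>)^2 = poly \<xi> \<theta>) \<and> (\<Prod>\<theta>\<in>roots f. r \<theta>) = m \<and>
          pair_cocycle k f r \<in> \<epsilon>)"

section \<open>Models\<close>

definition mat_over :: "complex set \<Rightarrow> complex^'n^'m \<Rightarrow> bool" where
  "mat_over K A \<longleftrightarrow> (\<forall>i j. A $ i $ j \<in> K)"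

definition GL :: "complex set \<Rightarrow> (complex^'n^'n) set" where
  "GL K = {A. invertible A \<and> mat_over K A}"

text \<open>The quadratic form with matrix \<open>M\<close>, normalised as one half of \<open>u\<^sup>T M u\<close>.\<close>

definition quad :: "complex^'n^'n \<Rightarrow> complex^'n \<Rightarrow> complex" where
  "quad M u = (\<Sum>i\<in>UNIV. \<Sum>j\<in>UNIV. M $ i $ j * u $ i * u $ j) / 2"

text \<open>In \<^typ>\<open>complex^6\<close> the coordinates \<open>u\<^sub>0, \<dots>, u\<^sub>5\<close> are \<open>u $ 1, \<dots>, u $ 6\<close>.\<close>

definition Gmat :: "complex^6^6" where
  "Gmat = vector [vector [0,0,0,0,0,1], vector [0,0,0,0,1,0], vector [0,0,0,1,0,0],
                  vector [0,0,1,0,0,0], vector [0,1,0,0,0,0], vector [1,0,0,0,0,0]]"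

definition is_model :: "complex set \<Rightarrow> complex poly \<Rightarrow> complex^6^6 \<Rightarrow> bool" where
  "is_model k f H \<longleftrightarrow> mat_over k H \<and> transpose H = H \<and>
     (\<forall>x. det (mat x ** Gmat - H) = - poly f x / coeff f 6)"

definition skew_of :: "complex^6 \<Rightarrow> complex^4^4" where
  "skew_of u = vector [vector [0, u$1, u$2, u$4], vector [- u$1, 0, u$3, - u$5],
                       vector [- u$2, - u$3, 0, u$6], vector [- u$4, u$5, - u$6, 0]]"

definition of_skew :: "complex^4^4 \<Rightarrow> complex^6" where
  "of_skew Z = vector [Z$1$2, Z$1$3, Z$2$3, Z$1$4, - Z$2$4, Z$3$4]"

definition wedge2 :: "complex^4^4 \<Rightarrow> complex^6 \<Rightarrow> complex^6" where
  "wedge2 R u = of_skew (R ** skew_of u ** transpose R)"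

definition k_equivalent :: "complex set \<Rightarrow> complex^6^6 \<Rightarrow> complex^6^6 \<Rightarrow> bool" where
  "k_equivalent k H H' \<longleftrightarrow> (\<exists>R\<in>GL k. \<forall>u. quad H' u = quad H (wedge2 R u) / det R)"

definition Qxi :: "complex poly \<Rightarrow> complex poly \<Rightarrow> nat \<Rightarrow> complex^6 \<Rightarrow> complex" where
  "Qxi f \<xi> j u = coeff ((\<xi> * [: u$1, u$2, u$3, u$4, u$5, u$6 :]^2) mod f) j"

definition model_represents ::
  "complex set \<Rightarrow> complex poly \<Rightarrow> complex^6^6 \<Rightarrow> ((complex \<Rightarrow> complex) \<Rightarrow> divisor set) set \<Rightarrow> bool"
where
  "model_represents k f H \<epsilon> \<longleftrightarrow> is_model k f H \<and>
     (\<exists>H' \<xi> m A. is_model k f H' \<and> k_equivalent k H H' \<and> pair_represents k f \<xi> m \<epsilon> \<and>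
        A \<in> GL k \<and> det A = m \<and>
        (\<forall>u. Qxi f \<xi> 5 u / 2 = quad Gmat (A *v u)) \<and>
        (\<forall>u. (coeff f 6 * Qxi f \<xi> 4 u - coeff f 5 * Qxi f \<xi> 5 u) / (2 * coeff f 6)
               = quad H' (A *v u)))"

definition H0form :: "complex poly \<Rightarrow> complex^6 \<Rightarrow> complex" where
  "H0form f u = u$1 * u$5 + u$2 * u$4 - coeff f 0 * (u$6)^2 - coeff f 1 * u$5 * u$6
     - coeff f 2 * (u$5)^2 - coeff f 3 * u$4 * u$5 - coeff f 4 * (u$4)^2
     + (u$3 - coeff f 5 * u$4)^2 / (4 * coeff f 6)"

section \<open>The quartics attached to a model\<close>

definition Lam :: "complex^4 \<Rightarrow> complex^6^4" where
  "Lam x = vector [vector [0, 0, x$4, 0, x$3, x$2],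
                   vector [0, - x$4, 0, x$3, 0, - x$1],
                   vector [x$4, 0, 0, - x$2, - x$1, 0],
                   vector [- x$3, x$2, - x$1, 0, 0, 0]]"

text \<open>\<open>GN H r\<close> is the symmetric matrix \<open>G (G\<^sup>-\<^sup>1 H)\<^sup>r\<close>.\<close>

definition GN :: "complex^6^6 \<Rightarrow> nat \<Rightarrow> complex^6^6" where
  "GN H r = Gmat ** (((**) (matrix_inv Gmat ** H)) ^^ r) (mat 1)"

text \<open>\<open>Q\<^sub>j(u) = u\<^sup>T (Qmat f H j) u\<close>.\<close>

definition Qmat :: "complex poly \<Rightarrow> complex^6^6 \<Rightarrow> nat \<Rightarrow> complex^6^6" where
  "Qmat f H j = (\<chi> a b. (\<Sum>i = j + 1..6. coeff f i * GN H (i - j - 1) $ a $ b) / coeff f 6)"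

text \<open>The \<open>a\<close>-th coordinate of \<open>u\<close> is the matrix entry \<open>z\<^sub>p\<^sub>q\<close> of \<open>skew_of u\<close> with \<open>p = zrow $ a\<close>
  and \<open>q = zcol $ a\<close>; since \<open>u\<^sub>4 = - z\<^sub>2\<^sub>4 = z\<^sub>4\<^sub>2\<close>, no signs are needed.\<close>

definition zrow :: "(4, 6) vec" where "zrow = vector [1, 1, 2, 1, 4, 3]"
definition zcol :: "(4, 6) vec" where "zcol = vector [2, 3, 3, 4, 2, 4]"

definition qstar :: "complex^6^6 \<Rightarrow> complex^4^4 \<Rightarrow> complex" where
  "qstar M B = (\<Sum>a\<in>UNIV. \<Sum>b\<in>UNIV. M $ a $ b *
     (B $ (zrow$a) $ (zrow$b) * B $ (zcol$a) $ (zcol$b) - B $ (zrow$a) $ (zcol$b) * B $ (zcol$a) $ (zrow$b)))"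

text \<open>The \<open>(i, j)\<close> entry of the adjugate is the cofactor of the entry \<open>(j, i)\<close>.\<close>

definition adjugate :: "complex^'n^'n \<Rightarrow> complex^'n^'n" where
  "adjugate M = (\<chi> i j. det (\<chi> a b. if a = j then (if b = i then 1 else 0) else M $ a $ b))"

text \<open>\<open>E\<^sub>r\<close>, and hence \<open>F\<^sub>0, \<dots>, F\<^sub>4\<close>, are polynomial functions of \<open>x\<close>, but the expression below
  computes them only where \<open>x\<^sub>4 \<noteq> 0\<close>.\<close>

definition Er :: "complex^6^6 \<Rightarrow> nat \<Rightarrow> complex^4 \<Rightarrow> complex" where
  "Er H r x = adjugate (Lam x ** GN H r ** transpose (Lam x)) $ 4 $ 4 / (x$4)^2"

definition QstarH :: "complex poly \<Rightarrow> complex^6^6 \<Rightarrow> nat \<Rightarrow> complex^4 \<Rightarrow> complex" where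
  "QstarH f H j x = qstar (Qmat f H j) (Lam x ** H ** transpose (Lam x))"

definition F0 :: "complex poly \<Rightarrow> complex^6^6 \<Rightarrow> complex^4 \<Rightarrow> complex" where
  "F0 f H x = Er H 1 x / (2 * coeff f 6)"
definition F1 :: "complex poly \<Rightarrow> complex^6^6 \<Rightarrow> complex^4 \<Rightarrow> complex" where
  "F1 f H x = QstarH f H 2 x - 2 * coeff f 4 * F0 f H x"
definition F2 :: "complex poly \<Rightarrow> complex^6^6 \<Rightarrow> complex^4 \<Rightarrow> complex" where
  "F2 f H x = - QstarH f H 1 x + coeff f 3 * F0 f H x"
definition F3 :: "complex poly \<Rightarrow> complex^6^6 \<Rightarrow> complex^4 \<Rightarrow> complex" where
  "F3 f H x = QstarH f H 0 x"
definition F4 :: "complex poly \<Rightarrow> complex^6^6 \<Rightarrow> complex^4 \<Rightarrow> complex" where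
  "F4 f H x = coeff f 6 * Er H 3 x
     - (coeff f 2 * QstarH f H 2 x - coeff f 3 * QstarH f H 1 x + coeff f 4 * QstarH f H 0 x)
     - (coeff f 1 * coeff f 5 - 4 * coeff f 2 * coeff f 4 + 2 * (coeff f 3)^2) * F0 f H x"

section \<open>The algebra \<open>L\<^sub>1\<^sub>0\<close>\<close>

definition partitions :: "complex poly \<Rightarrow> complex set set set" where
  "partitions f = {{A, B} | A B. A \<union> B = roots f \<and> A \<inter> B = {} \<and> card A = 3 \<and> card B = 3}"

definition L10 :: "complex set \<Rightarrow> complex poly \<Rightarrow> (complex set set \<Rightarrow> complex) set" where
  "L10 k f = {a \<in> partitions f \<rightarrow>\<^sub>E alg_cl k.
     \<forall>\<sigma>\<in>gal k. \<forall>\<gamma>\<in>partitions f. a ((`) ((`) \<sigma>) \<gamma>) = \<sigma> (a \<gamma>)}"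

definition L10_units :: "complex set \<Rightarrow> complex poly \<Rightarrow> (complex set set \<Rightarrow> complex) set" where
  "L10_units k f = {a \<in> L10 k f. \<forall>\<gamma>\<in>partitions f. a \<gamma> \<noteq> 0}"

text \<open>A quadratic form over \<open>L\<^sub>1\<^sub>0\<close> is given by its symmetric matrix (one for each partition).\<close>

definition L10_form :: "complex set \<Rightarrow> complex poly \<Rightarrow> (complex set set \<Rightarrow> complex^4^4) \<Rightarrow> bool" where
  "L10_form k f S \<longleftrightarrow> (\<forall>\<gamma>\<in>partitions f. transpose (S \<gamma>) = S \<gamma>) \<and>
     (\<forall>i j. (\<lambda>\<gamma>\<in>partitions f. S \<gamma> $ i $ j) \<in> L10 k f)"

definition L10_trace :: "complex poly \<Rightarrow> (complex set set \<Rightarrow> complex) \<Rightarrow> complex" where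
  "L10_trace f a = (\<Sum>\<gamma>\<in>partitions f. a \<gamma>)"

definition monic_with :: "complex set \<Rightarrow> complex poly" where
  "monic_with A = (\<Prod>a\<in>A. [:- a, 1:])"

definition lam1 :: "complex poly \<Rightarrow> complex set set \<Rightarrow> complex" where
  "lam1 f \<gamma> = coeff f 6 *
     (\<Sum>A\<in>\<gamma>. \<Sum>B\<in>\<gamma> - {A}. coeff (monic_with A) 0 * coeff (monic_with B) 2)"
definition lam2 :: "complex poly \<Rightarrow> complex set set \<Rightarrow> complex" where
  "lam2 f \<gamma> = coeff f 6 * (\<Sum>A\<in>\<gamma>. coeff (monic_with A) 0)"
definition lam3 :: "complex poly \<Rightarrow> complex set set \<Rightarrow> complex" where
  "lam3 f \<gamma> = coeff f 6 * (\<Sum>A\<in>\<gamma>. coeff (monic_with A) 1)"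

definition Peps :: "complex poly \<Rightarrow> complex^6^6 \<Rightarrow> complex set set \<Rightarrow> complex^4 \<Rightarrow> complex" where
  "Peps f H \<gamma> x = ((lam2 f \<gamma>)^2 - lam1 f \<gamma> * lam3 f \<gamma>) * F0 f H x
     + lam1 f \<gamma> * F1 f H x + lam2 f \<gamma> * F2 f H x + lam3 f \<gamma> * F3 f H x + F4 f H x"

text \<open>The factorisation \<open>P = \<alpha> Q\<^sup>2\<close>, where \<open>Q\<close> has matrix \<open>S\<close>.  The condition \<open>x\<^sub>4 \<noteq> 0\<close> avoids
  the spurious values of \<^const>\<open>Er\<close>; on the dense set where it holds, equality of the polynomial
  functions is equality of the polynomials.\<close>

definition factorisation ::
  "complex set \<Rightarrow> complex poly \<Rightarrow> complex^6^6 \<Rightarrow> (complex set set \<Rightarrow> complex) \<Rightarrow>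
   (complex set set \<Rightarrow> complex^4^4) \<Rightarrow> bool"
where
  "factorisation k f H \<alpha> S \<longleftrightarrow> \<alpha> \<in> L10_units k f \<and> L10_form k f S \<and>
     (\<forall>\<gamma>\<in>partitions f. \<forall>x. x$4 \<noteq> 0 \<longrightarrow> Peps f H \<gamma> x = \<alpha> \<gamma> * (quad (S \<gamma>) x)^2)"

section \<open>The Kummer map\<close>

primrec hX :: "curve_pt \<Rightarrow> complex" where "hX (Aff x y) = x" | "hX (Inf s) = 1"
primrec hY :: "curve_pt \<Rightarrow> complex" where "hY (Aff x y) = y" | "hY (Inf s) = s"
primrec hZ :: "curve_pt \<Rightarrow> complex" where "hZ (Aff x y) = 1" | "hZ (Inf s) = 0"

definition P2 :: "complex \<Rightarrow> complex \<Rightarrow> complex \<Rightarrow> complex" where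
  "P2 x1 x2 x3 = x2^2 - 4 * x1 * x3"

definition P3 :: "complex poly \<Rightarrow> complex \<Rightarrow> complex \<Rightarrow> complex \<Rightarrow> complex" where
  "P3 f x1 x2 x3 = 2 * (2 * coeff f 0 * x1^3 + coeff f 1 * x1^2 * x2 + 2 * coeff f 2 * x1^2 * x3
     + coeff f 3 * x1 * x2 * x3 + 2 * coeff f 4 * x1 * x3^2 + coeff f 5 * x2 * x3^2
     + 2 * coeff f 6 * x3^3)"

text \<open>The solution of \<open>P\<^sub>3\<^sup>2 - 4 P\<^sub>2 P\<^sub>4 = 16 Res\<^sub>t(x\<^sub>1 t\<^sup>2 - x\<^sub>2 t + x\<^sub>3, f(t))\<close>, written out.\<close>

definition P4 :: "complex poly \<Rightarrow> complex \<Rightarrow> complex \<Rightarrow> complex \<Rightarrow> complex" where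
  "P4 f x1 x2 x3 = (let f0 = coeff f 0; f1 = coeff f 1; f2 = coeff f 2; f3 = coeff f 3;
       f4 = coeff f 4; f5 = coeff f 5; f6 = coeff f 6 in
     (f1^2 - 4*f0*f2) * x1^4 - 4*f0*f3 * x1^3 * x2 - 2*f1*f3 * x1^3 * x3
     - 4*f0*f4 * x1^2 * x2^2 + 4*(f0*f5 - f1*f4) * x1^2 * x2 * x3
     + (f3^2 + 2*f1*f5 - 4*f2*f4 - 4*f0*f6) * x1^2 * x3^2
     - 4*f0*f5 * x1 * x2^3 + 4*(2*f0*f6 - f1*f5) * x1 * x2^2 * x3
     + 4*(f1*f6 - f2*f5) * x1 * x2 * x3^2 - 2*f3*f5 * x1 * x3^3
     - 4*f0*f6 * x2^4 - 4*f1*f6 * x2^3 * x3 - 4*f2*f6 * x2^2 * x3^2 - 4*f3*f6 * x2 * x3^3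
     + (f5^2 - 4*f4*f6) * x3^4)"

text \<open>If \<open>a, b\<close> are the roots of \<open>l t\<^sup>2 - l (a + b) t + l a b\<close>, its resultant with \<open>f\<close> is
  \<open>l\<^sup>6 f(a) f(b)\<close>.\<close>

lemma P4_resultant:
  assumes "degree f = 6"
  shows "(P3 f l (l*(a+b)) (l*a*b))^2 - 4 * P2 l (l*(a+b)) (l*a*b) * P4 f l (l*(a+b)) (l*a*b)
     = 16 * (l^6 * poly f a * poly f b)"
proof -
  have p: "poly f x = coeff f 0 + coeff f 1 * x + coeff f 2 * x^2 + coeff f 3 * x^3 + coeff f 4 * x^4
       + coeff f 5 * x^5 + coeff f 6 * x^6" for x
    by (simp add: poly_altdef assms eval_nat_numeral)
  show ?thesis unfolding p P2_def P3_def P4_def Let_def by algebra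
qed

text \<open>Coordinates on the Kummer surface of the class of \<open>p + q - \<kappa>\<close>.  The first case is the formula
  \<open>(1 : x + x' : x x' : x\<^sub>4)\<close> of a general point, homogenised with \<open>(X : Y : Z)\<close> of weights
  \<open>(1, 3, 1)\<close> so as to include points at infinity.  If \<open>p = q\<close> is not a Weierstrass point then
  \<open>P\<^sub>2 = 0\<close>, and \<open>x\<^sub>4\<close> is the solution of the equation \<open>P\<^sub>2 x\<^sub>4\<^sup>2 - P\<^sub>3 x\<^sub>4 + P\<^sub>4 = 0\<close> of the Kummer
  surface.  In the remaining case \<open>p + q\<close> is canonical and the image is that of the identity.\<close>

definition kummer_vec :: "complex poly \<Rightarrow> curve_pt \<Rightarrow> curve_pt \<Rightarrow> complex^4" where
  "kummer_vec f p q = (let x1 = hZ p * hZ q; x2 = hX p * hZ q + hX q * hZ p; x3 = hX p * hX q in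
     if P2 x1 x2 x3 \<noteq> 0
     then vector [x1, x2, x3, (P3 f x1 x2 x3 / 2 - 2 * hY p * hY q) / P2 x1 x2 x3]
     else if p = q \<and> hY p \<noteq> 0 then vector [x1, x2, x3, P4 f x1 x2 x3 / P3 f x1 x2 x3]
     else vector [0, 0, 0, 1])"

text \<open>\<open>v\<close> is a vector of homogeneous coordinates of the image of the point \<open>c\<close> of the Jacobian.\<close>

definition kummer_rep :: "complex poly \<Rightarrow> divisor set \<Rightarrow> complex^4 \<Rightarrow> bool" where
  "kummer_rep f c v \<longleftrightarrow> (\<exists>p\<in>curve_pts f UNIV. \<exists>q\<in>curve_pts f UNIV. \<exists>t. t \<noteq> 0 \<and>
     c = jac_class f (frag_of p + frag_of q - canonical_div f) \<and> v = t *s kummer_vec f p q)"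

section \<open>Flynn's biquadratic forms and their twists\<close>

inductive_set int_coeff_ring :: "complex poly \<Rightarrow> complex set" for f :: "complex poly" where
  "of_int n \<in> int_coeff_ring f"
| "coeff f i \<in> int_coeff_ring f"
| "x \<in> int_coeff_ring f \<Longrightarrow> y \<in> int_coeff_ring f \<Longrightarrow> x + y \<in> int_coeff_ring f"
| "x \<in> int_coeff_ring f \<Longrightarrow> y \<in> int_coeff_ring f \<Longrightarrow> x * y \<in> int_coeff_ring f"

definition form22_over :: "complex set \<Rightarrow> (complex^4 \<Rightarrow> complex^4 \<Rightarrow> complex) \<Rightarrow> bool" where
  "form22_over K B \<longleftrightarrow> (\<exists>C :: 4 \<Rightarrow> 4 \<Rightarrow> 4 \<Rightarrow> 4 \<Rightarrow> complex. (\<forall>a b c d. C a b c d \<in> K) \<and>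
     (\<forall>x y. B x y = (\<Sum>a\<in>UNIV. \<Sum>b\<in>UNIV. \<Sum>c\<in>UNIV. \<Sum>d\<in>UNIV.
        C a b c d * x$a * x$b * y$c * y$d)))"

definition form222_over :: "complex set \<Rightarrow> (complex^4 \<Rightarrow> complex^4 \<Rightarrow> complex^4 \<Rightarrow> complex) \<Rightarrow> bool" where
  "form222_over K \<Psi> \<longleftrightarrow> (\<exists>C :: 4 \<Rightarrow> 4 \<Rightarrow> complex^4 \<Rightarrow> complex^4 \<Rightarrow> complex.
     (\<forall>i j. form22_over K (C i j)) \<and>
     (\<forall>x y z. \<Psi> x y z = (\<Sum>i\<in>UNIV. \<Sum>j\<in>UNIV. C i j x y * z$i * z$j)))"

definition flynn_forms ::
  "complex set \<Rightarrow> complex poly \<Rightarrow> (4 \<Rightarrow> 4 \<Rightarrow> complex^4 \<Rightarrow> complex^4 \<Rightarrow> complex) \<Rightarrow> bool" where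
  "flynn_forms k f \<Phi> \<longleftrightarrow>
     (\<forall>i j. \<Phi> i j = \<Phi> j i \<and> form22_over (int_coeff_ring f) (\<Phi> i j)) \<and>
     (\<forall>P\<in>jac_pts f (alg_cl k). \<forall>Q\<in>jac_pts f (alg_cl k). \<forall>p q a b.
        kummer_rep f P p \<longrightarrow> kummer_rep f Q q \<longrightarrow>
        kummer_rep f (P \<otimes>\<^bsub>jac f\<^esub> Q) a \<longrightarrow> kummer_rep f (P \<otimes>\<^bsub>jac f\<^esub> inv\<^bsub>jac f\<^esub> Q) b \<longrightarrow>
        (\<exists>t. t \<noteq> 0 \<and> (\<forall>i j. \<Phi> i j p q = t * (a$i * b$j + b$i * a$j))))"

definition Phi222 ::
  "(4 \<Rightarrow> 4 \<Rightarrow> complex^4 \<Rightarrow> complex^4 \<Rightarrow> complex) \<Rightarrow> complex^4 \<Rightarrow> complex^4 \<Rightarrow> complex^4 \<Rightarrow> complex" where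
  "Phi222 \<Phi> x y z = (\<Sum>i\<in>UNIV. \<Sum>j\<in>UNIV. \<Phi> i j x y * z$i * z$j)"

text \<open>\<open>M\<close> acts on the Kummer surface as translation by the 2-torsion point \<open>T\<close>.\<close>

definition acts_as_translation ::
  "complex set \<Rightarrow> complex poly \<Rightarrow> divisor set \<Rightarrow> complex^4^4 \<Rightarrow> bool" where
  "acts_as_translation k f T M \<longleftrightarrow> (\<forall>P\<in>jac_pts f (alg_cl k). \<forall>v.
     kummer_rep f P v \<longrightarrow> kummer_rep f (P \<otimes>\<^bsub>jac f\<^esub> T) (M *v v))"

text \<open>For a cocycle \<open>e\<close>, the 2-covering \<open>J\<^sub>e\<close> with \<open>\<sigma>(\<phi>\<^sub>e) \<phi>\<^sub>e\<^sup>-\<^sup>1\<close> equal to translation by \<open>e \<sigma>\<close> is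
  described through its points over the algebraic closure, which \<open>\<phi>\<^sub>e\<close> identifies with those of the
  Jacobian; in these terms \<open>\<phi>\<^sub>e(\<sigma>(P)) = \<sigma>(\<phi>\<^sub>e(P)) - e \<sigma>\<close>.\<close>

definition twisted_gal ::
  "complex set \<Rightarrow> complex poly \<Rightarrow> ((complex \<Rightarrow> complex) \<Rightarrow> divisor set) \<Rightarrow> (complex \<Rightarrow> complex) \<Rightarrow>
   divisor set \<Rightarrow> divisor set" where
  "twisted_gal k f e \<sigma> P = gal_jac f k \<sigma> P \<otimes>\<^bsub>jac f\<^esub> inv\<^bsub>jac f\<^esub> (e \<sigma>)"

text \<open>The twisted group law \<open>m\<close> from \<open>J\<^sub>e \<times> J\<^sub>h\<close> to \<open>J\<^sub>g\<close>, which is addition after the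
  identifications by \<open>\<phi>\<^sub>e, \<phi>\<^sub>h, \<phi>\<^sub>g\<close>, is defined over \<open>k\<close>, i.e.\ is Galois equivariant.\<close>

definition twisted_law_rational ::
  "complex set \<Rightarrow> complex poly \<Rightarrow> ((complex \<Rightarrow> complex) \<Rightarrow> divisor set) \<Rightarrow>
   ((complex \<Rightarrow> complex) \<Rightarrow> divisor set) \<Rightarrow> ((complex \<Rightarrow> complex) \<Rightarrow> divisor set) \<Rightarrow> bool" where
  "twisted_law_rational k f e h g \<longleftrightarrow>
     (\<forall>\<sigma>\<in>gal k. \<forall>P\<in>jac_pts f (alg_cl k). \<forall>Q\<in>jac_pts f (alg_cl k).
        twisted_gal k f e \<sigma> P \<otimes>\<^bsub>jac f\<^esub> twisted_gal k f h \<sigma> Q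
          = twisted_gal k f g \<sigma> (P \<otimes>\<^bsub>jac f\<^esub> Q))"

text \<open>The linear map \<open>\<psi> = R\<^sup>-\<^sup>T\<close> of the model \<open>H\<close>, compatible with \<open>\<phi>\<^sub>e\<close>: the automorphism
  \<open>\<sigma>(\<psi>) \<psi>\<^sup>-\<^sup>1\<close> of the Kummer surface is the one induced by \<open>\<sigma>(\<phi>\<^sub>e) \<phi>\<^sub>e\<^sup>-\<^sup>1\<close>.\<close>

definition psi_compatible ::
  "complex set \<Rightarrow> complex poly \<Rightarrow> complex^6^6 \<Rightarrow> ((complex \<Rightarrow> complex) \<Rightarrow> divisor set) \<Rightarrow>
   complex^4^4 \<Rightarrow> bool" where
  "psi_compatible k f H e \<psi> \<longleftrightarrow>
     (\<exists>R \<in> GL (alg_cl k). (\<forall>u. quad H u = H0form f (wedge2 R u) / det R) \<and>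
        \<psi> = transpose (matrix_inv R)) \<and>
     (\<forall>\<sigma>\<in>gal k. acts_as_translation k f (e \<sigma>) ((\<chi> i j. \<sigma> (\<psi> $ i $ j)) ** matrix_inv \<psi>))"

definition compatible_triple ::
  "complex set \<Rightarrow> complex poly \<Rightarrow>
   ((complex \<Rightarrow> complex) \<Rightarrow> divisor set) set \<Rightarrow> ((complex \<Rightarrow> complex) \<Rightarrow> divisor set) set \<Rightarrow>
   complex^6^6 \<Rightarrow> complex^6^6 \<Rightarrow> complex^6^6 \<Rightarrow>
   complex^4^4 \<Rightarrow> complex^4^4 \<Rightarrow> complex^4^4 \<Rightarrow> bool" where
  "compatible_triple k f \<epsilon> \<eta> H\<^sub>1 H\<^sub>2 H\<^sub>3 \<psi>\<^sub>1 \<psi>\<^sub>2 \<psi>\<^sub>3 \<longleftrightarrow>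
     (\<exists>e\<in>\<epsilon>. \<exists>h\<in>\<eta>. \<exists>g \<in> \<epsilon> \<otimes>\<^bsub>H1 k f\<^esub> \<eta>. twisted_law_rational k f e h g \<and>
        psi_compatible k f H\<^sub>1 e \<psi>\<^sub>1 \<and> psi_compatible k f H\<^sub>2 h \<psi>\<^sub>2 \<and> psi_compatible k f H\<^sub>3 g \<psi>\<^sub>3)"

text \<open>All admissible normalisations of the twisted (2,2,2)-form: the nonzero multiples of
  \<open>\<Phi>(\<psi>\<^sub>1 x, \<psi>\<^sub>2 y, \<psi>\<^sub>3\<^sup>-\<^sup>T z)\<close> that have coefficients in \<open>k\<close>.\<close>

definition twisted_222_forms ::
  "complex set \<Rightarrow> (4 \<Rightarrow> 4 \<Rightarrow> complex^4 \<Rightarrow> complex^4 \<Rightarrow> complex) \<Rightarrow>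
   complex^4^4 \<Rightarrow> complex^4^4 \<Rightarrow> complex^4^4 \<Rightarrow> (complex^4 \<Rightarrow> complex^4 \<Rightarrow> complex^4 \<Rightarrow> complex) set" where
  "twisted_222_forms k \<Phi> \<psi>\<^sub>1 \<psi>\<^sub>2 \<psi>\<^sub>3 = {\<Psi>. form222_over k \<Psi> \<and>
     (\<exists>c. c \<noteq> 0 \<and> (\<forall>x y z. \<Psi> x y z =
        c * Phi222 \<Phi> (\<psi>\<^sub>1 *v x) (\<psi>\<^sub>2 *v y) (transpose (matrix_inv \<psi>\<^sub>3) *v z)))}"

text \<open>\<open>Tr(\<mu> Q\<^sub>1(x) Q\<^sub>2(y) Q\<^sub>3\<^sup>*(z))\<close>; the dual of the form with matrix \<open>S\<close> has matrix \<open>S\<^sup>-\<^sup>1\<close>.\<close>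

definition trace_form ::
  "complex poly \<Rightarrow> (complex set set \<Rightarrow> complex) \<Rightarrow> (complex set set \<Rightarrow> complex^4^4) \<Rightarrow>
   (complex set set \<Rightarrow> complex^4^4) \<Rightarrow> (complex set set \<Rightarrow> complex^4^4) \<Rightarrow>
   complex^4 \<Rightarrow> complex^4 \<Rightarrow> complex^4 \<Rightarrow> complex" where
  "trace_form f \<mu> S\<^sub>1 S\<^sub>2 S\<^sub>3 x y z =
     L10_trace f (\<lambda>\<gamma>. \<mu> \<gamma> * quad (S\<^sub>1 \<gamma>) x * quad (S\<^sub>2 \<gamma>) y * quad (matrix_inv (S\<^sub>3 \<gamma>)) z)"

end

theory Submission
  imports Defs
begin

text \<open>Over the algebraic closure every model is the identity model up to a linear substitution, and for
  the identity model the quartic of a partition \<open>\<gamma>\<close> of the roots is a multiple of the square of one of Klein's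
  ten fundamental quadrics \<open>q\<^sub>\<gamma>\<close>.  These are pairwise apolar, so that
  \<open>(\<Sum>\<^sub>i x\<^sub>i z\<^sub>i)\<^sup>2 = \<Sum>\<^sub>\<gamma> q\<^sub>\<gamma>(x) q\<^sub>\<gamma>\<^sup>*(z)\<close>, and at the image of a 2-torsion point they take, up to a factor independent of \<open>\<gamma>\<close>,
  the value of the character of \<open>\<J>[2]\<close> attached to \<open>\<gamma>\<close>.  Fourier analysis on
  \<open>\<J>[2]\<close> shows that a form that is quadratic in each of \<open>x\<close> and \<open>y\<close> and takes the values
  \<open>c(S, S') (\<Sum>\<^sub>i x\<^sub>i(S + S') z\<^sub>i)\<^sup>2\<close> at pairs of 2-torsion points \<open>S, S'\<close> is a multiple of
  \<open>\<Sum>\<^sub>\<gamma> q\<^sub>\<gamma>(x) q\<^sub>\<gamma>(y) q\<^sub>\<gamma>\<^sup>*(z)\<close>.  Flynn's form has this property, and so have its transforms by the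
  translations that describe the Galois action on the maps \<open>\<psi>\<close>.  Hence the twisted form is
  \<open>\<Sum>\<^sub>\<gamma> m\<^sub>\<gamma> Q\<^sub>\<epsilon> Q\<^sub>\<eta> Q\<^sup>*\<close>, where \<open>m\<close> is Galois equivariant up to the factor
  by which the form itself changes; dividing by the value at a rational point removes this factor, and comparing
  the constants in the factorisations gives \<open>s\<close>.\<close>

section \<open>The quartics of the identity model\<close>

text \<open>Flynn's forms are never written out. Apart from their bidegree and their coefficients,
  the only input is that P + Q = P - Q when Q is a 2-torsion point: there the form degenerates to
  the square of a linear form. Translating the arguments by 2-torsion points keeps this shape, and
  that is why the Galois conjugates of the twisted form are again its multiples. Explicit
  computation is confined to the quartics of the identity model; a general model is reached by
  covariance under \<open>R\<close>. At each partition a factor \<open>Q\<close> is a multiple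
  \<open>a\<close> of a transformed fundamental quadric, and alpha a^2 is a constant kappa
  independent of the partition, because it comes from det R alone. The coefficient of the twisted
  form is c0 a3 / (a1 a2), so its square is alpha1 alpha2 / alpha3 up to one constant. The obstacle
  is rationality: the numbers \<open>a\<close> are arbitrary square roots, without any Galois
  behaviour of their own. Equivariance is therefore read off from the form, whose coefficients are
  determined by its values at rational points; hence the insistence below on independence at
  rational arguments.\<close>

lemma exhaust_6:
  fixes x :: 6
  shows "x = 1 \<or> x = 2 \<or> x = 3 \<or> x = 4 \<or> x = 5 \<or> x = 6"
proof (induct x)
  case (of_int z)
  then have "z = 0 \<or> z = 1 \<or> z = 2 \<or> z = 3 \<or> z = 4 \<or> z = 5" by auto
  then show ?case by auto
qed

lemma forall_6: "(\<forall>i::6. P i) \<longleftrightarrow> P 1 \<and> P 2 \<and> P 3 \<and> P 4 \<and> P 5 \<and> P 6"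
  by (metis exhaust_6)

lemma UNIV_6: "UNIV = {1, 2, 3, 4, 5, 6::6}"
  using exhaust_6 by auto

lemma sum_6: "sum f (UNIV::6 set) = f 1 + f 2 + f 3 + f 4 + f 5 + f 6"
  unfolding UNIV_6 by (simp add: ac_simps)

lemma vector_4 [simp]:
  "(vector [a,b,c,d] :: ('a::zero)^4)$1 = a"
  "(vector [a,b,c,d] :: ('a::zero)^4)$2 = b"
  "(vector [a,b,c,d] :: ('a::zero)^4)$3 = c"
  "(vector [a,b,c,d] :: ('a::zero)^4)$4 = d"
  unfolding vector_def by simp_all

lemma vector_6 [simp]:
  "(vector [a,b,c,d,e,f] :: ('a::zero)^6)$1 = a"
  "(vector [a,b,c,d,e,f] :: ('a::zero)^6)$2 = b"
  "(vector [a,b,c,d,e,f] :: ('a::zero)^6)$3 = c"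
  "(vector [a,b,c,d,e,f] :: ('a::zero)^6)$4 = d"
  "(vector [a,b,c,d,e,f] :: ('a::zero)^6)$5 = e"
  "(vector [a,b,c,d,e,f] :: ('a::zero)^6)$6 = f"
  unfolding vector_def by simp_all

lemma det_4:
  fixes A :: "'a::comm_ring_1^4^4"
  shows "det A =
      A$1$1 * (A$2$2 * (A$3$3 * A$4$4 - A$3$4 * A$4$3) - A$2$3 * (A$3$2 * A$4$4 - A$3$4 * A$4$2) + A$2$4 * (A$3$2 * A$4$3 - A$3$3 * A$4$2))
    - A$1$2 * (A$2$1 * (A$3$3 * A$4$4 - A$3$4 * A$4$3) - A$2$3 * (A$3$1 * A$4$4 - A$3$4 * A$4$1) + A$2$4 * (A$3$1 * A$4$3 - A$3$3 * A$4$1))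
    + A$1$3 * (A$2$1 * (A$3$2 * A$4$4 - A$3$4 * A$4$2) - A$2$2 * (A$3$1 * A$4$4 - A$3$4 * A$4$1) + A$2$4 * (A$3$1 * A$4$2 - A$3$2 * A$4$1))
    - A$1$4 * (A$2$1 * (A$3$2 * A$4$3 - A$3$3 * A$4$2) - A$2$2 * (A$3$1 * A$4$3 - A$3$3 * A$4$1) + A$2$3 * (A$3$1 * A$4$2 - A$3$2 * A$4$1))"
proof -
  have f1: "finite {2::4, 3, 4}" "1 \<notin> {2::4, 3, 4}" by auto
  have f2: "finite {3::4, 4}" "2 \<notin> {3::4, 4}" by auto
  have f3: "finite {4::4}" "3 \<notin> {4::4}" by auto
  show ?thesis
    unfolding det_def UNIV_4
    unfolding sum_over_permutations_insert[OF f1]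
    unfolding sum_over_permutations_insert[OF f2]
    unfolding sum_over_permutations_insert[OF f3]
    unfolding permutes_sing
    by (simp add: sign_swap_id permutation_swap_id permutation_compose sign_compose sign_id swap_id_eq algebra_simps)
qed

lemma matrix_inv_mult:
  fixes A :: "'a::semiring_1^'n^'n"
  assumes "invertible A"
  shows "A ** matrix_inv A = mat 1" "matrix_inv A ** A = mat 1"
proof -
  have "A ** matrix_inv A = mat 1 \<and> matrix_inv A ** A = mat 1"
    using assms unfolding matrix_inv_def invertible_def by (rule someI_ex)
  then show "A ** matrix_inv A = mat 1" "matrix_inv A ** A = mat 1" by auto
qed

lemma matrix_inv_unique:
  fixes A :: "'a::semiring_1^'n^'n"
  assumes "A ** B = mat 1" "B ** A = mat 1"
  shows "matrix_inv A = B"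
proof -
  have "invertible A" using assms invertible_def by blast
  then have "matrix_inv A ** A = mat 1" by (rule matrix_inv_mult)
  then have "matrix_inv A ** (A ** B) = B"
    by (simp add: matrix_mul_assoc)
  then show ?thesis
    by (simp add: assms)
qed

lemma matrix_inv_unique_field:
  fixes A :: "'a::field^'n^'n"
  assumes "A ** B = mat 1"
  shows "invertible A" "matrix_inv A = B"
proof -
  have "B ** A = mat 1" using assms matrix_left_right_inverse by blast
  then show "invertible A" "matrix_inv A = B"
    using assms matrix_inv_unique invertible_def by blast+
qed

section \<open>The identity model: its matrix and the matrices derived from it\<close>

definition H0mat :: "complex poly \<Rightarrow> complex^6^6" where
  "H0mat f = (let f0 = coeff f 0; f1 = coeff f 1; f2 = coeff f 2; f3 = coeff f 3;
       f4 = coeff f 4; f5 = coeff f 5; f6 = coeff f 6 in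
     vector [vector [0, 0, 0, 0, 1, 0], vector [0, 0, 0, 1, 0, 0],
             vector [0, 0, 1 / (2*f6), - f5 / (2*f6), 0, 0],
             vector [0, 1, - f5 / (2*f6), f5^2 / (2*f6) - 2*f4, - f3, 0],
             vector [1, 0, 0, - f3, - 2*f2, - f1],
             vector [0, 0, 0, 0, - f1, - 2*f0]])"

lemma quad_H0mat:
  assumes "coeff f 6 \<noteq> 0"
  shows "quad (H0mat f) u = H0form f u"
  using assms unfolding quad_def H0form_def H0mat_def Let_def sum_6 vector_6
  by (simp add: field_simps power2_eq_square)

lemma symmetric_H0mat: "transpose (H0mat f) = H0mat f"
  unfolding H0mat_def Let_def by (simp add: vec_eq_iff forall_6 transpose_def)

lemma symmetric_Gmat: "transpose Gmat = Gmat"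
  unfolding Gmat_def by (simp add: vec_eq_iff forall_6 transpose_def)

lemma Gmat_square: "Gmat ** Gmat = mat 1"
  unfolding Gmat_def matrix_matrix_mult_def mat_def by (simp add: vec_eq_iff forall_6 sum_6)

lemma matrix_inv_Gmat: "matrix_inv Gmat = Gmat"
  by (rule matrix_inv_unique[OF Gmat_square Gmat_square])

lemma GN_0: "GN H 0 = Gmat"
  by (simp add: GN_def)

lemma GN_Suc: "GN H (Suc r) = H ** (Gmat ** GN H r)"
  by (simp add: GN_def matrix_inv_Gmat matrix_mul_assoc Gmat_square)

text \<open>\<open>Gmat\<close> is the permutation matrix that reverses the coordinates, so this
  product only reverses rows. The explicit matrices below are expanded row by row in this
  form.\<close>

lemma Gmat_mult:
  "(Gmat ** A) $ 1 = A $ 6" "(Gmat ** A) $ 2 = A $ 5" "(Gmat ** A) $ 3 = A $ 4"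
  "(Gmat ** A) $ 4 = A $ 3" "(Gmat ** A) $ 5 = A $ 2" "(Gmat ** A) $ 6 = A $ 1"
  unfolding Gmat_def matrix_matrix_mult_def by (simp_all add: vec_eq_iff sum_6)

text \<open>Horner's scheme: after the term i = j + 1 is split off, every remaining term has a
  factor H G on the left. The matrices are computed downwards from \<open>Qmat_6\<close>, where the
  sum is empty.\<close>

lemma Qmat_Suc:
  assumes "j < 6"
  shows "Qmat f H j $ a $ b =
    coeff f (Suc j) / coeff f 6 * Gmat $ a $ b + ((H ** Gmat) ** Qmat f H (Suc j)) $ a $ b"
proof -
  have "(\<Sum>i = j + 1..6. coeff f i * GN H (i - j - 1) $ a $ b) =
      coeff f (Suc j) * GN H 0 $ a $ b + (\<Sum>i = Suc j + 1..6. coeff f i * GN H (i - j - 1) $ a $ b)"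
    using assms by (simp add: sum.atLeast_Suc_atMost)
  also have "(\<Sum>i = Suc j + 1..6. coeff f i * GN H (i - j - 1) $ a $ b) =
      (\<Sum>i = Suc j + 1..6. \<Sum>c\<in>UNIV. (H ** Gmat) $ a $ c * (coeff f i * GN H (i - Suc j - 1) $ c $ b))"
  proof (intro sum.cong refl)
    fix i assume "i \<in> {Suc j + 1..6}"
    then have "i - j - 1 = Suc (i - Suc j - 1)" by auto
    then have "GN H (i - j - 1) = (H ** Gmat) ** GN H (i - Suc j - 1)"
      by (simp add: GN_Suc matrix_mul_assoc)
    then show "coeff f i * GN H (i - j - 1) $ a $ b =
        (\<Sum>c\<in>UNIV. (H ** Gmat) $ a $ c * (coeff f i * GN H (i - Suc j - 1) $ c $ b))"
      by (simp add: matrix_matrix_mult_def sum_distrib_left mult_ac)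
  qed
  also have "\<dots> = (\<Sum>c\<in>UNIV. (H ** Gmat) $ a $ c * (\<Sum>i = Suc j + 1..6. coeff f i * GN H (i - Suc j - 1) $ c $ b))"
    by (subst sum.swap) (simp add: sum_distrib_left)
  finally have "(\<Sum>i = j + 1..6. coeff f i * GN H (i - j - 1) $ a $ b) = coeff f (Suc j) * Gmat $ a $ b +
      (\<Sum>c\<in>UNIV. (H ** Gmat) $ a $ c * (\<Sum>i = Suc j + 1..6. coeff f i * GN H (i - Suc j - 1) $ c $ b))"
    unfolding GN_0 .
  then show ?thesis
    unfolding Qmat_def vec_lambda_beta matrix_matrix_mult_def[of "H ** Gmat"] times_divide_eq_right
    by (simp only: sum_divide_distrib[symmetric] add_divide_distrib times_divide_eq_left)
qed

lemma Qmat_6: "Qmat f H 6 $ a $ b = 0"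
  by (simp add: Qmat_def)

lemma matrix_mult_nth: "(A ** B) $ i $ j = (\<Sum>k\<in>UNIV. A $ i $ k * B $ k $ j)"
  by (simp add: matrix_matrix_mult_def)

text \<open>Each row of \<open>Lam x\<close> has only three nonzero entries; writing the products
  out once keeps the later expansions short.\<close>

lemma Lam_mult:
  fixes M :: "complex^6^6"
  shows "(Lam x ** M) $ 1 $ c = x$4 * M$3$c + x$3 * M$5$c + x$2 * M$6$c"
    "(Lam x ** M) $ 2 $ c = - x$4 * M$2$c + x$3 * M$4$c - x$1 * M$6$c"
    "(Lam x ** M) $ 3 $ c = x$4 * M$1$c - x$2 * M$4$c - x$1 * M$5$c"
    "(Lam x ** M) $ 4 $ c = - x$3 * M$1$c + x$2 * M$2$c - x$1 * M$3$c"
  by (simp_all add: Lam_def matrix_matrix_mult_def sum_6)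

lemma mult_transpose_Lam:
  fixes A :: "complex^6^4"
  shows "(A ** transpose (Lam x)) $ i $ 1 = x$4 * A$i$3 + x$3 * A$i$5 + x$2 * A$i$6"
    "(A ** transpose (Lam x)) $ i $ 2 = - x$4 * A$i$2 + x$3 * A$i$4 - x$1 * A$i$6"
    "(A ** transpose (Lam x)) $ i $ 3 = x$4 * A$i$1 - x$2 * A$i$4 - x$1 * A$i$5"
    "(A ** transpose (Lam x)) $ i $ 4 = - x$3 * A$i$1 + x$2 * A$i$2 - x$1 * A$i$3"
  by (simp_all add: Lam_def matrix_matrix_mult_def sum_6 transpose_def)

definition minor44 :: "complex^4^4 \<Rightarrow> complex" where
  "minor44 M = M$1$1 * (M$2$2 * M$3$3 - M$2$3 * M$3$2) - M$1$2 * (M$2$1 * M$3$3 - M$2$3 * M$3$1)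
     + M$1$3 * (M$2$1 * M$3$2 - M$2$2 * M$3$1)"

text \<open>The entries of the upper left block all carry the factor h/2. Taking it out leaves a
  polynomial with integer coefficients, on which ring normalisation works.\<close>

lemma minor44_halves:
  assumes "M$1$1 = h * b11 / 2" "M$2$2 = h * b22 / 2" "M$3$3 = h * b33 / 2" "M$2$3 = h * b23 / 2" "M$3$2 = h * b32 / 2"
    "M$1$2 = h * b12 / 2" "M$2$1 = h * b21 / 2" "M$1$3 = h * b13 / 2" "M$3$1 = h * b31 / 2"
  shows "8 * minor44 M = h^3 * (b11 * (b22 * b33 - b23 * b32) - b12 * (b21 * b33 - b23 * b31) + b13 * (b21 * b32 - b22 * b31))"
  unfolding minor44_def assms by (simp add: field_simps power3_eq_cube)

lemma eighth: "8 * a = b * (c * d) \<Longrightarrow> a = b * (c * d / 8)" for a :: complex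
  by (simp add: field_simps)

lemma adjugate_44: "adjugate M $ 4 $ 4 = minor44 M"
  by (simp add: adjugate_def det_4 minor44_def)

lemma Er_minor44: "Er H r x = minor44 (Lam x ** GN H r ** transpose (Lam x)) / (x$4)^2"
  by (simp add: Er_def adjugate_44)

lemma zrow_zcol:
  "zrow$1 = 1" "zrow$2 = 1" "zrow$3 = 2" "zrow$4 = 1" "zrow$5 = 4" "zrow$6 = 3"
  "zcol$1 = 2" "zcol$2 = 3" "zcol$3 = 3" "zcol$4 = 4" "zcol$5 = 2" "zcol$6 = 4"
  by (simp_all add: zrow_def zcol_def)

text \<open>With \<open>f\<^sub>i = h m\<^sub>i\<close> and \<open>x\<^sub>4 = h X\<close> the powers of the leading coefficient \<open>h\<close> separate from
  integral polynomials, which keeps the expansions free of denominators other than powers of \<open>h\<close>.\<close>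

context fixes f :: "complex poly" and h m0 m1 m2 m3 m4 m5 :: complex
 assumes h: "h \<noteq> 0" and cf: "coeff f 0 = h*m0" "coeff f 1 = h*m1" "coeff f 2 = h*m2" "coeff f 3 = h*m3" "coeff f 4 = h*m4" "coeff f 5 = h*m5" "coeff f 6 = h"
begin

lemma H0mat_h: "H0mat f = vector [
     vector [0, 0, 0, 0, 1, 0],
     vector [0, 0, 0, 1, 0, 0],
     vector [0, 0, (1/2)/h, - m5/2, 0, 0],
     vector [0, 1, - m5/2, - 2*h*m4 + h*m5^2/2, - h*m3, 0],
     vector [1, 0, 0, - h*m3, - 2*h*m2, - h*m1],
     vector [0, 0, 0, 0, - h*m1, - 2*h*m0]]"
  unfolding H0mat_def Let_def cf using h by (simp add: vec_eq_iff forall_6 field_simps power2_eq_square)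

lemma GN_H0_1: "GN (H0mat f) 1 = H0mat f"
 by (simp add: GN_Suc[of _ 0, simplified] GN_0 Gmat_square)

lemma GN_H0_2: "GN (H0mat f) 2 = vector [
     vector [0, 0, 0, 1, 0, 0],
     vector [0, 0, (1/2)/h, - m5/2, 0, 0],
     vector [0, (1/2)/h, (- m5/2)/h, - m4 + m5^2/2, - m3/2, 0],
     vector [1, - m5/2, - m4 + m5^2/2, - 2*h*m3 + 2*h*m4*m5 - h*m5^3/2, - 2*h*m2 + h*m3*m5/2, - h*m1],
     vector [0, 0, - m3/2, - 2*h*m2 + h*m3*m5/2, - 2*h*m1, - 2*h*m0],
     vector [0, 0, 0, - h*m1, - 2*h*m0, 0]]"
proof -
  have *: "GN (H0mat f) 2 = H0mat f ** (Gmat ** GN (H0mat f) 1)"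
    using GN_Suc[of "H0mat f" 1] by (simp add: eval_nat_numeral)
  show ?thesis
    unfolding * vec_eq_iff forall_6 matrix_mult_nth[of "H0mat f"] sum_6 Gmat_mult GN_H0_1
    unfolding H0mat_h vector_6
    using h by (simp add: field_simps power2_eq_square power3_eq_cube power4_eq_xxxx)
qed

lemma GN_H0_3: "GN (H0mat f) 3 = vector [
     vector [0, 0, (1/2)/h, - m5/2, 0, 0],
     vector [0, (1/2)/h, (- m5/2)/h, - m4 + m5^2/2, - m3/2, 0],
     vector [(1/2)/h, (- m5/2)/h, (- m4/2 + m5^2/2)/h, - m3 + 3*m4*m5/2 - m5^3/2, - m2 + m3*m5/2, - m1/2],
     vector [- m5/2, - m4 + m5^2/2, - m3 + 3*m4*m5/2 - m5^3/2, - 2*h*m2 + 2*h*m3*m5 - 5*h*m4*m5^2/2 + 2*h*m4^2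
         + h*m5^4/2, - 2*h*m1 + h*m2*m5 + h*m3*m4 - h*m3*m5^2/2, - 2*h*m0 + h*m1*m5/2],
     vector [0, - m3/2, - m2 + m3*m5/2, - 2*h*m1 + h*m2*m5 + h*m3*m4 - h*m3*m5^2/2, - 2*h*m0 + h*m3^2/2, 0],
     vector [0, 0, - m1/2, - 2*h*m0 + h*m1*m5/2, 0, 0]]"
proof -
  have *: "GN (H0mat f) 3 = H0mat f ** (Gmat ** GN (H0mat f) 2)"
    using GN_Suc[of "H0mat f" 2] by (simp add: eval_nat_numeral)
  show ?thesis
    unfolding * vec_eq_iff forall_6 matrix_mult_nth[of "H0mat f"] sum_6 Gmat_mult GN_H0_2
    unfolding H0mat_h vector_6
    using h by (simp add: field_simps power2_eq_square power3_eq_cube power4_eq_xxxx)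
qed

lemma Qmat_H0_5: "Qmat f (H0mat f) 5 = vector [
     vector [0, 0, 0, 0, 0, 1],
     vector [0, 0, 0, 0, 1, 0],
     vector [0, 0, 0, 1, 0, 0],
     vector [0, 0, 1, 0, 0, 0],
     vector [0, 1, 0, 0, 0, 0],
     vector [1, 0, 0, 0, 0, 0]]"
proof -
  have *: "Qmat f (H0mat f) 5 $ a $ b = coeff f 6 / coeff f 6 * Gmat $ a $ b + (H0mat f ** (Gmat ** Qmat f (H0mat f) 6)) $ a $ b" for a b
    using Qmat_Suc[of 5 f "H0mat f" a b] by (simp add: eval_nat_numeral matrix_mul_assoc)
  show ?thesis
    unfolding * vec_eq_iff forall_6 matrix_mult_nth[of "H0mat f"] sum_6 Gmat_mult Qmat_6 cf
    unfolding H0mat_h Gmat_def vector_6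
    using h by (simp add: field_simps power2_eq_square power3_eq_cube power4_eq_xxxx)
qed

lemma Qmat_H0_4: "Qmat f (H0mat f) 4 = vector [
     vector [0, 0, 0, 0, 1, m5],
     vector [0, 0, 0, 1, m5, 0],
     vector [0, 0, (1/2)/h, m5/2, 0, 0],
     vector [0, 1, m5/2, - 2*h*m4 + h*m5^2/2, - h*m3, 0],
     vector [1, m5, 0, - h*m3, - 2*h*m2, - h*m1],
     vector [m5, 0, 0, 0, - h*m1, - 2*h*m0]]"
proof -
  have *: "Qmat f (H0mat f) 4 $ a $ b = coeff f 5 / coeff f 6 * Gmat $ a $ b + (H0mat f ** (Gmat ** Qmat f (H0mat f) 5)) $ a $ b" for a b
    using Qmat_Suc[of 4 f "H0mat f" a b] by (simp add: eval_nat_numeral matrix_mul_assoc)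
  show ?thesis
    unfolding * vec_eq_iff forall_6 matrix_mult_nth[of "H0mat f"] sum_6 Gmat_mult Qmat_H0_5 cf
    unfolding H0mat_h Gmat_def vector_6
    using h by (simp add: field_simps power2_eq_square power3_eq_cube power4_eq_xxxx)
qed

lemma Qmat_H0_3: "Qmat f (H0mat f) 3 = vector [
     vector [0, 0, 0, 1, m5, m4],
     vector [0, 0, (1/2)/h, m5/2, m4, 0],
     vector [0, (1/2)/h, 0, 0, - m3/2, 0],
     vector [1, m5/2, 0, - 2*h*m3, - 2*h*m2 - h*m3*m5/2, - h*m1],
     vector [m5, m4, - m3/2, - 2*h*m2 - h*m3*m5/2, - 2*h*m1 - 2*h*m2*m5, - 2*h*m0 - h*m1*m5],
     vector [m4, 0, 0, - h*m1, - 2*h*m0 - h*m1*m5, - 2*h*m0*m5]]"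
proof -
  have *: "Qmat f (H0mat f) 3 $ a $ b = coeff f 4 / coeff f 6 * Gmat $ a $ b + (H0mat f ** (Gmat ** Qmat f (H0mat f) 4)) $ a $ b" for a b
    using Qmat_Suc[of 3 f "H0mat f" a b] by (simp add: eval_nat_numeral matrix_mul_assoc)
  show ?thesis
    unfolding * vec_eq_iff forall_6 matrix_mult_nth[of "H0mat f"] sum_6 Gmat_mult Qmat_H0_4 cf
    unfolding H0mat_h Gmat_def vector_6
    using h by (simp add: field_simps power2_eq_square power3_eq_cube power4_eq_xxxx)
qed

lemma Qmat_H0_2: "Qmat f (H0mat f) 2 = vector [
     vector [0, 0, (1/2)/h, m5/2, m4, m3],
     vector [0, (1/2)/h, 0, 0, m3/2, 0],
     vector [(1/2)/h, 0, 0, 0, - m2, - m1/2],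
     vector [m5/2, 0, 0, - 2*h*m2, - 2*h*m1 - h*m2*m5, - 2*h*m0 - h*m1*m5/2],
     vector [m4, m3/2, - m2, - 2*h*m1 - h*m2*m5, - 2*h*m0 - 2*h*m1*m5 - 2*h*m2*m4 + h*m3^2/2, - 2*h*m0*m5 - h*m1*m4],
     vector [m3, 0, - m1/2, - 2*h*m0 - h*m1*m5/2, - 2*h*m0*m5 - h*m1*m4, - 2*h*m0*m4]]"
proof -
  have *: "Qmat f (H0mat f) 2 $ a $ b = coeff f 3 / coeff f 6 * Gmat $ a $ b + (H0mat f ** (Gmat ** Qmat f (H0mat f) 3)) $ a $ b" for a b
    using Qmat_Suc[of 2 f "H0mat f" a b] by (simp add: eval_nat_numeral matrix_mul_assoc)
  show ?thesis
    unfolding * vec_eq_iff forall_6 matrix_mult_nth[of "H0mat f"] sum_6 Gmat_mult Qmat_H0_3 cf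
    unfolding H0mat_h Gmat_def vector_6
    using h by (simp add: field_simps power2_eq_square power3_eq_cube power4_eq_xxxx)
qed

lemma Qmat_H0_1: "Qmat f (H0mat f) 1 = vector [
     vector [0, (1/2)/h, 0, 0, m3/2, m2],
     vector [(1/2)/h, 0, 0, 0, 0, - m1/2],
     vector [0, 0, 0, 0, - m1, - m0],
     vector [0, 0, 0, - 2*h*m1, - 2*h*m0 - h*m1*m5, - h*m0*m5],
     vector [m3/2, 0, - m1, - 2*h*m0 - h*m1*m5, - 2*h*m0*m5 - 2*h*m1*m4, - 2*h*m0*m4 - h*m1*m3/2],
     vector [m2, - m1/2, - m0, - h*m0*m5, - 2*h*m0*m4 - h*m1*m3/2, - 2*h*m0*m3]]"
proof -
  have *: "Qmat f (H0mat f) 1 $ a $ b = coeff f 2 / coeff f 6 * Gmat $ a $ b + (H0mat f ** (Gmat ** Qmat f (H0mat f) 2)) $ a $ b" for a b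
    using Qmat_Suc[of 1 f "H0mat f" a b] by (simp add: eval_nat_numeral matrix_mul_assoc)
  show ?thesis
    unfolding * vec_eq_iff forall_6 matrix_mult_nth[of "H0mat f"] sum_6 Gmat_mult Qmat_H0_2 cf
    unfolding H0mat_h Gmat_def vector_6
    using h by (simp add: field_simps power2_eq_square power3_eq_cube power4_eq_xxxx)
qed

lemma Qmat_H0_0: "Qmat f (H0mat f) 0 = vector [
     vector [(1/2)/h, 0, 0, 0, 0, m1/2],
     vector [0, 0, 0, 0, 0, - m0],
     vector [0, 0, 0, 0, - m0, 0],
     vector [0, 0, 0, - 2*h*m0, - h*m0*m5, 0],
     vector [0, 0, - m0, - h*m0*m5, - 2*h*m0*m4, - h*m0*m3],
     vector [m1/2, - m0, 0, 0, - h*m0*m3, - 2*h*m0*m2 + h*m1^2/2]]"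
proof -
  have *: "Qmat f (H0mat f) 0 $ a $ b = coeff f 1 / coeff f 6 * Gmat $ a $ b + (H0mat f ** (Gmat ** Qmat f (H0mat f) 1)) $ a $ b" for a b
    using Qmat_Suc[of 0 f "H0mat f" a b] by (simp add: eval_nat_numeral matrix_mul_assoc)
  show ?thesis
    unfolding * vec_eq_iff forall_6 matrix_mult_nth[of "H0mat f"] sum_6 Gmat_mult Qmat_H0_1 cf
    unfolding H0mat_h Gmat_def vector_6
    using h by (simp add: field_simps power2_eq_square power3_eq_cube power4_eq_xxxx)
qed

context fixes x :: "complex^4" and x1 x2 x3 X
  assumes x: "x$1 = x1" "x$2 = x2" "x$3 = x3" "x$4 = h*X" and X: "X \<noteq> 0"
begin

text \<open>The last row and column enter \<open>qstar\<close> but not E_r, which sees only the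
  upper left block; this is why the analogous list for the third power stops after nine
  entries.\<close>

lemma B_H0_1:
  shows "(Lam x ** GN (H0mat f) 1 ** transpose (Lam x)) $ 1 $ 1 = h * (X^2 - 4*m0*x2^2 - 4*m1*x2*x3 - 4*m2*x3^2) / 2"
    "(Lam x ** GN (H0mat f) 1 ** transpose (Lam x)) $ 1 $ 2 = h * (- X*m5*x3 + 4*m0*x1*x2 + 2*m1*x1*x3 - 2*m3*x3^2) / 2"
    "(Lam x ** GN (H0mat f) 1 ** transpose (Lam x)) $ 1 $ 3 = h * (X*m5*x2 + 2*X*x3 + 2*m1*x1*x2 + 4*m2*x1*x3 + 2*m3*x2*x3) / 2"
    "(Lam x ** GN (H0mat f) 1 ** transpose (Lam x)) $ 1 $ 4 = (- X*x1 - 2*x3^2) / 2"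
    "(Lam x ** GN (H0mat f) 1 ** transpose (Lam x)) $ 2 $ 1 = h * (- X*m5*x3 + 4*m0*x1*x2 + 2*m1*x1*x3 - 2*m3*x3^2) / 2"
    "(Lam x ** GN (H0mat f) 1 ** transpose (Lam x)) $ 2 $ 2 = h * (- 4*X*x3 - 4*m0*x1^2 - 4*m4*x3^2 + m5^2*x3^2) / 2"
    "(Lam x ** GN (H0mat f) 1 ** transpose (Lam x)) $ 2 $ 3 = h * (2*X*x2 - 2*m1*x1^2 + 2*m3*x1*x3 + 4*m4*x2*x3 - m5^2*x2*x3) / 2"
    "(Lam x ** GN (H0mat f) 1 ** transpose (Lam x)) $ 2 $ 4 = (m5*x1*x3 + 2*x2*x3) / 2"
    "(Lam x ** GN (H0mat f) 1 ** transpose (Lam x)) $ 3 $ 1 = h * (X*m5*x2 + 2*X*x3 + 2*m1*x1*x2 + 4*m2*x1*x3 + 2*m3*x2*x3) / 2"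
    "(Lam x ** GN (H0mat f) 1 ** transpose (Lam x)) $ 3 $ 2 = h * (2*X*x2 - 2*m1*x1^2 + 2*m3*x1*x3 + 4*m4*x2*x3 - m5^2*x2*x3) / 2"
    "(Lam x ** GN (H0mat f) 1 ** transpose (Lam x)) $ 3 $ 3 = h * (- 4*X*x1 - 4*m2*x1^2 - 4*m3*x1*x2 - 4*m4*x2^2 + m5^2*x2^2) / 2"
    "(Lam x ** GN (H0mat f) 1 ** transpose (Lam x)) $ 3 $ 4 = (- m5*x1*x2 + 2*x1*x3 - 2*x2^2) / 2"
    "(Lam x ** GN (H0mat f) 1 ** transpose (Lam x)) $ 4 $ 1 = (- X*x1 - 2*x3^2) / 2"
    "(Lam x ** GN (H0mat f) 1 ** transpose (Lam x)) $ 4 $ 2 = (m5*x1*x3 + 2*x2*x3) / 2"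
    "(Lam x ** GN (H0mat f) 1 ** transpose (Lam x)) $ 4 $ 3 = (- m5*x1*x2 + 2*x1*x3 - 2*x2^2) / 2"
    "(Lam x ** GN (H0mat f) 1 ** transpose (Lam x)) $ 4 $ 4 = (x1^2) / (2*h)"
  unfolding Lam_mult mult_transpose_Lam x GN_H0_1
  unfolding H0mat_h vector_6
  using h by (simp_all add: field_simps power2_eq_square power3_eq_cube power4_eq_xxxx)

lemma Er_H0_1: "Er (H0mat f) 1 x = h * (16*X*m0*x1^3 + 8*X*m1*x1^2*x2 + 16*X*m2*x1^2*x3 + 8*X*m3*x1*x2*x3
    + 16*X*m4*x1*x3^2 + 8*X*m5*x2*x3^2 + 16*X*x3^3 + 16*X^2*x1*x3 - 4*X^2*x2^2 + 16*m0*m2*x1^4 + 16*m0*m3*x1^3*x2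
    + 16*m0*m4*x1^2*x2^2 + 16*m0*m5*x1*x2^3 - 16*m0*m5*x1^2*x2*x3 - 32*m0*x1*x2^2*x3 + 16*m0*x1^2*x3^2 + 16*m0*x2^4
    + 8*m1*m3*x1^3*x3 + 16*m1*m4*x1^2*x2*x3 + 16*m1*m5*x1*x2^2*x3 - 8*m1*m5*x1^2*x3^2 - 16*m1*x1*x2*x3^2
    + 16*m1*x2^3*x3 - 4*m1^2*x1^4 + 16*m2*m4*x1^2*x3^2 + 16*m2*m5*x1*x2*x3^2 + 16*m2*x2^2*x3^2 + 8*m3*m5*x1*x3^3
    + 16*m3*x2*x3^3 - 4*m3^2*x1^2*x3^2 + 16*m4*x3^4 - 4*m5^2*x3^4) / 8"
proof -
  have "8 * minor44 (Lam x ** GN (H0mat f) 1 ** transpose (Lam x)) = h^3 * ((X^2 - 4*m0*x2^2 - 4*m1*x2*x3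
      - 4*m2*x3^2) * ((- 4*X*x3 - 4*m0*x1^2 - 4*m4*x3^2 + m5^2*x3^2) * (- 4*X*x1 - 4*m2*x1^2 - 4*m3*x1*x2 - 4*m4*x2^2
      + m5^2*x2^2) - (2*X*x2 - 2*m1*x1^2 + 2*m3*x1*x3 + 4*m4*x2*x3 - m5^2*x2*x3) * (2*X*x2 - 2*m1*x1^2 + 2*m3*x1*x3
      + 4*m4*x2*x3 - m5^2*x2*x3)) - (- X*m5*x3 + 4*m0*x1*x2 + 2*m1*x1*x3 - 2*m3*x3^2) * ((- X*m5*x3 + 4*m0*x1*x2
      + 2*m1*x1*x3 - 2*m3*x3^2) * (- 4*X*x1 - 4*m2*x1^2 - 4*m3*x1*x2 - 4*m4*x2^2 + m5^2*x2^2) - (2*X*x2 - 2*m1*x1^2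
      + 2*m3*x1*x3 + 4*m4*x2*x3 - m5^2*x2*x3) * (X*m5*x2 + 2*X*x3 + 2*m1*x1*x2 + 4*m2*x1*x3 + 2*m3*x2*x3)) + (X*m5*x2
      + 2*X*x3 + 2*m1*x1*x2 + 4*m2*x1*x3 + 2*m3*x2*x3) * ((- X*m5*x3 + 4*m0*x1*x2 + 2*m1*x1*x3 - 2*m3*x3^2) * (2*X*x2
      - 2*m1*x1^2 + 2*m3*x1*x3 + 4*m4*x2*x3 - m5^2*x2*x3) - (- 4*X*x3 - 4*m0*x1^2 - 4*m4*x3^2 + m5^2*x3^2) * (X*m5*x2
      + 2*X*x3 + 2*m1*x1*x2 + 4*m2*x1*x3 + 2*m3*x2*x3)))"
    by (rule minor44_halves; rule B_H0_1)
  \<comment> \<open>Divisibility by x_4^2 = (h X)^2 is to be expected: the transpose of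
    \<open>Lam x\<close> annihilates x, so the adjugate of this symmetric matrix is proportional to
    x x^T.\<close>
  also have "\<dots> = (h*X)^2 * (h * (16*X*m0*x1^3 + 8*X*m1*x1^2*x2 + 16*X*m2*x1^2*x3 + 8*X*m3*x1*x2*x3
      + 16*X*m4*x1*x3^2 + 8*X*m5*x2*x3^2 + 16*X*x3^3 + 16*X^2*x1*x3 - 4*X^2*x2^2 + 16*m0*m2*x1^4 + 16*m0*m3*x1^3*x2
      + 16*m0*m4*x1^2*x2^2 + 16*m0*m5*x1*x2^3 - 16*m0*m5*x1^2*x2*x3 - 32*m0*x1*x2^2*x3 + 16*m0*x1^2*x3^2 + 16*m0*x2^4
      + 8*m1*m3*x1^3*x3 + 16*m1*m4*x1^2*x2*x3 + 16*m1*m5*x1*x2^2*x3 - 8*m1*m5*x1^2*x3^2 - 16*m1*x1*x2*x3^2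
      + 16*m1*x2^3*x3 - 4*m1^2*x1^4 + 16*m2*m4*x1^2*x3^2 + 16*m2*m5*x1*x2*x3^2 + 16*m2*x2^2*x3^2 + 8*m3*m5*x1*x3^3
      + 16*m3*x2*x3^3 - 4*m3^2*x1^2*x3^2 + 16*m4*x3^4 - 4*m5^2*x3^4))"
    by algebra
  finally have *: "minor44 (Lam x ** GN (H0mat f) 1 ** transpose (Lam x)) = (h*X)^2 * (h * (16*X*m0*x1^3
      + 8*X*m1*x1^2*x2 + 16*X*m2*x1^2*x3 + 8*X*m3*x1*x2*x3 + 16*X*m4*x1*x3^2 + 8*X*m5*x2*x3^2 + 16*X*x3^3
      + 16*X^2*x1*x3 - 4*X^2*x2^2 + 16*m0*m2*x1^4 + 16*m0*m3*x1^3*x2 + 16*m0*m4*x1^2*x2^2 + 16*m0*m5*x1*x2^3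
      - 16*m0*m5*x1^2*x2*x3 - 32*m0*x1*x2^2*x3 + 16*m0*x1^2*x3^2 + 16*m0*x2^4 + 8*m1*m3*x1^3*x3 + 16*m1*m4*x1^2*x2*x3
      + 16*m1*m5*x1*x2^2*x3 - 8*m1*m5*x1^2*x3^2 - 16*m1*x1*x2*x3^2 + 16*m1*x2^3*x3 - 4*m1^2*x1^4 + 16*m2*m4*x1^2*x3^2
      + 16*m2*m5*x1*x2*x3^2 + 16*m2*x2^2*x3^2 + 8*m3*m5*x1*x3^3 + 16*m3*x2*x3^3 - 4*m3^2*x1^2*x3^2 + 16*m4*x3^4
      - 4*m5^2*x3^4) / 8)"
    by (rule eighth)
  have c: "(h*X)^2 * p / (h*X)^2 = p" for p
    using h X by simp
  show ?thesis
    unfolding Er_minor44 x * by (rule c)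
qed

lemma B_H0_3:
  shows "(Lam x ** GN (H0mat f) 3 ** transpose (Lam x)) $ 1 $ 1 = h * (- 2*X*m1*x2 - 4*X*m2*x3 + 2*X*m3*m5*x3 - X^2*m4 + X^2*m5^2 - 4*m0*x3^2 + m3^2*x3^2) / 2"
    "(Lam x ** GN (H0mat f) 3 ** transpose (Lam x)) $ 1 $ 2 = h * (X*m1*x1 - X*m3*x3 + 3*X*m4*m5*x3 - X*m5^3*x3
        + X^2*m5 - 4*m0*x2*x3 + m1*m5*x2*x3 - 4*m1*x3^2 + 2*m2*m5*x3^2 + 2*m3*m4*x3^2 - m3*m5^2*x3^2) / 2"
    "(Lam x ** GN (H0mat f) 3 ** transpose (Lam x)) $ 1 $ 3 = h * (2*X*m2*x1 - X*m3*m5*x1 + 2*X*m3*x2 - 3*X*m4*m5*x2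
        + X*m5^3*x2 + X^2 + 4*m0*x1*x3 + 4*m0*x2^2 - m1*m5*x2^2 + 4*m1*x2*x3 - 2*m2*m5*x2*x3 - 2*m3*m4*x2*x3
        + m3*m5^2*x2*x3 - m3^2*x1*x3) / 2"
    "(Lam x ** GN (H0mat f) 3 ** transpose (Lam x)) $ 2 $ 1 = h * (X*m1*x1 - X*m3*x3 + 3*X*m4*m5*x3 - X*m5^3*x3
        + X^2*m5 - 4*m0*x2*x3 + m1*m5*x2*x3 - 4*m1*x3^2 + 2*m2*m5*x3^2 + 2*m3*m4*x3^2 - m3*m5^2*x3^2) / 2"
    "(Lam x ** GN (H0mat f) 3 ** transpose (Lam x)) $ 2 $ 2 = h * (4*X*m4*x3 - 2*X*m5^2*x3 + X^2 + 8*m0*x1*x3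
        - 2*m1*m5*x1*x3 - 4*m2*x3^2 + 4*m3*m5*x3^2 - 5*m4*m5^2*x3^2 + 4*m4^2*x3^2 + m5^4*x3^2) / 2"
    "(Lam x ** GN (H0mat f) 3 ** transpose (Lam x)) $ 2 $ 3 = h * (- X*m3*x1 - 2*X*m4*x2 - X*m5*x3 + X*m5^2*x2
        - 4*m0*x1*x2 + m1*m5*x1*x2 + 4*m1*x1*x3 - 2*m2*m5*x1*x3 + 4*m2*x2*x3 - 2*m3*m4*x1*x3 - 4*m3*m5*x2*x3
        + m3*m5^2*x1*x3 + 5*m4*m5^2*x2*x3 - 4*m4^2*x2*x3 - m5^4*x2*x3) / 2"
    "(Lam x ** GN (H0mat f) 3 ** transpose (Lam x)) $ 3 $ 1 = h * (2*X*m2*x1 - X*m3*m5*x1 + 2*X*m3*x2 - 3*X*m4*m5*x2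
        + X*m5^3*x2 + X^2 + 4*m0*x1*x3 + 4*m0*x2^2 - m1*m5*x2^2 + 4*m1*x2*x3 - 2*m2*m5*x2*x3 - 2*m3*m4*x2*x3
        + m3*m5^2*x2*x3 - m3^2*x1*x3) / 2"
    "(Lam x ** GN (H0mat f) 3 ** transpose (Lam x)) $ 3 $ 2 = h * (- X*m3*x1 - 2*X*m4*x2 - X*m5*x3 + X*m5^2*x2
        - 4*m0*x1*x2 + m1*m5*x1*x2 + 4*m1*x1*x3 - 2*m2*m5*x1*x3 + 4*m2*x2*x3 - 2*m3*m4*x1*x3 - 4*m3*m5*x2*x3
        + m3*m5^2*x1*x3 + 5*m4*m5^2*x2*x3 - 4*m4^2*x2*x3 - m5^4*x2*x3) / 2"
    "(Lam x ** GN (H0mat f) 3 ** transpose (Lam x)) $ 3 $ 3 = h * (2*X*m5*x2 - 4*m0*x1^2 - 8*m1*x1*x2 + 4*m2*m5*x1*x2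
        - 4*m2*x2^2 + 4*m3*m4*x1*x2 + 4*m3*m5*x2^2 - 2*m3*m5^2*x1*x2 + m3^2*x1^2 - 5*m4*m5^2*x2^2 + 4*m4^2*x2^2
        + m5^4*x2^2) / 2"
  unfolding Lam_mult mult_transpose_Lam x GN_H0_3
  unfolding  vector_6
  using h by (simp_all add: field_simps power2_eq_square power3_eq_cube power4_eq_xxxx)

lemma Er_H0_3: "Er (H0mat f) 3 x = h * (8*X*m0*m1*m5*x1^3 - 16*X*m0*m2*m5*x1^2*x2 - 16*X*m0*m2*x1*x2^2
    - 32*X*m0*m2*x1^2*x3 + 8*X*m0*m3*m4*x1^2*x2 - 16*X*m0*m3*m5*x1*x2^2 - 32*X*m0*m3*x1*x2*x3 - 16*X*m0*m3*x2^3
    + 24*X*m0*m4*m5*x1*x2*x3 + 8*X*m0*m4*m5*x2^3 - 32*X*m0*m4*x1*x3^2 - 16*X*m0*m4*x2^2*x3 + 16*X*m0*m4^2*x1*x2^2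
    + 16*X*m0*m4^2*x1^2*x3 + 8*X*m0*m5^2*x1*x3^2 + 16*X*m0*m5^2*x2^2*x3 - 4*X*m1*m2*m3*x1^3 - 8*X*m1*m2*m4*x1^2*x2
    + 4*X*m1*m2*m5*x1*x2^2 + 16*X*m1*m2*m5*x1^2*x3 + 24*X*m1*m2*x1*x2*x3 + 8*X*m1*m2*x2^3 - 8*X*m1*m3*m4*x1*x2^2
    - 12*X*m1*m3*m4*x1^2*x3 - 16*X*m1*m3*m5*x1*x2*x3 - 4*X*m1*m3*m5*x2^3 - 16*X*m1*m3*x2^2*x3 - 4*X*m1*m3^2*x1^2*x2
    + 16*X*m1*m4*m5*x1*x3^2 + 4*X*m1*m4*m5*x2^2*x3 - 16*X*m1*m4*x2*x3^2 + 8*X*m1*m4^2*x1*x2*x3 + 8*X*m1*m5*x3^3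
    + 16*X*m1*m5^2*x2*x3^2 + 16*X*m1^2*m5*x1^2*x2 + 16*X*m1^2*x1*x2^2 + 8*X*m1^2*x1^2*x3 - 24*X*m2*m3*m4*x1*x2*x3
    - 12*X*m2*m3*m5*x1*x3^2 - 8*X*m2*m3*m5*x2^2*x3 + 8*X*m2*m3*x2*x3^2 + 8*X*m2*m3^2*x1^2*x3 - 8*X*m2*m4*m5*x2*x3^2
    - 16*X*m2*m4^2*x1*x3^2 - 16*X*m2^2*m4*x1^2*x3 + 8*X*m2^2*m5*x1*x2*x3 + 16*X*m2^2*x1*x3^2 + 16*X*m2^2*x2^2*x3
    - 4*X*m3*m4*m5*x3^3 + 8*X*m3^2*m4*x1*x3^2 - 4*X*m3^2*m5*x2*x3^2 + 8*X*m3^3*x1*x2*x3 + 4*X^2*m0*m4*x1^2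
    - 8*X^2*m0*m5*x1*x2 - 16*X^2*m0*x1*x3 - 8*X^2*m0*x2^2 - 2*X^2*m1*m3*x1^2 + 4*X^2*m1*m4*x1*x2 + 8*X^2*m1*m5*x1*x3
    - 2*X^2*m1*m5*x2^2 - 8*X^2*m1*x2*x3 - 8*X^2*m2*m3*x1*x2 - 16*X^2*m2*m4*x1*x3 + 4*X^2*m2*m4*x2^2
    + 4*X^2*m2*m5*x2*x3 + 4*X^2*m2*x3^2 - 4*X^2*m2^2*x1^2 - 8*X^2*m3*m4*x2*x3 - 2*X^2*m3*m5*x3^2 + 4*X^2*m3^2*x1*x3
    - 4*X^2*m3^2*x2^2 - 4*X^2*m4^2*x3^2 - 4*X^3*m2*x1 - 4*X^3*m3*x2 - 4*X^3*m4*x3 - X^4 - 16*m0*m1*m2*x1^3*x2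
    + 8*m0*m1*m3*m5*x1^3*x2 - 8*m0*m1*m3*x1^2*x2^2 - 16*m0*m1*m3*x1^3*x3 + 16*m0*m1*m4*m5*x1^2*x2^2
    + 16*m0*m1*m4*m5*x1^3*x3 + 16*m0*m1*m4*x1*x2^3 + 48*m0*m1*m4*x1^2*x2*x3 - 48*m0*m1*m5*x1*x2^2*x3
    + 8*m0*m1*m5*x1^2*x3^2 + 8*m0*m1*m5*x2^4 + 8*m0*m1*m5^2*x1*x2^3 - 24*m0*m1*m5^2*x1^2*x2*x3 - 64*m0*m1*x1*x2*x3^2
    - 32*m0*m1*x2^3*x3 + 4*m0*m1^2*x1^4 + 32*m0*m2*m3*m5*x1^3*x3 + 32*m0*m2*m4*m5*x1^2*x2*x3 + 32*m0*m2*m4*x1*x2^2*x3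
    - 16*m0*m2*m4*x1^2*x3^2 + 48*m0*m2*m5*x1*x2*x3^2 + 16*m0*m2*m5*x2^3*x3 + 16*m0*m2*m5^2*x1*x2^2*x3
    + 16*m0*m2*m5^2*x1^2*x3^2 + 32*m0*m2*x1*x3^3 + 16*m0*m2*x2^2*x3^2 - 32*m0*m2^2*x1^3*x3 - 8*m0*m3*m4*m5*x1*x2^2*x3
    - 32*m0*m3*m4*m5*x1^2*x3^2 - 16*m0*m3*m4^2*x1^2*x2*x3 - 16*m0*m3*m5*x1*x3^3 - 8*m0*m3*m5*x2^2*x3^2
    - 24*m0*m3*m5^2*x1*x2*x3^2 - 8*m0*m3^2*m4*x1^3*x3 + 16*m0*m3^2*m5*x1^2*x2*x3 + 16*m0*m3^2*x1*x2^2*x3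
    + 32*m0*m3^2*x1^2*x3^2 - 16*m0*m4*m5*x2*x3^3 + 16*m0*m4*m5^2*x1*x3^3 + 4*m0*m4*m5^2*x2^2*x3^2
    + 16*m0*m4^2*m5*x1*x2*x3^2 - 32*m0*m4^2*x1*x3^3 + 16*m0*m4^3*x1^2*x3^2 + 4*m0*m5^2*x3^4 + 8*m0*m5^3*x2*x3^3
    + 16*m0^2*m4*x1^2*x2^2 + 32*m0^2*m4*x1^3*x3 - 32*m0^2*m5*x1*x2^3 - 64*m0^2*m5*x1^2*x2*x3 - 16*m0^2*m5^2*x1^2*x2^2
    - 32*m0^2*m5^2*x1^3*x3 - 64*m0^2*x1*x2^2*x3 - 64*m0^2*x1^2*x3^2 - 16*m0^2*x2^4 - 8*m1*m2*m3*m4*x1^3*x3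
    - 12*m1*m2*m3*m5*x1^2*x2*x3 - 8*m1*m2*m3*x1*x2^2*x3 - 32*m1*m2*m3*x1^2*x3^2 - 16*m1*m2*m4*m5*x1*x2^2*x3
    + 32*m1*m2*m4*m5*x1^2*x3^2 + 32*m1*m2*m4*x1*x2*x3^2 - 16*m1*m2*m4^2*x1^2*x2*x3 + 16*m1*m2*m5*x1*x3^3
    + 16*m1*m2*m5*x2^2*x3^2 + 16*m1*m2*m5^2*x1*x2*x3^2 - 4*m1*m2*m5^2*x2^3*x3 + 16*m1*m2^2*x1^2*x2*x3
    - 12*m1*m3*m4*m5*x1*x2*x3^2 + 32*m1*m3*m4*x1*x3^3 - 16*m1*m3*m4^2*x1^2*x3^2 + 8*m1*m3*m5*x2*x3^3
    - 8*m1*m3*m5^2*x1*x3^3 - 2*m1*m3*m5^2*x2^2*x3^2 + 8*m1*m3^2*m4*x1^2*x2*x3 + 4*m1*m3^2*m5*x1*x2^2*x3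
    + 14*m1*m3^2*m5*x1^2*x3^2 + 16*m1*m3^2*x1*x2*x3^2 + 4*m1*m3^3*x1^3*x3 + 4*m1^2*m2*x1^2*x2^2 + 16*m1^2*m2*x1^3*x3
    - 4*m1^2*m3*m4*x1^3*x2 - 2*m1^2*m3*m5*x1^2*x2^2 - 8*m1^2*m3*m5*x1^3*x3 - 24*m1^2*m3*x1^2*x2*x3 - m1^2*m3^2*x1^4
    - 4*m1^2*m4*m5*x1*x2^3 + 16*m1^2*m4*m5*x1^2*x2*x3 + 16*m1^2*m4*x1*x2^2*x3 + 16*m1^2*m4*x1^2*x3^2
    - 4*m1^2*m4^2*x1^2*x2^2 - 24*m1^2*m5*x1*x2*x3^2 + 8*m1^2*m5*x2^3*x3 + 8*m1^2*m5^2*x1*x2^2*x3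
    - 16*m1^2*m5^2*x1^2*x3^2 - m1^2*m5^2*x2^4 - 32*m1^2*x1*x3^3 - 16*m1^2*x2^2*x3^2 + 8*m1^3*x1^3*x2
    - 8*m2*m3*m4*m5*x1*x3^3 - 4*m2*m3*m5^2*x2*x3^3 + 20*m2*m3^2*m4*x1^2*x3^2 + 8*m2*m3^2*m5*x1*x2*x3^2
    - 8*m2*m3^2*x1*x3^3 - 16*m2^2*m3*m5*x1^2*x3^2 - 16*m2^2*m3*x1*x2*x3^2 - 16*m2^2*m4*m5*x1*x2*x3^2
    - 16*m2^2*m4^2*x1^2*x3^2 - 4*m2^2*m5^2*x2^2*x3^2 + 16*m2^3*x1^2*x3^2 - m3^2*m5^2*x3^4 + 4*m3^3*m5*x1*x3^3
    - 4*m3^4*x1^2*x3^2) / 8"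
proof -
  have "8 * minor44 (Lam x ** GN (H0mat f) 3 ** transpose (Lam x)) = h^3 * ((- 2*X*m1*x2 - 4*X*m2*x3 + 2*X*m3*m5*x3
      - X^2*m4 + X^2*m5^2 - 4*m0*x3^2 + m3^2*x3^2) * ((4*X*m4*x3 - 2*X*m5^2*x3 + X^2 + 8*m0*x1*x3 - 2*m1*m5*x1*x3
      - 4*m2*x3^2 + 4*m3*m5*x3^2 - 5*m4*m5^2*x3^2 + 4*m4^2*x3^2 + m5^4*x3^2) * (2*X*m5*x2 - 4*m0*x1^2 - 8*m1*x1*x2
      + 4*m2*m5*x1*x2 - 4*m2*x2^2 + 4*m3*m4*x1*x2 + 4*m3*m5*x2^2 - 2*m3*m5^2*x1*x2 + m3^2*x1^2 - 5*m4*m5^2*x2^2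
      + 4*m4^2*x2^2 + m5^4*x2^2) - (- X*m3*x1 - 2*X*m4*x2 - X*m5*x3 + X*m5^2*x2 - 4*m0*x1*x2 + m1*m5*x1*x2
      + 4*m1*x1*x3 - 2*m2*m5*x1*x3 + 4*m2*x2*x3 - 2*m3*m4*x1*x3 - 4*m3*m5*x2*x3 + m3*m5^2*x1*x3 + 5*m4*m5^2*x2*x3
      - 4*m4^2*x2*x3 - m5^4*x2*x3) * (- X*m3*x1 - 2*X*m4*x2 - X*m5*x3 + X*m5^2*x2 - 4*m0*x1*x2 + m1*m5*x1*x2
      + 4*m1*x1*x3 - 2*m2*m5*x1*x3 + 4*m2*x2*x3 - 2*m3*m4*x1*x3 - 4*m3*m5*x2*x3 + m3*m5^2*x1*x3 + 5*m4*m5^2*x2*x3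
      - 4*m4^2*x2*x3 - m5^4*x2*x3)) - (X*m1*x1 - X*m3*x3 + 3*X*m4*m5*x3 - X*m5^3*x3 + X^2*m5 - 4*m0*x2*x3
      + m1*m5*x2*x3 - 4*m1*x3^2 + 2*m2*m5*x3^2 + 2*m3*m4*x3^2 - m3*m5^2*x3^2) * ((X*m1*x1 - X*m3*x3 + 3*X*m4*m5*x3
      - X*m5^3*x3 + X^2*m5 - 4*m0*x2*x3 + m1*m5*x2*x3 - 4*m1*x3^2 + 2*m2*m5*x3^2 + 2*m3*m4*x3^2
      - m3*m5^2*x3^2) * (2*X*m5*x2 - 4*m0*x1^2 - 8*m1*x1*x2 + 4*m2*m5*x1*x2 - 4*m2*x2^2 + 4*m3*m4*x1*x2 + 4*m3*m5*x2^2
      - 2*m3*m5^2*x1*x2 + m3^2*x1^2 - 5*m4*m5^2*x2^2 + 4*m4^2*x2^2 + m5^4*x2^2) - (- X*m3*x1 - 2*X*m4*x2 - X*m5*x3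
      + X*m5^2*x2 - 4*m0*x1*x2 + m1*m5*x1*x2 + 4*m1*x1*x3 - 2*m2*m5*x1*x3 + 4*m2*x2*x3 - 2*m3*m4*x1*x3 - 4*m3*m5*x2*x3
      + m3*m5^2*x1*x3 + 5*m4*m5^2*x2*x3 - 4*m4^2*x2*x3 - m5^4*x2*x3) * (2*X*m2*x1 - X*m3*m5*x1 + 2*X*m3*x2
      - 3*X*m4*m5*x2 + X*m5^3*x2 + X^2 + 4*m0*x1*x3 + 4*m0*x2^2 - m1*m5*x2^2 + 4*m1*x2*x3 - 2*m2*m5*x2*x3
      - 2*m3*m4*x2*x3 + m3*m5^2*x2*x3 - m3^2*x1*x3)) + (2*X*m2*x1 - X*m3*m5*x1 + 2*X*m3*x2 - 3*X*m4*m5*x2 + X*m5^3*x2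
      + X^2 + 4*m0*x1*x3 + 4*m0*x2^2 - m1*m5*x2^2 + 4*m1*x2*x3 - 2*m2*m5*x2*x3 - 2*m3*m4*x2*x3 + m3*m5^2*x2*x3
      - m3^2*x1*x3) * ((X*m1*x1 - X*m3*x3 + 3*X*m4*m5*x3 - X*m5^3*x3 + X^2*m5 - 4*m0*x2*x3 + m1*m5*x2*x3 - 4*m1*x3^2
      + 2*m2*m5*x3^2 + 2*m3*m4*x3^2 - m3*m5^2*x3^2) * (- X*m3*x1 - 2*X*m4*x2 - X*m5*x3 + X*m5^2*x2 - 4*m0*x1*x2
      + m1*m5*x1*x2 + 4*m1*x1*x3 - 2*m2*m5*x1*x3 + 4*m2*x2*x3 - 2*m3*m4*x1*x3 - 4*m3*m5*x2*x3 + m3*m5^2*x1*x3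
      + 5*m4*m5^2*x2*x3 - 4*m4^2*x2*x3 - m5^4*x2*x3) - (4*X*m4*x3 - 2*X*m5^2*x3 + X^2 + 8*m0*x1*x3 - 2*m1*m5*x1*x3
      - 4*m2*x3^2 + 4*m3*m5*x3^2 - 5*m4*m5^2*x3^2 + 4*m4^2*x3^2 + m5^4*x3^2) * (2*X*m2*x1 - X*m3*m5*x1 + 2*X*m3*x2
      - 3*X*m4*m5*x2 + X*m5^3*x2 + X^2 + 4*m0*x1*x3 + 4*m0*x2^2 - m1*m5*x2^2 + 4*m1*x2*x3 - 2*m2*m5*x2*x3
      - 2*m3*m4*x2*x3 + m3*m5^2*x2*x3 - m3^2*x1*x3)))"
    by (rule minor44_halves; rule B_H0_3)
  also have "\<dots> = (h*X)^2 * (h * (8*X*m0*m1*m5*x1^3 - 16*X*m0*m2*m5*x1^2*x2 - 16*X*m0*m2*x1*x2^2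
      - 32*X*m0*m2*x1^2*x3 + 8*X*m0*m3*m4*x1^2*x2 - 16*X*m0*m3*m5*x1*x2^2 - 32*X*m0*m3*x1*x2*x3 - 16*X*m0*m3*x2^3
      + 24*X*m0*m4*m5*x1*x2*x3 + 8*X*m0*m4*m5*x2^3 - 32*X*m0*m4*x1*x3^2 - 16*X*m0*m4*x2^2*x3 + 16*X*m0*m4^2*x1*x2^2
      + 16*X*m0*m4^2*x1^2*x3 + 8*X*m0*m5^2*x1*x3^2 + 16*X*m0*m5^2*x2^2*x3 - 4*X*m1*m2*m3*x1^3 - 8*X*m1*m2*m4*x1^2*x2
      + 4*X*m1*m2*m5*x1*x2^2 + 16*X*m1*m2*m5*x1^2*x3 + 24*X*m1*m2*x1*x2*x3 + 8*X*m1*m2*x2^3 - 8*X*m1*m3*m4*x1*x2^2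
      - 12*X*m1*m3*m4*x1^2*x3 - 16*X*m1*m3*m5*x1*x2*x3 - 4*X*m1*m3*m5*x2^3 - 16*X*m1*m3*x2^2*x3 - 4*X*m1*m3^2*x1^2*x2
      + 16*X*m1*m4*m5*x1*x3^2 + 4*X*m1*m4*m5*x2^2*x3 - 16*X*m1*m4*x2*x3^2 + 8*X*m1*m4^2*x1*x2*x3 + 8*X*m1*m5*x3^3
      + 16*X*m1*m5^2*x2*x3^2 + 16*X*m1^2*m5*x1^2*x2 + 16*X*m1^2*x1*x2^2 + 8*X*m1^2*x1^2*x3 - 24*X*m2*m3*m4*x1*x2*x3
      - 12*X*m2*m3*m5*x1*x3^2 - 8*X*m2*m3*m5*x2^2*x3 + 8*X*m2*m3*x2*x3^2 + 8*X*m2*m3^2*x1^2*x3 - 8*X*m2*m4*m5*x2*x3^2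
      - 16*X*m2*m4^2*x1*x3^2 - 16*X*m2^2*m4*x1^2*x3 + 8*X*m2^2*m5*x1*x2*x3 + 16*X*m2^2*x1*x3^2 + 16*X*m2^2*x2^2*x3
      - 4*X*m3*m4*m5*x3^3 + 8*X*m3^2*m4*x1*x3^2 - 4*X*m3^2*m5*x2*x3^2 + 8*X*m3^3*x1*x2*x3 + 4*X^2*m0*m4*x1^2
      - 8*X^2*m0*m5*x1*x2 - 16*X^2*m0*x1*x3 - 8*X^2*m0*x2^2 - 2*X^2*m1*m3*x1^2 + 4*X^2*m1*m4*x1*x2 + 8*X^2*m1*m5*x1*x3
      - 2*X^2*m1*m5*x2^2 - 8*X^2*m1*x2*x3 - 8*X^2*m2*m3*x1*x2 - 16*X^2*m2*m4*x1*x3 + 4*X^2*m2*m4*x2^2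
      + 4*X^2*m2*m5*x2*x3 + 4*X^2*m2*x3^2 - 4*X^2*m2^2*x1^2 - 8*X^2*m3*m4*x2*x3 - 2*X^2*m3*m5*x3^2 + 4*X^2*m3^2*x1*x3
      - 4*X^2*m3^2*x2^2 - 4*X^2*m4^2*x3^2 - 4*X^3*m2*x1 - 4*X^3*m3*x2 - 4*X^3*m4*x3 - X^4 - 16*m0*m1*m2*x1^3*x2
      + 8*m0*m1*m3*m5*x1^3*x2 - 8*m0*m1*m3*x1^2*x2^2 - 16*m0*m1*m3*x1^3*x3 + 16*m0*m1*m4*m5*x1^2*x2^2
      + 16*m0*m1*m4*m5*x1^3*x3 + 16*m0*m1*m4*x1*x2^3 + 48*m0*m1*m4*x1^2*x2*x3 - 48*m0*m1*m5*x1*x2^2*x3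
      + 8*m0*m1*m5*x1^2*x3^2 + 8*m0*m1*m5*x2^4 + 8*m0*m1*m5^2*x1*x2^3 - 24*m0*m1*m5^2*x1^2*x2*x3 - 64*m0*m1*x1*x2*x3^2
      - 32*m0*m1*x2^3*x3 + 4*m0*m1^2*x1^4 + 32*m0*m2*m3*m5*x1^3*x3 + 32*m0*m2*m4*m5*x1^2*x2*x3
      + 32*m0*m2*m4*x1*x2^2*x3 - 16*m0*m2*m4*x1^2*x3^2 + 48*m0*m2*m5*x1*x2*x3^2 + 16*m0*m2*m5*x2^3*x3
      + 16*m0*m2*m5^2*x1*x2^2*x3 + 16*m0*m2*m5^2*x1^2*x3^2 + 32*m0*m2*x1*x3^3 + 16*m0*m2*x2^2*x3^2
      - 32*m0*m2^2*x1^3*x3 - 8*m0*m3*m4*m5*x1*x2^2*x3 - 32*m0*m3*m4*m5*x1^2*x3^2 - 16*m0*m3*m4^2*x1^2*x2*x3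
      - 16*m0*m3*m5*x1*x3^3 - 8*m0*m3*m5*x2^2*x3^2 - 24*m0*m3*m5^2*x1*x2*x3^2 - 8*m0*m3^2*m4*x1^3*x3
      + 16*m0*m3^2*m5*x1^2*x2*x3 + 16*m0*m3^2*x1*x2^2*x3 + 32*m0*m3^2*x1^2*x3^2 - 16*m0*m4*m5*x2*x3^3
      + 16*m0*m4*m5^2*x1*x3^3 + 4*m0*m4*m5^2*x2^2*x3^2 + 16*m0*m4^2*m5*x1*x2*x3^2 - 32*m0*m4^2*x1*x3^3
      + 16*m0*m4^3*x1^2*x3^2 + 4*m0*m5^2*x3^4 + 8*m0*m5^3*x2*x3^3 + 16*m0^2*m4*x1^2*x2^2 + 32*m0^2*m4*x1^3*x3
      - 32*m0^2*m5*x1*x2^3 - 64*m0^2*m5*x1^2*x2*x3 - 16*m0^2*m5^2*x1^2*x2^2 - 32*m0^2*m5^2*x1^3*x3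
      - 64*m0^2*x1*x2^2*x3 - 64*m0^2*x1^2*x3^2 - 16*m0^2*x2^4 - 8*m1*m2*m3*m4*x1^3*x3 - 12*m1*m2*m3*m5*x1^2*x2*x3
      - 8*m1*m2*m3*x1*x2^2*x3 - 32*m1*m2*m3*x1^2*x3^2 - 16*m1*m2*m4*m5*x1*x2^2*x3 + 32*m1*m2*m4*m5*x1^2*x3^2
      + 32*m1*m2*m4*x1*x2*x3^2 - 16*m1*m2*m4^2*x1^2*x2*x3 + 16*m1*m2*m5*x1*x3^3 + 16*m1*m2*m5*x2^2*x3^2
      + 16*m1*m2*m5^2*x1*x2*x3^2 - 4*m1*m2*m5^2*x2^3*x3 + 16*m1*m2^2*x1^2*x2*x3 - 12*m1*m3*m4*m5*x1*x2*x3^2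
      + 32*m1*m3*m4*x1*x3^3 - 16*m1*m3*m4^2*x1^2*x3^2 + 8*m1*m3*m5*x2*x3^3 - 8*m1*m3*m5^2*x1*x3^3
      - 2*m1*m3*m5^2*x2^2*x3^2 + 8*m1*m3^2*m4*x1^2*x2*x3 + 4*m1*m3^2*m5*x1*x2^2*x3 + 14*m1*m3^2*m5*x1^2*x3^2
      + 16*m1*m3^2*x1*x2*x3^2 + 4*m1*m3^3*x1^3*x3 + 4*m1^2*m2*x1^2*x2^2 + 16*m1^2*m2*x1^3*x3 - 4*m1^2*m3*m4*x1^3*x2
      - 2*m1^2*m3*m5*x1^2*x2^2 - 8*m1^2*m3*m5*x1^3*x3 - 24*m1^2*m3*x1^2*x2*x3 - m1^2*m3^2*x1^4 - 4*m1^2*m4*m5*x1*x2^3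
      + 16*m1^2*m4*m5*x1^2*x2*x3 + 16*m1^2*m4*x1*x2^2*x3 + 16*m1^2*m4*x1^2*x3^2 - 4*m1^2*m4^2*x1^2*x2^2
      - 24*m1^2*m5*x1*x2*x3^2 + 8*m1^2*m5*x2^3*x3 + 8*m1^2*m5^2*x1*x2^2*x3 - 16*m1^2*m5^2*x1^2*x3^2 - m1^2*m5^2*x2^4
      - 32*m1^2*x1*x3^3 - 16*m1^2*x2^2*x3^2 + 8*m1^3*x1^3*x2 - 8*m2*m3*m4*m5*x1*x3^3 - 4*m2*m3*m5^2*x2*x3^3
      + 20*m2*m3^2*m4*x1^2*x3^2 + 8*m2*m3^2*m5*x1*x2*x3^2 - 8*m2*m3^2*x1*x3^3 - 16*m2^2*m3*m5*x1^2*x3^2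
      - 16*m2^2*m3*x1*x2*x3^2 - 16*m2^2*m4*m5*x1*x2*x3^2 - 16*m2^2*m4^2*x1^2*x3^2 - 4*m2^2*m5^2*x2^2*x3^2
      + 16*m2^3*x1^2*x3^2 - m3^2*m5^2*x3^4 + 4*m3^3*m5*x1*x3^3 - 4*m3^4*x1^2*x3^2))"
    by algebra
  finally have *: "minor44 (Lam x ** GN (H0mat f) 3 ** transpose (Lam x)) = (h*X)^2 * (h * (8*X*m0*m1*m5*x1^3
      - 16*X*m0*m2*m5*x1^2*x2 - 16*X*m0*m2*x1*x2^2 - 32*X*m0*m2*x1^2*x3 + 8*X*m0*m3*m4*x1^2*x2 - 16*X*m0*m3*m5*x1*x2^2
      - 32*X*m0*m3*x1*x2*x3 - 16*X*m0*m3*x2^3 + 24*X*m0*m4*m5*x1*x2*x3 + 8*X*m0*m4*m5*x2^3 - 32*X*m0*m4*x1*x3^2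
      - 16*X*m0*m4*x2^2*x3 + 16*X*m0*m4^2*x1*x2^2 + 16*X*m0*m4^2*x1^2*x3 + 8*X*m0*m5^2*x1*x3^2 + 16*X*m0*m5^2*x2^2*x3
      - 4*X*m1*m2*m3*x1^3 - 8*X*m1*m2*m4*x1^2*x2 + 4*X*m1*m2*m5*x1*x2^2 + 16*X*m1*m2*m5*x1^2*x3 + 24*X*m1*m2*x1*x2*x3
      + 8*X*m1*m2*x2^3 - 8*X*m1*m3*m4*x1*x2^2 - 12*X*m1*m3*m4*x1^2*x3 - 16*X*m1*m3*m5*x1*x2*x3 - 4*X*m1*m3*m5*x2^3
      - 16*X*m1*m3*x2^2*x3 - 4*X*m1*m3^2*x1^2*x2 + 16*X*m1*m4*m5*x1*x3^2 + 4*X*m1*m4*m5*x2^2*x3 - 16*X*m1*m4*x2*x3^2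
      + 8*X*m1*m4^2*x1*x2*x3 + 8*X*m1*m5*x3^3 + 16*X*m1*m5^2*x2*x3^2 + 16*X*m1^2*m5*x1^2*x2 + 16*X*m1^2*x1*x2^2
      + 8*X*m1^2*x1^2*x3 - 24*X*m2*m3*m4*x1*x2*x3 - 12*X*m2*m3*m5*x1*x3^2 - 8*X*m2*m3*m5*x2^2*x3 + 8*X*m2*m3*x2*x3^2
      + 8*X*m2*m3^2*x1^2*x3 - 8*X*m2*m4*m5*x2*x3^2 - 16*X*m2*m4^2*x1*x3^2 - 16*X*m2^2*m4*x1^2*x3
      + 8*X*m2^2*m5*x1*x2*x3 + 16*X*m2^2*x1*x3^2 + 16*X*m2^2*x2^2*x3 - 4*X*m3*m4*m5*x3^3 + 8*X*m3^2*m4*x1*x3^2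
      - 4*X*m3^2*m5*x2*x3^2 + 8*X*m3^3*x1*x2*x3 + 4*X^2*m0*m4*x1^2 - 8*X^2*m0*m5*x1*x2 - 16*X^2*m0*x1*x3
      - 8*X^2*m0*x2^2 - 2*X^2*m1*m3*x1^2 + 4*X^2*m1*m4*x1*x2 + 8*X^2*m1*m5*x1*x3 - 2*X^2*m1*m5*x2^2 - 8*X^2*m1*x2*x3
      - 8*X^2*m2*m3*x1*x2 - 16*X^2*m2*m4*x1*x3 + 4*X^2*m2*m4*x2^2 + 4*X^2*m2*m5*x2*x3 + 4*X^2*m2*x3^2
      - 4*X^2*m2^2*x1^2 - 8*X^2*m3*m4*x2*x3 - 2*X^2*m3*m5*x3^2 + 4*X^2*m3^2*x1*x3 - 4*X^2*m3^2*x2^2 - 4*X^2*m4^2*x3^2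
      - 4*X^3*m2*x1 - 4*X^3*m3*x2 - 4*X^3*m4*x3 - X^4 - 16*m0*m1*m2*x1^3*x2 + 8*m0*m1*m3*m5*x1^3*x2
      - 8*m0*m1*m3*x1^2*x2^2 - 16*m0*m1*m3*x1^3*x3 + 16*m0*m1*m4*m5*x1^2*x2^2 + 16*m0*m1*m4*m5*x1^3*x3
      + 16*m0*m1*m4*x1*x2^3 + 48*m0*m1*m4*x1^2*x2*x3 - 48*m0*m1*m5*x1*x2^2*x3 + 8*m0*m1*m5*x1^2*x3^2 + 8*m0*m1*m5*x2^4
      + 8*m0*m1*m5^2*x1*x2^3 - 24*m0*m1*m5^2*x1^2*x2*x3 - 64*m0*m1*x1*x2*x3^2 - 32*m0*m1*x2^3*x3 + 4*m0*m1^2*x1^4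
      + 32*m0*m2*m3*m5*x1^3*x3 + 32*m0*m2*m4*m5*x1^2*x2*x3 + 32*m0*m2*m4*x1*x2^2*x3 - 16*m0*m2*m4*x1^2*x3^2
      + 48*m0*m2*m5*x1*x2*x3^2 + 16*m0*m2*m5*x2^3*x3 + 16*m0*m2*m5^2*x1*x2^2*x3 + 16*m0*m2*m5^2*x1^2*x3^2
      + 32*m0*m2*x1*x3^3 + 16*m0*m2*x2^2*x3^2 - 32*m0*m2^2*x1^3*x3 - 8*m0*m3*m4*m5*x1*x2^2*x3
      - 32*m0*m3*m4*m5*x1^2*x3^2 - 16*m0*m3*m4^2*x1^2*x2*x3 - 16*m0*m3*m5*x1*x3^3 - 8*m0*m3*m5*x2^2*x3^2
      - 24*m0*m3*m5^2*x1*x2*x3^2 - 8*m0*m3^2*m4*x1^3*x3 + 16*m0*m3^2*m5*x1^2*x2*x3 + 16*m0*m3^2*x1*x2^2*x3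
      + 32*m0*m3^2*x1^2*x3^2 - 16*m0*m4*m5*x2*x3^3 + 16*m0*m4*m5^2*x1*x3^3 + 4*m0*m4*m5^2*x2^2*x3^2
      + 16*m0*m4^2*m5*x1*x2*x3^2 - 32*m0*m4^2*x1*x3^3 + 16*m0*m4^3*x1^2*x3^2 + 4*m0*m5^2*x3^4 + 8*m0*m5^3*x2*x3^3
      + 16*m0^2*m4*x1^2*x2^2 + 32*m0^2*m4*x1^3*x3 - 32*m0^2*m5*x1*x2^3 - 64*m0^2*m5*x1^2*x2*x3
      - 16*m0^2*m5^2*x1^2*x2^2 - 32*m0^2*m5^2*x1^3*x3 - 64*m0^2*x1*x2^2*x3 - 64*m0^2*x1^2*x3^2 - 16*m0^2*x2^4
      - 8*m1*m2*m3*m4*x1^3*x3 - 12*m1*m2*m3*m5*x1^2*x2*x3 - 8*m1*m2*m3*x1*x2^2*x3 - 32*m1*m2*m3*x1^2*x3^2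
      - 16*m1*m2*m4*m5*x1*x2^2*x3 + 32*m1*m2*m4*m5*x1^2*x3^2 + 32*m1*m2*m4*x1*x2*x3^2 - 16*m1*m2*m4^2*x1^2*x2*x3
      + 16*m1*m2*m5*x1*x3^3 + 16*m1*m2*m5*x2^2*x3^2 + 16*m1*m2*m5^2*x1*x2*x3^2 - 4*m1*m2*m5^2*x2^3*x3
      + 16*m1*m2^2*x1^2*x2*x3 - 12*m1*m3*m4*m5*x1*x2*x3^2 + 32*m1*m3*m4*x1*x3^3 - 16*m1*m3*m4^2*x1^2*x3^2
      + 8*m1*m3*m5*x2*x3^3 - 8*m1*m3*m5^2*x1*x3^3 - 2*m1*m3*m5^2*x2^2*x3^2 + 8*m1*m3^2*m4*x1^2*x2*x3
      + 4*m1*m3^2*m5*x1*x2^2*x3 + 14*m1*m3^2*m5*x1^2*x3^2 + 16*m1*m3^2*x1*x2*x3^2 + 4*m1*m3^3*x1^3*x3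
      + 4*m1^2*m2*x1^2*x2^2 + 16*m1^2*m2*x1^3*x3 - 4*m1^2*m3*m4*x1^3*x2 - 2*m1^2*m3*m5*x1^2*x2^2
      - 8*m1^2*m3*m5*x1^3*x3 - 24*m1^2*m3*x1^2*x2*x3 - m1^2*m3^2*x1^4 - 4*m1^2*m4*m5*x1*x2^3
      + 16*m1^2*m4*m5*x1^2*x2*x3 + 16*m1^2*m4*x1*x2^2*x3 + 16*m1^2*m4*x1^2*x3^2 - 4*m1^2*m4^2*x1^2*x2^2
      - 24*m1^2*m5*x1*x2*x3^2 + 8*m1^2*m5*x2^3*x3 + 8*m1^2*m5^2*x1*x2^2*x3 - 16*m1^2*m5^2*x1^2*x3^2 - m1^2*m5^2*x2^4
      - 32*m1^2*x1*x3^3 - 16*m1^2*x2^2*x3^2 + 8*m1^3*x1^3*x2 - 8*m2*m3*m4*m5*x1*x3^3 - 4*m2*m3*m5^2*x2*x3^3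
      + 20*m2*m3^2*m4*x1^2*x3^2 + 8*m2*m3^2*m5*x1*x2*x3^2 - 8*m2*m3^2*x1*x3^3 - 16*m2^2*m3*m5*x1^2*x3^2
      - 16*m2^2*m3*x1*x2*x3^2 - 16*m2^2*m4*m5*x1*x2*x3^2 - 16*m2^2*m4^2*x1^2*x3^2 - 4*m2^2*m5^2*x2^2*x3^2
      + 16*m2^3*x1^2*x3^2 - m3^2*m5^2*x3^4 + 4*m3^3*m5*x1*x3^3 - 4*m3^4*x1^2*x3^2) / 8)"
    by (rule eighth)
  have c: "(h*X)^2 * p / (h*X)^2 = p" for p
    using h X by simp
  show ?thesis
    unfolding Er_minor44 x * by (rule c)
qed

text \<open>With x_4 = h X each of these quartics is h/8 times a polynomial with integer
  coefficients, the shape in which \<open>quartic_eq_square\<close> consumes them.\<close>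

lemma QstarH_H0_0: "QstarH f (H0mat f) 0 x = h * (32*X*m0*m2*x1^3 + 24*X*m0*m3*x1^2*x2 + 16*X*m0*m4*x1*x2^2
    + 16*X*m0*m4*x1^2*x3 + 24*X*m0*m5*x1*x2*x3 + 8*X*m0*m5*x2^3 + 48*X*m0*x2^2*x3 + 4*X*m1*m3*x1^2*x3
    + 8*X*m1*m4*x1*x2*x3 + 8*X*m1*m5*x1*x3^2 + 4*X*m1*m5*x2^2*x3 + 32*X*m1*x2*x3^2 - 8*X*m1^2*x1^3 + 16*X*m2*x3^3
    - 4*X*m3*m5*x3^3 + 12*X^2*m0*x1^2 + 4*X^2*m1*x1*x2 - 4*X^2*m4*x3^2 - 4*X^3*x3 - 8*m0*m1*m3*x1^4
    + 8*m0*m1*m5*x1^2*x2^2 + 16*m0*m1*m5*x1^3*x3 + 16*m0*m1*x1*x2^3 + 16*m0*m1*x1^2*x2*x3 + 16*m0*m2*m3*x1^3*x2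
    + 16*m0*m2*m4*x1^2*x2^2 + 16*m0*m2*m5*x1*x2^3 + 48*m0*m2*x1^2*x3^2 + 16*m0*m2*x2^4 + 16*m0*m2^2*x1^4
    + 16*m0*m3*m4*x1^2*x2*x3 + 24*m0*m3*m5*x1*x2^2*x3 - 24*m0*m3*m5*x1^2*x3^2 + 32*m0*m3*x2^3*x3 + 8*m0*m3^2*x1^3*x3
    + 16*m0*m4*m5*x1*x2*x3^2 - 32*m0*m4*x1*x3^3 + 64*m0*m4*x2^2*x3^2 + 16*m0*m4^2*x1^2*x3^2 + 16*m0*m5*x2*x3^3
    + 16*m0*m5^2*x1*x3^3 - 12*m0*m5^2*x2^2*x3^2 + 16*m0*x3^4 + 16*m0^2*m4*x1^4 + 32*m0^2*m5*x1^3*x2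
    + 48*m0^2*x1^2*x2^2 - 32*m0^2*x1^3*x3 + 8*m1*m2*m5*x1^2*x3^2 + 16*m1*m2*x1*x2*x3^2 + 4*m1*m3*m5*x1*x2*x3^2
    + 16*m1*m3*x1*x3^3 + 8*m1*m3*x2^2*x3^2 + 32*m1*m4*x2*x3^3 - 8*m1*m5^2*x2*x3^3 - 4*m1^2*m2*x1^4 - 4*m1^2*m3*x1^3*x2
    - 4*m1^2*m4*x1^2*x2^2 - 4*m1^2*m5*x1*x2^3 + 8*m1^2*m5*x1^2*x2*x3 + 16*m1^2*x1*x2^2*x3 - 16*m1^2*x1^2*x3^2
    - 4*m1^2*x2^4 + 16*m2*m4*x3^4 - 4*m2*m5^2*x3^4 - 4*m3^2*x3^4) / 8"
  unfolding QstarH_def qstar_def sum_6 zrow_zcol Qmat_H0_0 vector_6 B_H0_1[unfolded GN_H0_1]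
  using h by (simp add: field_simps power2_eq_square power3_eq_cube power4_eq_xxxx)

lemma QstarH_H0_1: "QstarH f (H0mat f) 1 x = h * (24*X*m0*m3*x1^3 + 16*X*m0*m4*x1^2*x2 + 8*X*m0*m5*x1*x2^2
    - 16*X*m0*m5*x1^2*x3 - 48*X*m0*x1*x2*x3 + 12*X*m1*m3*x1^2*x2 + 8*X*m1*m4*x1*x2^2 + 16*X*m1*m4*x1^2*x3
    + 16*X*m1*m5*x1*x2*x3 + 4*X*m1*m5*x2^3 - 16*X*m1*x1*x3^2 + 8*X*m1*x2^2*x3 + 8*X*m2*m3*x1^2*x3
    + 16*X*m2*m4*x1*x2*x3 + 16*X*m2*m5*x1*x3^2 + 8*X*m2*m5*x2^2*x3 + 16*X*m2*x2*x3^2 + 8*X*m3*m4*x1*x3^2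
    + 12*X*m3*m5*x2*x3^2 + 24*X*m3*x3^3 + 4*X^2*m1*x1^2 + 8*X^2*m2*x1*x2 + 12*X^2*m3*x1*x3 + 8*X^2*m4*x2*x3
    + 4*X^2*m5*x3^2 + 4*X^3*x2 + 16*m0*m1*m5*x1^3*x2 + 32*m0*m1*x1^2*x2^2 + 16*m0*m2*m3*x1^4 - 32*m0*m2*m5*x1^3*x3
    - 64*m0*m2*x1^2*x2*x3 + 16*m0*m3*m4*x1^2*x2^2 + 16*m0*m3*m4*x1^3*x3 + 16*m0*m3*m5*x1*x2^3 - 40*m0*m3*m5*x1^2*x2*x3
    - 96*m0*m3*x1*x2^2*x3 + 16*m0*m3*x2^4 + 16*m0*m3^2*x1^3*x2 + 32*m0*m4*m5*x1*x2^2*x3 - 64*m0*m4*x1*x2*x3^2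
    + 32*m0*m4^2*x1^2*x2*x3 + 32*m0*m5*x2^2*x3^2 + 32*m0*m5^2*x1*x2*x3^2 + 8*m0*m5^2*x2^3*x3 + 32*m0*x2*x3^3
    + 16*m0^2*m5*x1^4 + 32*m0^2*x1^3*x2 + 16*m1*m2*m5*x1^2*x2*x3 + 32*m1*m2*x1*x2^2*x3 + 8*m1*m3*m4*x1^2*x2*x3
    + 12*m1*m3*m5*x1*x2^2*x3 - 24*m1*m3*m5*x1^2*x3^2 - 40*m1*m3*x1*x2*x3^2 + 16*m1*m3*x2^3*x3 + 4*m1*m3^2*x1^3*x3
    + 16*m1*m4*m5*x1*x2*x3^2 - 32*m1*m4*x1*x3^3 + 16*m1*m4^2*x1^2*x3^2 + 16*m1*m5*x2*x3^3 + 16*m1*m5^2*x1*x3^3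
    + 4*m1*m5^2*x2^2*x3^2 + 16*m1*x3^4 - 4*m1^2*m3*x1^4 + 4*m1^2*m5*x1^2*x2^2 + 16*m1^2*m5*x1^3*x3 + 8*m1^2*x1*x2^3
    + 32*m1^2*x1^2*x2*x3 + 8*m2*m3*m5*x1*x2*x3^2 + 16*m2*m3*x1*x3^3 + 16*m2*m3*x2^2*x3^2 + 16*m2^2*m5*x1^2*x3^2
    + 32*m2^2*x1*x2*x3^2 + 16*m3*m4*x3^4 - 4*m3*m5^2*x3^4 + 4*m3^2*m5*x1*x3^3 + 16*m3^2*x2*x3^3) / 8"
  unfolding QstarH_def qstar_def sum_6 zrow_zcol Qmat_H0_1 vector_6 B_H0_1[unfolded GN_H0_1]
  using h by (simp add: field_simps power2_eq_square power3_eq_cube power4_eq_xxxx)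

lemma QstarH_H0_2: "QstarH f (H0mat f) 2 x = h * (32*X*m0*m4*x1^3 + 32*X*m0*m5*x1^2*x2 + 48*X*m0*x1*x2^2
    - 4*X*m1*m3*x1^3 + 8*X*m1*m4*x1^2*x2 + 4*X*m1*m5*x1*x2^2 + 8*X*m1*m5*x1^2*x3 + 24*X*m1*x1*x2*x3 + 8*X*m1*x2^3
    + 16*X*m2*m4*x1^2*x3 + 8*X*m2*m5*x1*x2*x3 + 16*X*m2*x1*x3^2 + 16*X*m2*x2^2*x3 + 8*X*m3*m4*x1*x2*x3
    + 4*X*m3*m5*x1*x3^2 + 24*X*m3*x2*x3^2 + 8*X*m4*m5*x2*x3^2 + 48*X*m4*x3^3 + 16*X*m4^2*x1*x3^2 - 8*X*m5^2*x3^3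
    - 4*X^2*m2*x1^2 + 16*X^2*m4*x1*x3 - 4*X^2*m4*x2^2 + 4*X^2*m5*x2*x3 + 12*X^2*x3^2 - 4*X^3*x1 + 16*m0*m1*x1^3*x2
    + 32*m0*m2*m4*x1^4 + 32*m0*m2*m5*x1^3*x2 + 64*m0*m2*x1^2*x2^2 - 32*m0*m2*x1^3*x3 + 16*m0*m3*m4*x1^3*x2
    + 8*m0*m3*m5*x1^2*x2^2 + 16*m0*m3*m5*x1^3*x3 + 32*m0*m3*x1*x2^3 - 4*m0*m3^2*x1^4 + 16*m0*m4*m5*x1*x2^3
    - 32*m0*m4*x1*x2^2*x3 + 64*m0*m4*x1^2*x3^2 + 32*m0*m4*x2^4 + 16*m0*m4^2*x1^2*x2^2 + 16*m0*m5*x1*x2*x3^2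
    + 16*m0*m5*x2^3*x3 + 16*m0*m5^2*x1*x2^2*x3 - 16*m0*m5^2*x1^2*x3^2 - 4*m0*m5^2*x2^4 - 32*m0*x1*x3^3
    + 48*m0*x2^2*x3^2 + 16*m0^2*x1^4 + 16*m1*m2*x1^2*x2*x3 + 8*m1*m3*m4*x1^3*x3 + 4*m1*m3*m5*x1^2*x2*x3
    + 24*m1*m3*x1*x2^2*x3 - 24*m1*m3*x1^2*x3^2 + 16*m1*m4*m5*x1*x2^2*x3 - 16*m1*m4*x1*x2*x3^2 + 32*m1*m4*x2^3*x3
    + 16*m1*m4^2*x1^2*x2*x3 + 16*m1*m5*x1*x3^3 + 8*m1*m5*x2^2*x3^2 + 8*m1*m5^2*x1*x2*x3^2 - 4*m1*m5^2*x2^3*x3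
    + 32*m1*x2*x3^3 - 8*m1^2*m4*x1^4 - 8*m1^2*m5*x1^3*x2 - 12*m1^2*x1^2*x2^2 + 16*m1^2*x1^3*x3 + 16*m2*m3*x1*x2*x3^2
    + 16*m2*m4*m5*x1*x2*x3^2 + 32*m2*m4*x2^2*x3^2 + 16*m2*m4^2*x1^2*x3^2 - 4*m2*m5^2*x2^2*x3^2 + 16*m2*x3^4
    + 16*m2^2*x1^2*x3^2 + 8*m3*m4*m5*x1*x3^3 + 32*m3*m4*x2*x3^3 - 8*m3*m5*x3^4 - 4*m3*m5^2*x2*x3^3
    - 4*m3^2*m4*x1^2*x3^2 + 8*m3^2*x1*x3^3 - 8*m4*m5^2*x3^4 + 32*m4^2*x3^4) / 8"
  unfolding QstarH_def qstar_def sum_6 zrow_zcol Qmat_H0_2 vector_6 B_H0_1[unfolded GN_H0_1]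
  using h by (simp add: field_simps power2_eq_square power3_eq_cube power4_eq_xxxx)

end

end

section \<open>The ten fundamental quadrics\<close>

text \<open>In the normalisation of \<open>quad\<close> this is the form (x_4 + h l.x)^2 + h^2 x^T a
  x, where l.x and x^T a x involve only the first three coordinates.\<close>

definition quadric_mat :: "complex \<Rightarrow> complex \<Rightarrow> complex \<Rightarrow> complex \<Rightarrow> complex \<Rightarrow> complex \<Rightarrow> complex \<Rightarrow>
    complex \<Rightarrow> complex \<Rightarrow> complex \<Rightarrow> complex^4^4" where
  "quadric_mat h a11 a12 a13 a22 a23 a33 l1 l2 l3 =
     vector [vector [2*h^2*(a11 + l1*l1), 2*h^2*(a12 + l1*l2), 2*h^2*(a13 + l1*l3), 2*h*l1],
             vector [2*h^2*(a12 + l1*l2), 2*h^2*(a22 + l2*l2), 2*h^2*(a23 + l2*l3), 2*h*l2],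
             vector [2*h^2*(a13 + l1*l3), 2*h^2*(a23 + l2*l3), 2*h^2*(a33 + l3*l3), 2*h*l3],
             vector [2*h*l1, 2*h*l2, 2*h*l3, 2]]"

text \<open>The block diagonal matrix with blocks K/h^2 and d, transformed by the substitution
  contragredient to x_4 -> x_4 + h l.x. For d = det K it is 2 d times the inverse of the quadric
  built from a = adj K.\<close>

definition coquadric_mat :: "complex \<Rightarrow> complex \<Rightarrow> complex \<Rightarrow> complex \<Rightarrow> complex \<Rightarrow> complex \<Rightarrow> complex \<Rightarrow>
    complex \<Rightarrow> complex \<Rightarrow> complex \<Rightarrow> complex \<Rightarrow> complex^4^4" where
  "coquadric_mat h k11 k12 k13 k22 k23 k33 d l1 l2 l3 =
     (let m1 = k11*l1 + k12*l2 + k13*l3; m2 = k12*l1 + k22*l2 + k23*l3; m3 = k13*l1 + k23*l2 + k33*l3 in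
     vector [vector [k11/h^2, k12/h^2, k13/h^2, - m1/h],
             vector [k12/h^2, k22/h^2, k23/h^2, - m2/h],
             vector [k13/h^2, k23/h^2, k33/h^2, - m3/h],
             vector [- m1/h, - m2/h, - m3/h, d + l1*m1 + l2*m2 + l3*m3]])"

definition det_sym3 :: "complex \<Rightarrow> complex \<Rightarrow> complex \<Rightarrow> complex \<Rightarrow> complex \<Rightarrow> complex \<Rightarrow> complex" where
  "det_sym3 k11 k12 k13 k22 k23 k33 = k11*(k22*k33 - k23*k23) - k12*(k12*k33 - k23*k13) + k13*(k12*k23 - k22*k13)"

text \<open>For a factorisation of \<open>f/h\<close> into monic cubics \<open>r\<close> and \<open>s\<close>, let \<open>K\<close> be their Bezout matrix (up to signs)
  and \<open>\<lambda> = h l\<close> the vector of the first three \<open>\<lambda>\<^sub>i\<close>.  The square root of the quartic is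
  \<open>(x\<^sub>4 + \<lambda> x)\<^sup>2 + h\<^sup>2 x\<^sup>T adj(K) x\<close>, so that the dual form is given by \<open>K\<close> itself.\<close>

definition kummer_quadric :: "complex \<Rightarrow> complex poly \<Rightarrow> complex poly \<Rightarrow> complex^4^4" where
  "kummer_quadric h r s = (let r0 = coeff r 0; r1 = coeff r 1; r2 = coeff r 2;
       s0 = coeff s 0; s1 = coeff s 1; s2 = coeff s 2;
       k11 = r2 - s2; k12 = s1 - r1; k13 = r0 - s0;
       k22 = r0 - s0 + r1* s2 - r2* s1; k23 = r2* s0 - r0* s2; k33 = r0* s1 - r1* s0 in
     quadric_mat h (k22*k33 - k23*k23) (k13*k23 - k12*k33) (k12*k23 - k13*k22)
       (k11*k33 - k13*k13) (k12*k13 - k11*k23) (k11*k22 - k12*k12) (r0* s2 + r2* s0) (r0 + s0) (r1 + s1))"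

definition bezout_det :: "complex poly \<Rightarrow> complex poly \<Rightarrow> complex" where
  "bezout_det r s = (let r0 = coeff r 0; r1 = coeff r 1; r2 = coeff r 2;
       s0 = coeff s 0; s1 = coeff s 1; s2 = coeff s 2 in
     det_sym3 (r2 - s2) (s1 - r1) (r0 - s0) (r0 - s0 + r1* s2 - r2* s1) (r2* s0 - r0* s2) (r0* s1 - r1* s0))"

definition kummer_coquadric :: "complex \<Rightarrow> complex poly \<Rightarrow> complex poly \<Rightarrow> complex^4^4" where
  "kummer_coquadric h r s = (let r0 = coeff r 0; r1 = coeff r 1; r2 = coeff r 2;
       s0 = coeff s 0; s1 = coeff s 1; s2 = coeff s 2 in
     coquadric_mat h (r2 - s2) (s1 - r1) (r0 - s0) (r0 - s0 + r1* s2 - r2* s1) (r2* s0 - r0* s2) (r0* s1 - r1* s0)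
       (bezout_det r s) (r0* s2 + r2* s0) (r0 + s0) (r1 + s1))"

lemma symmetric_kummer_quadric: "transpose (kummer_quadric h r s) = kummer_quadric h r s"
  unfolding kummer_quadric_def Let_def quadric_mat_def vec_eq_iff forall_4 transpose_def vec_lambda_beta vector_4
  by (intro conjI refl)

lemma symmetric_kummer_coquadric: "transpose (kummer_coquadric h r s) = kummer_coquadric h r s"
  unfolding kummer_coquadric_def Let_def coquadric_mat_def vec_eq_iff forall_4 transpose_def vec_lambda_beta vector_4
  by (intro conjI refl)

text \<open>Exchanging the two cubics negates every k_ij and fixes l, and the adjugate is quadratic
  in the k_ij. So the quadric depends only on the unordered partition.\<close>

lemma kummer_quadric_commute: "kummer_quadric h s r = kummer_quadric h r s"
proof -
  have "coeff s 2 - coeff r 2 = - (coeff r 2 - coeff s 2)" "coeff r 1 - coeff s 1 = - (coeff s 1 - coeff r 1)"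
    "coeff s 0 - coeff r 0 = - (coeff r 0 - coeff s 0)"
    "coeff s 0 - coeff r 0 + coeff s 1 * coeff r 2 - coeff s 2 * coeff r 1 =
       - (coeff r 0 - coeff s 0 + coeff r 1 * coeff s 2 - coeff r 2 * coeff s 1)"
    "coeff s 2 * coeff r 0 - coeff s 0 * coeff r 2 = - (coeff r 2 * coeff s 0 - coeff r 0 * coeff s 2)"
    "coeff s 0 * coeff r 1 - coeff s 1 * coeff r 0 = - (coeff r 0 * coeff s 1 - coeff r 1 * coeff s 0)"
    "coeff s 0 * coeff r 2 + coeff s 2 * coeff r 0 = coeff r 0 * coeff s 2 + coeff r 2 * coeff s 0"
    by (simp_all add: algebra_simps)
  then show ?thesis
    unfolding kummer_quadric_def Let_def minus_mult_minus
    by (simp only: minus_mult_minus add.commute[of "coeff s 0"] add.commute[of "coeff s 1"])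
qed

text \<open>After the common unipotent substitution this is adj(K) K = det(K), a polynomial identity
  valid also for singular K.\<close>

lemma quadric_mat_coquadric_mat:
  assumes "h \<noteq> 0"
  shows "quadric_mat h (k22*k33 - k23*k23) (k13*k23 - k12*k33) (k12*k23 - k13*k22)
       (k11*k33 - k13*k13) (k12*k13 - k11*k23) (k11*k22 - k12*k12) l1 l2 l3
     ** coquadric_mat h k11 k12 k13 k22 k23 k33 (det_sym3 k11 k12 k13 k22 k23 k33) l1 l2 l3
     = mat (2 * det_sym3 k11 k12 k13 k22 k23 k33)"
  using assms unfolding quadric_mat_def coquadric_mat_def det_sym3_def Let_def
  by (simp add: vec_eq_iff forall_4 mat_def matrix_matrix_mult_def sum_4 field_simps power2_eq_square)

lemma kummer_quadric_coquadric:
  assumes "h \<noteq> 0"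
  shows "kummer_quadric h r s ** kummer_coquadric h r s = mat (2 * bezout_det r s)"
  unfolding kummer_quadric_def kummer_coquadric_def bezout_det_def Let_def
  by (rule quadric_mat_coquadric_mat[OF assms])

text \<open>The Bezout determinant is the resultant of the two cubics. It does not vanish when they
  have no common root, and then the quadric is nondegenerate.\<close>

lemma bezout_det_eq:
  assumes "r = [:-a, 1:] * [:-b, 1:] * [:-c, 1:]" "s = [:s0, s1, s2, 1:]"
  shows "bezout_det r s = poly s a * poly s b * poly s c"
  unfolding bezout_det_def det_sym3_def Let_def assms by (simp add: eval_nat_numeral coeff_pCons) algebra

lemma quad_4:
  fixes S :: "complex^4^4"
  assumes "transpose S = S"
  shows "quad S x = (S$1$1 * x$1^2 + S$2$2 * x$2^2 + S$3$3 * x$3^2 + S$4$4 * x$4^2) / 2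
    + S$1$2 * x$1 * x$2 + S$1$3 * x$1 * x$3 + S$1$4 * x$1 * x$4
    + S$2$3 * x$2 * x$3 + S$2$4 * x$2 * x$4 + S$3$4 * x$3 * x$4"
proof -
  have "transpose S $ i $ j = S $ j $ i" for i j by (simp add: transpose_def)
  then have *: "S $ i $ j = S $ j $ i" for i j by (simp add: assms)
  show ?thesis
    unfolding quad_def sum_4 *[of 2 1] *[of 3 1] *[of 4 1] *[of 3 2] *[of 4 2] *[of 4 3]
    by (simp add: field_simps power2_eq_square)
qed

lemma quad_quadric_mat:
  assumes "x $ 4 = h * X"
  shows "quad (quadric_mat h a11 a12 a13 a22 a23 a33 l1 l2 l3) x = h^2 * ((X + l1*x$1 + l2*x$2 + l3*x$3)^2
    + a11*(x$1)^2 + a22*(x$2)^2 + a33*(x$3)^2 + 2*a12*x$1*x$2 + 2*a13*x$1*x$3 + 2*a23*x$2*x$3)"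
proof -
  have sym: "transpose (quadric_mat h a11 a12 a13 a22 a23 a33 l1 l2 l3) = quadric_mat h a11 a12 a13 a22 a23 a33 l1 l2 l3"
    unfolding quadric_mat_def vec_eq_iff forall_4 transpose_def vec_lambda_beta vector_4
    by (intro conjI refl)
  show ?thesis
    unfolding quad_4[OF sym] unfolding quadric_mat_def vector_4 assms
    by (simp add: field_simps power2_eq_square)
qed

text \<open>The pairing of a form with a dual form is invariant under simultaneous substitution.
  Moving l to 0 turns l' into l' - l, hence only the differences appear, and the powers of h
  cancel.\<close>

lemma coquadric_mat_quadric_mat_trace:
  assumes "h \<noteq> 0"
  shows "(\<Sum>i\<in>UNIV. \<Sum>j\<in>UNIV. coquadric_mat h k11 k12 k13 k22 k23 k33 d l1 l2 l3 $ i $ j *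
      quadric_mat h a11 a12 a13 a22 a23 a33 l1' l2' l3' $ i $ j) =
    2 * (k11 * (a11 + (l1'-l1)^2) + k22 * (a22 + (l2'-l2)^2) + k33 * (a33 + (l3'-l3)^2)
      + 2*k12 * (a12 + (l1'-l1)*(l2'-l2)) + 2*k13 * (a13 + (l1'-l1)*(l3'-l3)) + 2*k23 * (a23 + (l2'-l2)*(l3'-l3)) + d)"
proof -
  have 1: "a / h^2 * (2*h^2*b) = 2*(a*b)" "- a / h * (2*h*b) = - 2*(a*b)" for a b
    using assms by simp_all
  show ?thesis
    unfolding quadric_mat_def coquadric_mat_def Let_def sum_4 vector_4 1
    by (simp add: algebra_simps power2_eq_square)
qed

text \<open>Two partitions whose parts meet in two and one elements: \<open>{p, q, a | b, c, d}\<close> and \<open>{p, q, b | a, c, d}\<close>,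
  where \<open>u\<close> vanishes at \<open>p, q\<close> and \<open>w\<close> at \<open>c, d\<close>.\<close>

lemma kummer_quadric_apolar:
  assumes "h \<noteq> 0" "r = [:u0, u1, 1:] * [:- a, 1:]" "s = [:w0, w1, 1:] * [:- b, 1:]"
    "r' = [:u0, u1, 1:] * [:- b, 1:]" "s' = [:w0, w1, 1:] * [:- a, 1:]"
  shows "(\<Sum>i\<in>UNIV. \<Sum>j\<in>UNIV. kummer_coquadric h r s $ i $ j * kummer_quadric h r' s' $ i $ j) = 0"
proof -
  have c: "coeff r 0 = - a*u0" "coeff r 1 = u0 - a*u1" "coeff r 2 = u1 - a"
    "coeff s 0 = - b*w0" "coeff s 1 = w0 - b*w1" "coeff s 2 = w1 - b"
    "coeff r' 0 = - b*u0" "coeff r' 1 = u0 - b*u1" "coeff r' 2 = u1 - b"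
    "coeff s' 0 = - a*w0" "coeff s' 1 = w0 - a*w1" "coeff s' 2 = w1 - a"
    unfolding assms by (simp_all add: eval_nat_numeral coeff_pCons)
  show ?thesis
    unfolding kummer_coquadric_def kummer_quadric_def bezout_det_def det_sym3_def Let_def
      coquadric_mat_quadric_mat_trace[OF assms(1)] c
    by algebra
qed

lemma cubic_product_coeffs:
  fixes h :: complex
  assumes "f = smult h ([:r0, r1, r2, 1:] * [:s0, s1, s2, 1:])"
  shows "coeff f 0 = h * (r0* s0)" "coeff f 1 = h * (r0* s1 + r1* s0)" "coeff f 2 = h * (r0* s2 + r1* s1 + r2* s0)"
    "coeff f 3 = h * (r0 + r1* s2 + r2* s1 + s0)" "coeff f 4 = h * (r1 + r2* s2 + s1)" "coeff f 5 = h * (r2 + s2)"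
    "coeff f 6 = h"
  unfolding assms by (simp_all add: eval_nat_numeral coeff_pCons algebra_simps)

text \<open>The computational core, freed of h: the left side is 64 P / h^2 with the coefficients of
  E_1, Q_2, Q_1, Q_0 and E_3 collected, the right side is -8 times the square of the fundamental
  quadric divided by h^2. After substitution it is an identity between polynomials in the
  coefficients of the cubics and x_1, x_2, x_3, X.\<close>

lemma quartic_eq_square:
  fixes r0 r1 r2 s0 s1 s2 m0 m1 m2 m3 m4 m5 l1 l2 l3 k11 k12 k13 k22 k23 k33 x1 x2 x3 X :: complex
  assumes "m0 = r0* s0" "m1 = r0* s1 + r1* s0" "m2 = r0* s2 + r1* s1 + r2* s0" "m3 = r0 + r1* s2 + r2* s1
      + s0" "m4 = r1 + r2* s2 + s1" "m5 = r2 + s2" "k11 = r2 - s2" "k12 = s1 - r1" "k13 = r0 - s0" "k22 = r0 - s0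
      + r1* s2 - r2* s1" "k23 = r2* s0 - r0* s2" "k33 = r0* s1 - r1* s0" "l1 = r0* s2 + r2* s0" "l2 = r0
      + s0" "l3 = r1 + s1"
  shows "4*(l2^2 - l1*l3 - 2*m4*l1 + m3*l2 - (m1*m5 - 4*m2*m4 + 2*m3^2))*(16*X*m0*x1^3 + 8*X*m1*x1^2*x2
      + 16*X*m2*x1^2*x3 + 8*X*m3*x1*x2*x3 + 16*X*m4*x1*x3^2 + 8*X*m5*x2*x3^2 + 16*X*x3^3 + 16*X^2*x1*x3 - 4*X^2*x2^2
      + 16*m0*m2*x1^4 + 16*m0*m3*x1^3*x2 + 16*m0*m4*x1^2*x2^2 + 16*m0*m5*x1*x2^3 - 16*m0*m5*x1^2*x2*x3
      - 32*m0*x1*x2^2*x3 + 16*m0*x1^2*x3^2 + 16*m0*x2^4 + 8*m1*m3*x1^3*x3 + 16*m1*m4*x1^2*x2*x3 + 16*m1*m5*x1*x2^2*x3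
      - 8*m1*m5*x1^2*x3^2 - 16*m1*x1*x2*x3^2 + 16*m1*x2^3*x3 - 4*m1^2*x1^4 + 16*m2*m4*x1^2*x3^2 + 16*m2*m5*x1*x2*x3^2
      + 16*m2*x2^2*x3^2 + 8*m3*m5*x1*x3^3 + 16*m3*x2*x3^3 - 4*m3^2*x1^2*x3^2 + 16*m4*x3^4 - 4*m5^2*x3^4) + 8*((l1
      - m2)*(32*X*m0*m4*x1^3 + 32*X*m0*m5*x1^2*x2 + 48*X*m0*x1*x2^2 - 4*X*m1*m3*x1^3 + 8*X*m1*m4*x1^2*x2
      + 4*X*m1*m5*x1*x2^2 + 8*X*m1*m5*x1^2*x3 + 24*X*m1*x1*x2*x3 + 8*X*m1*x2^3 + 16*X*m2*m4*x1^2*x3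
      + 8*X*m2*m5*x1*x2*x3 + 16*X*m2*x1*x3^2 + 16*X*m2*x2^2*x3 + 8*X*m3*m4*x1*x2*x3 + 4*X*m3*m5*x1*x3^2
      + 24*X*m3*x2*x3^2 + 8*X*m4*m5*x2*x3^2 + 48*X*m4*x3^3 + 16*X*m4^2*x1*x3^2 - 8*X*m5^2*x3^3 - 4*X^2*m2*x1^2
      + 16*X^2*m4*x1*x3 - 4*X^2*m4*x2^2 + 4*X^2*m5*x2*x3 + 12*X^2*x3^2 - 4*X^3*x1 + 16*m0*m1*x1^3*x2
      + 32*m0*m2*m4*x1^4 + 32*m0*m2*m5*x1^3*x2 + 64*m0*m2*x1^2*x2^2 - 32*m0*m2*x1^3*x3 + 16*m0*m3*m4*x1^3*x2
      + 8*m0*m3*m5*x1^2*x2^2 + 16*m0*m3*m5*x1^3*x3 + 32*m0*m3*x1*x2^3 - 4*m0*m3^2*x1^4 + 16*m0*m4*m5*x1*x2^3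
      - 32*m0*m4*x1*x2^2*x3 + 64*m0*m4*x1^2*x3^2 + 32*m0*m4*x2^4 + 16*m0*m4^2*x1^2*x2^2 + 16*m0*m5*x1*x2*x3^2
      + 16*m0*m5*x2^3*x3 + 16*m0*m5^2*x1*x2^2*x3 - 16*m0*m5^2*x1^2*x3^2 - 4*m0*m5^2*x2^4 - 32*m0*x1*x3^3
      + 48*m0*x2^2*x3^2 + 16*m0^2*x1^4 + 16*m1*m2*x1^2*x2*x3 + 8*m1*m3*m4*x1^3*x3 + 4*m1*m3*m5*x1^2*x2*x3
      + 24*m1*m3*x1*x2^2*x3 - 24*m1*m3*x1^2*x3^2 + 16*m1*m4*m5*x1*x2^2*x3 - 16*m1*m4*x1*x2*x3^2 + 32*m1*m4*x2^3*x3
      + 16*m1*m4^2*x1^2*x2*x3 + 16*m1*m5*x1*x3^3 + 8*m1*m5*x2^2*x3^2 + 8*m1*m5^2*x1*x2*x3^2 - 4*m1*m5^2*x2^3*x3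
      + 32*m1*x2*x3^3 - 8*m1^2*m4*x1^4 - 8*m1^2*m5*x1^3*x2 - 12*m1^2*x1^2*x2^2 + 16*m1^2*x1^3*x3 + 16*m2*m3*x1*x2*x3^2
      + 16*m2*m4*m5*x1*x2*x3^2 + 32*m2*m4*x2^2*x3^2 + 16*m2*m4^2*x1^2*x3^2 - 4*m2*m5^2*x2^2*x3^2 + 16*m2*x3^4
      + 16*m2^2*x1^2*x3^2 + 8*m3*m4*m5*x1*x3^3 + 32*m3*m4*x2*x3^3 - 8*m3*m5*x3^4 - 4*m3*m5^2*x2*x3^3
      - 4*m3^2*m4*x1^2*x3^2 + 8*m3^2*x1*x3^3 - 8*m4*m5^2*x3^4 + 32*m4^2*x3^4) + (m3 - l2)*(24*X*m0*m3*x1^3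
      + 16*X*m0*m4*x1^2*x2 + 8*X*m0*m5*x1*x2^2 - 16*X*m0*m5*x1^2*x3 - 48*X*m0*x1*x2*x3 + 12*X*m1*m3*x1^2*x2
      + 8*X*m1*m4*x1*x2^2 + 16*X*m1*m4*x1^2*x3 + 16*X*m1*m5*x1*x2*x3 + 4*X*m1*m5*x2^3 - 16*X*m1*x1*x3^2
      + 8*X*m1*x2^2*x3 + 8*X*m2*m3*x1^2*x3 + 16*X*m2*m4*x1*x2*x3 + 16*X*m2*m5*x1*x3^2 + 8*X*m2*m5*x2^2*x3
      + 16*X*m2*x2*x3^2 + 8*X*m3*m4*x1*x3^2 + 12*X*m3*m5*x2*x3^2 + 24*X*m3*x3^3 + 4*X^2*m1*x1^2 + 8*X^2*m2*x1*x2
      + 12*X^2*m3*x1*x3 + 8*X^2*m4*x2*x3 + 4*X^2*m5*x3^2 + 4*X^3*x2 + 16*m0*m1*m5*x1^3*x2 + 32*m0*m1*x1^2*x2^2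
      + 16*m0*m2*m3*x1^4 - 32*m0*m2*m5*x1^3*x3 - 64*m0*m2*x1^2*x2*x3 + 16*m0*m3*m4*x1^2*x2^2 + 16*m0*m3*m4*x1^3*x3
      + 16*m0*m3*m5*x1*x2^3 - 40*m0*m3*m5*x1^2*x2*x3 - 96*m0*m3*x1*x2^2*x3 + 16*m0*m3*x2^4 + 16*m0*m3^2*x1^3*x2
      + 32*m0*m4*m5*x1*x2^2*x3 - 64*m0*m4*x1*x2*x3^2 + 32*m0*m4^2*x1^2*x2*x3 + 32*m0*m5*x2^2*x3^2
      + 32*m0*m5^2*x1*x2*x3^2 + 8*m0*m5^2*x2^3*x3 + 32*m0*x2*x3^3 + 16*m0^2*m5*x1^4 + 32*m0^2*x1^3*x2
      + 16*m1*m2*m5*x1^2*x2*x3 + 32*m1*m2*x1*x2^2*x3 + 8*m1*m3*m4*x1^2*x2*x3 + 12*m1*m3*m5*x1*x2^2*x3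
      - 24*m1*m3*m5*x1^2*x3^2 - 40*m1*m3*x1*x2*x3^2 + 16*m1*m3*x2^3*x3 + 4*m1*m3^2*x1^3*x3 + 16*m1*m4*m5*x1*x2*x3^2
      - 32*m1*m4*x1*x3^3 + 16*m1*m4^2*x1^2*x3^2 + 16*m1*m5*x2*x3^3 + 16*m1*m5^2*x1*x3^3 + 4*m1*m5^2*x2^2*x3^2
      + 16*m1*x3^4 - 4*m1^2*m3*x1^4 + 4*m1^2*m5*x1^2*x2^2 + 16*m1^2*m5*x1^3*x3 + 8*m1^2*x1*x2^3 + 32*m1^2*x1^2*x2*x3
      + 8*m2*m3*m5*x1*x2*x3^2 + 16*m2*m3*x1*x3^3 + 16*m2*m3*x2^2*x3^2 + 16*m2^2*m5*x1^2*x3^2 + 32*m2^2*x1*x2*x3^2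
      + 16*m3*m4*x3^4 - 4*m3*m5^2*x3^4 + 4*m3^2*m5*x1*x3^3 + 16*m3^2*x2*x3^3) + (l3 - m4)*(32*X*m0*m2*x1^3
      + 24*X*m0*m3*x1^2*x2 + 16*X*m0*m4*x1*x2^2 + 16*X*m0*m4*x1^2*x3 + 24*X*m0*m5*x1*x2*x3 + 8*X*m0*m5*x2^3
      + 48*X*m0*x2^2*x3 + 4*X*m1*m3*x1^2*x3 + 8*X*m1*m4*x1*x2*x3 + 8*X*m1*m5*x1*x3^2 + 4*X*m1*m5*x2^2*x3
      + 32*X*m1*x2*x3^2 - 8*X*m1^2*x1^3 + 16*X*m2*x3^3 - 4*X*m3*m5*x3^3 + 12*X^2*m0*x1^2 + 4*X^2*m1*x1*x2
      - 4*X^2*m4*x3^2 - 4*X^3*x3 - 8*m0*m1*m3*x1^4 + 8*m0*m1*m5*x1^2*x2^2 + 16*m0*m1*m5*x1^3*x3 + 16*m0*m1*x1*x2^3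
      + 16*m0*m1*x1^2*x2*x3 + 16*m0*m2*m3*x1^3*x2 + 16*m0*m2*m4*x1^2*x2^2 + 16*m0*m2*m5*x1*x2^3 + 48*m0*m2*x1^2*x3^2
      + 16*m0*m2*x2^4 + 16*m0*m2^2*x1^4 + 16*m0*m3*m4*x1^2*x2*x3 + 24*m0*m3*m5*x1*x2^2*x3 - 24*m0*m3*m5*x1^2*x3^2
      + 32*m0*m3*x2^3*x3 + 8*m0*m3^2*x1^3*x3 + 16*m0*m4*m5*x1*x2*x3^2 - 32*m0*m4*x1*x3^3 + 64*m0*m4*x2^2*x3^2
      + 16*m0*m4^2*x1^2*x3^2 + 16*m0*m5*x2*x3^3 + 16*m0*m5^2*x1*x3^3 - 12*m0*m5^2*x2^2*x3^2 + 16*m0*x3^4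
      + 16*m0^2*m4*x1^4 + 32*m0^2*m5*x1^3*x2 + 48*m0^2*x1^2*x2^2 - 32*m0^2*x1^3*x3 + 8*m1*m2*m5*x1^2*x3^2
      + 16*m1*m2*x1*x2*x3^2 + 4*m1*m3*m5*x1*x2*x3^2 + 16*m1*m3*x1*x3^3 + 8*m1*m3*x2^2*x3^2 + 32*m1*m4*x2*x3^3
      - 8*m1*m5^2*x2*x3^3 - 4*m1^2*m2*x1^4 - 4*m1^2*m3*x1^3*x2 - 4*m1^2*m4*x1^2*x2^2 - 4*m1^2*m5*x1*x2^3
      + 8*m1^2*m5*x1^2*x2*x3 + 16*m1^2*x1*x2^2*x3 - 16*m1^2*x1^2*x3^2 - 4*m1^2*x2^4 + 16*m2*m4*x3^4 - 4*m2*m5^2*x3^4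
      - 4*m3^2*x3^4) + (8*X*m0*m1*m5*x1^3 - 16*X*m0*m2*m5*x1^2*x2 - 16*X*m0*m2*x1*x2^2 - 32*X*m0*m2*x1^2*x3
      + 8*X*m0*m3*m4*x1^2*x2 - 16*X*m0*m3*m5*x1*x2^2 - 32*X*m0*m3*x1*x2*x3 - 16*X*m0*m3*x2^3 + 24*X*m0*m4*m5*x1*x2*x3
      + 8*X*m0*m4*m5*x2^3 - 32*X*m0*m4*x1*x3^2 - 16*X*m0*m4*x2^2*x3 + 16*X*m0*m4^2*x1*x2^2 + 16*X*m0*m4^2*x1^2*x3
      + 8*X*m0*m5^2*x1*x3^2 + 16*X*m0*m5^2*x2^2*x3 - 4*X*m1*m2*m3*x1^3 - 8*X*m1*m2*m4*x1^2*x2 + 4*X*m1*m2*m5*x1*x2^2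
      + 16*X*m1*m2*m5*x1^2*x3 + 24*X*m1*m2*x1*x2*x3 + 8*X*m1*m2*x2^3 - 8*X*m1*m3*m4*x1*x2^2 - 12*X*m1*m3*m4*x1^2*x3
      - 16*X*m1*m3*m5*x1*x2*x3 - 4*X*m1*m3*m5*x2^3 - 16*X*m1*m3*x2^2*x3 - 4*X*m1*m3^2*x1^2*x2 + 16*X*m1*m4*m5*x1*x3^2
      + 4*X*m1*m4*m5*x2^2*x3 - 16*X*m1*m4*x2*x3^2 + 8*X*m1*m4^2*x1*x2*x3 + 8*X*m1*m5*x3^3 + 16*X*m1*m5^2*x2*x3^2
      + 16*X*m1^2*m5*x1^2*x2 + 16*X*m1^2*x1*x2^2 + 8*X*m1^2*x1^2*x3 - 24*X*m2*m3*m4*x1*x2*x3 - 12*X*m2*m3*m5*x1*x3^2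
      - 8*X*m2*m3*m5*x2^2*x3 + 8*X*m2*m3*x2*x3^2 + 8*X*m2*m3^2*x1^2*x3 - 8*X*m2*m4*m5*x2*x3^2 - 16*X*m2*m4^2*x1*x3^2
      - 16*X*m2^2*m4*x1^2*x3 + 8*X*m2^2*m5*x1*x2*x3 + 16*X*m2^2*x1*x3^2 + 16*X*m2^2*x2^2*x3 - 4*X*m3*m4*m5*x3^3
      + 8*X*m3^2*m4*x1*x3^2 - 4*X*m3^2*m5*x2*x3^2 + 8*X*m3^3*x1*x2*x3 + 4*X^2*m0*m4*x1^2 - 8*X^2*m0*m5*x1*x2
      - 16*X^2*m0*x1*x3 - 8*X^2*m0*x2^2 - 2*X^2*m1*m3*x1^2 + 4*X^2*m1*m4*x1*x2 + 8*X^2*m1*m5*x1*x3 - 2*X^2*m1*m5*x2^2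
      - 8*X^2*m1*x2*x3 - 8*X^2*m2*m3*x1*x2 - 16*X^2*m2*m4*x1*x3 + 4*X^2*m2*m4*x2^2 + 4*X^2*m2*m5*x2*x3 + 4*X^2*m2*x3^2
      - 4*X^2*m2^2*x1^2 - 8*X^2*m3*m4*x2*x3 - 2*X^2*m3*m5*x3^2 + 4*X^2*m3^2*x1*x3 - 4*X^2*m3^2*x2^2 - 4*X^2*m4^2*x3^2
      - 4*X^3*m2*x1 - 4*X^3*m3*x2 - 4*X^3*m4*x3 - X^4 - 16*m0*m1*m2*x1^3*x2 + 8*m0*m1*m3*m5*x1^3*x2
      - 8*m0*m1*m3*x1^2*x2^2 - 16*m0*m1*m3*x1^3*x3 + 16*m0*m1*m4*m5*x1^2*x2^2 + 16*m0*m1*m4*m5*x1^3*x3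
      + 16*m0*m1*m4*x1*x2^3 + 48*m0*m1*m4*x1^2*x2*x3 - 48*m0*m1*m5*x1*x2^2*x3 + 8*m0*m1*m5*x1^2*x3^2 + 8*m0*m1*m5*x2^4
      + 8*m0*m1*m5^2*x1*x2^3 - 24*m0*m1*m5^2*x1^2*x2*x3 - 64*m0*m1*x1*x2*x3^2 - 32*m0*m1*x2^3*x3 + 4*m0*m1^2*x1^4
      + 32*m0*m2*m3*m5*x1^3*x3 + 32*m0*m2*m4*m5*x1^2*x2*x3 + 32*m0*m2*m4*x1*x2^2*x3 - 16*m0*m2*m4*x1^2*x3^2
      + 48*m0*m2*m5*x1*x2*x3^2 + 16*m0*m2*m5*x2^3*x3 + 16*m0*m2*m5^2*x1*x2^2*x3 + 16*m0*m2*m5^2*x1^2*x3^2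
      + 32*m0*m2*x1*x3^3 + 16*m0*m2*x2^2*x3^2 - 32*m0*m2^2*x1^3*x3 - 8*m0*m3*m4*m5*x1*x2^2*x3
      - 32*m0*m3*m4*m5*x1^2*x3^2 - 16*m0*m3*m4^2*x1^2*x2*x3 - 16*m0*m3*m5*x1*x3^3 - 8*m0*m3*m5*x2^2*x3^2
      - 24*m0*m3*m5^2*x1*x2*x3^2 - 8*m0*m3^2*m4*x1^3*x3 + 16*m0*m3^2*m5*x1^2*x2*x3 + 16*m0*m3^2*x1*x2^2*x3
      + 32*m0*m3^2*x1^2*x3^2 - 16*m0*m4*m5*x2*x3^3 + 16*m0*m4*m5^2*x1*x3^3 + 4*m0*m4*m5^2*x2^2*x3^2
      + 16*m0*m4^2*m5*x1*x2*x3^2 - 32*m0*m4^2*x1*x3^3 + 16*m0*m4^3*x1^2*x3^2 + 4*m0*m5^2*x3^4 + 8*m0*m5^3*x2*x3^3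
      + 16*m0^2*m4*x1^2*x2^2 + 32*m0^2*m4*x1^3*x3 - 32*m0^2*m5*x1*x2^3 - 64*m0^2*m5*x1^2*x2*x3
      - 16*m0^2*m5^2*x1^2*x2^2 - 32*m0^2*m5^2*x1^3*x3 - 64*m0^2*x1*x2^2*x3 - 64*m0^2*x1^2*x3^2 - 16*m0^2*x2^4
      - 8*m1*m2*m3*m4*x1^3*x3 - 12*m1*m2*m3*m5*x1^2*x2*x3 - 8*m1*m2*m3*x1*x2^2*x3 - 32*m1*m2*m3*x1^2*x3^2
      - 16*m1*m2*m4*m5*x1*x2^2*x3 + 32*m1*m2*m4*m5*x1^2*x3^2 + 32*m1*m2*m4*x1*x2*x3^2 - 16*m1*m2*m4^2*x1^2*x2*x3
      + 16*m1*m2*m5*x1*x3^3 + 16*m1*m2*m5*x2^2*x3^2 + 16*m1*m2*m5^2*x1*x2*x3^2 - 4*m1*m2*m5^2*x2^3*x3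
      + 16*m1*m2^2*x1^2*x2*x3 - 12*m1*m3*m4*m5*x1*x2*x3^2 + 32*m1*m3*m4*x1*x3^3 - 16*m1*m3*m4^2*x1^2*x3^2
      + 8*m1*m3*m5*x2*x3^3 - 8*m1*m3*m5^2*x1*x3^3 - 2*m1*m3*m5^2*x2^2*x3^2 + 8*m1*m3^2*m4*x1^2*x2*x3
      + 4*m1*m3^2*m5*x1*x2^2*x3 + 14*m1*m3^2*m5*x1^2*x3^2 + 16*m1*m3^2*x1*x2*x3^2 + 4*m1*m3^3*x1^3*x3
      + 4*m1^2*m2*x1^2*x2^2 + 16*m1^2*m2*x1^3*x3 - 4*m1^2*m3*m4*x1^3*x2 - 2*m1^2*m3*m5*x1^2*x2^2
      - 8*m1^2*m3*m5*x1^3*x3 - 24*m1^2*m3*x1^2*x2*x3 - m1^2*m3^2*x1^4 - 4*m1^2*m4*m5*x1*x2^3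
      + 16*m1^2*m4*m5*x1^2*x2*x3 + 16*m1^2*m4*x1*x2^2*x3 + 16*m1^2*m4*x1^2*x3^2 - 4*m1^2*m4^2*x1^2*x2^2
      - 24*m1^2*m5*x1*x2*x3^2 + 8*m1^2*m5*x2^3*x3 + 8*m1^2*m5^2*x1*x2^2*x3 - 16*m1^2*m5^2*x1^2*x3^2 - m1^2*m5^2*x2^4
      - 32*m1^2*x1*x3^3 - 16*m1^2*x2^2*x3^2 + 8*m1^3*x1^3*x2 - 8*m2*m3*m4*m5*x1*x3^3 - 4*m2*m3*m5^2*x2*x3^3
      + 20*m2*m3^2*m4*x1^2*x3^2 + 8*m2*m3^2*m5*x1*x2*x3^2 - 8*m2*m3^2*x1*x3^3 - 16*m2^2*m3*m5*x1^2*x3^2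
      - 16*m2^2*m3*x1*x2*x3^2 - 16*m2^2*m4*m5*x1*x2*x3^2 - 16*m2^2*m4^2*x1^2*x3^2 - 4*m2^2*m5^2*x2^2*x3^2
      + 16*m2^3*x1^2*x3^2 - m3^2*m5^2*x3^4 + 4*m3^3*m5*x1*x3^3 - 4*m3^4*x1^2*x3^2)) = - (8 * ((X + l1*x1 + l2*x2
      + l3*x3)^2 + (k22*k33 - k23*k23)*x1^2 + (k11*k33 - k13*k13)*x2^2 + (k11*k22 - k12*k12)*x3^2 + 2*(k13*k23
      - k12*k33)*x1*x2 + 2*(k12*k23 - k13*k22)*x1*x3 + 2*(k12*k13 - k11*k23)*x2*x3)^2)"
  unfolding assms by algebra

lemma Peps_H0:
  assumes f: "f = smult h ([:r0, r1, r2, 1:] * [:s0, s1, s2, 1:])" and h: "h \<noteq> 0" and x4: "x $ 4 \<noteq> 0"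
    and lam: "lam1 f \<gamma> = h * (r0* s2 + r2* s0)" "lam2 f \<gamma> = h * (r0 + s0)" "lam3 f \<gamma> = h * (r1 + s1)"
  shows "Peps f (H0mat f) \<gamma> x = - ((quad (kummer_quadric h [:r0, r1, r2, 1:] [:s0, s1, s2, 1:]) x)^2) / (8 * h^2)"
proof -
  define X where "X = x $ 4 / h"
  have X: "x $ 4 = h * X" "X \<noteq> 0" using h x4 by (auto simp: X_def)
  note cf = cubic_product_coeffs[OF f]
  note ev = Er_H0_1[OF h cf refl refl refl X] Er_H0_3[OF h cf refl refl refl X]
    QstarH_H0_0[OF h cf refl refl refl X] QstarH_H0_1[OF h cf refl refl refl X] QstarH_H0_2[OF h cf refl refl refl X]
  \<comment> \<open>The large polynomials stay hidden behind these names while the linear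
    combination is rearranged, and are substituted only for the final identity.\<close>
  define E1 where "E1 = 8 * Er (H0mat f) 1 x / h"
  define E3 where "E3 = 8 * Er (H0mat f) 3 x / h"
  define Q0 where "Q0 = 8 * QstarH f (H0mat f) 0 x / h"
  define Q1 where "Q1 = 8 * QstarH f (H0mat f) 1 x / h"
  define Q2 where "Q2 = 8 * QstarH f (H0mat f) 2 x / h"
  have E: "Er (H0mat f) 1 x = h * E1 / 8" "Er (H0mat f) 3 x = h * E3 / 8" "QstarH f (H0mat f) 0 x = h * Q0 / 8"
    "QstarH f (H0mat f) 1 x = h * Q1 / 8" "QstarH f (H0mat f) 2 x = h * Q2 / 8"
    using h by (simp_all add: E1_def E3_def Q0_def Q1_def Q2_def)
  let ?m0 = "r0* s0" let ?m1 = "r0* s1 + r1* s0" let ?m2 = "r0* s2 + r1* s1 + r2* s0" let ?m3 = "r0 + r1* s2 + r2* s1 + s0"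
  let ?m4 = "r1 + r2* s2 + s1" let ?m5 = "r2 + s2" let ?l1 = "r0* s2 + r2* s0" let ?l2 = "r0 + s0" let ?l3 = "r1 + s1"
  \<comment> \<open>F_0 is E1/16 because of its denominator 2 f_6, which gives the weight 4; the
    other terms have denominator 8, which gives the weight 8.\<close>
  have "64 * Peps f (H0mat f) \<gamma> x = h^2 * (4*(?l2^2 - ?l1*?l3 - 2*?m4*?l1 + ?m3*?l2 - (?m1*?m5 - 4*?m2*?m4 + 2*?m3^2))*E1
      + 8*((?l1 - ?m2)*Q2 + (?m3 - ?l2)*Q1 + (?l3 - ?m4)*Q0 + E3))"
    using h unfolding Peps_def F0_def F1_def F2_def F3_def F4_def lam cf E
    by (simp add: field_simps power2_eq_square)
  also have "4*(?l2^2 - ?l1*?l3 - 2*?m4*?l1 + ?m3*?l2 - (?m1*?m5 - 4*?m2*?m4 + 2*?m3^2))*E1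
      + 8*((?l1 - ?m2)*Q2 + (?m3 - ?l2)*Q1 + (?l3 - ?m4)*Q0 + E3) =
      - (8 * (quad (kummer_quadric h [:r0, r1, r2, 1:] [:s0, s1, s2, 1:]) x / h^2)^2)"
  proof -
    have qp: "quad (kummer_quadric h [:r0, r1, r2, 1:] [:s0, s1, s2, 1:]) x / h^2 = (let
       k11 = r2 - s2; k12 = s1 - r1; k13 = r0 - s0;
       k22 = r0 - s0 + r1* s2 - r2* s1; k23 = r2* s0 - r0* s2; k33 = r0* s1 - r1* s0;
       l1 = r0* s2 + r2* s0; l2 = r0 + s0; l3 = r1 + s1; x1 = x$1; x2 = x$2; x3 = x$3 in ((X + l1*x1 + l2*x2
           + l3*x3)^2 + (k22*k33 - k23*k23)*x1^2 + (k11*k33 - k13*k13)*x2^2 + (k11*k22 - k12*k12)*x3^2 + 2*(k13*k23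
           - k12*k33)*x1*x2 + 2*(k12*k23 - k13*k22)*x1*x3 + 2*(k12*k13 - k11*k23)*x2*x3))"
    proof -
      have co: "coeff [:a, b, c, 1:] 0 = a" "coeff [:a, b, c, 1:] 1 = b" "coeff [:a, b, c, 1:] 2 = c" for a b c :: complex
        by (simp_all add: eval_nat_numeral)
      show ?thesis
        unfolding kummer_quadric_def Let_def quad_quadric_mat[OF X(1)] co
        using h by simp
    qed
    have c: "8 * (h * p / 8) / h = p" for p using h by simp
    show ?thesis
      unfolding qp Let_def E1_def E3_def Q0_def Q1_def Q2_def ev c
      by (rule quartic_eq_square; rule refl)
  qed
  finally show ?thesis using h by (simp add: field_simps power2_eq_square)
qed

text \<open>Both ordinates vanish, so x_4 = P_3 / (2 (p - q)^2). The factor (p - q)^4 clears the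
  denominator of the quadric and leaves polynomials to compare.\<close>

lemma node_value:
  fixes h :: complex
  assumes f: "f = smult h ([:r0, r1, r2, 1:] * [:s0, s1, s2, 1:])" and "h \<noteq> 0" "p \<noteq> q"
  shows "(p - q)^4 * quad (kummer_quadric h [:r0, r1, r2, 1:] [:s0, s1, s2, 1:]) (kummer_vec f (Aff p 0) (Aff q 0)) =
    h^2 * (let m0 = r0* s0; m1 = r0* s1 + r1* s0; m2 = r0* s2 + r1* s1 + r2* s0; m3 = r0 + r1* s2 + r2* s1 + s0;
       m4 = r1 + r2* s2 + s1; m5 = r2 + s2;
       k11 = r2 - s2; k12 = s1 - r1; k13 = r0 - s0;
       k22 = r0 - s0 + r1* s2 - r2* s1; k23 = r2* s0 - r0* s2; k33 = r0* s1 - r1* s0;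
       x2 = p + q; x3 = p * q;
       Y = 2*m0 + m1*x2 + 2*m2*x3 + m3*x2*x3 + 2*m4*x3^2 + m5*x2*x3^2 + 2*x3^3
         + (p - q)^2 * (r0* s2 + r2* s0 + (r0 + s0) * x2 + (r1 + s1) * x3) in
     Y^2 + (p - q)^4 * (k22*k33 - k23*k23 + (k11*k33 - k13*k13)*x2^2 + (k11*k22 - k12*k12)*x3^2
       + 2*(k13*k23 - k12*k33)*x2 + 2*(k12*k23 - k13*k22)*x3 + 2*(k12*k13 - k11*k23)*x2*x3))"
proof -
  note cf = cubic_product_coeffs[OF f]
  define D where "D = (p - q)^2"
  have D: "D \<noteq> 0" using assms(3) by (simp add: D_def)
  have P2: "P2 1 (p + q) (p * q) = D"
    by (simp add: P2_def D_def power2_eq_square algebra_simps)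
  define Z where "Z = 2*(r0* s0) + (r0* s1 + r1* s0)*(p + q) + 2*(r0* s2 + r1* s1 + r2* s0)*(p * q)
     + (r0 + r1* s2 + r2* s1 + s0)*(p + q)*(p * q) + 2*(r1 + r2* s2 + s1)*(p * q)^2 + (r2 + s2)*(p + q)*(p * q)^2 + 2*(p * q)^3"
  have P3: "P3 f 1 (p + q) (p * q) / 2 = h * Z"
    unfolding P3_def cf Z_def by (simp add: algebra_simps)
  define v where "v = kummer_vec f (Aff p 0) (Aff q 0)"
  have v: "v $ 1 = 1" "v $ 2 = p + q" "v $ 3 = p * q" "v $ 4 = h * (Z / D)"
    using D by (simp_all add: v_def kummer_vec_def Let_def P2 P3)
  have co: "coeff [:a, b, c, 1:] 0 = a" "coeff [:a, b, c, 1:] 1 = b" "coeff [:a, b, c, 1:] 2 = c" for a b c :: complex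
    by (simp_all add: eval_nat_numeral)
  have D4: "(p - q)^4 = D^2" by (simp add: D_def)
  have split: "D^2 * (h^2 * ((Z / D + L)^2 + N)) = h^2 * ((Z + D * L)^2 + D^2 * N)" for L N
  proof -
    have "D * (Z / D + L) = Z + D * L" using D by (simp add: field_simps)
    then have "D^2 * (Z / D + L)^2 = (Z + D * L)^2" by (metis power_mult_distrib)
    then show ?thesis by (simp add: algebra_simps)
  qed
  show ?thesis
    unfolding v_def[symmetric] kummer_quadric_def Let_def quad_quadric_mat[OF v(4)] co v(1-3) D4 D_def[symmetric]
      add.assoc[of "(Z / D + _ + _ + _)^2"] Z_def[symmetric]
    using split by (simp add: add.assoc)
qed

text \<open>In the next two lemmas \<open>p\<close> and \<open>q\<close> lie in the same part of the partition, respectively in different parts.\<close>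

lemma node_value_same:
  assumes "f = smult h ([:- p, 1:] * [:- q, 1:] * [:- a, 1:] * [:s0, s1, s2, 1:])" "h \<noteq> 0" "p \<noteq> q"
  shows "quad (kummer_quadric h ([:- p, 1:] * [:- q, 1:] * [:- a, 1:]) [:s0, s1, s2, 1:]) (kummer_vec f (Aff p 0) (Aff q 0)) =
    - (h^2 * ((p - a) * (q - a) * poly [:s0, s1, s2, 1:] p * poly [:s0, s1, s2, 1:] q))"
proof -
  have r: "[:- p, 1:] * [:- q, 1:] * [:- a, 1:] = [:- p*q*a, p*q + p*a + q*a, - p - q - a, 1:]"
    by (simp add: algebra_simps)
  \<comment> \<open>The term 0^2 records that x_4 + lambda x vanishes at this node when p and q lie
    in the same part; only the Bezout part contributes.\<close>
  have "(p - q)^4 * quad (kummer_quadric h ([:- p, 1:] * [:- q, 1:] * [:- a, 1:]) [:s0, s1, s2, 1:]) (kummer_vec f (Aff p 0) (Aff q 0)) =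
    h^2 * (0^2 + (p - q)^4 * (- ((p - a) * (q - a) * (s0 + p * (s1 + p * (s2 + p))) * (s0 + q * (s1 + q * (s2 + q))))))"
    unfolding r node_value[OF assms(1)[unfolded r] assms(2,3)] Let_def
    by (intro arg_cong2[where f = times] arg_cong2[where f = plus] arg_cong2[where f = power] refl; algebra)
  then have "(p - q)^4 * quad (kummer_quadric h ([:- p, 1:] * [:- q, 1:] * [:- a, 1:]) [:s0, s1, s2, 1:]) (kummer_vec f (Aff p 0) (Aff q 0)) =
    (p - q)^4 * - (h^2 * ((p - a) * (q - a) * (s0 + p * (s1 + p * (s2 + p))) * (s0 + q * (s1 + q * (s2 + q)))))"
    by (simp add: mult.left_commute)
  then have "quad (kummer_quadric h ([:- p, 1:] * [:- q, 1:] * [:- a, 1:]) [:s0, s1, s2, 1:]) (kummer_vec f (Aff p 0) (Aff q 0)) =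
    - (h^2 * ((p - a) * (q - a) * (s0 + p * (s1 + p * (s2 + p))) * (s0 + q * (s1 + q * (s2 + q)))))"
    by (rule mult_left_cancel[THEN iffD1, rotated]) (use assms(3) in simp)
  then show ?thesis by simp
qed

lemma node_value_diff:
  assumes "f = smult h ([:- p, 1:] * [:u0, u1, 1:] * ([:- q, 1:] * [:w0, w1, 1:]))" "h \<noteq> 0" "p \<noteq> q"
  shows "quad (kummer_quadric h ([:- p, 1:] * [:u0, u1, 1:]) ([:- q, 1:] * [:w0, w1, 1:])) (kummer_vec f (Aff p 0) (Aff q 0)) =
    h^2 * (poly [:u0, u1, 1:] p * poly [:w0, w1, 1:] p * poly [:u0, u1, 1:] q * poly [:w0, w1, 1:] q)"
proof -
  have r: "[:- p, 1:] * [:u0, u1, 1:] = [:- p*u0, u0 - p*u1, u1 - p, 1:]" for p u0 u1 :: complex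
    by (simp add: algebra_simps)
  have "(p - q)^4 * quad (kummer_quadric h ([:- p, 1:] * [:u0, u1, 1:]) ([:- q, 1:] * [:w0, w1, 1:])) (kummer_vec f (Aff p 0) (Aff q 0)) =
    (p - q)^4 * (h^2 * ((u0 + p * (u1 + p)) * (w0 + p * (w1 + p)) * (u0 + q * (u1 + q)) * (w0 + q * (w1 + q))))"
    unfolding r node_value[OF assms(1)[unfolded r] assms(2,3)] Let_def by algebra
  then have "quad (kummer_quadric h ([:- p, 1:] * [:u0, u1, 1:]) ([:- q, 1:] * [:w0, w1, 1:])) (kummer_vec f (Aff p 0) (Aff q 0)) =
    h^2 * ((u0 + p * (u1 + p)) * (w0 + p * (w1 + p)) * (u0 + q * (u1 + q)) * (w0 + q * (w1 + q)))"
    by (rule mult_left_cancel[THEN iffD1, rotated]) (use assms(3) in simp)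
  then show ?thesis by simp
qed

section \<open>Covariance of the quartics\<close>

definition msmult :: "complex \<Rightarrow> complex^'n^'m \<Rightarrow> complex^'n^'m" where
  "msmult c A = (\<chi> i j. c * A $ i $ j)"

lemma msmult_nth: "msmult c A $ i $ j = c * A $ i $ j"
  by (simp add: msmult_def)

lemma msmult_mult: "msmult c A ** B = msmult c (A ** B)" "A ** msmult c B = msmult c (A ** B)"
  by (simp_all add: vec_eq_iff msmult_nth matrix_matrix_mult_def sum_distrib_left mult_ac)

lemma msmult_msmult: "msmult c (msmult d A) = msmult (c * d) A"
  by (simp add: vec_eq_iff msmult_nth)

lemma transpose_msmult: "transpose (msmult c A) = msmult c (transpose A)"
  by (simp add: vec_eq_iff msmult_nth transpose_def)

lemma msmult_cancel: "c \<noteq> 0 \<Longrightarrow> msmult c A = msmult c B \<longleftrightarrow> A = B"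
  by (simp add: vec_eq_iff msmult_nth)

lemma msmult_mult_vec: "msmult c A *v x = c *s (A *v x)"
  by (simp add: vec_eq_iff msmult_nth matrix_vector_mult_def sum_distrib_left mult_ac)

lemma quad_msmult: "quad (msmult c A) x = c * quad A x"
  by (simp add: quad_def msmult_nth sum_distrib_left mult_ac)

text \<open>Polarisation; the factor 1/2 in \<open>quad\<close> makes the entry come out without a
  denominator. The vectors used have rational coordinates, which matters for Galois descent.\<close>

lemma quad_axis:
  assumes "transpose A = A"
  shows "A $ i $ j = (quad A (axis i 1 + axis j 1) - quad A (axis i 1) - quad A (axis j 1))"
    "quad A (axis i 1) = A $ i $ i / 2"
proof -
  have sym: "A $ j $ i = A $ i $ j" for i j
    using arg_cong[OF assms, of "\<lambda>M. M $ i $ j"] by (simp add: transpose_def)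
  define b where "b u v = (\<Sum>i\<in>UNIV. \<Sum>j\<in>UNIV. A $ i $ j * u $ i * v $ j)" for u v
  have b: "b (axis i 1) (axis j 1) = A $ i $ j" for i j
    unfolding b_def axis_def by (simp add: if_distrib[of "\<lambda>c. _ * c"] if_distrib[of "\<lambda>c. c * _"] sum.delta cong: if_cong)
  have add: "b (u + u') v = b u v + b u' v" "b v (u + u') = b v u + b v u'" for u u' v
    unfolding b_def by (simp_all add: algebra_simps sum.distrib)
  have q: "quad A u = b u u / 2" for u by (simp add: quad_def b_def)
  show "quad A (axis i 1) = A $ i $ i / 2" by (simp add: q b)
  show "A $ i $ j = (quad A (axis i 1 + axis j 1) - quad A (axis i 1) - quad A (axis j 1))"
    by (simp add: q add b sym[of i j] field_simps)
qed

lemma quad_eq_imp_eq: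
  assumes "transpose A = A" "transpose B = B" "\<And>u. quad A u = quad B u"
  shows "A = B"
  unfolding vec_eq_iff using quad_axis(1)[OF assms(1)] quad_axis(1)[OF assms(2)] assms(3) by simp

lemma quad_matrix: "quad A u = (\<Sum>i\<in>UNIV. u $ i * (A *v u) $ i) / 2"
  by (simp add: quad_def matrix_vector_mult_def sum_distrib_left mult_ac)

lemma inner_matrix_transpose:
  fixes A :: "complex^'n^'m"
  shows "(\<Sum>i\<in>UNIV. u $ i * (A *v v) $ i) = (\<Sum>j\<in>UNIV. (transpose A *v u) $ j * v $ j)"
proof -
  have "(\<Sum>i\<in>UNIV. u $ i * (A *v v) $ i) = (\<Sum>i\<in>UNIV. \<Sum>j\<in>UNIV. u $ i * A $ i $ j * v $ j)"
    by (simp add: matrix_vector_mult_def sum_distrib_left mult_ac)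
  also have "\<dots> = (\<Sum>j\<in>UNIV. \<Sum>i\<in>UNIV. u $ i * A $ i $ j * v $ j)" by (rule sum.swap)
  also have "\<dots> = (\<Sum>j\<in>UNIV. (\<Sum>i\<in>UNIV. u $ i * A $ i $ j) * v $ j)"
    by (simp only: sum_distrib_right)
  also have "\<dots> = (\<Sum>j\<in>UNIV. (transpose A *v u) $ j * v $ j)"
    unfolding matrix_vector_mult_def transpose_def vec_lambda_beta by (simp only: mult.commute)
  finally show ?thesis .
qed

lemma quad_substitute: "quad A (B *v u) = quad (transpose B ** A ** B) u"
proof -
  have "(\<Sum>i\<in>UNIV. (B *v u) $ i * (A *v (B *v u)) $ i) = (\<Sum>j\<in>UNIV. (transpose B *v (A *v (B *v u))) $ j * u $ j)"
    using inner_matrix_transpose[of "A *v (B *v u)" B u] by (simp add: mult.commute)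
  then show ?thesis by (simp add: quad_matrix matrix_vector_mul_assoc matrix_mul_assoc mult.commute)
qed

section \<open>The second exterior power and its action on G and \<open>Lam\<close>\<close>

definition wedge2mat :: "complex^4^4 \<Rightarrow> complex^6^6" where
  "wedge2mat R = (\<chi> a b. R $ (zrow$a) $ (zrow$b) * R $ (zcol$a) $ (zcol$b)
     - R $ (zrow$a) $ (zcol$b) * R $ (zcol$a) $ (zrow$b))"

text \<open>The star operation is the pairing of a quadratic form with the second compound of B, so
  its behaviour under \<open>R\<close> follows from the multiplicativity of compounds.\<close>

lemma qstar_wedge2mat: "qstar M B = (\<Sum>a\<in>UNIV. \<Sum>b\<in>UNIV. M $ a $ b * wedge2mat B $ a $ b)"
  by (simp add: qstar_def wedge2mat_def)

lemma qstar_trace: "qstar M B = trace (M ** transpose (wedge2mat B))"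
  by (simp add: qstar_wedge2mat trace_def matrix_matrix_mult_def transpose_def)

lemma trace_msmult: "trace (msmult c A) = c * trace A"
  by (simp add: trace_def msmult_nth sum_distrib_left)

lemma transpose_wedge2mat: "transpose (wedge2mat R) = wedge2mat (transpose R)"
  by (simp add: wedge2mat_def transpose_def vec_eq_iff mult_ac)

lemma wedge2_wedge2mat: "wedge2 R u = wedge2mat R *v u"
  unfolding wedge2_def of_skew_def skew_of_def vec_eq_iff forall_6 matrix_vector_mult_def sum_6
    wedge2mat_def vec_lambda_beta zrow_zcol matrix_matrix_mult_def sum_4 transpose_def vector_6 vector_4
  by (simp add: algebra_simps)

lemma skew_of_skew:
  assumes "transpose Z = - Z"
  shows "skew_of (of_skew Z) = Z"
proof -
  have sym: "Z $ j $ i = - Z $ i $ j" for i j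
    using arg_cong[OF assms, of "\<lambda>M. M $ i $ j"] by (simp add: transpose_def)
  have diag: "Z $ i $ i = 0" for i using sym[of i i] by simp
  show ?thesis
    unfolding skew_of_def of_skew_def vec_eq_iff forall_4 vector_4 vector_6
    using sym[of 1 2] sym[of 1 3] sym[of 1 4] sym[of 2 3] sym[of 2 4] sym[of 3 4] diag by simp
qed

text \<open>\<open>of_skew\<close> reads only six entries, so composing needs the inner product R Z
  R^T to be skew again before it can be recovered from them.\<close>

lemma wedge2_mult: "wedge2 (R ** S) u = wedge2 R (wedge2 S u)"
proof -
  have "transpose (skew_of u) = - skew_of u"
    by (simp add: skew_of_def vec_eq_iff forall_4 transpose_def)
  then have 1: "transpose (skew_of u) = msmult (-1) (skew_of u)"
    by (simp add: vec_eq_iff msmult_nth)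
  have "transpose (S ** skew_of u ** transpose S) = msmult (-1) (S ** skew_of u ** transpose S)"
    unfolding matrix_transpose_mul 1 transpose_transpose by (simp only: msmult_mult matrix_mul_assoc)
  then have "transpose (S ** skew_of u ** transpose S) = - (S ** skew_of u ** transpose S)"
    by (simp add: vec_eq_iff msmult_nth)
  then show ?thesis
    unfolding wedge2_def by (simp add: skew_of_skew matrix_transpose_mul matrix_mul_assoc)
qed

lemma wedge2mat_mult: "wedge2mat (R ** S) = wedge2mat R ** wedge2mat S"
  by (subst matrix_eq) (simp add: wedge2_wedge2mat[symmetric] wedge2_mult flip: matrix_vector_mul_assoc)

text \<open>\<open>Gmat\<close> is the matrix of the Pfaffian, and Pf(R Z R^T) = det(R)
  Pf(Z).\<close>

lemma wedge2mat_Gmat: "transpose (wedge2mat R) ** Gmat ** wedge2mat R = msmult (det R) Gmat"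
proof -
  have 2: "(transpose W ** Gmat ** W) $ a $ b = W$1$a * W$6$b + W$2$a * W$5$b + W$3$a * W$4$b
      + W$4$a * W$3$b + W$5$a * W$2$b + W$6$a * W$1$b" for W a b
    unfolding matrix_mul_assoc[symmetric] matrix_mult_nth[of "transpose W"] sum_6 Gmat_mult
    by (simp add: transpose_def)
  show ?thesis
    unfolding vec_eq_iff msmult_nth 2 forall_6 wedge2mat_def vec_lambda_beta zrow_zcol det_4
    unfolding Gmat_def vector_6
    by (intro conjI; algebra)
qed

lemma wedge2mat_Gmat': "wedge2mat R ** Gmat ** transpose (wedge2mat R) = msmult (det R) Gmat"
  using wedge2mat_Gmat[of "transpose R"] by (simp add: transpose_wedge2mat det_transpose)

text \<open>Up to sign, the transpose of \<open>Lam x\<close> maps v to the Hodge dual of the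
  bivector of x and v. The dual intertwines the exterior squares of R^T and R up to the factor det
  R.\<close>

lemma wedge2mat_Lam:
  "wedge2mat R ** transpose (Lam (transpose R *v y)) ** transpose R = msmult (det R) (transpose (Lam y))"
proof -
  show ?thesis
    unfolding vec_eq_iff forall_6 forall_4 msmult_nth det_4
    unfolding matrix_matrix_mult_def vec_lambda_beta sum_6 sum_4 wedge2mat_def zrow_zcol transpose_def Lam_def vector_4 vector_6
      matrix_vector_mult_def
    by (intro conjI; algebra)
qed

lemma Lam_kernel: "transpose (Lam x) *v x = 0"
  unfolding Lam_def vec_eq_iff forall_6 matrix_vector_mult_def transpose_def sum_4
  by (simp add: mult.commute)

text \<open>A symmetric M with M y = 0 has adjugate c y y^T. Then \<open>minor44 M\<close> = c
  y_4^2, and det(M + w w^T) = w^T adj(M) w = c (w.y)^2 as det M = 0. This expresses c, which is E_r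
  in the application, without singling out the fourth coordinate.\<close>

lemma det_rank_one_update:
  fixes M :: "complex^4^4"
  assumes sym: "transpose M = M" and ker: "M *v y = 0" and y4: "y $ 4 \<noteq> 0"
  shows "det (\<chi> i j. M $ i $ j + w $ i * w $ j) * (y $ 4)^2 = minor44 M * (\<Sum>i\<in>UNIV. w $ i * y $ i)^2"
proof -
  define t where "t i = y $ i / y $ 4" for i
  have y: "y $ i = t i * y $ 4" for i using y4 by (simp add: t_def)
  have t4: "t 4 = 1" using y4 by (simp add: t_def)
  have "M $ i $ 1 * y $ 1 + M $ i $ 2 * y $ 2 + M $ i $ 3 * y $ 3 + M $ i $ 4 * y $ 4 = 0" for i
    using arg_cong[OF ker, of "\<lambda>v. v $ i"] by (simp add: matrix_vector_mult_def sum_4)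
  then have "(M $ i $ 1 * t 1 + M $ i $ 2 * t 2 + M $ i $ 3 * t 3 + M $ i $ 4) * y $ 4 = 0" for i
    using y4 by (simp add: t_def algebra_simps)
  then have "M $ i $ 1 * t 1 + M $ i $ 2 * t 2 + M $ i $ 3 * t 3 + M $ i $ 4 = 0" for i using y4 by simp
  then have c: "M $ i $ 4 = - (M $ i $ 1 * t 1 + M $ i $ 2 * t 2 + M $ i $ 3 * t 3)" for i
    using add_eq_0_iff by blast
  have s: "M $ j $ i = M $ i $ j" for i j
    using arg_cong[OF sym, of "\<lambda>M. M $ i $ j"] by (simp add: transpose_def)
  define m11 m12 m13 m22 m23 m33 where m: "m11 = M$1$1" "m12 = M$1$2" "m13 = M$1$3" "m22 = M$2$2" "m23 = M$2$3" "m33 = M$3$3"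
  have e: "M$2$1 = m12" "M$3$1 = m13" "M$3$2 = m23" "M$4$1 = M$1$4" "M$4$2 = M$2$4" "M$4$3 = M$3$4"
    by (simp_all add: m s)
  have e4: "M$1$4 = - (m11 * t 1 + m12 * t 2 + m13 * t 3)" "M$2$4 = - (m12 * t 1 + m22 * t 2 + m23 * t 3)"
    "M$3$4 = - (m13 * t 1 + m23 * t 2 + m33 * t 3)"
    using c[of 1] c[of 2] c[of 3] by (simp_all add: m e)
  have e44: "M$4$4 = m11 * (t 1)^2 + m22 * (t 2)^2 + m33 * (t 3)^2 + 2 * m12 * t 1 * t 2 + 2 * m13 * t 1 * t 3 + 2 * m23 * t 2 * t 3"
    using c[of 4] unfolding e e4 by (simp add: power2_eq_square algebra_simps)
  have "det (\<chi> i j. M $ i $ j + w $ i * w $ j) = minor44 M * (w$1 * t 1 + w$2 * t 2 + w$3 * t 3 + w$4)^2"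
    unfolding det_4 minor44_def vec_lambda_beta e e4 e44 m[symmetric] by algebra
  moreover have "(\<Sum>i\<in>UNIV. w $ i * y $ i) = (w$1 * t 1 + w$2 * t 2 + w$3 * t 3 + w$4) * y $ 4"
    using y4 by (simp add: sum_4 t_def algebra_simps)
  ultimately show ?thesis by (simp add: power_mult_distrib)
qed

section \<open>Two models related by \<open>R\<close>: every quartic is multiplied by det R\<close>

context
  fixes R :: "complex^4^4" and H H' :: "complex^6^6" and W \<delta>
  defines "W \<equiv> wedge2mat R" and "\<delta> \<equiv> det R"
  assumes \<delta>: "\<delta> \<noteq> 0" and H: "msmult \<delta> H = transpose W ** H' ** W"
begin

text \<open>Each further power inserts W G W^T, which is det R times G; so every power has the same
  single factor det R.\<close>

lemma GN_covariant: "msmult \<delta> (GN H r) = transpose W ** GN H' r ** W"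
proof (induction r)
  case 0
  show ?case using wedge2mat_Gmat[of R] by (simp add: GN_0 W_def \<delta>_def)
next
  case (Suc r)
  have "msmult \<delta> (msmult \<delta> (GN H (Suc r))) = (msmult \<delta> H) ** (Gmat ** (msmult \<delta> (GN H r)))"
    unfolding GN_Suc by (simp only: msmult_mult matrix_mul_assoc)
  also have "\<dots> = transpose W ** H' ** (W ** Gmat ** transpose W) ** GN H' r ** W"
    unfolding H Suc by (simp only: matrix_mul_assoc)
  also have "W ** Gmat ** transpose W = msmult \<delta> Gmat"
    unfolding W_def \<delta>_def by (rule wedge2mat_Gmat')
  also have "transpose W ** H' ** (msmult \<delta> Gmat) ** GN H' r ** W = msmult \<delta> (transpose W ** GN H' (Suc r) ** W)"
    unfolding GN_Suc by (simp only: msmult_mult matrix_mul_assoc)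
  finally have "msmult \<delta> (msmult \<delta> (GN H (Suc r))) = msmult \<delta> (transpose W ** GN H' (Suc r) ** W)" .
  then show ?case using msmult_cancel[OF \<delta>] by blast
qed

lemma Qmat_covariant: "msmult \<delta> (Qmat f H j) = transpose W ** Qmat f H' j ** W"
proof -
  have g: "\<delta> * GN H r $ a $ b = (\<Sum>d\<in>UNIV. \<Sum>c\<in>UNIV. W $ c $ a * GN H' r $ c $ d * W $ d $ b)" for r a b
  proof -
    have "\<delta> * GN H r $ a $ b = (transpose W ** GN H' r ** W) $ a $ b"
      using arg_cong[OF GN_covariant[of r], of "\<lambda>M. M $ a $ b"] by (simp add: msmult_nth)
    then show ?thesis by (simp add: matrix_matrix_mult_def transpose_def sum_distrib_right)
  qed
  have "\<delta> * Qmat f H j $ a $ b = (\<Sum>d\<in>UNIV. \<Sum>c\<in>UNIV. W $ c $ a * Qmat f H' j $ c $ d * W $ d $ b)" for a b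
  proof -
    have "\<delta> * Qmat f H j $ a $ b = (\<Sum>i = j + 1..6. coeff f i / coeff f 6 * (\<delta> * GN H (i - j - 1) $ a $ b))"
      by (simp add: Qmat_def sum_distrib_left sum_divide_distrib mult_ac)
    also have "\<dots> = (\<Sum>i = j + 1..6. \<Sum>d\<in>UNIV. \<Sum>c\<in>UNIV. W $ c $ a * (coeff f i / coeff f 6 * GN H' (i - j - 1) $ c $ d) * W $ d $ b)"
      unfolding g by (simp add: sum_distrib_left mult_ac)
    also have "\<dots> = (\<Sum>d\<in>UNIV. \<Sum>i = j + 1..6. \<Sum>c\<in>UNIV. W $ c $ a * (coeff f i / coeff f 6 * GN H' (i - j - 1) $ c $ d) * W $ d $ b)"
      by (rule sum.swap)
    also have "\<dots> = (\<Sum>d\<in>UNIV. \<Sum>c\<in>UNIV. \<Sum>i = j + 1..6. W $ c $ a * (coeff f i / coeff f 6 * GN H' (i - j - 1) $ c $ d) * W $ d $ b)"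
      by (intro sum.cong refl sum.swap)
    finally show ?thesis
      by (simp add: Qmat_def sum_distrib_left sum_distrib_right sum_divide_distrib mult_ac)
  qed
  then show ?thesis
    by (simp add: vec_eq_iff msmult_nth) (simp add: matrix_matrix_mult_def transpose_def sum_distrib_right)
qed

text \<open>Both copies of \<open>Lam\<close> yield a factor det R by \<open>wedge2mat_Lam\<close>;
  one of them cancels against the factor in the hypothesis on M.\<close>

lemma Lam_covariant:
  assumes "msmult \<delta> M = transpose W ** M' ** W"
  shows "R ** (Lam (transpose R *v y) ** M ** transpose (Lam (transpose R *v y))) ** transpose R =
    msmult \<delta> (Lam y ** M' ** transpose (Lam y))"
proof -
  let ?L = "Lam (transpose R *v y)"
  have 1: "W ** transpose ?L ** transpose R = msmult \<delta> (transpose (Lam y))"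
    unfolding W_def \<delta>_def by (rule wedge2mat_Lam)
  have 2: "R ** ?L ** transpose W = msmult \<delta> (Lam y)"
    using arg_cong[OF 1, of transpose]
    by (simp add: matrix_transpose_mul matrix_mul_assoc transpose_msmult)
  have "msmult \<delta> (R ** (?L ** M ** transpose ?L) ** transpose R) = R ** ?L ** (msmult \<delta> M) ** transpose ?L ** transpose R"
    by (simp only: msmult_mult matrix_mul_assoc)
  also have "\<dots> = (R ** ?L ** transpose W) ** M' ** (W ** transpose ?L ** transpose R)"
    unfolding assms by (simp add: matrix_mul_assoc)
  also have "\<dots> = msmult \<delta> (msmult \<delta> (Lam y ** M' ** transpose (Lam y)))"
    unfolding 1 2 by (simp only: msmult_mult matrix_mul_assoc)
  finally show ?thesis using msmult_cancel[OF \<delta>] by blast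
qed

text \<open>The compound of det(R) B' contributes det(R)^2, and the matrix of Q_j takes one factor
  away again.\<close>

lemma QstarH_covariant: "QstarH f H j (transpose R *v y) = \<delta> * QstarH f H' j y"
proof -
  let ?B = "Lam (transpose R *v y) ** H ** transpose (Lam (transpose R *v y))"
  let ?B' = "Lam y ** H' ** transpose (Lam y)"
  have w: "wedge2mat (msmult \<delta> ?B') $ a $ b = \<delta>^2 * wedge2mat ?B' $ a $ b" for a b
    by (simp add: wedge2mat_def msmult_nth power2_eq_square algebra_simps)
  have "W ** wedge2mat ?B ** transpose W = wedge2mat (R ** ?B ** transpose R)"
    unfolding W_def transpose_wedge2mat wedge2mat_mult by simp
  then have WB: "(W ** wedge2mat ?B ** transpose W) $ c $ d = \<delta>^2 * wedge2mat ?B' $ c $ d" for c d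
    unfolding Lam_covariant[OF H] w[symmetric] by simp
  have WB': "W ** wedge2mat ?B ** transpose W = msmult (\<delta>^2) (wedge2mat ?B')"
    using WB by (simp add: vec_eq_iff msmult_nth)
  have "\<delta> * qstar (Qmat f H j) ?B = trace (msmult \<delta> (Qmat f H j) ** transpose (wedge2mat ?B))"
    by (simp add: qstar_trace msmult_mult trace_msmult)
  also have "\<dots> = trace (transpose W ** (Qmat f H' j ** W ** transpose (wedge2mat ?B)))"
    unfolding Qmat_covariant by (simp only: matrix_mul_assoc)
  also have "\<dots> = trace (Qmat f H' j ** transpose (W ** wedge2mat ?B ** transpose W))"
    by (subst trace_mul_sym) (simp add: matrix_transpose_mul matrix_mul_assoc)
  also have "\<dots> = \<delta>^2 * qstar (Qmat f H' j) ?B'"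
    unfolding WB' by (simp add: qstar_trace transpose_msmult msmult_mult trace_msmult)
  finally show ?thesis using \<delta> by (simp add: QstarH_def power2_eq_square)
qed

text \<open>E_r is the constant c with adj(B) = c x x^T. The two models are compared through the
  rank one update by w = e_4, which becomes R w on the other side; this handles the change of the
  fourth coordinate hidden in the division by x_4^2.\<close>

lemma Er_covariant:
  assumes symH: "transpose H = H" and symH': "transpose H' = H'"
    and "y $ 4 \<noteq> 0" "(transpose R *v y) $ 4 \<noteq> 0"
  shows "Er H r (transpose R *v y) = \<delta> * Er H' r y"
proof -
  define x where "x = transpose R *v y"
  define B where "B = Lam x ** GN H r ** transpose (Lam x)"
  define B' where "B' = Lam y ** GN H' r ** transpose (Lam y)"
  have symGN: "transpose (GN K r) = GN K r" if "transpose K = K" for K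
  proof (induction r)
    case (Suc r)
    \<comment> \<open>Moving one factor from left to right of the alternating product of H and G;
      this is what makes \<open>GN K r\<close> symmetric.\<close>
    have swap: "GN K r ** Gmat ** K = K ** (Gmat ** GN K r)" for r
    proof (induction r)
      case 0
      show ?case by (simp add: GN_0 Gmat_square)
    next
      case (Suc r)
      have "GN K (Suc r) ** Gmat ** K = K ** Gmat ** (GN K r ** Gmat ** K)"
        unfolding GN_Suc by (simp only: matrix_mul_assoc)
      then show ?case unfolding Suc by (simp only: GN_Suc matrix_mul_assoc)
    qed
    have "transpose (GN K (Suc r)) = GN K r ** Gmat ** K"
      unfolding GN_Suc by (simp add: matrix_transpose_mul that Suc symmetric_Gmat matrix_mul_assoc)
    also have "\<dots> = K ** (Gmat ** GN K r)" by (rule swap)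
    finally show ?case by (simp add: GN_Suc)
  qed (simp add: GN_0 symmetric_Gmat)
  have x4: "x $ 4 \<noteq> 0" using assms(4) unfolding x_def .
  have symB: "transpose B = B" "transpose B' = B'"
    unfolding B_def B'_def by (simp_all add: matrix_transpose_mul symGN symH symH' matrix_mul_assoc)
  have kerB: "B *v x = 0" "B' *v y = 0"
    unfolding B_def B'_def by (simp_all add: Lam_kernel del: transpose_matrix_vector flip: matrix_vector_mul_assoc)
  have cov: "R ** B ** transpose R = msmult \<delta> B'"
    unfolding B_def B'_def x_def by (rule Lam_covariant[OF GN_covariant])
  define w :: "complex^4" where "w = axis 4 1"
  have wx: "(\<Sum>i\<in>UNIV. w $ i * x $ i) = x $ 4" by (simp add: w_def axis_def sum_4)
  have wy: "(\<Sum>i\<in>UNIV. (R *v w) $ i * y $ i) = x $ 4"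
    using inner_matrix_transpose[of y R w] by (simp add: x_def w_def axis_def sum_4 mult.commute)
  have "R ** (\<chi> i j. B $ i $ j + w $ i * w $ j) ** transpose R =
      (\<chi> i j. (msmult \<delta> B') $ i $ j + (R *v w) $ i * (R *v w) $ j)"
    unfolding cov[symmetric]
    by (simp add: vec_eq_iff matrix_matrix_mult_def matrix_vector_mult_def transpose_def sum_4 algebra_simps)
  from arg_cong[OF this, of det]
  have d: "\<delta>^2 * det (\<chi> i j. B $ i $ j + w $ i * w $ j) = det (\<chi> i j. (msmult \<delta> B') $ i $ j + (R *v w) $ i * (R *v w) $ j)"
    by (simp add: det_mul \<delta>_def power2_eq_square mult_ac)
  have 1: "det (\<chi> i j. B $ i $ j + w $ i * w $ j) * (x $ 4)^2 = minor44 B * (x $ 4)^2"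
    using det_rank_one_update[OF symB(1) kerB(1) x4, of w] unfolding wx .
  have sm: "transpose (msmult \<delta> B') = msmult \<delta> B'"
    using symB(2) by (simp add: transpose_msmult)
  have km: "(msmult \<delta> B') *v y = 0"
    using kerB(2) by (simp add: msmult_mult_vec)
  have "minor44 (msmult \<delta> B') = \<delta>^3 * minor44 B'"
    unfolding minor44_def msmult_nth by (simp add: power3_eq_cube algebra_simps)
  then have 2: "det (\<chi> i j. (msmult \<delta> B') $ i $ j + (R *v w) $ i * (R *v w) $ j) * (y $ 4)^2 = \<delta>^3 * minor44 B' * (x $ 4)^2"
    using det_rank_one_update[OF sm km assms(3), of "R *v w"] by (simp add: wy)
  have "minor44 B * (y $ 4)^2 = \<delta> * minor44 B' * (x $ 4)^2"
  proof -
    have d1: "det (\<chi> i j. B $ i $ j + w $ i * w $ j) = minor44 B" using 1 x4 by simp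
    have "\<delta>^2 * (minor44 B * (y $ 4)^2) = (\<delta>^2 * minor44 B) * (y $ 4)^2" by (simp only: mult.assoc)
    also have "\<dots> = \<delta>^3 * minor44 B' * (x $ 4)^2" using d 2 unfolding d1 by simp
    also have "\<dots> = \<delta>^2 * (\<delta> * minor44 B' * (x $ 4)^2)" by (simp add: power2_eq_square power3_eq_cube)
    finally show ?thesis using \<delta> by simp
  qed
  moreover have "a / c^2 = \<delta> * (b / d^2)" if "a * d^2 = \<delta> * b * c^2" "c \<noteq> 0" "d \<noteq> 0" for a b c d :: complex
    using that by (simp add: field_simps)
  ultimately show ?thesis
    using x4 assms(3) unfolding Er_minor44 B_def B'_def x_def by blast
qed

lemma Peps_covariant:
  assumes "transpose H = H" "transpose H' = H'" "y $ 4 \<noteq> 0" "(transpose R *v y) $ 4 \<noteq> 0"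
  shows "Peps f H \<gamma> (transpose R *v y) = \<delta> * Peps f H' \<gamma> y"
  unfolding Peps_def F0_def F1_def F2_def F3_def F4_def Er_covariant[OF assms] QstarH_covariant
  by (simp add: algebra_simps add_divide_distrib diff_divide_distrib)

end

section \<open>The fixed field of the absolute Galois group\<close>

interpretation rat_vs: vector_space "\<lambda>(q::rat) (x::complex). of_rat q * x"
  by unfold_locales (auto simp: algebra_simps of_rat_add of_rat_mult)

lemma span_mult_closed:
  assumes "\<And>s. s \<in> S \<Longrightarrow> z * s \<in> rat_vs.span T" "x \<in> rat_vs.span S"
  shows "z * x \<in> rat_vs.span T"
  using assms(2)
proof (induction rule: rat_vs.span_induct_alt)
  case base
  show ?case using rat_vs.span_zero by simp
next
  case (step c x y)
  have "z * (of_rat c * x + y) = of_rat c * (z * x) + z * y" by (simp add: algebra_simps)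
  then show ?case
    using step assms(1) by (metis rat_vs.span_add rat_vs.span_scale)
qed

text \<open>All powers of z lie in a rational space of dimension at most card S, so the first card S
  + 1 of them are dependent.\<close>

lemma algebraic_if_span_closed:
  fixes z :: complex
  assumes "finite S" "1 \<in> rat_vs.span S" "\<And>s. s \<in> S \<Longrightarrow> z * s \<in> rat_vs.span S"
  shows "Polynomial.algebraic z"
proof -
  have pow: "z ^ n \<in> rat_vs.span S" for n
  proof (induction n)
    case 0
    show ?case using assms(2) by simp
  next
    case (Suc n)
    show ?case using span_mult_closed[OF assms(3) Suc] by simp
  qed
  define n where "n = card S"
  have ndep: "\<exists>p :: complex poly. p \<noteq> 0 \<and> (\<forall>i. coeff p i \<in> \<rat>) \<and> poly p z = 0"
  \<comment> \<open>A repeated power is already a relation. Otherwise the powers form a set of card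
    S + 1 elements, to which the dimension bound applies.\<close>
  proof (cases "inj_on (\<lambda>i. z ^ i) {..n}")
    case False
    then obtain i j where "z ^ i = z ^ j" "i \<noteq> j" by (auto simp: inj_on_def)
    then have "poly (monom 1 i - monom 1 j) z = 0" "monom 1 i - monom 1 j \<noteq> (0 :: complex poly)"
      by (auto simp: poly_monom poly_eq_iff monom_eq_iff')
    moreover have "\<forall>k. coeff (monom 1 i - monom 1 j :: complex poly) k \<in> \<rat>"
      by (auto simp: coeff_monom)
    ultimately show ?thesis by blast
  next
    case True
    have "card ((\<lambda>i. z ^ i) ` {..n}) = Suc n" using True by (simp add: card_image)
    then have "rat_vs.dependent ((\<lambda>i. z ^ i) ` {..n})"
      using rat_vs.independent_span_bound[OF assms(1), of "(\<lambda>i. z ^ i) ` {..n}"] pow n_def by force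
    then obtain u v where u: "v \<in> (\<lambda>i. z ^ i) ` {..n}" "u v \<noteq> 0"
        "(\<Sum>v\<in>(\<lambda>i. z ^ i) ` {..n}. of_rat (u v) * v) = 0"
      by (subst (asm) rat_vs.dependent_finite) auto
    define p :: "complex poly" where "p = (\<Sum>i\<le>n. monom (of_rat (u (z ^ i))) i)"
    have co: "coeff p i = (if i \<le> n then of_rat (u (z ^ i)) else 0)" for i
      unfolding p_def coeff_sum coeff_monom by (simp add: sum.delta)
    have "poly p z = (\<Sum>v\<in>(\<lambda>i. z ^ i) ` {..n}. of_rat (u v) * v)"
      using True by (simp add: p_def poly_sum poly_monom sum.reindex)
    moreover obtain i where "i \<le> n" "v = z ^ i" using u(1) by auto
    ultimately show ?thesis
      using u co by (intro exI[of _ p]) (auto simp: poly_eq_iff intro!: exI[of _ i])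
  qed
  then show ?thesis by (auto simp: algebraic_altdef)
qed

text \<open>The set consists of the b z^i with b from a rational spanning set of k and from {1}.
  Since k is finite over the rationals, the equation of z over k reduces the one power that falls
  outside.\<close>

lemma span_closedE:
  fixes z :: complex
  assumes "number_field k" "z \<in> alg_cl k"
  obtains S where "finite S" "1 \<in> S" "\<And>s. s \<in> S \<Longrightarrow> z * s \<in> rat_vs.span S"
proof -
  obtain B where k: "is_subfield k" and B: "B \<subseteq> k" "finite B"
    and Bx: "\<And>x. x \<in> k \<Longrightarrow> \<exists>c :: complex \<Rightarrow> rat. x = (\<Sum>b\<in>B. of_rat (c b) * b)"
    using assms(1) unfolding number_field_def by blast
  have kB: "x \<in> rat_vs.span B" if "x \<in> k" for x
    using Bx[OF that] by (metis (no_types, lifting) rat_vs.span_base rat_vs.span_scale rat_vs.span_sum)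
  obtain p where p: "p \<noteq> 0" "poly_over k p" "poly p z = 0"
    using assms(2) by (auto simp: alg_cl_def)
  define d where "d = degree p"
  \<comment> \<open>The exponent i = d is allowed, so that 1 is in S without showing d > 0 first;
    only z^(d + 1) has to be reduced.\<close>
  define S where "S = (\<lambda>(b, i). b * z ^ i) ` (insert 1 B \<times> {..<Suc d})"
  have sub: "x * z ^ i \<in> rat_vs.span S" if "x \<in> k" "i < Suc d" for x i
  proof -
    have "z ^ i * x \<in> rat_vs.span S"
    proof (rule span_mult_closed[OF _ kB[OF that(1)]])
      fix s assume "s \<in> B"
      then have "s * z ^ i \<in> S" using that(2) by (force simp: S_def)
      then show "z ^ i * s \<in> rat_vs.span S" using rat_vs.span_base by (metis mult.commute)
    qed
    then show ?thesis by (simp add: mult.commute)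
  qed
  have top: "x * z ^ Suc d \<in> rat_vs.span S" if "x \<in> k" for x
  proof -
    have lc: "lead_coeff p \<in> k" "lead_coeff p \<noteq> 0" using p by (auto simp: poly_over_def)
    have "(\<Sum>i\<le>d. coeff p i * z ^ i) = 0" using p(3) by (simp add: poly_altdef d_def)
    then have "lead_coeff p * z ^ d + (\<Sum>i<d. coeff p i * z ^ i) = 0"
      by (simp add: d_def lessThan_Suc_atMost[symmetric] add.commute)
    then have "z ^ d = - inverse (lead_coeff p) * (\<Sum>i<d. coeff p i * z ^ i)"
      using lc(2) by (simp add: field_simps eq_neg_iff_add_eq_0)
    then have "x * z ^ Suc d = (\<Sum>i<d. (- x * inverse (lead_coeff p) * coeff p i) * z ^ Suc i)"
      by (simp add: sum_distrib_left mult_ac sum_negf)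
    moreover have "- x * inverse (lead_coeff p) * coeff p i \<in> k" for i
      using k lc(1) p(2) that unfolding is_subfield_def poly_over_def by blast
    ultimately show ?thesis
      by (metis (no_types, lifting) sub lessThan_iff Suc_less_eq rat_vs.span_sum)
  qed
  show thesis
  proof
    show "finite S" using B by (auto simp: S_def)
    show "1 \<in> S" by (force simp: S_def)
    fix s assume "s \<in> S"
    then obtain b i where s: "s = b * z ^ i" "b \<in> insert 1 B" "i < Suc d" by (auto simp: S_def)
    then have b: "b \<in> k" using B k by (auto simp: is_subfield_def)
    have zs: "z * s = b * z ^ Suc i" using s by simp
    show "z * s \<in> rat_vs.span S"
      unfolding zs using sub[OF b, of "Suc i"] top[OF b] s(3) by (cases "i = d") (auto simp del: power_Suc)
  qed
qed

lemma span_mult: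
  assumes "x \<in> rat_vs.span S" "y \<in> rat_vs.span T"
  shows "x * y \<in> rat_vs.span ((\<lambda>(s, t). s * t) ` (S \<times> T))"
proof -
  have "y * x \<in> rat_vs.span ((\<lambda>(s, t). s * t) ` (S \<times> T))"
  proof (rule span_mult_closed[OF _ assms(1)])
    fix s assume s: "s \<in> S"
    have "s * y \<in> rat_vs.span ((\<lambda>(s, t). s * t) ` (S \<times> T))"
      by (rule span_mult_closed[OF _ assms(2)]) (use s in \<open>auto intro!: rat_vs.span_base\<close>)
    then show "y * s \<in> rat_vs.span ((\<lambda>(s, t). s * t) ` (S \<times> T))" by (simp add: mult.commute)
  qed
  then show ?thesis by (simp add: mult.commute)
qed

text \<open>Together with \<open>alg_cl_algebraic\<close>: over a number field, algebraic over k and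
  algebraic over the rationals mean the same, so closure properties can be proved with rational
  relations.\<close>

lemma algebraic_alg_cl:
  assumes "number_field k" "z \<in> alg_cl k"
  shows "Polynomial.algebraic z"
proof -
  obtain S where "finite S" "1 \<in> S" "\<And>s. s \<in> S \<Longrightarrow> z * s \<in> rat_vs.span S"
    using span_closedE[OF assms] by blast
  then show ?thesis
    using algebraic_if_span_closed[of S z] rat_vs.span_base[of 1 S] by blast
qed

lemma rat_in_number_field:
  assumes "is_subfield k" "x \<in> \<rat>"
  shows "x \<in> k"
proof -
  have nat: "of_nat n \<in> k" for n
    by (induction n) (use assms(1) in \<open>auto simp: is_subfield_def\<close>)
  have int: "of_int n \<in> k" for n
    using nat assms(1) by (cases n) (auto simp: is_subfield_def simp del: of_nat_Suc)
  obtain a b where "x = of_int a / of_int b" using assms(2) by (auto elim: Rats_cases')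
  then show ?thesis
    using int assms(1) unfolding is_subfield_def divide_inverse by blast
qed

lemma alg_cl_algebraic:
  assumes "is_subfield k" "Polynomial.algebraic z"
  shows "z \<in> alg_cl k"
  using assms rat_in_number_field unfolding algebraic_altdef alg_cl_def poly_over_def by blast

text \<open>The products s t span a finite-dimensional space that contains 1 and is stable under x
  and under y, hence under x + y and x y.\<close>

lemma alg_cl_add_mult:
  assumes "number_field k" "x \<in> alg_cl k" "y \<in> alg_cl k"
  shows "x + y \<in> alg_cl k" "x * y \<in> alg_cl k"
proof -
  obtain S where S: "finite S" "1 \<in> S" "\<And>s. s \<in> S \<Longrightarrow> x * s \<in> rat_vs.span S"
    using span_closedE[OF assms(1,2)] by metis
  obtain T where T: "finite T" "1 \<in> T" "\<And>s. s \<in> T \<Longrightarrow> y * s \<in> rat_vs.span T"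
    using span_closedE[OF assms(1,3)] by metis
  define U where "U = (\<lambda>(s, t). s * t) ` (S \<times> T)"
  have U: "finite U" "1 \<in> rat_vs.span U"
    unfolding U_def using S T by (auto intro!: rat_vs.span_base image_eqI[of _ _ "(1, 1)"])
  have x: "x * u \<in> rat_vs.span U" if "u \<in> U" for u
    using that span_mult[OF S(3) rat_vs.span_base] by (auto simp: U_def mult.assoc[symmetric])
  have y: "y * u \<in> rat_vs.span U" if "u \<in> U" for u
    using that span_mult[OF rat_vs.span_base T(3)] by (force simp: U_def mult.left_commute)
  have "(x * y) * u \<in> rat_vs.span U" if "u \<in> U" for u
    using span_mult_closed[OF x y[OF that]] by (simp add: mult.assoc)
  then have "Polynomial.algebraic (x * y)"
    using U algebraic_if_span_closed by blast
  moreover have "Polynomial.algebraic (x + y)"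
    using U x y rat_vs.span_add by (intro algebraic_if_span_closed[of U]) (auto simp: algebra_simps)
  ultimately show "x + y \<in> alg_cl k" "x * y \<in> alg_cl k"
    using assms(1) alg_cl_algebraic unfolding number_field_def by blast+
qed

lemma number_field_subset_alg_cl:
  assumes "is_subfield k"
  shows "k \<subseteq> alg_cl k"
proof
  fix x assume x: "x \<in> k"
  have "poly_over k [:- x, 1:]"
    using assms x by (auto simp: poly_over_def is_subfield_def coeff_pCons split: nat.splits)
  then show "x \<in> alg_cl k"
    unfolding alg_cl_def by (auto intro!: exI[of _ "[:- x, 1:]"])
qed

lemma is_subfield_alg_cl:
  assumes "number_field k"
  shows "is_subfield (alg_cl k)"
proof -
  have k: "is_subfield k" using assms by (simp add: number_field_def)
  then have "0 \<in> alg_cl k" "1 \<in> alg_cl k"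
    using number_field_subset_alg_cl[OF k] by (auto simp: is_subfield_def)
  moreover have "- x \<in> alg_cl k" "inverse x \<in> alg_cl k" if "x \<in> alg_cl k" for x
    using algebraic_alg_cl[OF assms that] alg_cl_algebraic[OF k] by auto
  ultimately show ?thesis
    using alg_cl_add_mult[OF assms] by (auto simp: is_subfield_def)
qed

text \<open>A partial automorphism is represented by its graph, so that the union of a chain of partial
  automorphisms is their set-theoretic union.\<close>

definition hom_graph :: "complex set \<Rightarrow> (complex \<times> complex) set \<Rightarrow> bool" where
  "hom_graph k G \<longleftrightarrow> G \<subseteq> alg_cl k \<times> alg_cl k \<and> (\<forall>x\<in>k. (x, x) \<in> G) \<and>
     (\<forall>x x' y y'. (x, x') \<in> G \<longrightarrow> (y, y') \<in> G \<longrightarrow>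
        (x + y, x' + y') \<in> G \<and> (x * y, x' * y') \<in> G \<and> (x = y \<longleftrightarrow> x' = y'))"

section \<open>Extending partial automorphisms of the closure\<close>

definition poly_rel :: "(complex \<times> complex) set \<Rightarrow> complex poly \<Rightarrow> complex poly \<Rightarrow> bool" where
  "poly_rel G p p' \<longleftrightarrow> (\<forall>i. (coeff p i, coeff p' i) \<in> G)"

context
  fixes k G
  assumes k: "number_field k" and G: "hom_graph k G"
begin

lemma sk: "is_subfield k" using k by (simp add: number_field_def)

lemma graph_closed:
  "(x, x') \<in> G \<Longrightarrow> (y, y') \<in> G \<Longrightarrow> (x + y, x' + y') \<in> G"
  "(x, x') \<in> G \<Longrightarrow> (y, y') \<in> G \<Longrightarrow> (x * y, x' * y') \<in> G"
  "(x, x') \<in> G \<Longrightarrow> (y, y') \<in> G \<Longrightarrow> x = y \<longleftrightarrow> x' = y'"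
  "x \<in> k \<Longrightarrow> (x, x) \<in> G"
  using G unfolding hom_graph_def by blast+

lemma graph_0: "(0, 0) \<in> G" "(1, 1) \<in> G" "(-1, -1) \<in> G"
  using graph_closed(4) sk by (auto simp: is_subfield_def)

lemma graph_eq_0: "(x, x') \<in> G \<Longrightarrow> x = 0 \<longleftrightarrow> x' = 0"
  using graph_closed(3)[OF _ graph_0(1)] .

lemma graph_diff: "(x, x') \<in> G \<Longrightarrow> (y, y') \<in> G \<Longrightarrow> (x - y, x' - y') \<in> G"
  using graph_closed(1)[OF _ graph_closed(2)[OF graph_0(3)], of x x' y y'] by simp

lemma graph_sum:
  assumes "\<And>i. i \<in> I \<Longrightarrow> (f i, f' i) \<in> G"
  shows "(sum f I, sum f' I) \<in> G"
  using assms by (induction I rule: infinite_finite_induct) (auto intro: graph_0 graph_closed)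

lemma graph_power: "(x, x') \<in> G \<Longrightarrow> (x ^ n, x' ^ n) \<in> G"
  by (induction n) (auto intro: graph_0 graph_closed)

lemma poly_rel_degree: "poly_rel G p p' \<Longrightarrow> degree p = degree p'"
proof -
  assume "poly_rel G p p'"
  then have "coeff p i = 0 \<longleftrightarrow> coeff p' i = 0" for i
    using graph_eq_0 by (simp add: poly_rel_def)
  then show ?thesis by (simp add: Polynomial.degree_def)
qed

lemma poly_rel_0: "poly_rel G p p' \<Longrightarrow> p = 0 \<longleftrightarrow> p' = 0"
proof -
  assume "poly_rel G p p'"
  then have "coeff p i = 0 \<longleftrightarrow> coeff p' i = 0" for i
    using graph_eq_0 by (simp add: poly_rel_def)
  then show ?thesis by (simp add: poly_eq_iff)
qed

lemma poly_rel_ops: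
  assumes "poly_rel G p p'" "poly_rel G q q'"
  shows "poly_rel G (p + q) (p' + q')" "poly_rel G (p - q) (p' - q')" "poly_rel G (p * q) (p' * q')"
  using assms unfolding poly_rel_def coeff_mult
  by (auto intro!: graph_closed graph_diff graph_sum)

lemma poly_rel_monom: "(a, a') \<in> G \<Longrightarrow> poly_rel G (monom a n) (monom a' n)"
  unfolding poly_rel_def coeff_monom using graph_0 by auto

lemma poly_rel_self: "poly_over k p \<Longrightarrow> poly_rel G p p"
  unfolding poly_rel_def poly_over_def using graph_closed(4) by blast

lemma poly_rel_poly:
  assumes "poly_rel G p p'" "(x, x') \<in> G"
  shows "(poly p x, poly p' x') \<in> G"
proof -
  have "(\<Sum>i\<le>degree p. coeff p i * x ^ i, \<Sum>i\<le>degree p. coeff p' i * x' ^ i) \<in> G"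
    using assms unfolding poly_rel_def by (intro graph_sum graph_closed graph_power) auto
  then show ?thesis
    using poly_rel_degree[OF assms(1)] by (simp add: poly_altdef)
qed

text \<open>The graph is only assumed closed under sums and products. A rational equation c + x q(x)
  = 0 with c nonzero makes the inverse a polynomial in x, and the same equation holds for
  x'.\<close>

lemma graph_inverse:
  assumes "(x, x') \<in> G"
  shows "(inverse x, inverse x') \<in> G"
proof (cases "x = 0")
  case True
  then show ?thesis using graph_eq_0[OF assms] graph_0 by simp
next
  case False
  then have x': "x' \<noteq> 0" using graph_eq_0[OF assms] by simp
  have "x \<in> alg_cl k" using assms G by (auto simp: hom_graph_def)
  then obtain p0 :: "int poly" where p0: "p0 \<noteq> 0" "coeff p0 0 \<noteq> 0" "poly (map_poly of_int p0) x = 0"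
    using algebraicE'_nonzero[OF algebraic_alg_cl[OF k] False] by blast
  define p :: "complex poly" where "p = map_poly of_int p0"
  have p: "poly p x = 0" "coeff p 0 \<noteq> 0" using p0 by (simp_all add: p_def coeff_map_poly)
  have pk: "poly_over k p" using rat_in_number_field[OF sk] by (simp add: poly_over_def p_def coeff_map_poly)
  obtain c q where cq: "p = pCons c q" by (cases p)
  have c: "c \<noteq> 0" "c \<in> k" using p pk by (auto simp: cq poly_over_def dest: spec[of _ 0])
  have "poly_over k q" unfolding poly_over_def
  proof
    fix i show "coeff q i \<in> k"
      using pk[unfolded poly_over_def, rule_format, of "Suc i"] by (simp add: cq)
  qed
  then have q: "(poly q x, poly q x') \<in> G" using poly_rel_poly poly_rel_self assms by blast
  have "poly p x' = 0"
    using graph_eq_0[OF poly_rel_poly[OF poly_rel_self[OF pk] assms]] p(1) by simp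
  then have "inverse x' = - inverse c * poly q x'"
    using x' c by (simp add: cq field_simps add_eq_0_iff)
  moreover have "inverse x = - inverse c * poly q x"
    using False c p(1) by (simp add: cq field_simps add_eq_0_iff)
  moreover have "- inverse c \<in> k" using c sk by (simp add: is_subfield_def)
  ultimately show ?thesis
    using graph_closed(2)[OF graph_closed(4) q] by metis
qed

text \<open>Division with remainder carried out simultaneously on both sides of the graph, so that
  quotients and remainders correspond as well.\<close>

lemma poly_rel_division:
  assumes "poly_rel G m m'" "m \<noteq> 0" "poly_rel G p p'"
  shows "\<exists>q q' r r'. poly_rel G q q' \<and> poly_rel G r r' \<and> p = q * m + r \<and> p' = q' * m' + r' \<and>
    (r = 0 \<or> degree r < degree m)"
  using assms(3)
proof (induction "degree p" arbitrary: p p' rule: less_induct)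
  case less
  show ?case
  proof (cases "p = 0 \<or> degree p < degree m")
    case True
    have "poly_rel G 0 0" using graph_0 by (simp add: poly_rel_def)
    then show ?thesis using True less.prems by (intro exI[of _ 0] exI[of _ p] exI[of _ p']) auto
  next
    case False
    define c where "c = lead_coeff p * inverse (lead_coeff m)"
    define c' where "c' = lead_coeff p' * inverse (lead_coeff m')"
    define n where "n = degree p - degree m"
    have "(c, c') \<in> G"
      using less.prems assms(1) poly_rel_degree[OF less.prems] poly_rel_degree[OF assms(1)]
      unfolding c_def c'_def poly_rel_def by (auto intro: graph_closed graph_inverse)
    then have t: "poly_rel G (monom c n) (monom c' n)" by (rule poly_rel_monom)
    define p1 where "p1 = p - monom c n * m"
    define p1' where "p1' = p' - monom c' n * m'"
    have rel: "poly_rel G p1 p1'"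
      unfolding p1_def p1'_def using less.prems assms(1) t by (intro poly_rel_ops)
    have c0: "c \<noteq> 0" using False assms(2) by (simp add: c_def)
    have dm: "degree (monom c n * m) = degree p"
      using False assms(2) c0 by (simp add: degree_mult_eq degree_monom_eq n_def monom_eq_0_iff)
    have "lead_coeff (monom c n * m) = lead_coeff p"
      unfolding lead_coeff_mult lead_coeff_monom using assms(2) by (simp add: c_def)
    then have z: "coeff p1 (degree p) = 0"
      by (simp add: p1_def dm)
    have le: "degree p1 \<le> degree p" unfolding p1_def using dm by (metis degree_diff_le order_refl)
    have "p1 = 0 \<or> degree p1 < degree p"
      using z le by (metis le_neq_implies_less leading_coeff_0_iff)
    then show ?thesis
    proof
      assume "p1 = 0"
      then have "p = monom c n * m + 0" "p' = monom c' n * m' + 0"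
        using poly_rel_0[OF rel] by (auto simp: p1_def p1'_def)
      moreover have "poly_rel G 0 0" using graph_0 by (simp add: poly_rel_def)
      ultimately show ?thesis using t by blast
    next
      assume "degree p1 < degree p"
      from less.hyps[OF this rel] obtain q q' r r' where
        *: "poly_rel G q q'" "poly_rel G r r'" "p1 = q * m + r" "p1' = q' * m' + r'" "r = 0 \<or> degree r < degree m"
        by blast
      then have "p = (monom c n + q) * m + r" "p' = (monom c' n + q') * m' + r'"
        by (auto simp: p1_def p1'_def algebra_simps)
      then show ?thesis using * poly_rel_ops(1)[OF t *(1)] by blast
    qed
  qed
qed

text \<open>The minimal polynomial of w over the domain of G, up to a scalar, together with its
  image under the partial automorphism.\<close>

definition minimal_at :: "complex \<Rightarrow> complex poly \<Rightarrow> complex poly \<Rightarrow> bool" where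
  "minimal_at w m m' \<longleftrightarrow> poly_rel G m m' \<and> m \<noteq> 0 \<and> poly m w = 0 \<and>
     (\<forall>p p'. poly_rel G p p' \<and> p \<noteq> 0 \<and> poly p w = 0 \<longrightarrow> degree m \<le> degree p)"

lemma minimal_atE:
  assumes "w \<in> alg_cl k"
  obtains m m' where "minimal_at w m m'"
proof -
  obtain p where "p \<noteq> 0" "poly_over k p" "poly p w = 0" using assms by (auto simp: alg_cl_def)
  then have ex: "\<exists>p. \<exists>p'. poly_rel G p p' \<and> p \<noteq> 0 \<and> poly p w = 0" using poly_rel_self by blast
  define Q where "Q = (\<lambda>p. \<exists>p'. poly_rel G p p' \<and> p \<noteq> 0 \<and> poly p w = 0)"
  obtain p0 where "Q p0" using ex unfolding Q_def by blast
  then obtain m where "Q m" "\<forall>p. Q p \<longrightarrow> degree m \<le> degree p"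
    using ex_has_least_nat[of Q p0 degree] by blast
  then show thesis using that unfolding minimal_at_def Q_def by blast
qed

lemma minimal_at_dvd:
  assumes "minimal_at w m m'" "poly_rel G p p'" "poly p w = 0"
  obtains q q' where "poly_rel G q q'" "p = q * m" "p' = q' * m'"
proof -
  have m: "poly_rel G m m'" "m \<noteq> 0" "poly m w = 0" using assms(1) by (auto simp: minimal_at_def)
  obtain q q' r r' where *: "poly_rel G q q'" "poly_rel G r r'" "p = q * m + r" "p' = q' * m' + r'"
    "r = 0 \<or> degree r < degree m"
    using poly_rel_division[OF m(1,2) assms(2)] by blast
  have "poly r w = 0" using *(3) assms(3) m(3) by simp
  then have "r = 0" using *(2,5) assms(1) unfolding minimal_at_def by (meson not_less)
  then show thesis using that * poly_rel_0[OF *(2)] by simp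
qed

text \<open>One direction is divisibility by m. For the converse, take n of least degree with n'(w')
  = 0: it divides p and m, and has positive degree. The cofactor m / n has smaller degree than m,
  hence does not vanish at w, so n(w) = 0. This replaces an appeal to irreducibility of m'.\<close>

lemma minimal_at_root:
  assumes "minimal_at w m m'" "poly m' w' = 0" "poly_rel G p p'"
  shows "poly p w = 0 \<longleftrightarrow> poly p' w' = 0"
proof
  assume "poly p w = 0"
  then show "poly p' w' = 0" using minimal_at_dvd[OF assms(1,3)] assms(2) by (metis mult_zero_right poly_mult)
next
  assume p': "poly p' w' = 0"
  have m: "poly_rel G m m'" "m \<noteq> 0" "poly m w = 0" using assms(1) by (auto simp: minimal_at_def)
  define Q where "Q = (\<lambda>n. \<exists>n'. poly_rel G n n' \<and> n \<noteq> 0 \<and> poly n' w' = 0)"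
  have "Q m" unfolding Q_def using m assms(2) by blast
  then obtain n where "Q n" "\<forall>p. Q p \<longrightarrow> degree n \<le> degree p"
    using ex_has_least_nat[of Q m degree] by blast
  then obtain n' where
    n: "poly_rel G n n'" "n \<noteq> 0" "poly n' w' = 0" and
    nmin: "\<And>p p'. poly_rel G p p' \<Longrightarrow> p \<noteq> 0 \<Longrightarrow> poly p' w' = 0 \<Longrightarrow> degree n \<le> degree p"
    unfolding Q_def by blast
  have dvd: "\<exists>q q'. poly_rel G q q' \<and> p = q * n \<and> p' = q' * n'" if pp: "poly_rel G p p'" "poly p' w' = 0" for p p'
  proof -
    obtain q q' r r' where *: "poly_rel G q q'" "poly_rel G r r'" "p = q * n + r" "p' = q' * n' + r'"
      "r = 0 \<or> degree r < degree n"
      using poly_rel_division[OF n(1,2) pp(1)] by blast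
    have "poly r' w' = 0" using *(4) pp(2) n(3) by simp
    then have "r = 0" using *(2,5) nmin by (meson not_less)
    then show ?thesis using * poly_rel_0[OF *(2)] by (intro exI[of _ q] exI[of _ q']) simp
  qed
  have dn: "degree n > 0"
  proof (rule ccontr)
    assume "\<not> degree n > 0"
    then have "degree n' = 0" using poly_rel_degree[OF n(1)] by simp
    then obtain c where "n' = [:c:]" by (metis degree_eq_zeroE)
    then show False using n poly_rel_0[OF n(1)] by simp
  qed
  obtain q q' where q: "poly_rel G q q'" "m = q * n" using dvd[OF m(1) assms(2)] by blast
  have "q \<noteq> 0" using m(2) q(2) by auto
  then have "degree q < degree m" using dn n(2) q(2) by (simp add: degree_mult_eq)
  then have "poly q w \<noteq> 0" using assms(1) q(1) \<open>q \<noteq> 0\<close> unfolding minimal_at_def by (meson not_less)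
  then have "poly n w = 0" using m(3) q(2) by simp
  moreover obtain u where "p = u * n" using dvd[OF assms(3) p'] by blast
  ultimately show "poly p w = 0" by simp
qed

text \<open>The usual extension p(w) -> p'(w') to a simple extension; \<open>minimal_at_root\<close>
  makes it well defined and injective.\<close>

lemma hom_graph_extend:
  assumes "w \<in> alg_cl k" "minimal_at w m m'" "poly m' w' = 0"
  obtains G' where "hom_graph k G'" "G \<subseteq> G'" "(w, w') \<in> G'"
proof
  have w': "w' \<in> alg_cl k"
  proof -
    obtain p where p: "p \<noteq> 0" "poly_over k p" "poly p w = 0" using assms(1) by (auto simp: alg_cl_def)
    then have "poly p w' = 0" using minimal_at_root[OF assms(2,3) poly_rel_self] by blast
    then show ?thesis using p by (auto simp: alg_cl_def)
  qed
  define G' where "G' = {(poly p w, poly p' w') | p p'. poly_rel G p p'}"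
  have const: "poly_rel G [:a:] [:a':]" if "(a, a') \<in> G" for a a'
    using poly_rel_monom[OF that, of 0] by (simp add: monom_0)
  show sub: "G \<subseteq> G'"
  proof
    fix z assume "z \<in> G"
    then show "z \<in> G'" unfolding G'_def using const[of "fst z" "snd z"] by (cases z) (auto intro!: exI)
  qed
  show "(w, w') \<in> G'"
    unfolding G'_def using poly_rel_monom[OF graph_0(2), of 1]
    by (auto intro!: exI[of _ "monom 1 1"] simp: poly_monom)
  have field: "is_subfield (alg_cl k)" using is_subfield_alg_cl[OF k] .
  have val: "poly p x \<in> alg_cl k" if "\<And>i. coeff p i \<in> alg_cl k" "x \<in> alg_cl k" for p x
    using that
  proof (induction p)
    case (pCons a p)
    have "coeff p i \<in> alg_cl k" for i using pCons.prems(1)[of "Suc i"] by simp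
    moreover have "a \<in> alg_cl k" using pCons.prems(1)[of 0] by simp
    ultimately show ?case using pCons.IH pCons.prems(2) field by (simp add: is_subfield_def)
  qed (use field in \<open>simp add: is_subfield_def\<close>)
  have GA: "G \<subseteq> alg_cl k \<times> alg_cl k" using G by (simp add: hom_graph_def)
  show "hom_graph k G'" unfolding hom_graph_def
  proof (intro conjI allI impI)
    show "G' \<subseteq> alg_cl k \<times> alg_cl k"
      unfolding G'_def poly_rel_def using GA assms(1) w' by (auto intro!: val)
    show "\<forall>x\<in>k. (x, x) \<in> G'" using sub graph_closed(4) by blast
    fix x x' y y' assume "(x, x') \<in> G'" "(y, y') \<in> G'"
    then obtain p p' q q' where *: "x = poly p w" "x' = poly p' w'" "poly_rel G p p'"
      "y = poly q w" "y' = poly q' w'" "poly_rel G q q'" unfolding G'_def by blast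
    show "(x + y, x' + y') \<in> G'" unfolding G'_def
      using * poly_rel_ops(1)[OF *(3,6)] by (intro CollectI exI[of _ "p + q"] exI[of _ "p' + q'"]) simp
    show "(x * y, x' * y') \<in> G'" unfolding G'_def
      using * poly_rel_ops(3)[OF *(3,6)] by (intro CollectI exI[of _ "p * q"] exI[of _ "p' * q'"]) simp
    show "x = y \<longleftrightarrow> x' = y'"
      using minimal_at_root[OF assms(2,3) poly_rel_ops(2)[OF *(3,6)]] * by simp
  qed
qed

end

text \<open>Zorn's lemma on graphs. A maximal one is total, since otherwise a root of m' would give
  a proper extension.\<close>

lemma hom_graph_maximal:
  assumes "number_field k" "hom_graph k G"
  obtains M where "hom_graph k M" "G \<subseteq> M" "\<And>x. x \<in> alg_cl k \<Longrightarrow> \<exists>y. (x, y) \<in> M"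
proof -
  define A where "A = {M. hom_graph k M \<and> G \<subseteq> M}"
  have "\<exists>M\<in>A. \<forall>X\<in>A. M \<subseteq> X \<longrightarrow> X = M"
  proof (rule subset_Zorn_nonempty)
    show "A \<noteq> {}" using assms by (auto simp: A_def)
    fix C assume C: "C \<noteq> {}" "subset.chain A C"
    then have CA: "C \<subseteq> A" by (simp add: subset_chain_def)
    have both: "\<exists>M\<in>C. u \<in> M \<and> v \<in> M" if uv: "u \<in> \<Union>C" "v \<in> \<Union>C" for u v
    proof -
      obtain M N where *: "M \<in> C" "u \<in> M" "N \<in> C" "v \<in> N" using uv by blast
      then have "M \<subseteq> N \<or> N \<subseteq> M" using C(2) by (auto simp: subset_chain_def)
      then show ?thesis using * by blast
    qed
    have "hom_graph k (\<Union>C)" unfolding hom_graph_def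
    proof (intro conjI allI impI)
      show "\<Union>C \<subseteq> alg_cl k \<times> alg_cl k" using CA unfolding A_def hom_graph_def by blast
      show "\<forall>x\<in>k. (x, x) \<in> \<Union>C" using CA C(1) unfolding A_def hom_graph_def by blast
      fix x x' y y' assume "(x, x') \<in> \<Union>C" "(y, y') \<in> \<Union>C"
      then obtain M where M: "M \<in> C" "(x, x') \<in> M" "(y, y') \<in> M" using both by blast
      then have *: "(x + y, x' + y') \<in> M \<and> (x * y, x' * y') \<in> M \<and> (x = y \<longleftrightarrow> x' = y')"
        using CA unfolding A_def hom_graph_def by blast
      then show "(x + y, x' + y') \<in> \<Union>C" "(x * y, x' * y') \<in> \<Union>C" "x = y \<longleftrightarrow> x' = y'"
        using M(1) by blast+
    qed
    then show "\<Union>C \<in> A" using C(1) CA by (auto simp: A_def)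
  qed
  then obtain M where MA: "M \<in> A" and maxA: "\<forall>X\<in>A. M \<subseteq> X \<longrightarrow> X = M" by blast
  have M: "hom_graph k M" "G \<subseteq> M" using MA by (simp_all add: A_def)
  have max: "X = M" if "hom_graph k X" "M \<subseteq> X" for X
  proof -
    have "X \<in> A" using that M(2) by (auto simp: A_def)
    then show ?thesis using maxA that(2) by blast
  qed
  have "\<exists>y. (x, y) \<in> M" if x: "x \<in> alg_cl k" for x
  proof -
    obtain m m' where m: "minimal_at M x m m'" using minimal_atE[OF assms(1) M(1) x] by blast
    have "degree m \<noteq> 0"
    proof
      assume "degree m = 0"
      then obtain c where "m = [:c:]" by (metis degree_eq_zeroE)
      then show False using m by (simp add: minimal_at_def[OF assms(1) M(1)])
    qed
    then have "degree m' \<noteq> 0"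
      using m poly_rel_degree[OF assms(1) M(1), of m m'] by (simp add: minimal_at_def[OF assms(1) M(1)])
    then obtain y where "poly m' y = 0"
      using fundamental_theorem_of_algebra[of m'] by (auto simp: constant_degree)
    then obtain X where "hom_graph k X" "M \<subseteq> X" "(x, y) \<in> X"
      using hom_graph_extend[OF assms(1) M(1) x m] by blast
    then show ?thesis using max by blast
  qed
  then show thesis using that M by blast
qed

lemma hom_graph_gal:
  assumes "number_field k" "hom_graph k M" "\<And>x. x \<in> alg_cl k \<Longrightarrow> \<exists>y. (x, y) \<in> M"
  obtains \<sigma> where "\<sigma> \<in> gal k" "\<And>x y. (x, y) \<in> M \<Longrightarrow> \<sigma> x = y"
proof
  define \<sigma> where "\<sigma> = restrict (\<lambda>x. SOME y. (x, y) \<in> M) (alg_cl k)"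
  have k: "is_subfield k" using assms(1) by (simp add: number_field_def)
  have M: "(x, \<sigma> x) \<in> M" if "x \<in> alg_cl k" for x
    using someI_ex[OF assms(3)[OF that]] that by (simp add: \<sigma>_def)
  have A: "M \<subseteq> alg_cl k \<times> alg_cl k" using assms(2) by (simp add: hom_graph_def)
  note gc = graph_closed[OF assms(1,2)]
  show eq: "\<sigma> x = y" if "(x, y) \<in> M" for x y
    using gc(3)[OF that M] that A by blast
  have inj: "inj_on \<sigma> (alg_cl k)"
    using gc(3)[OF M M] by (auto simp: inj_on_def)
  have im: "\<sigma> ` alg_cl k \<subseteq> alg_cl k" using M A by blast
  have "alg_cl k \<subseteq> \<sigma> ` alg_cl k"
  proof
    fix y assume "y \<in> alg_cl k"
    \<comment> \<open>Surjectivity: an injective map that permutes the finite root set of p within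
      itself reaches every root.\<close>
    then obtain p where p: "p \<noteq> 0" "poly_over k p" "poly p y = 0" by (auto simp: alg_cl_def)
    define Z where "Z = {z. poly p z = 0}"
    have Z: "finite Z" "Z \<subseteq> alg_cl k" using p poly_roots_finite by (auto simp: Z_def alg_cl_def)
    have "\<sigma> z \<in> Z" if "z \<in> Z" for z
    proof -
      have "(poly p z, poly p (\<sigma> z)) \<in> M"
        using poly_rel_poly[OF assms(1,2) poly_rel_self[OF assms(1,2) p(2)] M] that Z by blast
      then show ?thesis using graph_eq_0[OF assms(1,2)] that by (auto simp: Z_def)
    qed
    then have "\<sigma> ` Z = Z"
      using Z inj by (intro endo_inj_surj) (auto intro: inj_on_subset)
    then show "y \<in> \<sigma> ` alg_cl k" using Z p(3) by (auto simp: Z_def)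
  qed
  then have "bij_betw \<sigma> (alg_cl k) (alg_cl k)" using inj im by (auto simp: bij_betw_def)
  moreover have "\<sigma> x = x" if "x \<in> k" for x using eq gc(4)[OF that] by blast
  moreover have "\<sigma> (x + y) = \<sigma> x + \<sigma> y \<and> \<sigma> (x * y) = \<sigma> x * \<sigma> y" if "x \<in> alg_cl k" "y \<in> alg_cl k" for x y
    using eq gc(1,2)[OF M M] that by blast
  ultimately show "\<sigma> \<in> gal k" by (simp add: gal_def \<sigma>_def)
qed

text \<open>If the minimal polynomial of z has a second root w, some automorphism takes z to w. The
  case of a single root is excluded by characteristic 0.\<close>

theorem gal_fixed_field:
  assumes "number_field k" "z \<in> alg_cl k" "\<And>\<sigma>. \<sigma> \<in> gal k \<Longrightarrow> \<sigma> z = z"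
  shows "z \<in> k"
proof (rule ccontr)
  assume z: "z \<notin> k"
  have k: "is_subfield k" using assms(1) by (simp add: number_field_def)
  define G where "G = {(x, x) | x. x \<in> k}"
  have G: "hom_graph k G"
    using k number_field_subset_alg_cl[OF k] by (auto simp: hom_graph_def G_def is_subfield_def)
  note min_def = minimal_at_def[OF assms(1) G]
  obtain m m' where m: "minimal_at G z m m'" using minimal_atE[OF assms(1) G assms(2)] by blast
  have rel: "poly_rel G m m'" "m \<noteq> 0" "poly m z = 0" using m by (auto simp: min_def)
  have mm: "m' = m" and mk: "poly_over k m"
    using rel(1) by (auto simp: poly_rel_def G_def poly_eq_iff poly_over_def)
  have "\<exists>w. poly m w = 0 \<and> w \<noteq> z"
  proof (rule ccontr)
    assume "\<not> ?thesis"
    then have only: "poly m w = 0 \<Longrightarrow> w = z" for w by blast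
    define d where "d = Polynomial.order z m"
    obtain q where q: "m = [:- z, 1:] ^ d * q" "\<not> [:- z, 1:] dvd q"
      using order_decomp[OF rel(2)] d_def by blast
    have "poly q w \<noteq> 0" for w
    proof (cases "w = z")
      case True
      then show ?thesis using q(2) by (simp add: poly_eq_0_iff_dvd)
    next
      case False
      then have "poly m w \<noteq> 0" using only by blast
      then show ?thesis using q(1) by (metis mult_zero_right poly_mult)
    qed
    then have "constant (poly q)" using fundamental_theorem_of_algebra[of q] by blast
    then have "degree q = 0" by (simp add: constant_degree)
    then obtain c where c: "q = [:c:]" by (metis degree_eq_zeroE)
    have c0: "c \<noteq> 0" using rel(2) q c by auto
    have dpos: "d > 0" using rel by (simp add: d_def order_root)
    then obtain e where e: "d = Suc e" using gr0_conv_Suc by blast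
    have "m = smult c ([:- z, 1:] ^ d)" using q c by simp
    then have cm: "coeff m i = c * (of_nat (d choose i) * 1 ^ i * (- z) ^ (d - i))" if "i \<le> d" for i
      using that by (simp only: coeff_smult coeff_linear_poly_power)
    have cd: "coeff m d = c" using cm[of d] by simp
    \<comment> \<open>The second highest coefficient of c (X - z)^d is -d z c; dividing by c and d,
      both nonzero elements of k, would put z into k.\<close>
    have "coeff m e = - (of_nat d * z * c)" using cm[of e] by (simp add: e)
    then have ce: "of_nat d * z * c = - coeff m e" by simp
    have m_in: "coeff m i \<in> k" for i using mk by (simp add: poly_over_def)
    have mult: "x * y \<in> k" if "x \<in> k" "y \<in> k" for x y using k that by (simp add: is_subfield_def)
    have inv: "inverse x \<in> k" "- x \<in> k" if "x \<in> k" for x using k that by (simp_all add: is_subfield_def)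
    have 1: "c \<in> k" using m_in[of d] by (simp add: cd)
    have 2: "of_nat d * z * c \<in> k" unfolding ce by (intro inv m_in)
    have 3: "of_nat d \<in> k" using rat_in_number_field[OF k] by simp
    have "(of_nat d * z * c) * inverse c * inverse (of_nat d) \<in> k"
      using mult[OF mult[OF 2 inv(1)[OF 1]] inv(1)[OF 3]] .
    also have "(of_nat d * z * c) * inverse c * inverse (of_nat d) = z"
      using c0 dpos by (simp add: field_simps)
    finally have "z \<in> k" .
    then show False using z by simp
  qed
  then obtain w where w: "poly m' w = 0" "w \<noteq> z" using mm by blast
  obtain G' where G': "hom_graph k G'" "(z, w) \<in> G'"
    using hom_graph_extend[OF assms(1) G assms(2) m w(1)] by blast
  obtain M where M: "hom_graph k M" "G' \<subseteq> M" "\<And>x. x \<in> alg_cl k \<Longrightarrow> \<exists>y. (x, y) \<in> M"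
    using hom_graph_maximal[OF assms(1) G'(1)] by blast
  obtain \<sigma> where "\<sigma> \<in> gal k" "\<sigma> z = w"
    using hom_graph_gal[OF assms(1) M(1,3)] G'(2) M(2) by (metis subsetD)
  then show False using assms(3) w(2) by auto
qed

section \<open>Divisors of functions\<close>

lemma poly_fls_pCons: "poly_fls (pCons a p) X = fls_const a + X * poly_fls p X"
  by (simp add: map_poly_pCons)

lemma poly_fls_add: "poly_fls (p + q) X = poly_fls p X + poly_fls q X"
proof (induction p arbitrary: q)
  case (pCons a p)
  obtain b r where q: "q = pCons b r" by (cases q)
  show ?case unfolding q add_pCons poly_fls_pCons pCons.IH by (simp add: algebra_simps fls_plus_const[symmetric])
qed simp

lemma poly_fls_smult: "poly_fls (smult c p) X = fls_const c * poly_fls p X"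
proof (induction p)
  case (pCons a p)
  show ?case unfolding smult_pCons poly_fls_pCons pCons.IH by (simp add: algebra_simps flip: fls_const_mult_const)
qed simp

lemma poly_fls_mult: "poly_fls (p * q) X = poly_fls p X * poly_fls q X"
proof (induction p)
  case (pCons a p)
  show ?case unfolding mult_pCons_left poly_fls_add poly_fls_smult poly_fls_pCons pCons.IH
    by (simp add: algebra_simps)
qed simp

lemma poly_fls_minus: "poly_fls (- p) X = - poly_fls p X"
  using poly_fls_smult[of "-1" p X] by simp

lemma poly_fls_fps:
  "\<exists>W. poly_fls p (fps_to_fls U) = fps_to_fls W \<and> fps_nth W 0 = poly p (fps_nth U 0)"
proof (induction p)
  case 0
  show ?case by (intro exI[of _ 0]) simp
next
  case (pCons a p)
  then obtain W where W: "poly_fls p (fps_to_fls U) = fps_to_fls W" "fps_nth W 0 = poly p (fps_nth U 0)"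
    by blast
  show ?case
    unfolding poly_fls_pCons W(1)
    by (intro exI[of _ "fps_const a + U * W"])
      (simp add: W(2) fls_times_fps_to_fls)
qed

lemma fls_subdegree_fps_unit:
  "fps_nth W 0 \<noteq> 0 \<Longrightarrow> fls_subdegree (fps_to_fls W) = 0"
  by (simp add: fls_subdegree_fls_to_fps)

lemma fls_subdegree_fps_1:
  "fps_nth W 0 = 0 \<Longrightarrow> fps_nth W 1 \<noteq> 0 \<Longrightarrow> fls_subdegree (fps_to_fls W) = 1"
proof -
  assume W: "fps_nth W 0 = 0" "fps_nth W 1 \<noteq> 0"
  have "subdegree W = 1"
    by (rule subdegreeI) (use W in auto)
  then show ?thesis by (simp add: fls_subdegree_fls_to_fps)
qed

text \<open>At a finite point a constant X forces V^2 to be constant while V has a nonzero linear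
  coefficient, so V vanishes at 0, and then V^2 = 0, a contradiction.\<close>

lemma local_param_nonconstant:
  assumes "local_param f P X Y" "on_curve f P"
  shows "X \<noteq> fls_const a"
proof (cases P)
  case (Aff x y)
  then obtain U V where UV: "Y^2 = poly_fls f X" "X = fps_to_fls U" "Y = fps_to_fls V"
    "fps_nth U 0 = x" "fps_nth V 0 = y" "fps_nth U 1 \<noteq> 0 \<or> fps_nth V 1 \<noteq> 0"
    using assms by auto
  show ?thesis
  proof
    assume X: "X = fls_const a"
    then have "fps_to_fls U = fps_to_fls (fps_const a)" using UV(2) by simp
    then have U: "U = fps_const a" by (simp only: fps_to_fls_eq_iff)
    then have V1: "fps_nth V 1 \<noteq> 0" using UV(6) by auto
    have "poly_fls p (fls_const a) = fls_const (poly p a)" for p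
      by (induction p) (simp_all add: map_poly_pCons fls_plus_const)
    then have "fps_to_fls (V^2) = fps_to_fls (fps_const (poly f a))"
      using UV(1,3) X by (simp add: fps_to_fls_power)
    then have V: "V^2 = fps_const (poly f a)" by (simp only: fps_to_fls_eq_iff)
    then have "fps_nth (V * V) 1 = 0" by (simp add: power2_eq_square)
    then have "fps_nth V 0 = 0" using V1 by (simp add: fps_mult_nth)
    then have "poly f a = 0" using arg_cong[OF V, of "\<lambda>W. fps_nth W 0"] by (simp add: power2_eq_square)
    then have "V^2 = 0" using V by simp
    then show False using V1 by simp
  qed
next
  case (Inf s)
  then obtain U where U: "X = inverse (fps_to_fls U)" "fps_nth U 0 = 0" "fps_nth U 1 \<noteq> 0"
    using assms by auto
  show ?thesis
  proof
    assume "X = fls_const a"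
    then have "fps_to_fls U = fls_const (inverse a)" using U(1) by (metis fls_inverse_const inverse_inverse_eq)
    then have "fps_to_fls U = fps_to_fls (fps_const (inverse a))" by simp
    then have "U = fps_const (inverse a)" by (simp only: fps_to_fls_eq_iff)
    then show False using U(3) by simp
  qed
qed

text \<open>A nonconstant Laurent series is transcendental over the complex numbers: p splits into
  linear factors X - a, none of which is zero.\<close>

lemma poly_fls_nonzero:
  assumes "\<And>a. X \<noteq> fls_const a" "p \<noteq> 0"
  shows "poly_fls p X \<noteq> 0"
  using assms(2)
proof (induction "degree p" arbitrary: p)
  case 0
  then obtain c where "p = [:c:]" by (metis degree_eq_zeroE)
  then show ?case using 0 by (simp add: map_poly_pCons)
next
  case (Suc n)
  then have "\<not> constant (poly p)" by (simp add: constant_degree)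
  then obtain a where "poly p a = 0" using fundamental_theorem_of_algebra by blast
  then obtain q where q: "p = [:- a, 1:] * q" by (metis dvdE poly_eq_0_iff_dvd)
  have q0: "q \<noteq> 0" using Suc.prems q by auto
  then have "degree p = Suc (degree q)" unfolding q by (subst degree_mult_eq) auto
  then have "poly_fls q X \<noteq> 0" using Suc.hyps q0 by simp
  moreover have "poly_fls [:- a, 1:] X = X - fls_const a"
    unfolding poly_fls_pCons by simp
  ultimately show ?case unfolding q poly_fls_mult using assms(1)[of a] by simp
qed

section \<open>Degrees, and the group of principal divisors\<close>

lemma div_deg_superset:
  assumes "finite A" "Poly_Mapping.keys D \<subseteq> A"
  shows "div_deg D = (\<Sum>p\<in>A. Poly_Mapping.lookup D p)"
  unfolding div_deg_def by (rule sum.mono_neutral_left) (use assms in \<open>auto simp: in_keys_iff\<close>)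

lemma div_deg_simps [simp]:
  "div_deg 0 = 0" "div_deg (D + E) = div_deg D + div_deg E" "div_deg (- D) = - div_deg D"
  "div_deg (D - E) = div_deg D - div_deg E" "div_deg (frag_of p) = 1" "div_deg (frag_cmul n D) = n * div_deg D"
proof -
  let ?A = "Poly_Mapping.keys D \<union> Poly_Mapping.keys E"
  have A: "finite ?A" by simp
  show add: "div_deg (D + E) = div_deg D + div_deg E" for E
    using div_deg_superset[of "Poly_Mapping.keys D \<union> Poly_Mapping.keys E" "D + E"]
      div_deg_superset[of "Poly_Mapping.keys D \<union> Poly_Mapping.keys E" D]
      div_deg_superset[of "Poly_Mapping.keys D \<union> Poly_Mapping.keys E" E]
      Poly_Mapping.keys_add[of D E] by (simp add: lookup_add sum.distrib)
  show cm: "div_deg (frag_cmul n D) = n * div_deg D" for n D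
    using div_deg_superset[of "Poly_Mapping.keys D" "frag_cmul n D"] keys_cmul[of n D]
    by (simp add: div_deg_def sum_distrib_left)
  show m: "div_deg (- D) = - div_deg D" for D using cm[of "-1" D] by simp
  show "div_deg (D - E) = div_deg D - div_deg E" using add[of "- E"] m[of E] by simp
qed (simp_all add: div_deg_def)

lemma div_deg_sum [simp]: "div_deg (sum g I) = (\<Sum>i\<in>I. div_deg (g i))"
  by (induction I rule: infinite_finite_induct) auto

lemma Div0_iff: "D \<in> Div0 f K \<longleftrightarrow> Poly_Mapping.keys D \<subseteq> curve_pts f K \<and> div_deg D = 0"
  by (auto simp: Div0_def)

lemma Div0_add: "D \<in> Div0 f K \<Longrightarrow> E \<in> Div0 f K \<Longrightarrow> D + E \<in> Div0 f K"
  using Poly_Mapping.keys_add[of D E] by (auto simp: Div0_iff)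

lemma Div0_closed:
  "0 \<in> Div0 f K" "D \<in> Div0 f K \<Longrightarrow> - D \<in> Div0 f K"
  "D \<in> Div0 f K \<Longrightarrow> E \<in> Div0 f K \<Longrightarrow> D - E \<in> Div0 f K"
proof -
  show minus: "D \<in> Div0 f K \<Longrightarrow> - D \<in> Div0 f K" for D by (simp add: Div0_iff)
  show "D \<in> Div0 f K \<Longrightarrow> E \<in> Div0 f K \<Longrightarrow> D - E \<in> Div0 f K"
    using Div0_add[of D f K "- E"] minus[of E] by simp
qed (simp add: Div0_iff)

lemma Div0_UNIV: "D \<in> Div0 f K \<Longrightarrow> D \<in> Div0 f UNIV"
  by (auto simp: Div0_iff curve_pts_def)

context
  fixes f :: "complex poly"
  assumes f: "degree f = 6" "squarefree f"
begin

lemma f_nonzero: "f \<noteq> 0" using f by auto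

lemma order_root_1: "poly f t = 0 \<Longrightarrow> Polynomial.order t f = 1"
proof -
  assume t: "poly f t = 0"
  have "Polynomial.order t f \<noteq> 0" using t f_nonzero by (simp add: order_root)
  moreover have "\<not> [:- t, 1:]^2 dvd f" using f(2) squarefreeD[of f "[:- t, 1:]"] by (auto simp: is_unit_iff_degree)
  then have "Polynomial.order t f < 2" using order_divides[of t 2 f] f_nonzero by auto
  ultimately show ?thesis by linarith
qed

text \<open>f has a simple root t, where b^2 f has odd order and a^2 even order. So the norm of a
  nonzero function a + b y is a nonzero polynomial.\<close>

lemma not_square_multiple:
  assumes "a \<noteq> 0 \<or> b \<noteq> 0"
  shows "a^2 - b^2 * f \<noteq> 0"
proof
  assume eq: "a^2 - b^2 * f = 0"
  have "\<not> constant (poly f)" using f by (simp add: constant_degree)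
  then obtain t where t: "poly f t = 0" using fundamental_theorem_of_algebra by blast
  note o1 = order_root_1[OF t]
  show False
  proof (cases "b = 0")
    case True
    then show False using eq assms by simp
  next
    case False
    have ab: "a^2 = b^2 * f" using eq by simp
    then have a: "a \<noteq> 0" using False f_nonzero by auto
    have "Polynomial.order t (a^2) = 2 * Polynomial.order t a"
      using a by (simp add: power2_eq_square order_mult)
    moreover have "Polynomial.order t (b^2 * f) = 2 * Polynomial.order t b + 1"
      using False f_nonzero o1 by (simp add: power2_eq_square order_mult)
    ultimately have "2 * Polynomial.order t a = 2 * Polynomial.order t b + 1" using ab by simp
    then show False by presburger
  qed
qed

definition fun_at :: "complex poly \<Rightarrow> complex poly \<Rightarrow> complex poly \<Rightarrow> complex fls \<Rightarrow> complex fls \<Rightarrow> complex fls" where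
  "fun_at a b c X Y = (poly_fls a X + poly_fls b X * Y) / poly_fls c X"

lemma fun_at_norm:
  assumes "Y^2 = poly_fls f X"
  shows "(poly_fls a X + poly_fls b X * Y) * (poly_fls a X - poly_fls b X * Y) = poly_fls (a^2 - b^2 * f) X"
proof -
  have "poly_fls (a^2 - b^2 * f) X = (poly_fls a X)^2 - (poly_fls b X)^2 * poly_fls f X"
    by (simp only: diff_conv_add_uminus poly_fls_add poly_fls_minus poly_fls_mult power2_eq_square)
  moreover have "(A + B * Y) * (A - B * Y) = A^2 - B^2 * Y^2" for A B :: "complex fls"
    by (simp add: power2_eq_square algebra_simps)
  ultimately show ?thesis using assms by simp
qed

lemma local_param_curve: "local_param f P X Y \<Longrightarrow> Y^2 = poly_fls f X"
  by (cases P) auto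

lemma fun_at_nonzero:
  assumes "local_param f P X Y" "on_curve f P" "c \<noteq> 0" "a \<noteq> 0 \<or> b \<noteq> 0"
  shows "poly_fls a X + poly_fls b X * Y \<noteq> 0" "poly_fls c X \<noteq> 0" "fun_at a b c X Y \<noteq> 0"
proof -
  note nc = local_param_nonconstant[OF assms(1,2)]
  show 1: "poly_fls a X + poly_fls b X * Y \<noteq> 0"
    using fun_at_norm[OF local_param_curve[OF assms(1)], of a b]
      poly_fls_nonzero[OF nc not_square_multiple[OF assms(4)]] by auto
  show 2: "poly_fls c X \<noteq> 0" using poly_fls_nonzero[OF nc assms(3)] .
  show "fun_at a b c X Y \<noteq> 0" using 1 2 by (simp add: fun_at_def)
qed

definition is_div :: "divisor \<Rightarrow> complex poly \<Rightarrow> complex poly \<Rightarrow> complex poly \<Rightarrow> bool" where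
  "is_div D a b c \<longleftrightarrow> (\<forall>P X Y. on_curve f P \<longrightarrow> local_param f P X Y \<longrightarrow>
     Poly_Mapping.lookup D P = fls_subdegree (fun_at a b c X Y))"

lemma principal_divs_iff:
  "D \<in> principal_divs f \<longleftrightarrow> D \<in> Div0 f UNIV \<and> (\<exists>a b c. c \<noteq> 0 \<and> (a \<noteq> 0 \<or> b \<noteq> 0) \<and> is_div D a b c)"
  unfolding principal_divs_def is_div_def fun_at_def curve_pts_def by auto

lemma principal_divs_0: "0 \<in> principal_divs f"
  unfolding principal_divs_iff is_div_def
  by (intro conjI exI[of _ 1] exI[of _ 0] exI[of _ 1]) (auto simp: Div0_closed fun_at_def)

lemma principal_divs_add:
  assumes "D \<in> principal_divs f" "E \<in> principal_divs f"
  shows "D + E \<in> principal_divs f"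
proof -
  obtain a b c where D: "D \<in> Div0 f UNIV" "c \<noteq> 0" "a \<noteq> 0 \<or> b \<noteq> 0" "is_div D a b c"
    using assms(1) by (auto simp: principal_divs_iff)
  obtain a' b' c' where E: "E \<in> Div0 f UNIV" "c' \<noteq> 0" "a' \<noteq> 0 \<or> b' \<noteq> 0" "is_div E a' b' c'"
    using assms(2) by (auto simp: principal_divs_iff)
  define A where "A = a * a' + b * b' * f"
  define B where "B = a * b' + b * a'"
  have norm: "A^2 - B^2 * f = (a^2 - b^2 * f) * (a'^2 - b'^2 * f)"
    by (simp add: A_def B_def power2_eq_square algebra_simps)
  have AB: "A \<noteq> 0 \<or> B \<noteq> 0"
    using norm not_square_multiple[OF D(3)] not_square_multiple[OF E(3)] by auto
  have "is_div (D + E) A B (c * c')" unfolding is_div_def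
  proof (intro allI impI)
    fix P X Y assume P: "on_curve f P" "local_param f P X Y"
    have "poly_fls A X + poly_fls B X * Y =
        (poly_fls a X + poly_fls b X * Y) * (poly_fls a' X + poly_fls b' X * Y)"
      using local_param_curve[OF P(2)]
      by (simp add: A_def B_def poly_fls_add poly_fls_mult algebra_simps power2_eq_square)
    then have "fun_at A B (c * c') X Y = fun_at a b c X Y * fun_at a' b' c' X Y"
      by (simp add: fun_at_def poly_fls_mult)
    then show "Poly_Mapping.lookup (D + E) P = fls_subdegree (fun_at A B (c * c') X Y)"
      using D(4) E(4) P fun_at_nonzero(3)[OF P(2,1) D(2,3)] fun_at_nonzero(3)[OF P(2,1) E(2,3)]
      by (simp add: is_div_def lookup_add)
  qed
  then show ?thesis unfolding principal_divs_iff
    using AB D(1,2) E(1,2) Div0_add by (intro conjI exI[of _ A] exI[of _ B] exI[of _ "c * c'"]) auto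
qed

text \<open>The reciprocal is put into the required shape by its conjugate: c / (a + b y) = c (a - b
  y) / (a^2 - b^2 f).\<close>

lemma principal_divs_uminus:
  assumes "D \<in> principal_divs f"
  shows "- D \<in> principal_divs f"
proof -
  obtain a b c where D: "D \<in> Div0 f UNIV" "c \<noteq> 0" "a \<noteq> 0 \<or> b \<noteq> 0" "is_div D a b c"
    using assms(1) by (auto simp: principal_divs_iff)
  define n where "n = a^2 - b^2 * f"
  have n: "n \<noteq> 0" using not_square_multiple[OF D(3)] by (simp add: n_def)
  have "is_div (- D) (c * a) (- (c * b)) n" unfolding is_div_def
  proof (intro allI impI)
    fix P X Y assume P: "on_curve f P" "local_param f P X Y"
    note nz = fun_at_nonzero[OF P(2,1) D(2,3)]
    have "poly_fls n X = (poly_fls a X + poly_fls b X * Y) * (poly_fls a X - poly_fls b X * Y)"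
      using fun_at_norm[OF local_param_curve[OF P(2)], of a b] by (simp add: n_def)
    moreover have "poly_fls n X \<noteq> 0"
      using poly_fls_nonzero[OF local_param_nonconstant[OF P(2,1)] n] .
    moreover have "C * (A - B * Y) / ((A + B * Y) * (A - B * Y)) = inverse ((A + B * Y) / C)"
      if "(A + B * Y) * (A - B * Y) \<noteq> 0" for A B C :: "complex fls"
      using that by simp
    ultimately have "poly_fls c X * (poly_fls a X - poly_fls b X * Y) / poly_fls n X = inverse (fun_at a b c X Y)"
      by (metis fun_at_def)
    then have "fun_at (c * a) (- (c * b)) n X Y = inverse (fun_at a b c X Y)"
      by (simp add: fun_at_def poly_fls_mult poly_fls_minus right_diff_distrib mult.assoc)
    then show "Poly_Mapping.lookup (- D) P = fls_subdegree (fun_at (c * a) (- (c * b)) n X Y)"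
      using D(4) P nz by (simp add: is_div_def)
  qed
  moreover have "c * a \<noteq> 0 \<or> - (c * b) \<noteq> 0" using D by auto
  ultimately show ?thesis unfolding principal_divs_iff
    using n D(1) Div0_closed(2) by (intro conjI exI[of _ "c * a"] exI[of _ "- (c * b)"] exI[of _ n]) auto
qed

lemma principal_divs_diff:
  "D \<in> principal_divs f \<Longrightarrow> E \<in> principal_divs f \<Longrightarrow> D - E \<in> principal_divs f"
  using principal_divs_add[of D "- E"] principal_divs_uminus[of E] by simp

lemma principal_divs_sum:
  "(\<And>i. i \<in> I \<Longrightarrow> g i \<in> principal_divs f) \<Longrightarrow> sum g I \<in> principal_divs f"
  by (induction I rule: infinite_finite_induct) (auto intro: principal_divs_0 principal_divs_add)

lemma principal_divs_Div0: "D \<in> principal_divs f \<Longrightarrow> D \<in> Div0 f UNIV"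
  by (simp add: principal_divs_iff)

lemma leading_coeff_nonzero: "coeff f 6 \<noteq> 0"
  using f f_nonzero by (metis leading_coeff_0_iff)

lemma csqrt_leading: "csqrt (coeff f 6) \<noteq> 0" "(csqrt (coeff f 6))^2 = coeff f 6"
  using leading_coeff_nonzero by auto

lemma lookup_canonical_div:
  "Poly_Mapping.lookup (canonical_div f) P = (case P of Aff x y \<Rightarrow> 0 | Inf s \<Rightarrow> if s^2 = coeff f 6 then 1 else 0)"
proof (cases P)
  case (Inf s)
  have "s^2 = coeff f 6 \<longleftrightarrow> s = csqrt (coeff f 6) \<or> s = - csqrt (coeff f 6)"
    using csqrt_leading(2) power2_eq_iff by metis
  then show ?thesis using csqrt_leading(1) Inf
    by (auto simp: canonical_div_def lookup_add lookup_frag_of)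
qed (auto simp: canonical_div_def lookup_add lookup_frag_of)

lemma div_deg_canonical: "div_deg (canonical_div f) = 2"
  by (simp add: canonical_div_def)

text \<open>With f = (x - t) g and g(t) nonzero, Y^2 = (X - t) g(X) shows that X - t has twice the
  order of Y; the uniformiser condition fixes the orders.\<close>

lemma weierstrass_local:
  assumes "poly f t = 0" "local_param f (Aff t 0) X Y"
  shows "fls_subdegree Y = 1" "fls_subdegree (X - fls_const t) = 2"
proof -
  obtain U V where UV: "Y^2 = poly_fls f X" "X = fps_to_fls U" "Y = fps_to_fls V"
    "fps_nth U 0 = t" "fps_nth V 0 = 0" "fps_nth U 1 \<noteq> 0 \<or> fps_nth V 1 \<noteq> 0"
    using assms by auto
  obtain g where g: "f = [:- t, 1:] * g" using assms(1) by (metis dvdE poly_eq_0_iff_dvd)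
  have gt: "poly g t \<noteq> 0"
  proof
    assume "poly g t = 0"
    then obtain q where "g = [:- t, 1:] * q" by (metis dvdE poly_eq_0_iff_dvd)
    then have "[:- t, 1:]^2 dvd f" unfolding g by (metis dvd_triv_left mult.assoc power2_eq_square)
    then show False using f(2) squarefreeD[of f "[:- t, 1:]"] by (auto simp: is_unit_iff_degree)
  qed
  obtain W where W: "poly_fls g X = fps_to_fls W" "fps_nth W 0 = poly g t"
    using poly_fls_fps[of g U] UV by auto
  have lin: "poly_fls [:- t, 1:] X = X - fls_const t"
    unfolding poly_fls_pCons by simp
  have eq: "Y^2 = (X - fls_const t) * poly_fls g X"
    unfolding UV(1) by (subst g) (simp only: poly_fls_mult lin)
  have X0: "X - fls_const t \<noteq> 0"
    using local_param_nonconstant[OF assms(2)] assms(1) by simp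
  have g0: "poly_fls g X \<noteq> 0" "fls_subdegree (poly_fls g X) = 0"
    using W gt fls_subdegree_fps_unit[of W] by auto
  have deg: "2 * fls_subdegree Y = fls_subdegree (X - fls_const t)"
    using arg_cong[OF eq, of fls_subdegree] X0 g0 by (simp add: fls_subdegree_pow)
  have Xt: "X - fls_const t = fps_to_fls (U - fps_const t)" using UV(2) by (simp add: fps_to_fls_minus)
  show "fls_subdegree Y = 1"
  proof (cases "fps_nth V 1 = 0")
    case True
    \<comment> \<open>An impossible case: this order is even by \<open>deg\<close>.\<close>
    then have "fls_subdegree (X - fls_const t) = 1"
      unfolding Xt using UV by (intro fls_subdegree_fps_1) auto
    then show ?thesis using deg by presburger
  next
    case False
    then show ?thesis using UV fls_subdegree_fps_1 by simp
  qed
  then show "fls_subdegree (X - fls_const t) = 2" using deg by simp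
qed

lemma finite_local:
  assumes "local_param f (Aff x y) X Y" "x \<noteq> t"
  shows "fls_subdegree (X - fls_const t) = 0"
proof -
  obtain U where U: "X = fps_to_fls U" "fps_nth U 0 = x" using assms by auto
  have "X - fls_const t = fps_to_fls (U - fps_const t)" using U by (simp add: fps_to_fls_minus)
  then show ?thesis using U assms(2) fls_subdegree_fps_unit[of "U - fps_const t"] by simp
qed

lemma finite_local_Y:
  assumes "local_param f (Aff x y) X Y" "y \<noteq> 0"
  shows "fls_subdegree Y = 0"
  using assms fls_subdegree_fps_unit by auto

lemma infinite_local:
  assumes "local_param f (Inf s) X Y" "s \<noteq> 0"
  shows "fls_subdegree (X - fls_const t) = -1" "fls_subdegree Y = -3"
proof -
  obtain U V where UV: "X = inverse (fps_to_fls U)" "Y = fps_to_fls V / fps_to_fls U ^ 3"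
    "fps_nth U 0 = 0" "fps_nth V 0 = s" "fps_nth U 1 \<noteq> 0"
    using assms by auto
  have U: "fls_subdegree (fps_to_fls U) = 1" using UV fls_subdegree_fps_1 by auto
  have U0: "fps_to_fls U \<noteq> 0" using UV(5) by auto
  define W where "W = 1 - fps_const t * U"
  have W: "fls_subdegree (fps_to_fls W) = 0" "fps_to_fls W \<noteq> 0"
    proof -
    have "fps_nth W 0 = 1" using UV(3) by (simp add: W_def)
    then show "fls_subdegree (fps_to_fls W) = 0" "fps_to_fls W \<noteq> 0"
      using fls_subdegree_fps_unit[of W] by auto
  qed
  have "X - fls_const t = fps_to_fls W * inverse (fps_to_fls U)"
    using U0 by (simp add: W_def UV(1) fps_to_fls_minus fls_times_fps_to_fls algebra_simps)
  then show "fls_subdegree (X - fls_const t) = -1" using W U U0 by simp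
  have V: "fls_subdegree (fps_to_fls V) = 0" "fps_to_fls V \<noteq> 0"
    using UV(4) assms(2) fls_subdegree_fps_unit[of V] by auto
  have "Y = fps_to_fls V * inverse (fps_to_fls U) ^ 3"
    using UV(2) by (simp add: divide_inverse power_inverse)
  then show "fls_subdegree Y = -3" using V U U0 by (simp add: fls_subdegree_pow)
qed

text \<open>The divisor of x - t: a double zero at the Weierstrass point and a simple pole at each
  point at infinity.\<close>

lemma principal_double_weierstrass:
  assumes "poly f t = 0"
  shows "frag_cmul 2 (frag_of (Aff t 0)) - canonical_div f \<in> principal_divs f" (is "?D \<in> _")
proof -
  have lk: "Poly_Mapping.lookup ?D P = (if P = Aff t 0 then 2 else 0) -
      (case P of Aff x y \<Rightarrow> 0 | Inf s \<Rightarrow> if s^2 = coeff f 6 then 1 else 0)" for P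
    by (simp add: lookup_minus lookup_canonical_div lookup_frag_of)
  have "?D \<in> Div0 f UNIV"
    using assms by (auto simp: Div0_iff div_deg_canonical in_keys_iff lk curve_pts_def split: curve_pt.splits if_splits)
  moreover have "is_div ?D [:- t, 1:] 0 1" unfolding is_div_def
  proof (intro allI impI)
    fix P X Y assume P: "on_curve f P" "local_param f P X Y"
    have "fun_at [:- t, 1:] 0 1 X Y = X - fls_const t"
      by (simp add: fun_at_def map_poly_pCons)
    moreover have "Poly_Mapping.lookup ?D P = fls_subdegree (X - fls_const t)"
    proof (cases P)
      case (Aff x y)
      show ?thesis
      proof (cases "x = t")
        case True
        then have "y = 0" using P(1) Aff assms by simp
        then show ?thesis using Aff True P(2) weierstrass_local[OF assms] lk by simp
      next
        case False
        then show ?thesis using finite_local P(2) Aff lk by simp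
      qed
    next
      case (Inf s)
      then have "s^2 = coeff f 6" using P(1) by simp
      moreover from this have "s \<noteq> 0" using leading_coeff_nonzero by auto
      ultimately show ?thesis using infinite_local P(2) Inf lk by simp
    qed
    ultimately show "Poly_Mapping.lookup ?D P = fls_subdegree (fun_at [:- t, 1:] 0 1 X Y)" by simp
  qed
  ultimately show ?thesis unfolding principal_divs_iff
    by (intro conjI exI[of _ "[:- t, 1:]"] exI[of _ 0] exI[of _ 1]) auto
qed

lemma finite_roots: "finite (roots f)"
  using poly_roots_finite[OF f_nonzero] by (simp add: roots_def)

lemma f_eq_prod_roots: "f = smult (coeff f 6) (monic_with (roots f))"
proof -
  have "rsquarefree f"
    unfolding rsquarefree_def using f_nonzero order_root_1 by (metis order_root)
  from complex_poly_decompose_rsquarefree[OF this] show ?thesis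
    using f(1) by (simp add: monic_with_def roots_def)
qed

lemma card_roots: "card (roots f) = 6"
proof -
  have "degree (monic_with (roots f)) = card (roots f)"
    unfolding monic_with_def by (subst degree_prod_eq_sum_degree) auto
  then show ?thesis
    using f_eq_prod_roots f(1) leading_coeff_nonzero by (metis degree_smult_eq)
qed

lemma lookup_sum_weierstrass:
  "finite S \<Longrightarrow> Poly_Mapping.lookup (\<Sum>t\<in>S. frag_of (Aff t 0)) P =
    (case P of Aff x y \<Rightarrow> if y = 0 \<and> x \<in> S then 1 else 0 | Inf s \<Rightarrow> 0)"
  by (induction S rule: finite_induct) (auto simp: lookup_add lookup_frag_of split: curve_pt.splits)

text \<open>The divisor of y: simple zeros at the six Weierstrass points and triple poles at the two
  points at infinity.\<close>

lemma principal_all_weierstrass: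
  "(\<Sum>t\<in>roots f. frag_of (Aff t 0)) - frag_cmul 3 (canonical_div f) \<in> principal_divs f" (is "?D \<in> _")
proof -
  have lk: "Poly_Mapping.lookup ?D P = (case P of Aff x y \<Rightarrow> if y = 0 \<and> x \<in> roots f then 1 else 0
      | Inf s \<Rightarrow> if s^2 = coeff f 6 then -3 else 0)" for P
    using finite_roots by (auto simp: lookup_minus lookup_canonical_div lookup_sum_weierstrass split: curve_pt.splits)
  have "Poly_Mapping.keys ?D \<subseteq> curve_pts f UNIV"
    unfolding curve_pts_def by (auto simp del: lookup_minus simp: in_keys_iff lk)
      (auto simp: roots_def split: curve_pt.splits if_splits)
  then have "?D \<in> Div0 f UNIV"
    by (simp add: Div0_iff div_deg_canonical card_roots)
  moreover have "is_div ?D 0 1 1" unfolding is_div_def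
  proof (intro allI impI)
    fix P X Y assume P: "on_curve f P" "local_param f P X Y"
    have "fun_at 0 1 1 X Y = Y" by (simp add: fun_at_def)
    moreover have "Poly_Mapping.lookup ?D P = fls_subdegree Y"
    proof (cases P)
      case (Aff x y)
      show ?thesis
      proof (cases "y = 0")
        case True
        then have "poly f x = 0" using P(1) Aff by simp
        then show ?thesis using Aff True P(2) weierstrass_local lk by (simp add: roots_def)
      next
        case False
        then show ?thesis using finite_local_Y P(2) Aff lk by simp
      qed
    next
      case (Inf s)
      then have "s^2 = coeff f 6" using P(1) by simp
      moreover from this have "s \<noteq> 0" using leading_coeff_nonzero by auto
      ultimately show ?thesis using infinite_local P(2) Inf lk by simp
    qed
    ultimately show "Poly_Mapping.lookup ?D P = fls_subdegree (fun_at 0 1 1 X Y)" by simp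
  qed
  ultimately show ?thesis unfolding principal_divs_iff
    by (intro conjI exI[of _ 0] exI[of _ 1] exI[of _ 1]) auto
qed

end

section \<open>The Jacobian and its Galois action\<close>

lemma gal_props:
  assumes "\<sigma> \<in> gal k"
  shows "x \<in> alg_cl k \<Longrightarrow> \<sigma> x \<in> alg_cl k"
    "x \<in> alg_cl k \<Longrightarrow> y \<in> alg_cl k \<Longrightarrow> \<sigma> (x + y) = \<sigma> x + \<sigma> y"
    "x \<in> alg_cl k \<Longrightarrow> y \<in> alg_cl k \<Longrightarrow> \<sigma> (x * y) = \<sigma> x * \<sigma> y"
    "x \<in> k \<Longrightarrow> \<sigma> x = x"
    "x \<in> alg_cl k \<Longrightarrow> y \<in> alg_cl k \<Longrightarrow> \<sigma> x = \<sigma> y \<longleftrightarrow> x = y"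
    "\<sigma> ` alg_cl k = alg_cl k"
  using assms unfolding gal_def bij_betw_def inj_on_def by auto

locale galois =
  fixes k :: "complex set" and \<sigma> :: "complex \<Rightarrow> complex"
  assumes nf: "number_field k" and \<sigma>: "\<sigma> \<in> gal k"
begin

lemma ground: "is_subfield k" using nf by (simp add: number_field_def)

lemma closure_mem:
  "0 \<in> alg_cl k" "1 \<in> alg_cl k" "x \<in> alg_cl k \<Longrightarrow> y \<in> alg_cl k \<Longrightarrow> x + y \<in> alg_cl k"
  "x \<in> alg_cl k \<Longrightarrow> y \<in> alg_cl k \<Longrightarrow> x * y \<in> alg_cl k" "x \<in> alg_cl k \<Longrightarrow> - x \<in> alg_cl k"
  "x \<in> alg_cl k \<Longrightarrow> inverse x \<in> alg_cl k" "x \<in> k \<Longrightarrow> x \<in> alg_cl k"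
  using is_subfield_alg_cl[OF nf] number_field_subset_alg_cl[OF ground] unfolding is_subfield_def by auto

lemma closure_divide: "x \<in> alg_cl k \<Longrightarrow> y \<in> alg_cl k \<Longrightarrow> x / y \<in> alg_cl k"
  using closure_mem(4)[of x "inverse y"] closure_mem(6)[of y] by (simp add: divide_inverse)

lemma closure_sum: "(\<And>i. i \<in> I \<Longrightarrow> g i \<in> alg_cl k) \<Longrightarrow> sum g I \<in> alg_cl k"
  by (induction I rule: infinite_finite_induct) (auto intro: closure_mem)

lemma closure_power: "x \<in> alg_cl k \<Longrightarrow> x ^ n \<in> alg_cl k"
  by (induction n) (auto intro: closure_mem)

lemma rat_mem: "x \<in> \<rat> \<Longrightarrow> x \<in> k"
  using rat_in_number_field[OF ground] .

lemma gal_mem: "x \<in> alg_cl k \<Longrightarrow> \<sigma> x \<in> alg_cl k"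
  and gal_add: "x \<in> alg_cl k \<Longrightarrow> y \<in> alg_cl k \<Longrightarrow> \<sigma> (x + y) = \<sigma> x + \<sigma> y"
  and gal_mult: "x \<in> alg_cl k \<Longrightarrow> y \<in> alg_cl k \<Longrightarrow> \<sigma> (x * y) = \<sigma> x * \<sigma> y"
  and gal_fix: "x \<in> k \<Longrightarrow> \<sigma> x = x"
  and gal_inj: "x \<in> alg_cl k \<Longrightarrow> y \<in> alg_cl k \<Longrightarrow> \<sigma> x = \<sigma> y \<longleftrightarrow> x = y"
  using gal_props[OF \<sigma>] by blast+

lemma gal_01: "\<sigma> 0 = 0" "\<sigma> 1 = 1"
  using gal_fix rat_mem by auto

lemma gal_inverse: "x \<in> alg_cl k \<Longrightarrow> \<sigma> (inverse x) = inverse (\<sigma> x)"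
proof (cases "x = 0")
  case False
  assume x: "x \<in> alg_cl k"
  have "\<sigma> x * \<sigma> (inverse x) = 1"
    using gal_mult[OF x closure_mem(6)[OF x]] False gal_01 by simp
  then show ?thesis by (metis inverse_unique)
qed (simp add: gal_01)

lemma gal_divide: "x \<in> alg_cl k \<Longrightarrow> y \<in> alg_cl k \<Longrightarrow> \<sigma> (x / y) = \<sigma> x / \<sigma> y"
  using gal_mult[of x "inverse y"] gal_inverse[of y] closure_mem by (simp add: divide_inverse)

lemma gal_sum: "(\<And>i. i \<in> I \<Longrightarrow> g i \<in> alg_cl k) \<Longrightarrow> \<sigma> (sum g I) = (\<Sum>i\<in>I. \<sigma> (g i))"
  by (induction I rule: infinite_finite_induct) (auto simp: gal_01 gal_add closure_sum)

lemma gal_power: "x \<in> alg_cl k \<Longrightarrow> \<sigma> (x ^ n) = \<sigma> x ^ n"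
  by (induction n) (auto simp: gal_01 gal_mult closure_power)

lemma gal_poly:
  assumes "poly_over k p" "x \<in> alg_cl k"
  shows "\<sigma> (poly p x) = poly p (\<sigma> x)" "poly p x \<in> alg_cl k"
proof -
  have c: "coeff p i \<in> k" for i using assms(1) by (simp add: poly_over_def)
  have t: "coeff p i * x ^ i \<in> alg_cl k" for i
    using closure_mem(4)[OF closure_mem(7)[OF c] closure_power[OF assms(2)]] .
  show "poly p x \<in> alg_cl k" unfolding poly_altdef by (intro closure_sum t)
  have "\<sigma> (coeff p i * x ^ i) = coeff p i * \<sigma> x ^ i" for i
    using gal_mult[OF closure_mem(7)[OF c] closure_power[OF assms(2)]] gal_fix[OF c] gal_power[OF assms(2)] by simp
  then show "\<sigma> (poly p x) = poly p (\<sigma> x)" unfolding poly_altdef by (subst gal_sum[OF t]) simp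
qed

end

definition gal_div :: "(complex \<Rightarrow> complex) \<Rightarrow> divisor \<Rightarrow> divisor" where
  "gal_div \<sigma> D = frag_extend (\<lambda>p. frag_of (gal_pt \<sigma> p)) D"

lemma gal_div_simps:
  "gal_div \<sigma> (D + E) = gal_div \<sigma> D + gal_div \<sigma> E" "gal_div \<sigma> (D - E) = gal_div \<sigma> D - gal_div \<sigma> E"
  "gal_div \<sigma> (- D) = - gal_div \<sigma> D" "gal_div \<sigma> 0 = 0"
  by (simp_all add: gal_div_def frag_extend_add frag_extend_diff frag_extend_minus)

lemma div_deg_gal_div: "div_deg (gal_div \<sigma> D) = div_deg D"
  unfolding gal_div_def frag_extend_def by (simp add: div_deg_def[of D])

locale genus2 =
  fixes f :: "complex poly"
  assumes f: "degree f = 6" "squarefree f"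
begin

abbreviation cl :: "divisor \<Rightarrow> divisor set" where "cl D \<equiv> jac_class f D"

lemma Div0_group_simps:
  "carrier (Div0_group f) = Div0 f UNIV" "monoid.mult (Div0_group f) = (+)" "one (Div0_group f) = 0"
  by (simp_all add: Div0_group_def free_Abelian_group_def)

lemma comm_group_Div0: "comm_group (Div0_group f)"
proof (rule comm_groupI; unfold Div0_group_simps)
  show "\<exists>y\<in>Div0 f UNIV. y + x = 0" if "x \<in> Div0 f UNIV" for x
    using that Div0_closed(2) by (intro bexI[of _ "- x"]) auto
qed (auto simp: Div0_add Div0_closed add_ac)

lemma normal_principal: "principal_divs f \<lhd> Div0_group f"
proof -
  interpret G: comm_group "Div0_group f" by (rule comm_group_Div0)
  have inv: "inv\<^bsub>Div0_group f\<^esub> x = - x" if "x \<in> Div0 f UNIV" for x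
    by (rule G.inv_equality) (use that Div0_closed in \<open>auto simp: Div0_group_simps\<close>)
  have "subgroup (principal_divs f) (Div0_group f)"
  proof
    show "principal_divs f \<subseteq> carrier (Div0_group f)"
      using principal_divs_Div0[OF f] by (auto simp: Div0_group_simps)
    show "\<And>x y. x \<in> principal_divs f \<Longrightarrow> y \<in> principal_divs f \<Longrightarrow> x \<otimes>\<^bsub>Div0_group f\<^esub> y \<in> principal_divs f"
      using principal_divs_add[OF f] by (simp add: Div0_group_simps)
    show "\<one>\<^bsub>Div0_group f\<^esub> \<in> principal_divs f" using principal_divs_0[OF f] by (simp add: Div0_group_simps)
    show "\<And>x. x \<in> principal_divs f \<Longrightarrow> inv\<^bsub>Div0_group f\<^esub> x \<in> principal_divs f"
      using principal_divs_uminus[OF f] inv principal_divs_Div0[OF f] by simp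
  qed
  then show ?thesis using G.normal_iff_subgroup by blast
qed

lemma jac_class_eq: "cl D = {n + D | n. n \<in> principal_divs f}"
  by (auto simp: jac_class_def r_coset_def Div0_group_simps)

lemma jac_class_self: "D \<in> cl D"
  unfolding jac_class_eq using principal_divs_0[OF f] by force

lemma jac_class_eq_iff: "cl D = cl E \<longleftrightarrow> D - E \<in> principal_divs f"
proof
  assume "cl D = cl E"
  then have "D \<in> cl E" using jac_class_self by blast
  then show "D - E \<in> principal_divs f" by (auto simp: jac_class_eq)
next
  assume DE: "D - E \<in> principal_divs f"
  show "cl D = cl E"
  proof (intro equalityI subsetI)
    fix x assume "x \<in> cl D"
    then obtain n where "x = n + D" "n \<in> principal_divs f" by (auto simp: jac_class_eq)
    then have "x = (n + (D - E)) + E" "n + (D - E) \<in> principal_divs f"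
      using DE principal_divs_add[OF f] by auto
    then show "x \<in> cl E" unfolding jac_class_eq by blast
  next
    fix x assume "x \<in> cl E"
    then obtain n where "x = n + E" "n \<in> principal_divs f" by (auto simp: jac_class_eq)
    then have "x = (n - (D - E)) + D" "n - (D - E) \<in> principal_divs f"
      using DE principal_divs_diff[OF f] by auto
    then show "x \<in> cl D" unfolding jac_class_eq by blast
  qed
qed

lemma group_jac: "group (jac f)"
  unfolding jac_def by (rule normal.factorgroup_is_group[OF normal_principal])

lemma jac_one: "\<one>\<^bsub>jac f\<^esub> = cl 0"
  by (auto simp: jac_def FactGroup_def jac_class_eq)

lemma jac_carrier: "D \<in> Div0 f UNIV \<Longrightarrow> cl D \<in> carrier (jac f)"
  by (auto simp: jac_def FactGroup_def RCOSETS_def jac_class_def Div0_group_simps)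

lemma jac_mult:
  assumes "D \<in> Div0 f UNIV" "E \<in> Div0 f UNIV"
  shows "cl D \<otimes>\<^bsub>jac f\<^esub> cl E = cl (D + E)"
  using normal.rcos_sum[OF normal_principal, of D E] assms
  by (simp add: jac_def FactGroup_def jac_class_def Div0_group_simps)

lemma jac_inv:
  assumes "D \<in> Div0 f UNIV"
  shows "inv\<^bsub>jac f\<^esub> cl D = cl (- D)"
  by (rule group.inv_equality[OF group_jac])
    (use assms Div0_closed in \<open>auto simp: jac_mult jac_one jac_carrier\<close>)

lemma two_torsion_iff:
  "T \<in> jac_two f K \<longleftrightarrow> (\<exists>D\<in>Div0 f K. T = cl D \<and> D + D \<in> principal_divs f)"
proof -
  have "cl D \<otimes>\<^bsub>jac f\<^esub> cl D = \<one>\<^bsub>jac f\<^esub> \<longleftrightarrow> D + D \<in> principal_divs f" if "D \<in> Div0 f K" for D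
    using Div0_UNIV[OF that] by (simp add: jac_mult jac_one jac_class_eq_iff)
  then show ?thesis unfolding jac_two_def jac_pts_def by blast
qed

end

locale genus2_galois = genus2 f + galois k \<sigma> for f k \<sigma> +
  assumes fk: "poly_over k f"
begin

lemma gal_pt_curve: "p \<in> curve_pts f (alg_cl k) \<Longrightarrow> gal_pt \<sigma> p \<in> curve_pts f (alg_cl k)"
proof (cases p)
  case (Aff x y)
  assume "p \<in> curve_pts f (alg_cl k)"
  then have *: "y^2 = poly f x" "x \<in> alg_cl k" "y \<in> alg_cl k" using Aff by (auto simp: curve_pts_def)
  then have "(\<sigma> y)^2 = poly f (\<sigma> x)" using gal_poly(1)[OF fk *(2)] gal_power[OF *(3), of 2] by simp
  then show ?thesis using * Aff gal_mem by (simp add: curve_pts_def)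
next
  case (Inf s)
  assume "p \<in> curve_pts f (alg_cl k)"
  then have *: "s^2 = coeff f 6" "s \<in> alg_cl k" using Inf by (auto simp: curve_pts_def)
  have "coeff f 6 \<in> k" using fk by (simp add: poly_over_def)
  then have "(\<sigma> s)^2 = coeff f 6" using gal_power[OF *(2), of 2] gal_fix * by simp
  then show ?thesis using * Inf gal_mem by (simp add: curve_pts_def)
qed

lemma gal_div_Div0: "D \<in> Div0 f (alg_cl k) \<Longrightarrow> gal_div \<sigma> D \<in> Div0 f (alg_cl k)"
proof -
  assume D: "D \<in> Div0 f (alg_cl k)"
  have "Poly_Mapping.keys (gal_div \<sigma> D) \<subseteq> gal_pt \<sigma> ` Poly_Mapping.keys D"
    unfolding gal_div_def frag_extend_def
    by (rule order_trans[OF keys_sum]) (auto dest!: keys_cmul[THEN subsetD] simp del: keys_cmul_iff)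
  then show ?thesis
    using D gal_pt_curve by (auto simp: Div0_iff div_deg_gal_div)
qed

lemma restrict_id_gal: "restrict (\<lambda>x. x) (alg_cl k) \<in> gal k"
  using closure_mem by (auto simp: gal_def bij_betw_def inj_on_def)

text \<open>The union defining \<open>gal_jac\<close> collapses to one class once sigma preserves
  principal divisors. This is a hypothesis here because principal divisors are tested on complex
  Laurent series, whose coefficients need not lie in the domain of sigma.\<close>

lemma gal_jac_eq:
  assumes "D \<in> Div0 f (alg_cl k)" "\<And>n. n \<in> principal_divs f \<Longrightarrow> n \<in> Div0 f (alg_cl k) \<Longrightarrow> gal_div \<sigma> n \<in> principal_divs f"
  shows "gal_jac f k \<sigma> (cl D) = cl (gal_div \<sigma> D)"
proof -
  have "cl (gal_div \<sigma> E) = cl (gal_div \<sigma> D)" if E: "E \<in> cl D \<inter> Div0 f (alg_cl k)" for E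
  proof -
    obtain n where n: "E = n + D" "n \<in> principal_divs f" using E by (auto simp: jac_class_eq)
    then have "n = E - D" by simp
    then have "n \<in> Div0 f (alg_cl k)" using E assms(1) Div0_closed(3) by blast
    then have "gal_div \<sigma> n \<in> principal_divs f" using assms(2) n by blast
    then show ?thesis by (simp add: jac_class_eq_iff n gal_div_simps)
  qed
  moreover have "D \<in> cl D \<inter> Div0 f (alg_cl k)" using assms(1) jac_class_self by blast
  ultimately show ?thesis unfolding gal_jac_def gal_div_def[symmetric] by blast
qed

text \<open>That the Galois action on divisors preserves principal divisors is a consequence of the existence of
  a cocycle: the cocycle condition forces the union in the definition of the action to be a single class.\<close>

lemma gal_div_principal:
  assumes "z \<in> carrier (Z1 k f)" "n \<in> principal_divs f" "n \<in> Div0 f (alg_cl k)"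
  shows "gal_div \<sigma> n \<in> principal_divs f"
proof -
  let ?i = "restrict (\<lambda>x. x) (alg_cl k)"
  have zz: "z \<in> gal k \<rightarrow>\<^sub>E jac_two f (alg_cl k)"
    and coc: "\<And>\<sigma> \<tau>. \<sigma> \<in> gal k \<Longrightarrow> \<tau> \<in> gal k \<Longrightarrow>
        z (compose (alg_cl k) \<sigma> \<tau>) = z \<sigma> \<otimes>\<^bsub>jac f\<^esub> gal_jac f k \<sigma> (z \<tau>)"
    using assms(1) by (auto simp: Z1_def)
  \<comment> \<open>The cocycle condition is applied to sigma and the identity, so that the class
    \<open>z \<sigma>\<close> absorbs the image of the value at the identity.\<close>
  have "compose (alg_cl k) \<sigma> ?i = \<sigma>"
    using \<sigma> by (auto simp: compose_def gal_def extensional_def fun_eq_iff)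
  then have c: "z \<sigma> = z \<sigma> \<otimes>\<^bsub>jac f\<^esub> gal_jac f k \<sigma> (z ?i)"
    using coc[OF \<sigma> restrict_id_gal] by simp
  obtain E where E: "E \<in> Div0 f (alg_cl k)" "z \<sigma> = cl E"
    using zz \<sigma> by (auto simp: two_torsion_iff dest!: PiE_mem)
  obtain D where D: "D \<in> Div0 f (alg_cl k)" "z ?i = cl D"
    using zz restrict_id_gal by (auto simp: two_torsion_iff dest!: PiE_mem)
  \<comment> \<open>For every x in the union, E + x lies in the product, which is the class of E; so
    the whole union consists of principal divisors. It contains the images of both D and n + D,
    whose difference is the image of n.\<close>
  have X: "x \<in> principal_divs f" if "x \<in> gal_jac f k \<sigma> (cl D)" for x
  proof -
    have "E + x \<in> cl E \<otimes>\<^bsub>jac f\<^esub> gal_jac f k \<sigma> (cl D)"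
      using that jac_class_self[of E] by (auto simp: jac_def FactGroup_def set_mult_def Div0_group_simps)
    then have "E + x \<in> cl E" using c E(2) D(2) by simp
    then show ?thesis by (auto simp: jac_class_eq add.commute)
  qed
  have in_gj: "gal_div \<sigma> E \<in> gal_jac f k \<sigma> (cl D)" if "E \<in> cl D" "E \<in> Div0 f (alg_cl k)" for E
    unfolding gal_jac_def gal_div_def[symmetric] using that jac_class_self by blast
  have "gal_div \<sigma> (n + D) \<in> principal_divs f"
    using assms D by (intro X in_gj Div0_add) (auto simp: jac_class_eq)
  moreover have "gal_div \<sigma> D \<in> principal_divs f"
    using D jac_class_self by (intro X in_gj) auto
  ultimately have "gal_div \<sigma> (n + D) - gal_div \<sigma> D \<in> principal_divs f"
    using principal_divs_diff[OF f] by blast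
  then show ?thesis by (simp add: gal_div_simps)
qed

lemma cocycle_class_torsion:
  assumes "\<epsilon> \<in> carrier (H1 k f)" "e \<in> \<epsilon>"
  shows "\<exists>X\<in>Div0 f (alg_cl k). e \<sigma> = cl X \<and> X + X \<in> principal_divs f"
proof -
  obtain z where z: "z \<in> carrier (Z1 k f)" "\<epsilon> = B1 k f #>\<^bsub>Z1 k f\<^esub> z"
    using assms(1) by (auto simp: H1_def FactGroup_def RCOSETS_def)
  obtain b where b: "b \<in> B1 k f" "e = b \<otimes>\<^bsub>Z1 k f\<^esub> z"
    using assms(2) z(2) by (auto simp: r_coset_def)
  then have e: "e \<sigma> = b \<sigma> \<otimes>\<^bsub>jac f\<^esub> z \<sigma>" using \<sigma> by (simp add: Z1_def)
  obtain T where T: "T \<in> jac_two f (alg_cl k)" "b \<sigma> = gal_jac f k \<sigma> T \<otimes>\<^bsub>jac f\<^esub> inv\<^bsub>jac f\<^esub> T"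
    using b(1) \<sigma> by (auto simp: B1_def)
  obtain D where D: "D \<in> Div0 f (alg_cl k)" "T = cl D" "D + D \<in> principal_divs f"
    using T(1) two_torsion_iff by blast
  have "z \<sigma> \<in> jac_two f (alg_cl k)" using z(1) \<sigma> by (auto simp: Z1_def)
  then obtain E where E: "E \<in> Div0 f (alg_cl k)" "z \<sigma> = cl E" "E + E \<in> principal_divs f"
    using two_torsion_iff by blast
  define F where "F = gal_div \<sigma> D"
  have F: "F \<in> Div0 f (alg_cl k)" using gal_div_Div0 D(1) by (simp add: F_def)
  have F2: "F + F \<in> principal_divs f"
    using gal_div_principal[OF z(1) D(3) Div0_add[OF D(1) D(1)]] by (simp add: F_def gal_div_simps)
  note U = Div0_UNIV[OF F] Div0_UNIV[OF D(1)] Div0_UNIV[OF E(1)]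
  have "gal_jac f k \<sigma> T = cl F"
    unfolding D(2) F_def using gal_jac_eq[OF D(1)] gal_div_principal[OF z(1)] by blast
  then have "e \<sigma> = cl (F - D + E)"
    using U Div0_closed Div0_add D(2) E(2) e T(2) by (simp add: jac_inv jac_mult)
  moreover have "(F - D + E) + (F - D + E) = (F + F) - (D + D) + (E + E)" by simp
  then have "(F - D + E) + (F - D + E) \<in> principal_divs f"
    using F2 D(3) E(3) principal_divs_add[OF f] principal_divs_diff[OF f] by metis
  moreover have "F - D + E \<in> Div0 f (alg_cl k)"
    using F D(1) E(1) Div0_closed Div0_add by blast
  ultimately show ?thesis by blast
qed

lemma product_class_torsion:
  assumes "\<epsilon> \<in> carrier (H1 k f)" "\<eta> \<in> carrier (H1 k f)" "g \<in> \<epsilon> \<otimes>\<^bsub>H1 k f\<^esub> \<eta>"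
  shows "\<exists>X\<in>Div0 f (alg_cl k). g \<sigma> = cl X \<and> X + X \<in> principal_divs f"
proof -
  obtain e h where eh: "e \<in> \<epsilon>" "h \<in> \<eta>" "g = e \<otimes>\<^bsub>Z1 k f\<^esub> h"
    using assms(3) by (auto simp: H1_def FactGroup_def set_mult_def)
  then have g: "g \<sigma> = e \<sigma> \<otimes>\<^bsub>jac f\<^esub> h \<sigma>" using \<sigma> by (simp add: Z1_def)
  obtain X where X: "X \<in> Div0 f (alg_cl k)" "e \<sigma> = cl X" "X + X \<in> principal_divs f"
    using cocycle_class_torsion[OF assms(1) eh(1)] by blast
  obtain Y where Y: "Y \<in> Div0 f (alg_cl k)" "h \<sigma> = cl Y" "Y + Y \<in> principal_divs f"
    using cocycle_class_torsion[OF assms(2) eh(2)] by blast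
  have "g \<sigma> = cl (X + Y)" using g X Y Div0_UNIV by (simp add: jac_mult)
  moreover have "(X + Y) + (X + Y) = (X + X) + (Y + Y)" by simp
  then have "(X + Y) + (X + Y) \<in> principal_divs f" using X(3) Y(3) principal_divs_add[OF f] by metis
  moreover have "X + Y \<in> Div0 f (alg_cl k)" using X Y Div0_add by blast
  ultimately show ?thesis by blast
qed

text \<open>Rationality of the group law at P = Q = 0 leaves only the translations: -X - Y and -Z
  have the same class.\<close>

lemma twisted_law_sum:
  assumes "\<epsilon> \<in> carrier (H1 k f)" "\<sigma> \<in> gal k" "twisted_law_rational k f e h g"
    "X \<in> Div0 f (alg_cl k)" "Y \<in> Div0 f (alg_cl k)" "Z \<in> Div0 f (alg_cl k)"
    "e \<sigma> = cl X" "h \<sigma> = cl Y" "g \<sigma> = cl Z"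
  shows "X + Y - Z \<in> principal_divs f"
proof -
  obtain z where z: "z \<in> carrier (Z1 k f)" using assms(1) by (auto simp: H1_def FactGroup_def RCOSETS_def)
  have 0: "0 \<in> Div0 f (alg_cl k)" "0 \<in> Div0 f UNIV" by (simp_all add: Div0_closed)
  have gj: "gal_jac f k \<sigma> (cl 0) = cl 0"
    using gal_jac_eq[OF 0(1)] gal_div_principal[OF z] by (simp add: gal_div_simps)
  have tw: "twisted_gal k f c \<sigma> (cl 0) = cl (- D)" if "D \<in> Div0 f (alg_cl k)" "c \<sigma> = cl D" for c D
    using that 0 Div0_UNIV[OF that(1)] Div0_closed by (simp add: twisted_gal_def gj jac_inv jac_mult)
  have P: "cl 0 \<in> jac_pts f (alg_cl k)" using 0 by (auto simp: jac_pts_def)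
  have "twisted_gal k f e \<sigma> (cl 0) \<otimes>\<^bsub>jac f\<^esub> twisted_gal k f h \<sigma> (cl 0) = twisted_gal k f g \<sigma> (cl 0 \<otimes>\<^bsub>jac f\<^esub> cl 0)"
    using assms(2,3) P unfolding twisted_law_rational_def by blast
  then have "cl (- X + - Y) = cl (- Z)"
    using tw[of X e, OF assms(4,7)] tw[of Y h, OF assms(5,8)] tw[of Z g, OF assms(6,9)] 0 assms(4,5) Div0_UNIV Div0_closed
    by (simp add: jac_mult)
  then have "(- X + - Y) - (- Z) \<in> principal_divs f" by (simp only: jac_class_eq_iff)
  from principal_divs_uminus[OF f this] show ?thesis by (simp add: algebra_simps)
qed

end

section \<open>Apolar quadratic forms\<close>

text \<open>A one-sided inverse of a square matrix is two-sided; the index sets are carried to the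
  type \<open>10\<close> by bijections.\<close>

lemma left_right_inverse_sets:
  fixes A :: "'a \<Rightarrow> 'b \<Rightarrow> complex"
  assumes "finite I" "card I = 10" "finite J" "card J = 10"
    and "\<And>i i'. i \<in> I \<Longrightarrow> i' \<in> I \<Longrightarrow> (\<Sum>j\<in>J. A i j * B j i') = (if i = i' then 1 else 0)"
    and "j \<in> J" "j' \<in> J"
  shows "(\<Sum>i\<in>I. B j i * A i j') = (if j = j' then 1 else 0)"
proof -
  have c: "card (UNIV :: 10 set) = 10" by simp
  obtain e where e: "bij_betw e (UNIV :: 10 set) I"
    using finite_same_card_bij[of "UNIV :: 10 set" I] assms(1,2) c by auto
  obtain d where d: "bij_betw d (UNIV :: 10 set) J"
    using finite_same_card_bij[of "UNIV :: 10 set" J] assms(3,4) c by auto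
  define MA :: "complex^10^10" where "MA = (\<chi> i j. A (e i) (d j))"
  define MB :: "complex^10^10" where "MB = (\<chi> j i. B (d j) (e i))"
  have "MA ** MB = mat 1"
  proof -
    have "(\<Sum>k\<in>UNIV. A (e i) (d k) * B (d k) (e i')) = (if i = i' then 1 else 0)" for i i'
    proof -
      have "(\<Sum>k\<in>UNIV. A (e i) (d k) * B (d k) (e i')) = (\<Sum>j\<in>J. A (e i) j * B j (e i'))"
        by (rule sum.reindex_bij_betw[OF d])
      also have "\<dots> = (if e i = e i' then 1 else 0)"
        using assms(5) e by (simp add: bij_betw_apply)
      also have "\<dots> = (if i = i' then 1 else 0)"
        using e by (simp add: bij_betw_def inj_eq)
      finally show ?thesis .
    qed
    then show ?thesis by (simp add: MA_def MB_def matrix_matrix_mult_def mat_def vec_eq_iff)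
  qed
  then have BA: "MB ** MA = mat 1" by (simp add: matrix_left_right_inverse)
  obtain l l' where l: "j = d l" "j' = d l'" using d assms(6,7) by (auto simp: bij_betw_def)
  have "(\<Sum>i\<in>I. B j i * A i j') = (\<Sum>k\<in>UNIV. B (d l) (e k) * A (e k) (d l'))"
    unfolding l by (rule sum.reindex_bij_betw[OF e, symmetric])
  also have "\<dots> = (MB ** MA) $ l $ l'" by (simp add: MA_def MB_def matrix_matrix_mult_def)
  also have "\<dots> = (if l = l' then 1 else 0)" by (simp add: BA mat_def)
  also have "\<dots> = (if j = j' then 1 else 0)" using d l by (simp add: bij_betw_def inj_eq)
  finally show ?thesis .
qed

section \<open>Ten pairwise apolar forms as a basis of the quadratic forms in four variables\<close>

definition sym_pairs :: "(4 \<times> 4) set" where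
  "sym_pairs = {(1,1), (1,2), (1,3), (1,4), (2,2), (2,3), (2,4), (3,3), (3,4), (4,4)}"

definition pair_weight :: "4 \<times> 4 \<Rightarrow> complex" where
  "pair_weight p = (if fst p = snd p then 1 else 2)"

lemma finite_sym_pairs: "finite sym_pairs" and card_sym_pairs: "card sym_pairs = 10"
  by (simp_all add: sym_pairs_def)

lemma sum_sym_pairs:
  "(\<Sum>p\<in>sym_pairs. g p) = g (1,1) + g (1,2) + g (1,3) + g (1,4) + g (2,2) + g (2,3) + g (2,4) + g (3,3) + g (3,4) + g (4,4)"
  for g :: "4 \<times> 4 \<Rightarrow> complex"
  by (simp add: sym_pairs_def add.assoc)

lemma sum_symmetric:
  fixes g :: "4 \<Rightarrow> 4 \<Rightarrow> complex"
  assumes "\<And>i j. g i j = g j i"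
  shows "(\<Sum>i\<in>UNIV. \<Sum>j\<in>UNIV. g i j) = (\<Sum>p\<in>sym_pairs. pair_weight p * g (fst p) (snd p))"
  unfolding sum_sym_pairs pair_weight_def sum_4
  by (simp add: assms[of 2 1] assms[of 3 1] assms[of 4 1] assms[of 3 2] assms[of 4 2] assms[of 4 3])

lemma sum_swap3:
  "(\<Sum>i\<in>A. \<Sum>j\<in>B. \<Sum>a\<in>C. g i j a) = (\<Sum>a\<in>C. \<Sum>i\<in>A. \<Sum>j\<in>B. g i j a)"
proof -
  have "(\<Sum>j\<in>B. \<Sum>a\<in>C. g i j a) = (\<Sum>a\<in>C. \<Sum>j\<in>B. g i j a)" for i by (rule sum.swap)
  then have "(\<Sum>i\<in>A. \<Sum>j\<in>B. \<Sum>a\<in>C. g i j a) = (\<Sum>i\<in>A. \<Sum>a\<in>C. \<Sum>j\<in>B. g i j a)" by simp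
  then show ?thesis by (simp only: sum.swap[of _ C A])
qed

text \<open>If the matrices \<open>T a\<close> are the inverses of the \<open>S a\<close>, the pairing of \<open>S a\<close> with \<open>T a\<close> is the trace of
  the unit matrix, hence the normalisation 4.\<close>

locale apolar_basis =
  fixes I :: "'i set" and S T :: "'i \<Rightarrow> complex^4^4"
  assumes finite_I: "finite I" and card_I: "card I = 10"
    and sym_S: "a \<in> I \<Longrightarrow> transpose (S a) = S a" and sym_T: "a \<in> I \<Longrightarrow> transpose (T a) = T a"
    and orth: "a \<in> I \<Longrightarrow> b \<in> I \<Longrightarrow>
      (\<Sum>i\<in>UNIV. \<Sum>j\<in>UNIV. T a $ i $ j * S b $ i $ j) = (if a = b then 4 else 0)"
begin

lemma swap_S: "a \<in> I \<Longrightarrow> S a $ i $ j = S a $ j $ i"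
  using arg_cong[OF sym_S, of a "\<lambda>M. M $ i $ j"] by (simp add: transpose_def)

lemma swap_T: "a \<in> I \<Longrightarrow> T a $ i $ j = T a $ j $ i"
  using arg_cong[OF sym_T, of a "\<lambda>M. M $ i $ j"] by (simp add: transpose_def)

text \<open>\<open>orth\<close> says that a 10 by 10 matrix times another is 4 times the identity;
  being square, they can be multiplied in the other order. The weight accounts for off-diagonal
  pairs standing for two entries.\<close>

lemma dual_pairs:
  assumes "p \<in> sym_pairs" "q \<in> sym_pairs"
  shows "(\<Sum>a\<in>I. pair_weight p * T a $ fst p $ snd p * S a $ fst q $ snd q) = (if p = q then 4 else 0)"
proof -
  have "(\<Sum>a\<in>I. (pair_weight p * T a $ fst p $ snd p / 4) * S a $ fst q $ snd q) = (if p = q then 1 else 0)"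
  proof (rule left_right_inverse_sets[where A = "\<lambda>a q. S a $ fst q $ snd q"])
    fix a b assume ab: "a \<in> I" "b \<in> I"
    have "(\<Sum>i\<in>UNIV. \<Sum>j\<in>UNIV. T b $ i $ j * S a $ i $ j) =
      (\<Sum>p\<in>sym_pairs. pair_weight p * (T b $ fst p $ snd p * S a $ fst p $ snd p))"
      by (rule sum_symmetric) (use ab in \<open>metis swap_S swap_T\<close>)
    then have "(\<Sum>p\<in>sym_pairs. pair_weight p * (T b $ fst p $ snd p * S a $ fst p $ snd p)) = (if b = a then 4 else 0)"
      using orth ab by simp
    then have "(\<Sum>p\<in>sym_pairs. S a $ fst p $ snd p * (pair_weight p * T b $ fst p $ snd p / 4)) = (if b = a then 4 else 0) / 4"
      by (simp only: sum_divide_distrib times_divide_eq_right mult_ac flip: \<open>_ = (if b = a then 4 else 0)\<close>)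
    then show "(\<Sum>p\<in>sym_pairs. S a $ fst p $ snd p * (pair_weight p * T b $ fst p $ snd p / 4)) = (if a = b then 1 else 0)"
      by auto
  qed (use finite_I card_I finite_sym_pairs card_sym_pairs assms in auto)
  then have "4 * (\<Sum>a\<in>I. (pair_weight p * T a $ fst p $ snd p / 4) * S a $ fst q $ snd q) = (if p = q then 4 else 0)"
    by simp
  then show ?thesis by (simp add: sum_distrib_left)
qed

lemma product_expansion: "x $ i * x $ j = (\<Sum>a\<in>I. T a $ i $ j / 2 * quad (S a) x)"
proof -
  have main: "pair_weight p * (x $ fst p * x $ snd p) = pair_weight p * (\<Sum>a\<in>I. T a $ fst p $ snd p / 2 * quad (S a) x)"
    if p: "p \<in> sym_pairs" for p
  proof -
    have q: "quad (S a) x = (\<Sum>q\<in>sym_pairs. pair_weight q * (S a $ fst q $ snd q * x $ fst q * x $ snd q)) / 2" if "a \<in> I" for a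
      unfolding quad_def using sum_symmetric[of "\<lambda>i j. S a $ i $ j * x $ i * x $ j"] swap_S[OF that]
      by (simp add: mult_ac)
    have "pair_weight p * (\<Sum>a\<in>I. T a $ fst p $ snd p / 2 * quad (S a) x) =
      (\<Sum>a\<in>I. \<Sum>q\<in>sym_pairs. pair_weight q * (x $ fst q * x $ snd q) / 4 * (pair_weight p * T a $ fst p $ snd p * S a $ fst q $ snd q))"
      by (simp add: q sum_distrib_left sum_divide_distrib mult_ac)
    also have "\<dots> = (\<Sum>q\<in>sym_pairs. \<Sum>a\<in>I. pair_weight q * (x $ fst q * x $ snd q) / 4 * (pair_weight p * T a $ fst p $ snd p * S a $ fst q $ snd q))"
      by (rule sum.swap)
    also have "\<dots> = (\<Sum>q\<in>sym_pairs. pair_weight q * (x $ fst q * x $ snd q) / 4 * (if p = q then 4 else 0))"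
      by (intro sum.cong refl) (simp only: sum_distrib_left[symmetric] dual_pairs[OF p])
    also have "\<dots> = pair_weight p * (x $ fst p * x $ snd p)"
      using p finite_sym_pairs by (simp add: if_distrib[of "\<lambda>c. _ * c"] sum.delta cong: if_cong)
    finally show ?thesis by (rule sym)
  qed
  have w: "pair_weight p \<noteq> 0" for p by (simp add: pair_weight_def)
  have m: "x $ fst p * x $ snd p = (\<Sum>a\<in>I. T a $ fst p $ snd p / 2 * quad (S a) x)" if "p \<in> sym_pairs" for p
    using main[OF that] w[of p] by simp
  have "(i, j) \<in> sym_pairs \<or> (j, i) \<in> sym_pairs"
    using exhaust_4[of i] exhaust_4[of j] by (auto simp: sym_pairs_def)
  then show ?thesis
  proof
    assume "(i, j) \<in> sym_pairs"
    from m[OF this] show ?thesis by simp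
  next
    assume "(j, i) \<in> sym_pairs"
    from m[OF this] have "x $ i * x $ j = (\<Sum>a\<in>I. T a $ j $ i / 2 * quad (S a) x)" by (simp add: mult.commute)
    also have "\<dots> = (\<Sum>a\<in>I. T a $ i $ j / 2 * quad (S a) x)"
      by (intro sum.cong refl) (simp add: swap_T)
    finally show ?thesis .
  qed
qed

lemma quad_expansion:
  "quad M x = (\<Sum>a\<in>I. ((\<Sum>i\<in>UNIV. \<Sum>j\<in>UNIV. M $ i $ j * T a $ i $ j) / 4) * quad (S a) x)"
proof -
  have "quad M x = (\<Sum>i\<in>UNIV. \<Sum>j\<in>UNIV. M $ i $ j * (x $ i * x $ j)) / 2"
    unfolding quad_def by (simp only: mult.assoc)
  also have "\<dots> = (\<Sum>i\<in>UNIV. \<Sum>j\<in>UNIV. \<Sum>a\<in>I. M $ i $ j * (T a $ i $ j / 2 * quad (S a) x)) / 2"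
    unfolding product_expansion[of x] sum_distrib_left ..
  also have "\<dots> = (\<Sum>a\<in>I. \<Sum>i\<in>UNIV. \<Sum>j\<in>UNIV. M $ i $ j * (T a $ i $ j / 2 * quad (S a) x)) / 2"
    by (subst sum_swap3) (rule refl)
  also have "\<dots> = (\<Sum>a\<in>I. (\<Sum>i\<in>UNIV. \<Sum>j\<in>UNIV. M $ i $ j * T a $ i $ j) * (quad (S a) x / 2)) / 2"
  proof -
    have "M $ i $ j * (T a $ i $ j / 2 * quad (S a) x) = M $ i $ j * T a $ i $ j * (quad (S a) x / 2)" for i j a
      by simp
    then show ?thesis by (simp only: sum_distrib_right)
  qed
  also have "\<dots> = (\<Sum>a\<in>I. ((\<Sum>i\<in>UNIV. \<Sum>j\<in>UNIV. M $ i $ j * T a $ i $ j) / 4) * quad (S a) x)"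
  proof -
    have d: "(\<Sum>a\<in>I. X a * (Y a / 2)) / 2 = (\<Sum>a\<in>I. X a / 4 * Y a)" for X Y :: "'i \<Rightarrow> complex"
      unfolding sum_divide_distrib by (intro sum.cong refl) simp
    show ?thesis by (rule d)
  qed
  finally show ?thesis .
qed

text \<open>The square of the linear form with coefficients z has matrix 2 z z^T; a quarter of its
  pairing with \<open>T a\<close> is \<open>quad (T a) z\<close>.\<close>

lemma inner_square_expansion:
  "(\<Sum>i\<in>UNIV. x $ i * z $ i)^2 = (\<Sum>a\<in>I. quad (S a) x * quad (T a) z)"
proof -
  define M :: "complex^4^4" where "M = (\<chi> i j. 2 * z $ i * z $ j)"
  have "(\<Sum>i\<in>UNIV. x $ i * z $ i)^2 = quad M x"
  proof -
    have "(\<Sum>i\<in>UNIV. x $ i * z $ i)^2 = (\<Sum>i\<in>UNIV. \<Sum>j\<in>UNIV. z $ i * z $ j * x $ i * x $ j)"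
      unfolding power2_eq_square sum_product by (simp only: mult_ac)
    also have "\<dots> = (\<Sum>i\<in>UNIV. \<Sum>j\<in>UNIV. 2 * z $ i * z $ j * x $ i * x $ j) / 2"
      by (simp only: sum_divide_distrib) (simp add: mult.assoc)
    finally show ?thesis by (simp add: quad_def M_def)
  qed
  also have "\<dots> = (\<Sum>a\<in>I. quad (S a) x * quad (T a) z)"
  proof -
    have "(\<Sum>i\<in>UNIV. \<Sum>j\<in>UNIV. M $ i $ j * T a $ i $ j) / 4 = quad (T a) z" for a
    proof -
      have "(\<Sum>i\<in>UNIV. \<Sum>j\<in>UNIV. M $ i $ j * T a $ i $ j) = 2 * (\<Sum>i\<in>UNIV. \<Sum>j\<in>UNIV. T a $ i $ j * z $ i * z $ j)"
        unfolding M_def vec_lambda_beta sum_distrib_left by (simp only: mult_ac)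
      then show ?thesis by (simp add: quad_def)
    qed
    then show ?thesis unfolding quad_expansion[of M] by (simp only: mult.commute)
  qed
  finally show ?thesis .
qed

text \<open>Only rational x are needed, since polarisation recovers the matrix entries from the
  vectors e_i and e_i + e_j. Pairing with \<open>T b\<close> then isolates c b.\<close>

lemma independent:
  assumes "\<And>x. (\<forall>i. x $ i \<in> \<rat>) \<Longrightarrow> (\<Sum>a\<in>I. c a * quad (S a) x) = 0" "b \<in> I"
  shows "c b = 0"
proof -
  define M :: "complex^4^4" where "M = (\<chi> i j. \<Sum>a\<in>I. c a * S a $ i $ j)"
  have sym: "transpose M = M"
  proof -
    have "(\<Sum>a\<in>I. c a * S a $ j $ i) = (\<Sum>a\<in>I. c a * S a $ i $ j)" for i j
      by (intro sum.cong refl) (simp only: swap_S[of _ j i])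
    then show ?thesis by (simp add: M_def transpose_def vec_eq_iff)
  qed
  have q: "quad M x = (\<Sum>a\<in>I. c a * quad (S a) x)" for x
  proof -
    have "(\<Sum>i\<in>UNIV. \<Sum>j\<in>UNIV. (\<Sum>a\<in>I. c a * S a $ i $ j) * x $ i * x $ j) =
        (\<Sum>a\<in>I. \<Sum>i\<in>UNIV. \<Sum>j\<in>UNIV. c a * (S a $ i $ j * x $ i * x $ j))"
      unfolding sum_distrib_right mult.assoc by (rule sum_swap3)
    then show ?thesis by (simp add: quad_def M_def sum_distrib_left sum_divide_distrib)
  qed
  have "M $ i $ j = 0" for i j
  proof -
    have "axis i 1 $ l \<in> \<rat>" "(axis i 1 + axis j 1) $ l \<in> \<rat>" for i j l :: 4
      by (auto simp: axis_def)
    then have "quad M (axis i 1) = 0" "quad M (axis i 1 + axis j 1) = 0" for i j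
      unfolding q by (intro assms(1); blast)+
    then show ?thesis using quad_axis(1)[OF sym, of i j] by simp
  qed
  then have "(\<Sum>i\<in>UNIV. \<Sum>j\<in>UNIV. T b $ i $ j * M $ i $ j) = 0" by simp
  also have "(\<Sum>i\<in>UNIV. \<Sum>j\<in>UNIV. T b $ i $ j * M $ i $ j) = (\<Sum>a\<in>I. c a * (\<Sum>i\<in>UNIV. \<Sum>j\<in>UNIV. T b $ i $ j * S a $ i $ j))"
    unfolding M_def vec_lambda_beta sum_distrib_left
    by (subst sum_swap3) (simp only: mult.left_commute)
  also have "\<dots> = (\<Sum>a\<in>I. c a * (if b = a then 4 else 0))" using orth assms(2) by simp
  also have "\<dots> = 4 * c b" using finite_I assms(2) by (simp add: if_distrib[of "\<lambda>x. _ * x"] sum.delta' cong: if_cong)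
  finally show ?thesis by simp
qed

lemma nonzero_value:
  assumes "a \<in> I"
  obtains x where "\<forall>i. x $ i \<in> \<rat>" "quad (S a) x \<noteq> 0"
proof -
  have "\<exists>x. (\<forall>i. x $ i \<in> \<rat>) \<and> quad (S a) x \<noteq> 0"
  proof (rule ccontr)
    assume "\<not> ?thesis"
    then have "(\<Sum>b\<in>I. (if b = a then 1 else 0) * quad (S b) x) = 0" if "\<forall>i. x $ i \<in> \<rat>" for x
      using that by (intro sum.neutral) auto
    then show False using independent[of "\<lambda>b. if b = a then 1 else 0" a] assms by auto
  qed
  then show thesis using that by blast
qed

lemma dual_basis: "apolar_basis I T S"
proof
  show "(\<Sum>i\<in>UNIV. \<Sum>j\<in>UNIV. S a $ i $ j * T b $ i $ j) = (if a = b then 4 else 0)" if "a \<in> I" "b \<in> I" for a b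
    using orth[OF that(2,1)] by (simp add: mult.commute eq_commute)
qed (fact finite_I card_I sym_S sym_T)+

end

section \<open>Even subsets of six points\<close>

definition sd :: "'a set \<Rightarrow> 'a set \<Rightarrow> 'a set" where
  "sd A B = (A - B) \<union> (B - A)"

definition chi :: "'a set \<Rightarrow> 'a set \<Rightarrow> complex" where
  "chi A S = (-1) ^ card (S \<inter> A)"

lemma sd_simps: "sd A {} = A" "sd {} A = A" "sd A A = {}" "sd A (sd A B) = B" "sd (sd A B) B = A"
  by (auto simp: sd_def)

lemma sd_commute: "sd A B = sd B A"
  by (auto simp: sd_def)

lemma sd_subset: "A \<subseteq> R \<Longrightarrow> B \<subseteq> R \<Longrightarrow> sd A B \<subseteq> R"
  by (auto simp: sd_def)

lemma card_sd:
  assumes "finite A" "finite B"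
  shows "card (sd A B) + 2 * card (A \<inter> B) = card A + card B"
proof -
  have "card (sd A B) = card (A - B) + card (B - A)"
    unfolding sd_def by (rule card_Un_disjoint) (use assms in auto)
  moreover have "card A = card (A - B) + card (A \<inter> B)"
    using card_Int_Diff[of A B] assms by simp
  moreover have "card B = card (B - A) + card (A \<inter> B)"
    using card_Int_Diff[of B A] assms by (simp add: Int_commute)
  ultimately show ?thesis by simp
qed

lemma chi_commute: "chi A S = chi S A"
  by (simp add: chi_def Int_commute)

lemma chi_sd:
  assumes "finite S" "finite S'"
  shows "chi A (sd S S') = chi A S * chi A S'"
proof -
  have *: "sd S S' \<inter> A = sd (S \<inter> A) (S' \<inter> A)" by (auto simp: sd_def)
  define n where "n = card (S \<inter> A \<inter> (S' \<inter> A))"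
  have "card (sd S S' \<inter> A) + 2 * n = card (S \<inter> A) + card (S' \<inter> A)"
    unfolding * n_def by (rule card_sd) (use assms in auto)
  then have "(-1::complex) ^ (card (sd S S' \<inter> A) + 2 * n) = (-1) ^ (card (S \<inter> A) + card (S' \<inter> A))" by simp
  then show ?thesis by (simp add: chi_def power_add power_mult)
qed

lemma chi_empty [simp]: "chi A {} = 1" "chi {} A = 1"
  by (simp_all add: chi_def)

lemma chi_square: "chi A S * chi A S = 1"
  by (simp add: chi_def flip: power_mult_distrib)

text \<open>Points of order 2 correspond to even subsets up to complements.  Working with all even subsets turns
  \<open>chi a\<close>, for \<open>a\<close> of odd size, into an honest character, at the price of a sign between the values at a
  subset and at its complement.  A partition into two halves is given by the half that contains \<open>base\<close>.\<close>

locale six_set =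
  fixes R :: "'a set" and base :: 'a
  assumes card_R: "card R = 6" and base: "base \<in> R"
begin

definition evn :: "'a set set" where "evn = {S. S \<subseteq> R \<and> even (card S)}"

definition halves :: "'a set set" where "halves = {A. A \<subseteq> R \<and> card A = 3 \<and> base \<in> A}"

lemma finite_R: "finite R" using card_R by (metis card.infinite zero_neq_numeral)

lemma finite_subset_R: "A \<subseteq> R \<Longrightarrow> finite A" using finite_R finite_subset by blast

lemma finite_halves: "finite halves"
  using finite_R by (auto simp: halves_def)

lemma evn_sd: "S \<in> evn \<Longrightarrow> S' \<in> evn \<Longrightarrow> sd S S' \<in> evn"
  using card_sd[of S S'] sd_subset[of S R S'] finite_subset_R
  by (auto simp: evn_def) (metis even_add even_mult_iff even_numeral)

lemma evn_finite: "S \<in> evn \<Longrightarrow> finite S" using finite_subset_R by (auto simp: evn_def)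

lemma halvesD: "A \<in> halves \<Longrightarrow> A \<subseteq> R" "A \<in> halves \<Longrightarrow> finite A" "A \<in> halves \<Longrightarrow> card A = 3" "A \<in> halves \<Longrightarrow> base \<in> A"
  using finite_subset_R by (auto simp: halves_def)

lemma card_halves: "card halves = 10"
proof -
  have "bij_betw (insert base) {B. B \<subseteq> R - {base} \<and> card B = 2} halves"
  proof (rule bij_betwI[where g = "\<lambda>A. A - {base}"])
    show "insert base \<in> {B. B \<subseteq> R - {base} \<and> card B = 2} \<rightarrow> halves"
    proof
      fix B assume B: "B \<in> {B. B \<subseteq> R - {base} \<and> card B = 2}"
      then have "card (insert base B) = 3" using finite_subset_R[of B] by (subst card_insert_disjoint) auto
      then show "insert base B \<in> halves" using B base by (auto simp: halves_def)
    qed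
  qed (use finite_subset_R in \<open>auto simp: halves_def card_Diff_singleton\<close>)
  then have "card halves = card {B. B \<subseteq> R - {base} \<and> card B = 2}" by (simp add: bij_betw_same_card)
  also have "\<dots> = card (R - {base}) choose 2" by (rule n_subsets) (use finite_R in auto)
  also have "\<dots> = 10" using card_R base by (simp add: card_Diff_singleton choose_two)
  finally show ?thesis .
qed

text \<open>Shifting by {i, j}, with i in a and j outside, permutes the even subsets and reverses
  the sign of the sum.\<close>

lemma sum_chi:
  assumes "a \<subseteq> R" "a \<noteq> {}" "a \<noteq> R"
  shows "(\<Sum>S\<in>evn. chi a S) = 0"
proof -
  obtain i j where ij: "i \<in> a" "j \<in> R" "j \<notin> a" using assms by blast
  define d where "d = {i, j}"
  have d: "d \<in> evn" "chi a d = -1" using ij assms(1) by (auto simp: d_def evn_def chi_def card_insert_if)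
  have "(\<Sum>S\<in>evn. chi a S) = (\<Sum>S\<in>evn. chi a (sd S d))"
    by (rule sum.reindex_bij_witness[where i = "\<lambda>S. sd S d" and j = "\<lambda>S. sd S d"]) (auto simp: sd_simps evn_sd d)
  also have "\<dots> = (\<Sum>S\<in>evn. - chi a S)"
    by (intro sum.cong refl) (simp add: chi_sd evn_finite d)
  also have "\<dots> = - (\<Sum>S\<in>evn. chi a S)" by (rule sum_negf)
  finally show ?thesis by simp
qed

lemma card_evn: "card evn = 32"
proof -
  define n where "n = of_nat (card evn) - (32::complex)"
  \<comment> \<open>1 + (-1)^|S| is twice the indicator of the even subsets; the alternating part
    sums to 0 by toggling \<open>base\<close>.\<close>
  have "(\<Sum>S\<in>Pow R. (\<Sum>a\<in>{{}, R}. chi a S)) = (\<Sum>S\<in>Pow R. if S \<in> evn then 2 else 0)"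
  proof (intro sum.cong refl)
    fix S assume "S \<in> Pow R"
    then have "S \<inter> R = S" "{} \<noteq> R" using base by auto
    then show "(\<Sum>a\<in>{{}, R}. chi a S) = (if S \<in> evn then 2 else 0)"
      using \<open>S \<in> Pow R\<close> by (auto simp: chi_def evn_def)
  qed
  also have "\<dots> = 2 * of_nat (card evn)"
  proof -
    have "Pow R \<inter> {S. S \<in> evn} = evn" by (auto simp: evn_def)
    then show ?thesis using finite_R by (simp add: sum.If_cases)
  qed
  finally have total: "(\<Sum>S\<in>Pow R. \<Sum>a\<in>{{}, R}. chi a S) = 2 * of_nat (card evn)" .
  have "(\<Sum>S\<in>Pow R. chi {} S) + (\<Sum>S\<in>Pow R. chi R S) = 2 * of_nat (card evn)"
  proof -
    have "{} \<noteq> R" using base by auto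
    then have "(\<Sum>a\<in>{{}, R}. chi a S) = chi {} S + chi R S" for S by simp
    with total show ?thesis by (simp only: sum.distrib)
  qed
  moreover have "(\<Sum>S\<in>Pow R. chi {} S) = 64" using finite_R card_R by (simp add: card_Pow)
  moreover have "(\<Sum>S\<in>Pow R. chi R S) = 0"
  proof -
    have "(\<Sum>S\<in>Pow R. chi R S) = (\<Sum>S\<in>Pow R. chi R (sd S {base}))"
      by (rule sum.reindex_bij_witness[where i = "\<lambda>S. sd S {base}" and j = "\<lambda>S. sd S {base}"])
        (use base sd_subset[of _ R "{base}"] in \<open>auto simp: sd_simps\<close>)
    also have "\<dots> = (\<Sum>S\<in>Pow R. - chi R S)"
    proof (intro sum.cong refl)
      fix S assume "S \<in> Pow R"
      moreover have "chi R {base} = -1" using base by (simp add: chi_def)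
      ultimately show "chi R (sd S {base}) = - chi R S" by (simp add: chi_sd finite_subset_R)
    qed
    also have "\<dots> = - (\<Sum>S\<in>Pow R. chi R S)" by (rule sum_negf)
    finally show ?thesis by simp
  qed
  ultimately have "2 * of_nat (card evn) = (64 :: complex)" by simp
  then have "of_nat (2 * card evn) = (of_nat 64 :: complex)" by simp
  then have "2 * card evn = 64" unfolding of_nat_eq_iff .
  then show ?thesis by simp
qed

text \<open>The two exclusions are the cases in which \<open>sd a u\<close> is empty or all of R,
  the subsets whose character is trivial on even subsets.\<close>

lemma sum_chi_halves:
  assumes "a \<in> halves" "u \<subseteq> R" "u \<noteq> a" "u \<noteq> R - a"
  shows "(\<Sum>S\<in>evn. chi a S * chi u S) = 0"
proof -
  have "chi a S * chi u S = chi (sd a u) S" if "S \<in> evn" for S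
    using chi_sd[of a u S] assms finite_subset_R halvesD by (simp add: chi_commute)
  moreover have "sd a u \<noteq> {}" "sd a u \<noteq> R" "sd a u \<subseteq> R"
    using assms halvesD(1)[OF assms(1)] by (auto simp: sd_def)
  ultimately show ?thesis using sum_chi by simp
qed

lemma sum_chi_halves_pair:
  assumes "a \<in> halves" "b \<in> halves"
  shows "(\<Sum>S\<in>evn. chi a S * chi b S) = (if a = b then 32 else 0)"
proof (cases "a = b")
  case True
  then show ?thesis by (simp add: chi_square card_evn)
next
  case False
  moreover have "b \<noteq> R - a" using assms halvesD(4) by auto
  ultimately show ?thesis using sum_chi_halves[OF assms(1)] halvesD(1)[OF assms(2)] by simp
qed

context
  fixes c :: "'a set \<Rightarrow> 'a set \<Rightarrow> complex" and r :: "'a set \<Rightarrow> 'a set \<Rightarrow> 'a set \<Rightarrow> complex"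
  assumes expansion: "\<And>g S S'. g \<in> halves \<Longrightarrow> S \<in> evn \<Longrightarrow> S' \<in> evn \<Longrightarrow>
    (\<Sum>a\<in>halves. \<Sum>b\<in>halves. r a b g * (chi a S * chi b S')) = c S S' * chi g (sd S S')"
begin

text \<open>It is formed from c alone. That it can be evaluated through every half g in turn is what
  forces the coefficients r to be diagonal.\<close>

definition fourier :: "'a set \<Rightarrow> 'a set \<Rightarrow> complex" where
  "fourier u v = (\<Sum>S\<in>evn. \<Sum>S'\<in>evn. c S S' * (chi u S * chi v S'))"

lemma fourier_eq:
  assumes "g \<in> halves" "u \<subseteq> R" "v \<subseteq> R"
  shows "fourier (sd u g) (sd v g) = (\<Sum>a\<in>halves. \<Sum>b\<in>halves.
    r a b g * ((\<Sum>S\<in>evn. chi a S * chi u S) * (\<Sum>S'\<in>evn. chi b S' * chi v S')))"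
proof -
  have "c S S' * (chi (sd u g) S * chi (sd v g) S') =
    (\<Sum>a\<in>halves. \<Sum>b\<in>halves. r a b g * ((chi a S * chi u S) * (chi b S' * chi v S')))"
    if "S \<in> evn" "S' \<in> evn" for S S'
  proof -
    have sdS: "chi (sd w g) U = chi w U * chi g U" if "w \<subseteq> R" for w U
      using chi_sd[of w g U] that assms finite_subset_R halvesD by (simp add: chi_commute)
    have "c S S' * (chi (sd u g) S * chi (sd v g) S') = (c S S' * chi g (sd S S')) * (chi u S * chi v S')"
      using that assms by (simp add: sdS chi_sd evn_finite)
    also have "\<dots> = (\<Sum>a\<in>halves. \<Sum>b\<in>halves. r a b g * (chi a S * chi b S')) * (chi u S * chi v S')"
      using expansion[OF assms(1) that] by simp
    finally show ?thesis by (simp add: sum_distrib_left sum_distrib_right mult_ac)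
  qed
  then have "fourier (sd u g) (sd v g) =
    (\<Sum>S\<in>evn. \<Sum>S'\<in>evn. \<Sum>a\<in>halves. \<Sum>b\<in>halves. r a b g * ((chi a S * chi u S) * (chi b S' * chi v S')))"
    unfolding fourier_def by simp
  also have "\<dots> = (\<Sum>a\<in>halves. \<Sum>S\<in>evn. \<Sum>S'\<in>evn. \<Sum>b\<in>halves. r a b g * ((chi a S * chi u S) * (chi b S' * chi v S')))"
    by (rule sum_swap3)
  also have "\<dots> = (\<Sum>a\<in>halves. \<Sum>b\<in>halves. \<Sum>S\<in>evn. \<Sum>S'\<in>evn. r a b g * ((chi a S * chi u S) * (chi b S' * chi v S')))"
    by (intro sum.cong refl sum_swap3)
  also have "\<dots> = (\<Sum>a\<in>halves. \<Sum>b\<in>halves.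
    r a b g * ((\<Sum>S\<in>evn. chi a S * chi u S) * (\<Sum>S'\<in>evn. chi b S' * chi v S')))"
    unfolding sum_product unfolding sum_distrib_left ..
  finally show ?thesis .
qed

text \<open>Orthogonality leaves one term on each side, of weight 32 each, and 1024 = 32^2.\<close>

lemma fourier_halves:
  assumes "g \<in> halves" "a \<in> halves" "b \<in> halves"
  shows "fourier (sd a g) (sd b g) = 1024 * r a b g"
proof -
  have "fourier (sd a g) (sd b g) = (\<Sum>a'\<in>halves. \<Sum>b'\<in>halves.
    r a' b' g * ((if a' = a then 32 else 0) * (if b' = b then 32 else 0)))"
    using fourier_eq[OF assms(1) halvesD(1)[OF assms(2)] halvesD(1)[OF assms(3)]] assms
    by (simp add: sum_chi_halves_pair)
  also have "\<dots> = (\<Sum>a'\<in>halves. if a' = a then 1024 * r a b g else 0)"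
    using finite_halves assms
    by (intro sum.cong refl) (simp add: if_distrib[of "\<lambda>x. _ * x"] sum.delta' cong: if_cong)
  finally show ?thesis using finite_halves assms by simp
qed

text \<open>The transform of \<open>c\<close> at \<open>(D, v)\<close>, computed with a half \<open>g2\<close>, vanishes unless \<open>sd D g2\<close> has 3 elements.
  For \<open>D = sd a g\<close> with \<open>a \<noteq> g\<close>, which has 2 or 4 elements, some \<open>g2\<close> violates this condition.\<close>

lemma coeff_left: 
  assumes "g \<in> halves" "a \<in> halves" "b \<in> halves" "a \<noteq> g"
  shows "r a b g = 0"
proof -
  define D where "D = sd a g"
  note aD = halvesD[OF assms(2)] and gD = halvesD[OF assms(1)]
  have D: "D \<subseteq> R" "base \<notin> D" "D \<noteq> {}" "finite D"
    using aD gD assms(4) finite_subset_R by (auto simp: D_def sd_def)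
  \<comment> \<open>The size of D is 6 - 2 |a Int g|. It is positive as a and g differ, and less
    than 6 as both contain \<open>base\<close>.\<close>
  have "card D + 2 * card (a \<inter> g) = 6"
    using card_sd[of a g] aD gD by (simp add: D_def)
  moreover have "card D \<noteq> 0" using D by simp
  moreover have "card (a \<inter> g) \<noteq> 0" using aD gD by auto
  ultimately have card_D: "card D = 2 \<or> card D = 4" by presburger
  obtain g2 where g2: "g2 \<in> halves" "card (sd D g2) \<noteq> 3"
  proof (cases "card D = 2")
    case True
    \<comment> \<open>For |D| = 2, adjoining \<open>base\<close> to D gives a half at symmetric
      difference 1 from D.\<close>
    have "sd D (insert base D) = {base}" using D by (auto simp: sd_def)
    moreover have "insert base D \<in> halves" using D True base by (simp add: halves_def)
    ultimately show thesis using that[of "insert base D"] by simp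
  next
    case False
    then have 4: "card D = 4" using card_D by simp
    have "card (R - D) = 2" using card_Diff_subset[of D R] D card_R 4 by simp
    then have "R - D - {base} \<noteq> {}" using D base by (metis card.empty card_Diff_singleton_if finite.emptyI nat.simps(3) numeral_2_eq_2 One_nat_def diff_Suc_1 DiffI)
    then obtain x where x: "x \<in> R" "x \<notin> D" "x \<noteq> base" by blast
    obtain d where d: "d \<in> D" using D by blast
    \<comment> \<open>For |D| = 4, a half meeting D in a single point has symmetric difference 5
      with D.\<close>
    have h: "{base, x, d} \<in> halves" using x d D base by (auto simp: halves_def card_insert_if)
    have "sd D {base, x, d} = insert base (insert x (D - {d}))" using x d D by (auto simp: sd_def)
    then have "card (sd D {base, x, d}) = 5" using x d D 4 by (simp add: card_insert_if)
    then show thesis using that[OF h] by simp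
  qed
  have ne: "sd D g2 \<noteq> a'" "sd D g2 \<noteq> R - a'" if "a' \<in> halves" for a'
    using g2(2) halvesD[OF that] card_Diff_subset[of a' R] card_R by auto
  have sub: "sd D g2 \<subseteq> R" "sd (sd b g) g2 \<subseteq> R"
    by (intro sd_subset D(1) halvesD(1) g2 assms)+
  have "fourier D (sd b g) = fourier (sd (sd D g2) g2) (sd (sd (sd b g) g2) g2)"
    by (simp add: sd_simps)
  also have "\<dots> = 0"
    unfolding fourier_eq[OF g2(1) sub] using sum_chi_halves[OF _ sub(1)] ne by simp
  finally show ?thesis using fourier_halves[OF assms(1-3)] by (simp add: D_def)
qed

text \<open>Both sides are the transform at the pair of empty sets, which does not involve
  g.\<close>

lemma coeff_diagonal:
  assumes "g \<in> halves" "g' \<in> halves"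
  shows "r g g g = r g' g' g'"
  using fourier_halves[OF assms(1,1,1)] fourier_halves[OF assms(2,2,2)] by (simp add: sd_simps)

end

lemma fourier_diagonal:
  assumes expansion: "\<And>g S S'. g \<in> halves \<Longrightarrow> S \<in> evn \<Longrightarrow> S' \<in> evn \<Longrightarrow>
    (\<Sum>a\<in>halves. \<Sum>b\<in>halves. r a b g * (chi a S * chi b S')) = c S S' * chi g (sd S S')"
  obtains c0 where "\<And>a b g. a \<in> halves \<Longrightarrow> b \<in> halves \<Longrightarrow> g \<in> halves \<Longrightarrow> r a b g = (if a = g \<and> b = g then c0 else 0)"
proof -
  have left: "r a b g = 0" if "a \<in> halves" "b \<in> halves" "g \<in> halves" "a \<noteq> g" for a b g
    using coeff_left[of r c, OF expansion] that by blast
  \<comment> \<open>The hypothesis is symmetric under exchanging the first two indices and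
    transposing c, so vanishing off b = g follows from vanishing off a = g.\<close>
  have "(\<Sum>a\<in>halves. \<Sum>b\<in>halves. r b a g * (chi a S * chi b S')) = c S' S * chi g (sd S S')"
    if "g \<in> halves" "S \<in> evn" "S' \<in> evn" for g S S'
    using expansion[OF that(1,3,2)]
    by (subst sum.swap) (simp add: sd_commute[of S' S] mult.commute[of "chi _ S"])
  then have right: "r a b g = 0" if "a \<in> halves" "b \<in> halves" "g \<in> halves" "b \<noteq> g" for a b g
    using coeff_left[of "\<lambda>a b. r b a" "\<lambda>S S'. c S' S"] that by blast
  obtain g0 where g0: "g0 \<in> halves" using card_halves by fastforce
  have diag: "r g g g = r g0 g0 g0" if "g \<in> halves" for g
    using coeff_diagonal[of r c, OF expansion] that g0 by blast
  show thesis using that[of "r g0 g0 g0"] left right diag by (metis (full_types))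
qed

end

locale signed_nodes = six_set R base + apolar_basis "six_set.halves R base" S T
  for R :: "'a set" and base S T +
  fixes node :: "'a set \<Rightarrow> complex^4" and \<rho> :: "'a set \<Rightarrow> complex"
  assumes node_value: "a \<in> halves \<Longrightarrow> U \<in> evn \<Longrightarrow> quad (S a) (node U) = \<rho> U * chi a U"
    and rho_nonzero: "U \<in> evn \<Longrightarrow> \<rho> U \<noteq> 0"
begin

text \<open>Up to rho, the values of a form at the nodes are a combination of the characters
  \<open>chi a\<close>. Inversion over the 32 even subsets recovers its coefficients, so a quadratic
  form is determined by its values at the nodes.\<close>

lemma node_expansion:
  "quad M x = (\<Sum>a\<in>halves. quad (S a) x * (\<Sum>U\<in>evn. chi a U * (quad M (node U) / \<rho> U)) / 32)"
proof -
  define p where "p a = (\<Sum>i\<in>UNIV. \<Sum>j\<in>UNIV. M $ i $ j * T a $ i $ j) / 4" for a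
  have q: "quad M x = (\<Sum>a\<in>halves. p a * quad (S a) x)" for x
    unfolding p_def by (rule quad_expansion)
  have "(\<Sum>U\<in>evn. chi a U * (quad M (node U) / \<rho> U)) = 32 * p a" if a: "a \<in> halves" for a
  proof -
    have "quad M (node U) / \<rho> U = (\<Sum>b\<in>halves. p b * chi b U)" if "U \<in> evn" for U
    proof -
      have "quad M (node U) = \<rho> U * (\<Sum>b\<in>halves. p b * chi b U)"
        unfolding q sum_distrib_left using that by (intro sum.cong refl) (simp add: node_value)
      then show ?thesis using rho_nonzero[OF that] by simp
    qed
    then have "(\<Sum>U\<in>evn. chi a U * (quad M (node U) / \<rho> U)) = (\<Sum>U\<in>evn. \<Sum>b\<in>halves. p b * (chi a U * chi b U))"
      by (simp add: sum_distrib_left mult.left_commute)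
    also have "\<dots> = (\<Sum>b\<in>halves. p b * (\<Sum>U\<in>evn. chi a U * chi b U))"
      by (subst sum.swap) (simp add: sum_distrib_left)
    also have "\<dots> = (\<Sum>b\<in>halves. if a = b then p b * 32 else 0)"
      using a by (intro sum.cong refl) (simp add: sum_chi_halves_pair)
    finally show ?thesis using a finite_halves by simp
  qed
  then show ?thesis by (simp add: q mult.commute)
qed

theorem unique_222_form:
  fixes \<Psi> :: "complex^4 \<Rightarrow> complex^4 \<Rightarrow> complex^4 \<Rightarrow> complex"
  assumes x: "\<And>y z. \<exists>M. \<forall>x. \<Psi> x y z = quad M x" and y: "\<And>x z. \<exists>M. \<forall>y. \<Psi> x y z = quad M y"
    and nodes: "\<And>U V z. U \<in> evn \<Longrightarrow> V \<in> evn \<Longrightarrow>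
      \<Psi> (node U) (node V) z = c U V * (\<Sum>i\<in>UNIV. node (sd U V) $ i * z $ i)^2"
  obtains c0 where "\<And>x y z. \<Psi> x y z = c0 * (\<Sum>a\<in>halves. quad (S a) x * quad (S a) y * quad (T a) z)"
proof -
  \<comment> \<open>Fourier inversion in x and in y; 1024 is the product of the two factors
    32.\<close>
  define W where "W a b z = (\<Sum>U\<in>evn. \<Sum>V\<in>evn. chi a U * chi b V * (\<Psi> (node U) (node V) z / (\<rho> U * \<rho> V))) / 1024" for a b z
  have ex: "\<Psi> x y z = (\<Sum>a\<in>halves. quad (S a) x * (\<Sum>U\<in>evn. chi a U * (\<Psi> (node U) y z / \<rho> U)) / 32)" for x y z
  proof -
    obtain M where "\<forall>x. \<Psi> x y z = quad M x" using x by blast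
    then show ?thesis using node_expansion[of M x] by simp
  qed
  have ey: "\<Psi> x y z = (\<Sum>a\<in>halves. quad (S a) y * (\<Sum>U\<in>evn. chi a U * (\<Psi> x (node U) z / \<rho> U)) / 32)" for x y z
  proof -
    obtain M where "\<forall>y. \<Psi> x y z = quad M y" using y by blast
    then show ?thesis using node_expansion[of M y] by simp
  qed
  have exy: "\<Psi> x y z = (\<Sum>a\<in>halves. \<Sum>b\<in>halves. quad (S a) x * quad (S b) y * W a b z)" for x y z
  proof -
    have "(\<Sum>U\<in>evn. chi a U * (\<Psi> (node U) y z / \<rho> U)) / 32 = (\<Sum>b\<in>halves. quad (S b) y * W a b z)" for a
    proof -
      have "(\<Sum>U\<in>evn. chi a U * (\<Psi> (node U) y z / \<rho> U)) / 32 =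
        (\<Sum>U\<in>evn. \<Sum>b\<in>halves. quad (S b) y * (\<Sum>V\<in>evn. chi a U * chi b V * (\<Psi> (node U) (node V) z / (\<rho> U * \<rho> V))) / 1024)"
        unfolding sum_divide_distrib
      proof (intro sum.cong refl)
        fix U
        have "chi a U * (\<Psi> (node U) y z / \<rho> U) / 32 = (\<Sum>b\<in>halves. chi a U / \<rho> U / 32 * (quad (S b) y * (\<Sum>V\<in>evn. chi b V * (\<Psi> (node U) (node V) z / \<rho> V)) / 32))"
          unfolding sum_distrib_left[symmetric] ey[of "node U" y z, symmetric] by simp
        also have "\<dots> = (\<Sum>b\<in>halves. quad (S b) y * (\<Sum>V\<in>evn. chi a U * chi b V * (\<Psi> (node U) (node V) z / (\<rho> U * \<rho> V))) / 1024)"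
          by (simp add: sum_distrib_left sum_divide_distrib mult_ac)
        finally show "chi a U * (\<Psi> (node U) y z / \<rho> U) / 32 =
          (\<Sum>b\<in>halves. quad (S b) y * (\<Sum>V\<in>evn. chi a U * chi b V * (\<Psi> (node U) (node V) z / (\<rho> U * \<rho> V))) / 1024)" .
      qed
      also have "\<dots> = (\<Sum>b\<in>halves. \<Sum>U\<in>evn. quad (S b) y * (\<Sum>V\<in>evn. chi a U * chi b V * (\<Psi> (node U) (node V) z / (\<rho> U * \<rho> V))) / 1024)"
        by (rule sum.swap)
      finally show ?thesis by (simp add: W_def sum_distrib_left sum_divide_distrib)
    qed
    then show ?thesis
      unfolding ex[of x y z] times_divide_eq_right[symmetric] by (simp add: sum_distrib_left mult.assoc)
  qed
  \<comment> \<open>The coefficients of W in the basis \<open>quad (T g)\<close>, obtained by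
    expanding the square of the linear form at the node \<open>sd U V\<close>.\<close>
  define r where "r a b g = (\<Sum>U\<in>evn. \<Sum>V\<in>evn. chi a U * chi b V * (c U V * \<rho> (sd U V) / (\<rho> U * \<rho> V)) * chi g (sd U V)) / 1024" for a b g
  have sq: "(\<Sum>i\<in>UNIV. node U $ i * z $ i)^2 = (\<Sum>g\<in>halves. \<rho> U * chi g U * quad (T g) z)" if "U \<in> evn" for U z
    unfolding inner_square_expansion using that by (intro sum.cong refl) (simp add: node_value)
  have W: "W a b z = (\<Sum>g\<in>halves. r a b g * quad (T g) z)" for a b z
  proof -
    have "W a b z = (\<Sum>U\<in>evn. \<Sum>V\<in>evn. (\<Sum>g\<in>halves. chi a U * chi b V * (c U V * \<rho> (sd U V) / (\<rho> U * \<rho> V)) * chi g (sd U V) * quad (T g) z)) / 1024"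
    proof -
      have "chi a U * chi b V * (\<Psi> (node U) (node V) z / (\<rho> U * \<rho> V)) =
        (\<Sum>g\<in>halves. chi a U * chi b V * (c U V * \<rho> (sd U V) / (\<rho> U * \<rho> V)) * chi g (sd U V) * quad (T g) z)"
        if "U \<in> evn" "V \<in> evn" for U V
        unfolding nodes[OF that] sq[OF evn_sd[OF that]] by (simp add: sum_distrib_left sum_divide_distrib mult_ac)
      then show ?thesis by (simp add: W_def)
    qed
    also have "\<dots> = (\<Sum>g\<in>halves. \<Sum>U\<in>evn. \<Sum>V\<in>evn. chi a U * chi b V * (c U V * \<rho> (sd U V) / (\<rho> U * \<rho> V)) * chi g (sd U V) * quad (T g) z) / 1024"
      by (subst sum_swap3) (rule refl)
    finally show ?thesis unfolding r_def by (simp add: sum_distrib_right sum_divide_distrib)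
  qed
  have expansion: "(\<Sum>a\<in>halves. \<Sum>b\<in>halves. r a b g * (chi a U * chi b V)) = (c U V * \<rho> (sd U V) / (\<rho> U * \<rho> V)) * chi g (sd U V)"
    if g: "g \<in> halves" and UV: "U \<in> evn" "V \<in> evn" for g U V
  proof -
    \<comment> \<open>The coefficient of \<open>T g\<close> in the value at a pair of nodes is
      computed in two ways, from the expansion and from the hypothesis on nodes; independence of the
      dual basis makes the two agree.\<close>
    define e where "e g = (\<Sum>a\<in>halves. \<Sum>b\<in>halves. r a b g * (chi a U * chi b V)) * (\<rho> U * \<rho> V) - c U V * \<rho> (sd U V) * chi g (sd U V)" for g
    have "(\<Sum>g\<in>halves. e g * quad (T g) z) = 0" for z
    proof -
      have "\<Psi> (node U) (node V) z = (\<Sum>a\<in>halves. \<Sum>b\<in>halves. \<Sum>g\<in>halves. r a b g * (chi a U * chi b V) * (\<rho> U * \<rho> V) * quad (T g) z)"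
        unfolding exy[of "node U"] W using UV by (simp add: node_value sum_distrib_left mult_ac)
      also have "\<dots> = (\<Sum>g\<in>halves. \<Sum>a\<in>halves. \<Sum>b\<in>halves. r a b g * (chi a U * chi b V) * (\<rho> U * \<rho> V) * quad (T g) z)"
        by (rule sum_swap3)
      finally have 1: "\<Psi> (node U) (node V) z = (\<Sum>g\<in>halves. (\<Sum>a\<in>halves. \<Sum>b\<in>halves. r a b g * (chi a U * chi b V)) * (\<rho> U * \<rho> V) * quad (T g) z)"
        by (simp add: sum_distrib_right)
      have 2: "\<Psi> (node U) (node V) z = (\<Sum>g\<in>halves. c U V * \<rho> (sd U V) * chi g (sd U V) * quad (T g) z)"
        unfolding nodes[OF UV] sq[OF evn_sd[OF UV]] by (simp add: sum_distrib_left mult_ac)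
      show ?thesis unfolding e_def left_diff_distrib sum_subtractf using 1 2 by simp
    qed
    then have "e g = 0" using apolar_basis.independent[OF dual_basis _ g] by blast
    then show ?thesis using rho_nonzero UV by (simp add: e_def field_simps)
  qed
  obtain c0 where c0: "\<And>a b g. a \<in> halves \<Longrightarrow> b \<in> halves \<Longrightarrow> g \<in> halves \<Longrightarrow> r a b g = (if a = g \<and> b = g then c0 else 0)"
  proof (rule fourier_diagonal[OF expansion])
    fix c0
    assume *: "\<And>a b g. a \<in> halves \<Longrightarrow> b \<in> halves \<Longrightarrow> g \<in> halves \<Longrightarrow> r a b g = (if a = g \<and> b = g then c0 else 0)"
    show thesis by (rule that[of c0]) (rule *)
  qed
  have "W a b z = (if a = b then c0 * quad (T a) z else 0)" if "a \<in> halves" "b \<in> halves" for a b z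
  proof -
    have "W a b z = (\<Sum>g\<in>halves. if g = a then (if a = b then c0 * quad (T a) z else 0) else 0)"
      unfolding W using that by (intro sum.cong refl) (auto simp: c0)
    then show ?thesis using finite_halves that by simp
  qed
  then have "\<Psi> x y z = (\<Sum>a\<in>halves. \<Sum>b\<in>halves. if b = a then c0 * (quad (S a) x * quad (S a) y * quad (T a) z) else 0)" for x y z
    unfolding exy[of x] by (intro sum.cong refl) auto
  then have "\<Psi> x y z = c0 * (\<Sum>a\<in>halves. quad (S a) x * quad (S a) y * quad (T a) z)" for x y z
    using finite_halves by (simp add: sum_distrib_left)
  then show thesis using that by blast
qed

end

section \<open>The nodes of the Kummer surface\<close>

lemma monic_with_2: "p \<noteq> q \<Longrightarrow> monic_with {p, q} = [:- p, 1:] * [:- q, 1:]"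
  by (simp add: monic_with_def)

lemma monic_with_insert: "finite A \<Longrightarrow> a \<notin> A \<Longrightarrow> monic_with (insert a A) = [:- a, 1:] * monic_with A"
  by (simp add: monic_with_def)

lemma monic_with_3:
  "p \<noteq> q \<Longrightarrow> p \<noteq> r \<Longrightarrow> q \<noteq> r \<Longrightarrow> monic_with {p, q, r} = [:- p, 1:] * [:- q, 1:] * [:- r, 1:]"
  by (simp add: monic_with_def mult.assoc del: mult_pCons_left mult_pCons_right)

lemma poly_monic_with: "poly (monic_with A) x = (\<Prod>a\<in>A. x - a)"
  by (simp add: monic_with_def poly_prod)

lemma monic_with_card_2:
  assumes "card A = 2"
  obtains u0 u1 where "monic_with A = [:u0, u1, 1:]"
proof -
  obtain p q where "A = {p, q}" "p \<noteq> q" using assms by (auto simp: card_2_iff)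
  then have "monic_with A = [:p * q, - p - q, 1:]" by (simp add: monic_with_2)
  then show thesis by (rule that)
qed

lemma monic_with_card_3:
  assumes "card A = 3"
  obtains s0 s1 s2 where "monic_with A = [:s0, s1, s2, 1:]"
proof -
  obtain p q r where "A = {p, q, r}" "p \<noteq> q" "q \<noteq> r" "p \<noteq> r" using assms by (auto simp: card_3_iff)
  then have "monic_with A = [:- p, 1:] * [:- q, 1:] * [:- r, 1:]" by (simp only: monic_with_3 not_False_eq_True)
  also have "\<dots> = [:- p * q * r, p * q + p * r + q * r, - q - r - p, 1:]" by (simp add: algebra_simps)
  finally show thesis by (rule that)
qed

context genus2
begin

definition root0 :: complex where "root0 = (SOME t. t \<in> roots f)"

sublocale six_set "roots f" root0
proof
  show "card (roots f) = 6" by (rule card_roots[OF f])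
  then have "roots f \<noteq> {}" by auto
  then show "root0 \<in> roots f" unfolding root0_def by (simp add: some_in_eq)
qed

definition split_quadric :: "complex set \<Rightarrow> complex^4^4" where
  "split_quadric A = kummer_quadric (coeff f 6) (monic_with A) (monic_with (roots f - A))"

definition split_coquadric :: "complex set \<Rightarrow> complex^4^4" where
  "split_coquadric A = msmult (1 / (2 * bezout_det (monic_with A) (monic_with (roots f - A))))
     (kummer_coquadric (coeff f 6) (monic_with A) (monic_with (roots f - A)))"

lemma f_split:
  assumes "A \<subseteq> roots f"
  shows "f = smult (coeff f 6) (monic_with A * monic_with (roots f - A))"
proof -
  have "monic_with A * monic_with (roots f - A) = monic_with (roots f)"
    unfolding monic_with_def by (subst prod.subset_diff[OF assms finite_R]) (rule mult.commute)
  then show ?thesis using f_eq_prod_roots[OF f] by simp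
qed

lemma card_complement: "A \<subseteq> roots f \<Longrightarrow> card (roots f - A) = 6 - card A"
  using card_Diff_subset[of A "roots f"] finite_subset_R card_R by simp

lemma split_quadric_complement: "A \<subseteq> roots f \<Longrightarrow> split_quadric (roots f - A) = split_quadric A"
  unfolding split_quadric_def by (subst kummer_quadric_commute) (simp add: double_diff)

lemma bezout_nonzero:
  assumes "A \<subseteq> roots f" "card A = 3"
  shows "bezout_det (monic_with A) (monic_with (roots f - A)) \<noteq> 0"
proof -
  obtain a b c where A: "A = {a, b, c}" "a \<noteq> b" "b \<noteq> c" "a \<noteq> c" using assms by (auto simp: card_3_iff)
  have "card (roots f - A) = 3" using card_complement[OF assms(1)] assms(2) by simp
  then obtain s0 s1 s2 where s: "monic_with (roots f - A) = [:s0, s1, s2, 1:]" by (rule monic_with_card_3)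
  have r: "monic_with A = [:- a, 1:] * [:- b, 1:] * [:- c, 1:]"
    unfolding A(1) by (rule monic_with_3) (use A in auto)
  have "poly (monic_with (roots f - A)) t \<noteq> 0" if "t \<in> A" for t
    unfolding poly_monic_with using that finite_R by auto
  then show ?thesis unfolding bezout_det_eq[OF r s] s[symmetric] using A by simp
qed

lemma split_quadric_inverse:
  assumes "A \<subseteq> roots f" "card A = 3"
  shows "split_quadric A ** split_coquadric A = mat 1"
proof -
  have "split_quadric A ** split_coquadric A =
    msmult (1 / (2 * bezout_det (monic_with A) (monic_with (roots f - A)))) (mat (2 * bezout_det (monic_with A) (monic_with (roots f - A))))"
    unfolding split_quadric_def split_coquadric_def
    by (simp add: msmult_mult kummer_quadric_coquadric leading_coeff_nonzero[OF f])
  also have "\<dots> = mat 1"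
    using bezout_nonzero[OF assms] by (simp add: vec_eq_iff mat_def msmult_def)
  finally show ?thesis .
qed

lemma split_quadric_apolar:
  assumes "A \<subseteq> roots f" "B \<subseteq> roots f" "card A = 3" "card B = 3" "card (A \<inter> B) = 2"
  shows "(\<Sum>i\<in>UNIV. \<Sum>j\<in>UNIV. split_coquadric A $ i $ j * split_quadric B $ i $ j) = 0"
proof -
  \<comment> \<open>U is the pair common to A and B, W the pair outside both, and a, b below are the
    two roots that are exchanged.\<close>
  define U where "U = A \<inter> B"
  define W where "W = roots f - (A \<union> B)"
  have fin: "finite A" "finite B" using finite_subset_R assms by auto
  have "card (A \<union> B) = 4" using card_Un_Int[OF fin] assms by simp
  then have W: "card W = 2" "finite W" using card_complement[of "A \<union> B"] assms(1,2) finite_R by (auto simp: W_def)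
  have U: "card U = 2" "finite U" using assms fin by (auto simp: U_def)
  have "card (A - B) = 1" "card (B - A) = 1"
    using card_Int_Diff[of A B] card_Int_Diff[of B A] fin assms by (auto simp: Int_commute)
  then obtain a b where ab: "A - B = {a}" "B - A = {b}" by (auto simp: card_1_singleton_iff)
  have sets: "A = insert a U" "B = insert b U" "roots f - A = insert b W" "roots f - B = insert a W"
    "a \<notin> U" "b \<notin> U" "a \<notin> W" "b \<notin> W"
    using ab assms(1,2) by (auto simp: U_def W_def)
  obtain u0 u1 where u: "monic_with U = [:u0, u1, 1:]" using U(1) by (rule monic_with_card_2)
  obtain w0 w1 where w: "monic_with W = [:w0, w1, 1:]" using W(1) by (rule monic_with_card_2)
  have m: "monic_with A = [:u0, u1, 1:] * [:- a, 1:]" "monic_with (roots f - A) = [:w0, w1, 1:] * [:- b, 1:]"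
    "monic_with B = [:u0, u1, 1:] * [:- b, 1:]" "monic_with (roots f - B) = [:w0, w1, 1:] * [:- a, 1:]"
    unfolding sets(3,4) unfolding sets(1,2) by (simp_all only: monic_with_insert[OF U(2) sets(5)] monic_with_insert[OF U(2) sets(6)]
      monic_with_insert[OF W(2) sets(7)] monic_with_insert[OF W(2) sets(8)] u w mult.commute)
  show ?thesis
    unfolding split_coquadric_def split_quadric_def msmult_nth mult.assoc sum_distrib_left[symmetric]
      kummer_quadric_apolar[OF leading_coeff_nonzero[OF f] m] by (rule mult_zero_right)
qed

lemma split_apolar_basis: "apolar_basis halves split_quadric split_coquadric"
proof
  show "finite halves" "card halves = 10" by (fact finite_halves card_halves)+
  show symS: "transpose (split_quadric A) = split_quadric A" for A
    by (simp add: split_quadric_def symmetric_kummer_quadric)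
  show symT: "transpose (split_coquadric A) = split_coquadric A" for A
    by (simp add: split_coquadric_def transpose_msmult symmetric_kummer_coquadric)
  show "(\<Sum>i\<in>UNIV. \<Sum>j\<in>UNIV. split_coquadric A $ i $ j * split_quadric B $ i $ j) = (if A = B then 4 else 0)"
    if A: "A \<in> halves" and B: "B \<in> halves" for A B
  proof (cases "A = B")
    case True
    have "(\<Sum>j\<in>UNIV. split_coquadric A $ i $ j * split_quadric A $ i $ j) = 1" for i
    proof -
      have "(\<Sum>j\<in>UNIV. split_coquadric A $ i $ j * split_quadric A $ i $ j) =
        (\<Sum>j\<in>UNIV. split_quadric A $ i $ j * split_coquadric A $ j $ i)"
      proof (intro sum.cong refl)
        fix j
        have "split_coquadric A $ i $ j = split_coquadric A $ j $ i"
          using arg_cong[OF symT[of A], of "\<lambda>M. M $ i $ j"] by (simp add: transpose_def)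
        then show "split_coquadric A $ i $ j * split_quadric A $ i $ j = split_quadric A $ i $ j * split_coquadric A $ j $ i"
          by simp
      qed
      also have "\<dots> = (split_quadric A ** split_coquadric A) $ i $ i" by (simp add: matrix_matrix_mult_def)
      also have "\<dots> = 1" using split_quadric_inverse halvesD A by (simp add: mat_def)
      finally show ?thesis .
    qed
    then show ?thesis using True by simp
  next
    case False
    have fin: "finite A" "finite B" using halvesD A B by auto
    have "root0 \<in> A \<inter> B" using halvesD A B by auto
    then have ne0: "card (A \<inter> B) \<noteq> 0" using fin by auto
    have ne3: "card (A \<inter> B) \<noteq> 3"
      using False fin halvesD(3)[OF A] halvesD(3)[OF B]
        card_subset_eq[of A "A \<inter> B"] card_subset_eq[of B "A \<inter> B"] by auto
    have "card (A \<inter> B) \<le> 3" using card_mono[of A "A \<inter> B"] fin halvesD(3)[OF A] by simp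
    then consider "card (A \<inter> B) = 1" | "card (A \<inter> B) = 2" using ne0 ne3 by linarith
    then show ?thesis
    proof cases
      case 1
      \<comment> \<open>Halves with one common root: the quadric of B is also that of its
        complement, which shares two roots with A.\<close>
      have "A \<inter> (roots f - B) = A - B" using halvesD(1)[OF A] by auto
      then have "card (A \<inter> (roots f - B)) = 2"
        using 1 card_Int_Diff[of A B] fin halvesD(3)[OF A] by simp
      moreover have "card (roots f - B) = 3" using card_complement halvesD B by simp
      ultimately show ?thesis
        using split_quadric_apolar[of A "roots f - B"] halvesD[OF A] halvesD[OF B] False
        by (simp add: split_quadric_complement)
    next
      case 2
      then show ?thesis using split_quadric_apolar[of A B] halvesD[OF A] halvesD[OF B] False by simp
    qed
  qed
qed

text \<open>What the two node computations have in common: it depends on the pair of roots but not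
  on the partition, so that only a sign, the character, distinguishes the quadrics at a
  node.\<close>

definition pair_factor :: "complex set \<Rightarrow> complex" where
  "pair_factor U = (coeff f 6)^2 * (\<Prod>t\<in>U. poly (monic_with (roots f - U)) t)"

lemma pair_value:
  assumes "A \<subseteq> roots f" "card A = 3" "p \<in> A" "q \<in> roots f" "p \<noteq> q"
  shows "quad (split_quadric A) (kummer_vec f (Aff p 0) (Aff q 0)) = - pair_factor {p, q} * chi A {p, q}"
proof (cases "q \<in> A")
  case True
  define V where "V = roots f - {p, q}"
  have "card (A - {p, q}) = 1" using card_Diff_subset[of "{p, q}" A] assms True by simp
  then obtain a where a: "A - {p, q} = {a}" by (auto simp: card_1_singleton_iff)
  then have A: "A = {p, q, a}" "a \<noteq> p" "a \<noteq> q" using True assms by auto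
  have cB: "card (roots f - A) = 3" using card_complement assms by simp
  obtain s0 s1 s2 where s: "monic_with (roots f - A) = [:s0, s1, s2, 1:]" using cB by (rule monic_with_card_3)
  have r: "monic_with A = [:- p, 1:] * [:- q, 1:] * [:- a, 1:]"
    unfolding A(1) by (rule monic_with_3) (use A assms in auto)
  have "V = insert a (roots f - A)" using A assms by (auto simp: V_def)
  then have "poly (monic_with V) t = (t - a) * poly (monic_with (roots f - A)) t" for t
    using A finite_R by (simp add: monic_with_insert algebra_simps)
  moreover have "chi A {p, q} = 1" using A assms by (simp add: chi_def)
  ultimately show ?thesis
    using node_value_same[of f "coeff f 6" p q a s0 s1 s2] f_split[OF assms(1)] assms(5) leading_coeff_nonzero[OF f]
    unfolding split_quadric_def pair_factor_def r s V_def[symmetric]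
    by (simp only: prod.insert finite.intros) (simp add: mult_ac)
next
  case False
  define V where "V = roots f - {p, q}"
  define U where "U = A - {p}"
  define W where "W = roots f - A - {q}"
  have U: "card U = 2" "finite U" "A = insert p U" "p \<notin> U"
    using assms finite_subset_R by (auto simp: U_def)
  have cB: "card (roots f - A) = 3" using card_complement assms by simp
  have W: "card W = 2" "finite W" "roots f - A = insert q W" "q \<notin> W"
    using assms finite_R False cB by (auto simp: W_def)
  obtain u0 u1 where u: "monic_with U = [:u0, u1, 1:]" using U(1) by (rule monic_with_card_2)
  obtain w0 w1 where w: "monic_with W = [:w0, w1, 1:]" using W(1) by (rule monic_with_card_2)
  have m: "monic_with A = [:- p, 1:] * [:u0, u1, 1:]" "monic_with (roots f - A) = [:- q, 1:] * [:w0, w1, 1:]"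
    unfolding W(3) using U(3) monic_with_insert[OF U(2,4)] monic_with_insert[OF W(2,4)] by (simp_all only: u w)
  have "V = U \<union> W" "U \<inter> W = {}" using assms False by (auto simp: V_def U_def W_def)
  then have "poly (monic_with V) t = poly (monic_with U) t * poly (monic_with W) t" for t
    using U W by (simp add: poly_monic_with prod.union_disjoint)
  moreover have "chi A {p, q} = -1" using False assms by (simp add: chi_def)
  ultimately show ?thesis
    using node_value_diff[of f "coeff f 6" p u0 u1 q w0 w1] f_split[OF assms(1)] assms(5) leading_coeff_nonzero[OF f]
    unfolding split_quadric_def pair_factor_def m V_def[symmetric] u w
    by (simp only: prod.insert finite.intros) (simp add: mult_ac)
qed

definition pair_node :: "complex set \<Rightarrow> complex^4" where
  "pair_node U = (let p = (SOME p. p \<in> U); q = (SOME q. q \<in> U - {p}) in kummer_vec f (Aff p 0) (Aff q 0))"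

lemma pair_node:
  assumes "card U = 2"
  obtains p q where "U = {p, q}" "p \<noteq> q" "pair_node U = kummer_vec f (Aff p 0) (Aff q 0)"
proof -
  define p where "p = (SOME p. p \<in> U)"
  define q where "q = (SOME q. q \<in> U - {p})"
  have fin: "finite U" using assms by (metis card.infinite zero_neq_numeral)
  have p: "p \<in> U" unfolding p_def some_in_eq using assms by auto
  have c: "card (U - {p}) = 1" using p assms fin by simp
  then have "U - {p} \<noteq> {}" by (metis card.empty zero_neq_one)
  then have q: "q \<in> U - {p}" unfolding q_def some_in_eq .
  have "{p, q} = U" by (rule card_subset_eq) (use fin p q assms in auto)
  moreover have "p \<noteq> q" using q by auto
  moreover have "pair_node U = kummer_vec f (Aff p 0) (Aff q 0)" by (simp only: pair_node_def Let_def p_def q_def)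
  ultimately show thesis using that by blast
qed

lemma pair_node_value:
  assumes "A \<in> halves" "U \<subseteq> roots f" "card U = 2"
  shows "quad (split_quadric A) (pair_node U) = - pair_factor U * chi A U"
proof -
  obtain p q where pq: "U = {p, q}" "p \<noteq> q" "pair_node U = kummer_vec f (Aff p 0) (Aff q 0)"
    using assms(3) by (rule pair_node)
  note A = halvesD[OF assms(1)]
  show ?thesis
  proof (cases "p \<in> A")
    case True
    then show ?thesis using pair_value[of A p q] A pq assms by simp
  next
    case False
    \<comment> \<open>U has an even number of elements, so passing to the complement of A changes
      neither the character nor the quadric.\<close>
    have "chi (roots f - A) U = chi A U" using False assms pq by (auto simp: chi_def card_insert_if Int_insert_left)
    then show ?thesis using pair_value[of "roots f - A" p q] A pq assms False
      by (simp add: split_quadric_complement card_complement)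
  qed
qed

text \<open>A subset and its complement represent the same point; the empty set and the full set
  both give the image of the identity.\<close>

definition node :: "complex set \<Rightarrow> complex^4" where
  "node U = (if card U = 2 then pair_node U else if card U = 4 then pair_node (roots f - U) else vector [0, 0, 0, 1])"

text \<open>As A has three elements, \<open>chi A\<close> changes sign when U is replaced by its
  complement, while the node stays the same. The opposite signs here compensate for this.\<close>

definition node_factor :: "complex set \<Rightarrow> complex" where
  "node_factor U = (if card U = 0 then 1 else if card U = 2 then - pair_factor U
     else if card U = 4 then pair_factor (roots f - U) else -1)"

lemma evn_cases:
  assumes "U \<in> evn"
  obtains "U = {}" | "card U = 2" "U \<subseteq> roots f" | "card U = 4" "U \<subseteq> roots f" "card (roots f - U) = 2" | "U = roots f"
proof -
  have U: "U \<subseteq> roots f" "even (card U)" "finite U" using assms finite_subset_R by (auto simp: evn_def)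
  have "card U \<le> 6" using card_mono[OF finite_R U(1)] card_R by simp
  then have "card U = 0 \<or> card U = 2 \<or> card U = 4 \<or> card U = 6" using U(2) by presburger
  then show thesis
  proof (elim disjE)
    assume "card U = 0"
    then show thesis using that(1) U(3) by simp
  next
    assume "card U = 2"
    then show thesis using that(2) U(1) by simp
  next
    assume "card U = 4"
    then show thesis using that(3) U(1) card_complement[OF U(1)] by simp
  next
    assume "card U = 6"
    then show thesis using that(4) card_subset_eq[OF finite_R U(1)] card_R by simp
  qed
qed

lemma quad_e4: "quad (split_quadric A) (vector [0, 0, 0, 1]) = 1"
  unfolding split_quadric_def quad_4[OF symmetric_kummer_quadric]
  by (simp add: kummer_quadric_def quadric_mat_def Let_def)

lemma pair_factor_nonzero: "U \<subseteq> roots f \<Longrightarrow> pair_factor U \<noteq> 0"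
  using leading_coeff_nonzero[OF f] finite_R finite_subset_R
  by (auto simp: pair_factor_def poly_monic_with)

sublocale signed_nodes "roots f" root0 split_quadric split_coquadric node node_factor
proof -
  interpret B: apolar_basis halves split_quadric split_coquadric by (rule split_apolar_basis)
  show "signed_nodes (roots f) root0 split_quadric split_coquadric node node_factor"
  proof
    fix A U assume A: "A \<in> halves" and U: "U \<in> evn"
    have cR: "chi A (roots f) = -1" using halvesD[OF A] by (simp add: chi_def Int_absorb1)
    show "quad (split_quadric A) (node U) = node_factor U * chi A U"
      using U
    proof (cases rule: evn_cases)
      case 1
      then show ?thesis by (simp add: node_def node_factor_def quad_e4)
    next
      case 2
      then show ?thesis using pair_node_value[OF A] by (simp add: node_def node_factor_def)
    next
      case 3
      have "sd (roots f) (roots f - U) = U" using 3 by (auto simp: sd_def)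
      then have "chi A U = - chi A (roots f - U)"
        using chi_sd[of "roots f" "roots f - U" A] finite_R cR by simp
      then show ?thesis using 3 pair_node_value[OF A, of "roots f - U"] by (simp add: node_def node_factor_def)
    next
      case 4
      then show ?thesis using card_R by (simp add: node_def node_factor_def quad_e4 cR)
    qed
  next
    show "node_factor U \<noteq> 0" if "U \<in> evn" for U
      using that pair_factor_nonzero[of U] pair_factor_nonzero[of "roots f - U"] by (auto simp: node_factor_def evn_def)
  qed
qed

section \<open>Divisor classes of order two and their images on the Kummer surface\<close>

definition wdiv :: "complex set \<Rightarrow> divisor" where
  "wdiv U = (\<Sum>t\<in>U. frag_of (Aff t 0)) - frag_cmul (int (card U) div 2) (canonical_div f)"

lemma wdiv_empty: "wdiv {} = 0"
  by (simp add: wdiv_def)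

lemma wdiv_roots: "wdiv (roots f) \<in> principal_divs f"
  using principal_all_weierstrass[OF f] by (simp add: wdiv_def card_R)

text \<open>The points of the intersection of U and V are counted twice, and each doubled
  Weierstrass point is equivalent to the canonical divisor.\<close>

lemma wdiv_sd:
  assumes "U \<in> evn" "V \<in> evn"
  shows "wdiv U + wdiv V - wdiv (sd U V) \<in> principal_divs f"
proof -
  have fin: "finite U" "finite V" using evn_finite assms by auto
  define n where "n = card (U \<inter> V)"
  have n: "card (sd U V) + 2 * n = card U + card V" unfolding n_def by (rule card_sd[OF fin])
  have "even (card (sd U V))" "even (card U)" "even (card V)" using evn_sd[OF assms] assms by (auto simp: evn_def)
  then obtain u v w where "card (sd U V) = 2 * w" "card U = 2 * u" "card V = 2 * v" by (elim evenE)
  then have c: "int (card U) div 2 + int (card V) div 2 - int (card (sd U V)) div 2 = int n" using n by simp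
  define g where "g t = frag_of (Aff t 0)" for t
  have s: "sum g U + sum g V - sum g (sd U V) = frag_cmul 2 (sum g (U \<inter> V))"
  proof -
    have "sum g (sd U V) = sum g (U - V) + sum g (V - U)"
      unfolding sd_def by (rule sum.union_disjoint) (use fin in auto)
    moreover have "sum g U = sum g (U \<inter> V) + sum g (U - V)" using fin sum.Int_Diff[of U g V] by simp
    moreover have "sum g V = sum g (U \<inter> V) + sum g (V - U)" using fin sum.Int_Diff[of V g U] by (simp add: Int_commute)
    moreover have "frag_cmul 2 (sum g (U \<inter> V)) = sum g (U \<inter> V) + sum g (U \<inter> V)"
      using frag_cmul_distrib[of 1 1 "sum g (U \<inter> V)"] by simp
    ultimately show ?thesis by simp
  qed
  have "wdiv U + wdiv V - wdiv (sd U V) = frag_cmul 2 (sum g (U \<inter> V)) - frag_cmul (int n) (canonical_div f)"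
    unfolding wdiv_def g_def[symmetric] s[symmetric] c[symmetric]
    by (simp add: frag_cmul_distrib frag_cmul_diff_distrib algebra_simps)
  also have "\<dots> = (\<Sum>t\<in>U \<inter> V. frag_cmul 2 (g t) - canonical_div f)"
  proof -
    have "(\<Sum>t\<in>I. a) = frag_cmul (int (card I)) a" if "finite I" for I :: "complex set" and a :: divisor
      using that by (induction I) (auto simp: frag_cmul_distrib)
    then have "(\<Sum>t\<in>U \<inter> V. canonical_div f) = frag_cmul (int n) (canonical_div f)" using fin by (simp add: n_def)
    then show ?thesis by (simp only: sum_subtractf frag_cmul_sum)
  qed
  also have "\<dots> \<in> principal_divs f"
  proof (rule principal_divs_sum[OF f])
    fix t assume "t \<in> U \<inter> V"
    then have "t \<in> roots f" using assms by (auto simp: evn_def)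
    then show "frag_cmul 2 (g t) - canonical_div f \<in> principal_divs f"
      unfolding g_def by (intro principal_double_weierstrass[OF f]) (simp add: roots_def)
  qed
  finally show ?thesis .
qed

lemma wdiv_double: "U \<in> evn \<Longrightarrow> wdiv U + wdiv U \<in> principal_divs f"
  using wdiv_sd[of U U] by (simp add: sd_simps wdiv_empty)

lemma wdiv_complement:
  assumes "U \<in> evn"
  shows "cl (wdiv U) = cl (wdiv (roots f - U))"
proof -
  have V: "roots f - U \<in> evn" using assms card_complement[of U] card_mono[of "roots f" U] finite_R card_R by (auto simp: evn_def)
  have "sd U (roots f - U) = roots f" using assms by (auto simp: sd_def evn_def)
  then have 1: "wdiv U + wdiv (roots f - U) - wdiv (roots f) \<in> principal_divs f" using wdiv_sd[OF assms V] by simp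
  have "wdiv U - wdiv (roots f - U) = (wdiv U + wdiv (roots f - U) - wdiv (roots f)) + wdiv (roots f)
    - (wdiv (roots f - U) + wdiv (roots f - U))" by simp
  also have "\<dots> \<in> principal_divs f"
    by (intro principal_divs_diff[OF f] principal_divs_add[OF f] 1 wdiv_roots wdiv_double V)
  finally show ?thesis by (simp only: jac_class_eq_iff)
qed

lemma kummer_rep_pair:
  assumes "U \<subseteq> roots f" "card U = 2"
  shows "kummer_rep f (cl (wdiv U)) (pair_node U)"
proof -
  obtain p q where pq: "U = {p, q}" "p \<noteq> q" "pair_node U = kummer_vec f (Aff p 0) (Aff q 0)"
    using assms(2) by (rule pair_node)
  have "Aff p 0 \<in> curve_pts f UNIV" "Aff q 0 \<in> curve_pts f UNIV" using assms pq by (auto simp: curve_pts_def roots_def)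
  moreover have "wdiv U = frag_of (Aff p 0) + frag_of (Aff q 0) - canonical_div f"
    using assms pq by (simp add: wdiv_def)
  moreover have "pair_node U = 1 *s kummer_vec f (Aff p 0) (Aff q 0)" using pq by simp
  ultimately show ?thesis unfolding kummer_rep_def by (metis zero_neq_one)
qed

text \<open>The two points at infinity add up to the chosen canonical divisor; for them
  \<open>kummer_vec\<close> takes its last case.\<close>

lemma kummer_rep_identity: "kummer_rep f (cl 0) (vector [0, 0, 0, 1])"
proof -
  let ?p = "Inf (csqrt (coeff f 6))" and ?q = "Inf (- csqrt (coeff f 6))"
  have ne: "?p \<noteq> ?q" using csqrt_leading[OF f] by simp
  have "?p \<in> curve_pts f UNIV" "?q \<in> curve_pts f UNIV" by (auto simp: curve_pts_def)
  moreover have "cl 0 = cl (frag_of ?p + frag_of ?q - canonical_div f)" by (simp add: canonical_div_def)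
  moreover have "vector [0, 0, 0, 1] = 1 *s kummer_vec f ?p ?q" using ne by (simp add: kummer_vec_def Let_def P2_def)
  ultimately show ?thesis unfolding kummer_rep_def by (metis zero_neq_one)
qed

lemma kummer_rep_node:
  assumes "U \<in> evn"
  shows "kummer_rep f (cl (wdiv U)) (node U)"
  using assms
proof (cases rule: evn_cases)
  case 1
  then show ?thesis using kummer_rep_identity by (simp add: node_def wdiv_empty)
next
  case 2
  then show ?thesis using kummer_rep_pair by (simp add: node_def)
next
  case 3
  then show ?thesis using kummer_rep_pair[of "roots f - U"] wdiv_complement[OF assms] by (simp add: node_def)
next
  case 4
  then have "cl (wdiv U) = cl 0" using wdiv_complement[OF assms] by (simp add: wdiv_empty)
  then show ?thesis using 4 kummer_rep_identity card_R by (simp add: node_def)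
qed

end

section \<open>Linear algebra and quadratic forms\<close>

text \<open>Being polynomial along lines replaces being polynomial: it suffices for the density argument that
  removes the conditions \<open>x $ 4 \<noteq> 0\<close>.\<close>

definition line_poly :: "(complex^'n \<Rightarrow> complex) \<Rightarrow> bool" where
  "line_poly F \<longleftrightarrow> (\<forall>x v. \<exists>p. \<forall>t. F (x + t *s v) = poly p t)"

lemma line_poly_const: "line_poly (\<lambda>x. c)"
  unfolding line_poly_def by (intro allI exI[of _ "[:c:]"]) simp

lemma line_poly_coord: "line_poly (\<lambda>x. x $ i)"
  unfolding line_poly_def
proof (intro allI)
  fix x v :: "complex^'a"
  show "\<exists>p. \<forall>t. (x + t *s v) $ i = poly p t"
    by (intro exI[of _ "[:x $ i, v $ i:]"]) (simp add: algebra_simps)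
qed

lemma line_poly_add: "line_poly F \<Longrightarrow> line_poly G \<Longrightarrow> line_poly (\<lambda>x. F x + G x)"
  unfolding line_poly_def by (metis poly_add)

lemma line_poly_mult: "line_poly F \<Longrightarrow> line_poly G \<Longrightarrow> line_poly (\<lambda>x. F x * G x)"
  unfolding line_poly_def by (metis poly_mult)

lemma line_poly_sum: "(\<And>i. i \<in> I \<Longrightarrow> line_poly (F i)) \<Longrightarrow> line_poly (\<lambda>x. \<Sum>i\<in>I. F i x)"
  by (induction I rule: infinite_finite_induct) (auto intro: line_poly_const line_poly_add)

lemma line_poly_quad: "line_poly (quad M)"
proof -
  have "line_poly (\<lambda>x. \<Sum>i\<in>UNIV. \<Sum>j\<in>UNIV. M $ i $ j / 2 * x $ i * x $ j)"
    by (intro line_poly_sum line_poly_mult line_poly_const line_poly_coord)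
  moreover have "(\<lambda>x. \<Sum>i\<in>UNIV. \<Sum>j\<in>UNIV. M $ i $ j / 2 * x $ i * x $ j) = quad M"
    by (simp add: fun_eq_iff quad_def sum_divide_distrib)
  ultimately show ?thesis by simp
qed

text \<open>On the line through a point where F does not vanish and one where G does not vanish, the
  two restrictions would be nonzero polynomials in one variable with product zero.\<close>

lemma line_poly_product_zero:
  assumes "line_poly F" "line_poly G" "\<And>x. F x * G x = 0"
  shows "(\<forall>x. F x = 0) \<or> (\<forall>x. G x = 0)"
proof (rule ccontr)
  assume "\<not> ?thesis"
  then obtain a b where ab: "F a \<noteq> 0" "G b \<noteq> 0" by blast
  obtain p where p: "\<And>t. F (a + t *s (b - a)) = poly p t" using assms(1) unfolding line_poly_def by blast
  obtain q where q: "\<And>t. G (a + t *s (b - a)) = poly q t" using assms(2) unfolding line_poly_def by blast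
  have "poly (p * q) t = 0" for t using assms(3) by (simp flip: p q)
  then have "p * q = 0" by (simp add: poly_all_0_iff_0[symmetric])
  moreover have "poly p 0 \<noteq> 0" "poly q 1 \<noteq> 0" using ab by (simp_all flip: p q)
  ultimately show False by auto
qed

text \<open>The difference of squares factors as (S + g M)(S - g M) with g^2 = beta / alpha.
  Multiplied by l1 l2 it vanishes everywhere, so one of the two factors is zero.\<close>

lemma proportional_quads:
  fixes S :: "complex^'n^'n"
  assumes eq: "\<And>x. l1 x \<noteq> 0 \<Longrightarrow> l2 x \<noteq> 0 \<Longrightarrow> \<alpha> * (quad S x)^2 = \<beta> * (quad M x)^2"
    and l: "line_poly l1" "line_poly l2" "l1 x1 \<noteq> 0" "l2 x2 \<noteq> 0" and "\<alpha> \<noteq> 0"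
  obtains a where "a^2 = \<beta> / \<alpha>" "\<And>x. quad S x = a * quad M x"
proof -
  define g where "g = csqrt (\<beta> / \<alpha>)"
  have g: "g^2 = \<beta> / \<alpha>" by (simp add: g_def)
  define u where "u x = quad S x + g * quad M x" for x
  define v where "v x = quad S x + (- g) * quad M x" for x
  have lp: "line_poly u" "line_poly v" "line_poly (\<lambda>x. l1 x * l2 x)" "line_poly (\<lambda>x. u x * v x)"
    unfolding u_def v_def by (intro line_poly_add line_poly_mult line_poly_const line_poly_quad l)+
  have "u x * v x * (l1 x * l2 x) = 0" for x
  proof (cases "l1 x = 0 \<or> l2 x = 0")
    case False
    then have "(quad S x)^2 = g^2 * (quad M x)^2" using eq[of x] assms(6) by (simp add: g field_simps)
    then have "u x * v x = 0" by (simp add: u_def v_def algebra_simps power2_eq_square)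
    then show ?thesis by simp
  qed auto
  then have "(\<forall>x. u x * v x = 0) \<or> (\<forall>x. l1 x * l2 x = 0)"
    using line_poly_product_zero[OF lp(4,3)] by blast
  moreover have "\<not> (\<forall>x. l1 x * l2 x = 0)"
    using line_poly_product_zero[OF l(1,2)] l(3,4) by blast
  ultimately have "(\<forall>x. u x = 0) \<or> (\<forall>x. v x = 0)" using line_poly_product_zero[OF lp(1,2)] by blast
  then show thesis
  proof
    assume "\<forall>x. u x = 0"
    then show thesis using that[of "- g"] g by (simp add: u_def eq_neg_iff_add_eq_0)
  next
    assume "\<forall>x. v x = 0"
    then show thesis using that[of g] g by (simp add: v_def)
  qed
qed

definition is_quad :: "(complex^'n \<Rightarrow> complex) \<Rightarrow> bool" where
  "is_quad F \<longleftrightarrow> (\<exists>M. \<forall>x. F x = quad M x)"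

lemma is_quad_scale: "is_quad F \<Longrightarrow> is_quad (\<lambda>x. c * F x)"
  unfolding is_quad_def by (metis quad_msmult)

lemma is_quad_scale': "is_quad F \<Longrightarrow> is_quad (\<lambda>x. F x * c)"
  using is_quad_scale[of F c] by (simp add: mult.commute)

lemma is_quad_add:
  fixes F G :: "complex^'n \<Rightarrow> complex"
  shows "is_quad F \<Longrightarrow> is_quad G \<Longrightarrow> is_quad (\<lambda>x. F x + G x)"
proof -
  have "quad A x + quad B x = quad (A + B) x" for A B and x :: "complex^'n"
    by (simp add: quad_def distrib_right sum.distrib add_divide_distrib)
  then show "is_quad F \<Longrightarrow> is_quad G \<Longrightarrow> ?thesis" unfolding is_quad_def by metis
qed

lemma is_quad_sum:
  fixes F :: "'i \<Rightarrow> complex^'n \<Rightarrow> complex"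
  shows "(\<And>i. i \<in> I \<Longrightarrow> is_quad (F i)) \<Longrightarrow> is_quad (\<lambda>x. \<Sum>i\<in>I. F i x)"
proof (induction I rule: infinite_finite_induct)
  have "is_quad (\<lambda>x :: complex^'n. 0)"
    unfolding is_quad_def by (intro exI[of _ 0]) (simp add: quad_def)
  then show "is_quad (\<lambda>x :: complex^'n. \<Sum>i\<in>{}. F i x)" "infinite A \<Longrightarrow> is_quad (\<lambda>x :: complex^'n. \<Sum>i\<in>A. F i x)" for A
    by simp_all
qed (auto intro: is_quad_add)

lemma is_quad_monomial: "is_quad (\<lambda>x. x $ a * x $ b)"
proof -
  have "x $ a * x $ b = quad (\<chi> i j. if i = a then if j = b then 2 else 0 else 0) x" for x
  proof -
    have "(\<Sum>j\<in>UNIV. (if i = a then if j = b then 2 else 0 else 0) * x $ i * x $ j) = (if i = a then 2 * x $ a * x $ b else 0)" for i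
      by (simp add: if_distrib[of "\<lambda>c. c * _"] sum.delta cong: if_cong)
    then show ?thesis by (simp add: quad_def)
  qed
  then show ?thesis unfolding is_quad_def by blast
qed

lemma is_quad_substitute: "is_quad F \<Longrightarrow> is_quad (\<lambda>x. F (A *v x))"
  unfolding is_quad_def by (metis quad_substitute)

lemma form22_is_quad:
  assumes "form22_over K B"
  shows "is_quad (\<lambda>x. B x y)" "is_quad (\<lambda>y. B x y)"
proof -
  obtain C where C: "\<And>x y. B x y = (\<Sum>a\<in>UNIV. \<Sum>b\<in>UNIV. \<Sum>c\<in>UNIV. \<Sum>d\<in>UNIV. C a b c d * x$a * x$b * y$c * y$d)"
    using assms unfolding form22_over_def by blast
  have "is_quad (\<lambda>x. \<Sum>a\<in>UNIV. \<Sum>b\<in>UNIV. \<Sum>c\<in>UNIV. \<Sum>d\<in>UNIV. C a b c d * y$c * y$d * (x$a * x$b))"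
    by (intro is_quad_sum is_quad_scale is_quad_monomial)
  then show "is_quad (\<lambda>x. B x y)" unfolding C by (simp only: mult_ac)
  have "is_quad (\<lambda>y. \<Sum>a\<in>UNIV. \<Sum>b\<in>UNIV. \<Sum>c\<in>UNIV. \<Sum>d\<in>UNIV. C a b c d * x$a * x$b * (y$c * y$d))"
    by (intro is_quad_sum is_quad_scale is_quad_monomial)
  then show "is_quad (\<lambda>y. B x y)" unfolding C by (simp only: mult.assoc)
qed

text \<open>The pairing is the trace of T S, which is invariant under conjugation; the scalars
  cancel on the diagonal and are irrelevant off it.\<close>

lemma (in apolar_basis) substituted_basis:
  assumes J: "bij_betw g I J" and psi: "\<psi>' ** \<psi> = mat 1"
    and S': "\<And>i. i \<in> I \<Longrightarrow> S' (g i) = msmult (c i) (transpose \<psi> ** S i ** \<psi>)"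
    and T': "\<And>i. i \<in> I \<Longrightarrow> T' (g i) = msmult (1 / c i) (\<psi>' ** T i ** transpose \<psi>')"
    and c: "\<And>i. i \<in> I \<Longrightarrow> c i \<noteq> 0"
  shows "apolar_basis J S' T'"
proof
  show "finite J" "card J = 10" using J finite_I card_I bij_betw_finite bij_betw_same_card by metis+
  show "transpose (S' a) = S' a" if "a \<in> J" for a
    using that J by (auto simp: bij_betw_def S' transpose_msmult matrix_transpose_mul sym_S matrix_mul_assoc)
  show "transpose (T' a) = T' a" if "a \<in> J" for a
    using that J by (auto simp: bij_betw_def T' transpose_msmult matrix_transpose_mul sym_T matrix_mul_assoc)
  have tr: "(\<Sum>i\<in>UNIV. \<Sum>j\<in>UNIV. A $ i $ j * B $ i $ j) = trace (transpose A ** B)" for A B :: "complex^4^4"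
    by (simp add: trace_def matrix_matrix_mult_def transpose_def) (rule sum.swap)
  show "(\<Sum>i\<in>UNIV. \<Sum>j\<in>UNIV. T' a $ i $ j * S' b $ i $ j) = (if a = b then 4 else 0)" if ab: "a \<in> J" "b \<in> J" for a b
  proof -
    obtain i j where ij: "i \<in> I" "j \<in> I" "a = g i" "b = g j" using ab J by (auto simp: bij_betw_def)
    have psi2: "\<psi> ** \<psi>' = mat 1" using psi by (simp add: matrix_left_right_inverse)
    have t: "transpose \<psi>' ** transpose \<psi> = mat 1"
      using arg_cong[OF psi2, of transpose] by (simp add: matrix_transpose_mul transpose_mat)
    have "(\<Sum>i\<in>UNIV. \<Sum>j\<in>UNIV. T' a $ i $ j * S' b $ i $ j) =
      trace (msmult (1 / c i) (\<psi>' ** T i ** transpose \<psi>') ** msmult (c j) (transpose \<psi> ** S j ** \<psi>))"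
      unfolding tr ij(3,4) T'[OF ij(1)] S'[OF ij(2)]
      by (simp add: transpose_msmult matrix_transpose_mul sym_T[OF ij(1)] matrix_mul_assoc)
    also have "(\<psi>' ** T i ** transpose \<psi>') ** (transpose \<psi> ** S j ** \<psi>) = \<psi>' ** T i ** (transpose \<psi>' ** transpose \<psi>) ** S j ** \<psi>"
      by (simp only: matrix_mul_assoc)
    then have "msmult (1 / c i) (\<psi>' ** T i ** transpose \<psi>') ** msmult (c j) (transpose \<psi> ** S j ** \<psi>) =
      msmult (c j / c i) (\<psi>' ** (T i ** S j) ** \<psi>)"
      by (simp only: msmult_mult msmult_msmult t matrix_mul_rid matrix_mul_assoc) simp
    also have "trace (msmult (c j / c i) (\<psi>' ** (T i ** S j) ** \<psi>)) = c j / c i * trace (T i ** S j)"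
    proof -
      have "trace (\<psi>' ** (T i ** S j) ** \<psi>) = trace (\<psi> ** (\<psi>' ** (T i ** S j)))" by (rule trace_mul_sym)
      also have "\<psi> ** (\<psi>' ** (T i ** S j)) = T i ** S j" by (simp add: matrix_mul_assoc psi2)
      finally show ?thesis by (simp add: trace_msmult)
    qed
    also have "trace (T i ** S j) = (if i = j then 4 else 0)"
      using orth[OF ij(1,2)] tr[of "T i" "S j"] sym_T[OF ij(1)] by simp
    finally show ?thesis using c[OF ij(1)] ij J by (auto simp: bij_betw_def inj_on_def)
  qed
qed

section \<open>Determinants and inverses of matrices over a subfield\<close>

lemma subfield_simps:
  assumes "is_subfield K"
  shows "0 \<in> K" "1 \<in> K" "x \<in> K \<Longrightarrow> y \<in> K \<Longrightarrow> x + y \<in> K" "x \<in> K \<Longrightarrow> y \<in> K \<Longrightarrow> x * y \<in> K"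
    "x \<in> K \<Longrightarrow> - x \<in> K" "x \<in> K \<Longrightarrow> inverse x \<in> K"
    "x \<in> K \<Longrightarrow> y \<in> K \<Longrightarrow> x / y \<in> K"
    "x \<in> K \<Longrightarrow> y \<in> K \<Longrightarrow> x - y \<in> K"
  using assms unfolding is_subfield_def divide_inverse by auto (metis add_uminus_conv_diff)

lemma subfield_sum: "is_subfield K \<Longrightarrow> (\<And>i. i \<in> I \<Longrightarrow> g i \<in> K) \<Longrightarrow> sum g I \<in> K"
  by (induction I rule: infinite_finite_induct) (auto intro: subfield_simps)

lemma subfield_prod: "is_subfield K \<Longrightarrow> (\<And>i. i \<in> I \<Longrightarrow> g i \<in> K) \<Longrightarrow> prod g I \<in> K"
  by (induction I rule: infinite_finite_induct) (auto intro: subfield_simps)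

lemma subfield_numeral: "is_subfield K \<Longrightarrow> numeral n \<in> K"
  by (rule rat_in_number_field) auto

lemma subfield_power: "is_subfield K \<Longrightarrow> x \<in> K \<Longrightarrow> x ^ n \<in> K"
  by (induction n) (auto intro: subfield_simps)

lemma subfield_det:
  assumes K: "is_subfield K" and "mat_over K A"
  shows "det A \<in> K"
proof -
  have "of_int (sign p) \<in> K" for p :: "'a \<Rightarrow> 'a"
    by (rule rat_in_number_field[OF K]) simp
  then show ?thesis
    unfolding det_def using assms
    by (intro subfield_sum subfield_simps(4) subfield_prod K) (auto simp: mat_over_def)
qed

text \<open>Cramer's rule writes each entry of the inverse as a quotient of determinants with
  entries in K.\<close>

lemma subfield_matrix_inv:
  fixes A :: "complex^'n^'n"
  assumes K: "is_subfield K" and A: "mat_over K A" "invertible A"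
  shows "mat_over K (matrix_inv A)"
proof -
  have d: "det A \<noteq> 0" using A(2) invertible_det_nz by blast
  have "matrix_inv A $ i $ j \<in> K" for i j
  proof -
    have "A *v (matrix_inv A *v axis j 1) = axis j 1"
      by (simp add: matrix_vector_mul_assoc matrix_inv_mult[OF A(2)])
    then have "matrix_inv A *v axis j 1 = (\<chi> k. det (\<chi> a b. if b = k then axis j 1 $ a else A $ a $ b) / det A)"
      unfolding cramer[OF d] .
    moreover have "matrix_inv A $ i $ j = (matrix_inv A *v axis j 1) $ i"
      by (simp add: matrix_vector_mult_def axis_def if_distrib[of "\<lambda>x. _ * x"] cong: if_cong)
    moreover have "det (\<chi> a b. if b = i then axis j 1 $ a else A $ a $ b) \<in> K"
      using A(1) subfield_simps(1,2)[OF K] by (intro subfield_det[OF K]) (auto simp: mat_over_def axis_def)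
    ultimately show ?thesis using subfield_det[OF K A(1)] by (auto intro: subfield_simps[OF K])
  qed
  then show ?thesis by (simp add: mat_over_def)
qed

lemma mat_over_transpose: "mat_over K (transpose A) \<longleftrightarrow> mat_over K A"
  by (auto simp: mat_over_def transpose_def)

lemma invertible_transpose: "invertible (transpose A) \<longleftrightarrow> invertible A" for A :: "complex^'n^'n"
  by (simp add: invertible_det_nz)

lemma matrix_inv_product:
  fixes A B :: "complex^'n^'n"
  assumes "invertible A" "invertible B"
  shows "matrix_inv (A ** B) = matrix_inv B ** matrix_inv A"
proof (rule matrix_inv_unique_field(2))
  have "A ** B ** (matrix_inv B ** matrix_inv A) = A ** (B ** matrix_inv B) ** matrix_inv A"
    by (simp only: matrix_mul_assoc)
  then show "A ** B ** (matrix_inv B ** matrix_inv A) = mat 1"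
    by (simp add: matrix_inv_mult assms)
qed

section \<open>Translates of Flynn's forms\<close>

locale flynn = genus2 f for f +
  fixes k :: "complex set" and \<Phi> :: "4 \<Rightarrow> 4 \<Rightarrow> complex^4 \<Rightarrow> complex^4 \<Rightarrow> complex"
  assumes nf: "number_field k" and fk: "poly_over k f" and flynn: "flynn_forms k f \<Phi>"
begin

lemma ground: "is_subfield k" and closure: "is_subfield (alg_cl k)"
  using nf is_subfield_alg_cl by (auto simp: number_field_def)

lemma ground_subset: "k \<subseteq> alg_cl k"
  by (rule number_field_subset_alg_cl[OF ground])

lemma roots_algebraic: "roots f \<subseteq> alg_cl k"
  using fk f_nonzero[OF f] by (auto simp: roots_def alg_cl_def)

lemma sqrt_algebraic: "x^2 \<in> alg_cl k \<Longrightarrow> x \<in> alg_cl k"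
proof -
  assume "x^2 \<in> alg_cl k"
  then have "Polynomial.algebraic (csqrt (x^2))" using algebraic_alg_cl[OF nf] algebraic_csqrt by blast
  moreover have "csqrt (x^2) = x \<or> csqrt (x^2) = - x" by (simp add: power2_eq_iff[symmetric])
  ultimately have "Polynomial.algebraic x" by auto
  then show "x \<in> alg_cl k" by (rule alg_cl_algebraic[OF ground])
qed

lemma wdiv_Div0:
  assumes "U \<in> evn"
  shows "wdiv U \<in> Div0 f (alg_cl k)"
proof -
  have U: "U \<subseteq> roots f" "even (card U)" using assms by (auto simp: evn_def)
  have s: "csqrt (coeff f 6) \<in> alg_cl k"
    by (rule sqrt_algebraic) (use fk ground_subset in \<open>auto simp: poly_over_def\<close>)
  obtain n where n: "card U = 2 * n" using U(2) by (elim evenE)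
  have "Poly_Mapping.keys (wdiv U) \<subseteq> curve_pts f (alg_cl k)"
  proof
    fix P assume "P \<in> Poly_Mapping.keys (wdiv U)"
    then have "P \<in> Poly_Mapping.keys (\<Sum>t\<in>U. frag_of (Aff t 0)) \<or> P \<in> Poly_Mapping.keys (canonical_div f)"
      using keys_diff[of "\<Sum>t\<in>U. frag_of (Aff t 0)"] by (auto simp: wdiv_def)
    then show "P \<in> curve_pts f (alg_cl k)"
    proof
      assume "P \<in> Poly_Mapping.keys (\<Sum>t\<in>U. frag_of (Aff t 0))"
      then obtain t where "t \<in> U" "P = Aff t 0" using keys_sum[of "\<lambda>t. frag_of (Aff t 0)" U] by auto
      then show ?thesis using U roots_algebraic subfield_simps[OF closure] by (auto simp: curve_pts_def roots_def)
    next
      assume "P \<in> Poly_Mapping.keys (canonical_div f)"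
      then have "P = Inf (csqrt (coeff f 6)) \<or> P = Inf (- csqrt (coeff f 6))"
        using Poly_Mapping.keys_add[of "frag_of (Inf (csqrt (coeff f 6)))" "frag_of (Inf (- csqrt (coeff f 6)))"]
        by (auto simp: canonical_div_def)
      then show ?thesis using s subfield_simps[OF closure] by (auto simp: curve_pts_def)
    qed
  qed
  moreover have "div_deg (wdiv U) = 0" using n by (simp add: wdiv_def div_deg_canonical[OF f])
  ultimately show ?thesis by (simp add: Div0_iff)
qed

lemma Phi222_is_quad: "is_quad (\<lambda>x. Phi222 \<Phi> x y z)" "is_quad (\<lambda>y. Phi222 \<Phi> x y z)"
proof -
  have F: "form22_over (int_coeff_ring f) (\<Phi> i j)" for i j using flynn by (simp add: flynn_forms_def)
  show "is_quad (\<lambda>x. Phi222 \<Phi> x y z)" "is_quad (\<lambda>y. Phi222 \<Phi> x y z)"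
    unfolding Phi222_def by (intro is_quad_sum is_quad_scale' form22_is_quad[OF F])+
qed

lemma int_coeff_ring_subset: "x \<in> int_coeff_ring f \<Longrightarrow> x \<in> k"
proof (induction rule: int_coeff_ring.induct)
  case (1 n)
  show ?case by (rule rat_in_number_field[OF ground]) simp
next
  case (2 i)
  show ?case using fk by (simp add: poly_over_def)
qed (auto intro: subfield_simps[OF ground])

lemma Phi222_mem:
  assumes L: "is_subfield L" "k \<subseteq> L" and xyz: "\<And>i. x $ i \<in> L" "\<And>i. y $ i \<in> L" "\<And>i. z $ i \<in> L"
  shows "Phi222 \<Phi> x y z \<in> L"
proof -
  have "\<Phi> i j x y \<in> L" for i j
  proof -
    have "form22_over (int_coeff_ring f) (\<Phi> i j)" using flynn by (simp add: flynn_forms_def)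
    then obtain C where "\<And>a b c d. C a b c d \<in> int_coeff_ring f"
      "\<Phi> i j x y = (\<Sum>a\<in>UNIV. \<Sum>b\<in>UNIV. \<Sum>c\<in>UNIV. \<Sum>d\<in>UNIV. C a b c d * x$a * x$b * y$c * y$d)"
      unfolding form22_over_def by blast
    moreover from this have "C a b c d \<in> L" for a b c d using int_coeff_ring_subset L by blast
    ultimately show ?thesis by (auto intro!: subfield_sum subfield_simps(4) L xyz)
  qed
  then show ?thesis unfolding Phi222_def by (intro subfield_sum subfield_simps(4) L xyz)
qed

text \<open>The translated arguments represent P = U + X and Q = V + Y, where 2 Q is principal. Both
  P + Q and P - Q are therefore the class of \<open>sd U V\<close> translated by Z, so Flynn's form
  is a multiple of the square of one linear form. The contragredient of the third matrix in z
  removes the translation by Z.\<close>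

lemma flynn_at_nodes:
  assumes U: "U \<in> evn" "V \<in> evn"
    and X: "X \<in> Div0 f (alg_cl k)" "Y \<in> Div0 f (alg_cl k)" "Z \<in> Div0 f (alg_cl k)"
      "Y + Y \<in> principal_divs f" "X + Y - Z \<in> principal_divs f"
    and M: "acts_as_translation k f (cl X) M\<^sub>1" "acts_as_translation k f (cl Y) M\<^sub>2"
      "acts_as_translation k f (cl Z) M\<^sub>3" "invertible M\<^sub>3"
  shows "\<exists>t. t \<noteq> 0 \<and> (\<forall>z. Phi222 \<Phi> (M\<^sub>1 *v node U) (M\<^sub>2 *v node V) (transpose (matrix_inv M\<^sub>3) *v z) =
    t * (\<Sum>i\<in>UNIV. node (sd U V) $ i * z $ i)^2)"
proof -
  define W where "W = sd U V"
  have W: "W \<in> evn" unfolding W_def by (rule evn_sd[OF U])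
  note wd = wdiv_Div0[OF U(1)] wdiv_Div0[OF U(2)] wdiv_Div0[OF W]
  have pts: "cl (wdiv V') \<in> jac_pts f (alg_cl k)" if "V' \<in> evn" for V'
    using wdiv_Div0[OF that] by (auto simp: jac_pts_def)
  have tr: "kummer_rep f (cl (wdiv V' + D)) (M *v node V')"
    if "V' \<in> evn" "D \<in> Div0 f (alg_cl k)" "acts_as_translation k f (cl D) M" for V' D M
  proof -
    have "cl (wdiv V') \<otimes>\<^bsub>jac f\<^esub> cl D = cl (wdiv V' + D)"
      using that wdiv_Div0[OF that(1)] Div0_UNIV by (intro jac_mult) auto
    then show ?thesis
      using that(3) pts[OF that(1)] kummer_rep_node[OF that(1)] unfolding acts_as_translation_def by metis
  qed
  define P where "P = wdiv U + X"
  define Q where "Q = wdiv V + Y"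
  have PQ: "P \<in> Div0 f (alg_cl k)" "Q \<in> Div0 f (alg_cl k)"
    unfolding P_def Q_def using wd X by (auto intro: Div0_add)
  then have PQU: "P \<in> Div0 f UNIV" "Q \<in> Div0 f UNIV" by (auto intro: Div0_UNIV)
  note pr = principal_divs_add[OF f] principal_divs_diff[OF f]
  have sum: "P + Q - (wdiv W + Z) \<in> principal_divs f"
  proof -
    have "P + Q - (wdiv W + Z) = (wdiv U + wdiv V - wdiv W) + (X + Y - Z)" by (simp add: P_def Q_def)
    then show ?thesis using pr(1)[OF wdiv_sd[OF U] X(5)] by (simp only: W_def)
  qed
  have diff: "P - Q - (wdiv W + Z) \<in> principal_divs f"
  proof -
    have "P - Q - (wdiv W + Z) = (P + Q - (wdiv W + Z)) - ((wdiv V + wdiv V) + (Y + Y))" by (simp add: Q_def)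
    then show ?thesis using pr(2)[OF sum pr(1)[OF wdiv_double[OF U(2)] X(4)]] by (simp only:)
  qed
  have rep: "kummer_rep f (cl (wdiv W + Z)) (M\<^sub>3 *v node W)" by (rule tr[OF W X(3) M(3)])
  have "cl P \<otimes>\<^bsub>jac f\<^esub> cl Q = cl (wdiv W + Z)" using sum by (simp add: jac_mult PQU jac_class_eq_iff)
  moreover have "cl P \<otimes>\<^bsub>jac f\<^esub> inv\<^bsub>jac f\<^esub> cl Q = cl (wdiv W + Z)"
    using diff by (simp add: jac_inv jac_mult PQU Div0_closed jac_class_eq_iff)
  moreover have "cl P \<in> jac_pts f (alg_cl k)" "cl Q \<in> jac_pts f (alg_cl k)" using PQ by (auto simp: jac_pts_def)
  moreover have "kummer_rep f (cl P) (M\<^sub>1 *v node U)" "kummer_rep f (cl Q) (M\<^sub>2 *v node V)"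
    unfolding P_def Q_def by (rule tr[OF U(1) X(1) M(1)], rule tr[OF U(2) X(2) M(2)])
  ultimately obtain t where t: "t \<noteq> 0" "\<And>i j. \<Phi> i j (M\<^sub>1 *v node U) (M\<^sub>2 *v node V) =
      t * ((M\<^sub>3 *v node W) $ i * (M\<^sub>3 *v node W) $ j + (M\<^sub>3 *v node W) $ i * (M\<^sub>3 *v node W) $ j)"
    using flynn rep unfolding flynn_forms_def by metis
  \<comment> \<open>The factor 2 comes from the symmetrised product a_i b_j + b_i a_j with a =
    b.\<close>
  have "Phi222 \<Phi> (M\<^sub>1 *v node U) (M\<^sub>2 *v node V) (transpose (matrix_inv M\<^sub>3) *v z) =
    2 * t * (\<Sum>i\<in>UNIV. node W $ i * z $ i)^2" for z
  proof -
    define w where "w = transpose (matrix_inv M\<^sub>3) *v z"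
    have "Phi222 \<Phi> (M\<^sub>1 *v node U) (M\<^sub>2 *v node V) w = 2 * t * (\<Sum>i\<in>UNIV. w $ i * (M\<^sub>3 *v node W) $ i)^2"
      unfolding Phi222_def t(2) power2_eq_square sum_product unfolding sum_distrib_left by (simp add: mult_ac)
    also have "(\<Sum>i\<in>UNIV. w $ i * (M\<^sub>3 *v node W) $ i) = (\<Sum>i\<in>UNIV. (transpose M\<^sub>3 *v w) $ i * node W $ i)"
      by (rule inner_matrix_transpose)
    also have "transpose M\<^sub>3 *v w = z"
    proof -
      have "transpose M\<^sub>3 *v w = (transpose M\<^sub>3 ** transpose (matrix_inv M\<^sub>3)) *v z"
        unfolding w_def by (rule matrix_vector_mul_assoc)
      also have "transpose M\<^sub>3 ** transpose (matrix_inv M\<^sub>3) = mat 1"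
        using arg_cong[OF matrix_inv_mult(2)[OF M(4)], of transpose] by (simp only: matrix_transpose_mul transpose_mat)
      finally show ?thesis by simp
    qed
    finally show ?thesis unfolding w_def by (simp only: mult.commute[of "z $ _"])
  qed
  then show ?thesis using t(1) unfolding W_def by (intro exI[of _ "2 * t"]) simp
qed

text \<open>The constant cannot vanish: at the pair of empty sets, where all nodes are e_4, the form
  takes a nonzero multiple of 1 for z = e_4.\<close>

lemma flynn_translated:
  assumes X: "X \<in> Div0 f (alg_cl k)" "Y \<in> Div0 f (alg_cl k)" "Z \<in> Div0 f (alg_cl k)"
      "Y + Y \<in> principal_divs f" "X + Y - Z \<in> principal_divs f"
    and M: "acts_as_translation k f (cl X) M\<^sub>1" "acts_as_translation k f (cl Y) M\<^sub>2"
      "acts_as_translation k f (cl Z) M\<^sub>3" "invertible M\<^sub>3"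
  obtains c0 where "c0 \<noteq> 0" "\<And>x y z. Phi222 \<Phi> (M\<^sub>1 *v x) (M\<^sub>2 *v y) (transpose (matrix_inv M\<^sub>3) *v z) =
    c0 * (\<Sum>A\<in>halves. quad (split_quadric A) x * quad (split_quadric A) y * quad (split_coquadric A) z)"
proof -
  define \<Psi> where "\<Psi> x y z = Phi222 \<Phi> (M\<^sub>1 *v x) (M\<^sub>2 *v y) (transpose (matrix_inv M\<^sub>3) *v z)" for x y z
  have q1: "\<exists>M. \<forall>x. \<Psi> x y z = quad M x" for y z
    unfolding \<Psi>_def is_quad_def[symmetric] by (rule is_quad_substitute[OF Phi222_is_quad(1)])
  have q2: "\<exists>M. \<forall>y. \<Psi> x y z = quad M y" for x z
    unfolding \<Psi>_def is_quad_def[symmetric] by (rule is_quad_substitute[OF Phi222_is_quad(2)])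
  have "\<forall>U V. \<exists>t. U \<in> evn \<longrightarrow> V \<in> evn \<longrightarrow> t \<noteq> 0 \<and> (\<forall>z. \<Psi> (node U) (node V) z = t * (\<Sum>i\<in>UNIV. node (sd U V) $ i * z $ i)^2)"
    using flynn_at_nodes[OF _ _ X M] unfolding \<Psi>_def by blast
  then obtain t where t: "\<And>U V. U \<in> evn \<Longrightarrow> V \<in> evn \<Longrightarrow> t U V \<noteq> 0"
    "\<And>U V z. U \<in> evn \<Longrightarrow> V \<in> evn \<Longrightarrow> \<Psi> (node U) (node V) z = t U V * (\<Sum>i\<in>UNIV. node (sd U V) $ i * z $ i)^2"
    by metis
  obtain c0 where c0: "\<And>x y z. \<Psi> x y z = c0 * (\<Sum>A\<in>halves. quad (split_quadric A) x * quad (split_quadric A) y * quad (split_coquadric A) z)"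
    using unique_222_form[OF q1 q2 t(2)] by blast
  have "c0 \<noteq> 0"
  proof
    assume "c0 = 0"
    then have "\<Psi> (node {}) (node {}) (vector [0, 0, 0, 1]) = 0" using c0 by simp
    moreover have "{} \<in> evn" by (simp add: evn_def)
    ultimately have "t {} {} * (\<Sum>i\<in>UNIV. (vector [0, 0, 0, 1] :: complex^4) $ i * (vector [0, 0, 0, 1] :: complex^4) $ i)^2 = 0"
      using t(2)[of "{}" "{}" "vector [0, 0, 0, 1]"] by (simp add: sd_simps node_def)
    then show False using t(1)[of "{}" "{}"] \<open>{} \<in> evn\<close> by (simp add: sum_4)
  qed
  then show thesis using that c0 unfolding \<Psi>_def by blast
qed

lemma acts_as_translation_mat_1: "acts_as_translation k f (cl 0) (mat 1)"
proof -
  have "P \<otimes>\<^bsub>jac f\<^esub> cl 0 = P" if "P \<in> jac_pts f (alg_cl k)" for P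
    using that Div0_UNIV Div0_closed(1) by (auto simp: jac_pts_def jac_mult)
  then show ?thesis by (simp add: acts_as_translation_def)
qed

text \<open>The untranslated case. In addition c0 is algebraic: it is the value at (e_4, e_4, e_4),
  because every fundamental quadric is 1 at e_4 and the remaining sum is (e_4.e_4)^2.\<close>

lemma flynn_expansion:
  obtains c0 where "c0 \<noteq> 0" "c0 \<in> alg_cl k" "\<And>x y z. Phi222 \<Phi> x y z =
    c0 * (\<Sum>A\<in>halves. quad (split_quadric A) x * quad (split_quadric A) y * quad (split_coquadric A) z)"
proof -
  have inv: "invertible (mat 1 :: complex^4^4)" "transpose (matrix_inv (mat 1 :: complex^4^4)) = mat 1"
    using matrix_inv_unique_field[of "mat 1 :: complex^4^4" "mat 1"] by (simp_all add: transpose_mat)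
  have p: "(0::divisor) + 0 \<in> principal_divs f" "(0::divisor) + 0 - 0 \<in> principal_divs f"
    using principal_divs_0[OF f] by simp_all
  from flynn_translated[OF Div0_closed(1) Div0_closed(1) Div0_closed(1) p acts_as_translation_mat_1
      acts_as_translation_mat_1 acts_as_translation_mat_1 inv(1)]
  obtain c0 where c0: "c0 \<noteq> 0" and
    e: "\<And>x y z. Phi222 \<Phi> (mat 1 *v x) (mat 1 *v y) (transpose (matrix_inv (mat 1)) *v z) =
      c0 * (\<Sum>A\<in>halves. quad (split_quadric A) x * quad (split_quadric A) y * quad (split_coquadric A) z)"
    by blast
  have e: "Phi222 \<Phi> x y z = c0 * (\<Sum>A\<in>halves. quad (split_quadric A) x * quad (split_quadric A) y * quad (split_coquadric A) z)" for x y z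
    using e[of x y z] by (simp only: inv(2) matrix_vector_mul_lid)
  define e4 where "e4 = (vector [0, 0, 0, 1] :: complex^4)"
  have "Phi222 \<Phi> e4 e4 e4 = c0 * (\<Sum>A\<in>halves. quad (split_quadric A) e4 * quad (split_coquadric A) e4)"
    unfolding e by (simp add: e4_def quad_e4)
  also have "\<dots> = c0 * (\<Sum>i\<in>UNIV. e4 $ i * e4 $ i)^2" unfolding inner_square_expansion ..
  also have "\<dots> = c0" by (simp add: e4_def sum_4)
  finally have "c0 = Phi222 \<Phi> e4 e4 e4" by simp
  moreover have "e4 $ i \<in> alg_cl k" for i
    using exhaust_4[of i] subfield_simps(1,2)[OF closure] by (auto simp: e4_def)
  then have "Phi222 \<Phi> e4 e4 e4 \<in> alg_cl k"
    by (intro Phi222_mem[OF closure ground_subset])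
  ultimately show thesis using that c0 e by blast
qed

end

section \<open>Partitions as halves, and the factorisation of the quartics of a model\<close>

context genus2
begin

definition part :: "complex set \<Rightarrow> complex set set" where
  "part A = {A, roots f - A}"

lemma part_bij: "bij_betw part halves (partitions f)"
proof (rule bij_betwI')
  show "part A = part B \<longleftrightarrow> A = B" if "A \<in> halves" "B \<in> halves" for A B
    using halvesD[OF that(1)] halvesD[OF that(2)] by (auto simp: part_def doubleton_eq_iff)
  show "part A \<in> partitions f" if "A \<in> halves" for A
    using halvesD[OF that] card_complement[of A] by (auto simp: part_def partitions_def)
  show "\<exists>A\<in>halves. \<gamma> = part A" if "\<gamma> \<in> partitions f" for \<gamma>
  proof -
    obtain A B where AB: "\<gamma> = {A, B}" "A \<union> B = roots f" "A \<inter> B = {}" "card A = 3" "card B = 3"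
      using \<open>\<gamma> \<in> partitions f\<close> by (auto simp: partitions_def)
    then have "roots f - A = B" "roots f - B = A" by auto
    then show ?thesis using AB base
      by (cases "root0 \<in> A") (auto simp: part_def halves_def insert_commute intro: bexI[of _ A] bexI[of _ B])
  qed
qed

lemma Peps_identity_model:
  assumes A: "A \<in> halves" and "x $ 4 \<noteq> 0"
  shows "Peps f (H0mat f) (part A) x = - ((quad (split_quadric A) x)^2) / (8 * (coeff f 6)^2)"
proof -
  note A' = halvesD[OF A]
  obtain r0 r1 r2 where r: "monic_with A = [:r0, r1, r2, 1:]" using A'(3) by (rule monic_with_card_3)
  have "card (roots f - A) = 3" using card_complement[OF A'(1)] A'(3) by simp
  then obtain s0 s1 s2 where s: "monic_with (roots f - A) = [:s0, s1, s2, 1:]" by (rule monic_with_card_3)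
  have ne: "A \<noteq> roots f - A" using A'(4) by auto
  then have "part A - {A} = {roots f - A}" "part A - {roots f - A} = {A}" by (auto simp: part_def)
  then have lam: "lam1 f (part A) = coeff f 6 * (r0 * s2 + r2 * s0)" "lam2 f (part A) = coeff f 6 * (r0 + s0)"
    "lam3 f (part A) = coeff f 6 * (r1 + s1)"
    using ne unfolding lam1_def lam2_def lam3_def part_def by (simp_all add: r s numeral_2_eq_2 mult.commute)
  have "f = smult (coeff f 6) ([:r0, r1, r2, 1:] * [:s0, s1, s2, 1:])"
    using f_split[OF A'(1)] unfolding r s .
  then show ?thesis
    using Peps_H0[of f "coeff f 6" r0 r1 r2 s0 s1 s2 x "part A"] lam assms(2) leading_coeff_nonzero[OF f]
    unfolding split_quadric_def r s by blast
qed

text \<open>Covariance gives P_H(x) = det(R) P_0(psi x), where P_0 belongs to the identity model. So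
  alpha S^2 and a multiple of the square of the transformed quadric agree wherever both fourth
  coordinates are nonzero, and the forms are proportional.\<close>

lemma factorisation_scaled:
  assumes model: "is_model K f H" and fac: "factorisation K f H \<alpha> S"
    and R: "invertible R" "\<And>u. quad H u = H0form f (wedge2 R u) / det R" and psi: "\<psi> = transpose (matrix_inv R)"
    and A: "A \<in> halves"
  obtains a where "a^2 = (- det R / (8 * (coeff f 6)^2)) / \<alpha> (part A)"
    "S (part A) = msmult a (transpose \<psi> ** split_quadric A ** \<psi>)"
proof -
  have p: "part A \<in> partitions f" using part_bij A by (auto simp: bij_betw_def)
  have d: "det R \<noteq> 0" using R(1) by (simp add: invertible_det_nz)
  have symH: "transpose H = H" using model by (simp add: is_model_def)
  define W where "W = transpose (wedge2mat R) ** H0mat f ** wedge2mat R"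
  have symW: "transpose W = W"
    by (simp add: W_def matrix_transpose_mul symmetric_H0mat matrix_mul_assoc)
  have HW: "msmult (det R) H = W"
  proof (rule quad_eq_imp_eq)
    show "quad (msmult (det R) H) u = quad W u" for u
      using d R(2)[of u] unfolding quad_msmult W_def quad_substitute[symmetric] quad_H0mat[OF leading_coeff_nonzero[OF f]]
        wedge2_wedge2mat by simp
  qed (simp_all add: transpose_msmult symH symW)
  have Rpsi: "transpose R ** \<psi> = mat 1"
    unfolding psi using arg_cong[OF matrix_inv_mult(2)[OF R(1)], of transpose] by (simp only: matrix_transpose_mul transpose_mat)
  then have psiR: "\<psi> ** transpose R = mat 1" by (simp add: matrix_left_right_inverse)
  have x: "transpose R *v (\<psi> *v x) = x" for x by (simp add: matrix_vector_mul_assoc Rpsi del: transpose_matrix_vector)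
  have eq: "\<alpha> (part A) * (quad (S (part A)) x)^2 = (- det R / (8 * (coeff f 6)^2)) * (quad (transpose \<psi> ** split_quadric A ** \<psi>) x)^2"
    if "x $ 4 \<noteq> 0" "(\<psi> *v x) $ 4 \<noteq> 0" for x
  proof -
    have "\<alpha> (part A) * (quad (S (part A)) x)^2 = Peps f H (part A) x"
      using fac p that by (simp add: factorisation_def)
    also have "\<dots> = det R * Peps f (H0mat f) (part A) (\<psi> *v x)"
      using Peps_covariant[OF d HW[unfolded W_def] symH symmetric_H0mat that(2), of f "part A"] that(1) unfolding x by simp
    also have "\<dots> = (- det R / (8 * (coeff f 6)^2)) * (quad (split_quadric A) (\<psi> *v x))^2"
      unfolding Peps_identity_model[OF A that(2)] by simp
    finally show ?thesis unfolding quad_substitute .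
  qed
  have l: "line_poly (\<lambda>x::complex^4. x $ 4)" by (rule line_poly_coord)
  have l': "line_poly (\<lambda>x. (\<psi> *v x) $ 4)"
    unfolding matrix_vector_mult_def vec_lambda_beta by (intro line_poly_sum line_poly_mult line_poly_const line_poly_coord)
  have v: "(vector [0, 0, 0, 1] :: complex^4) $ 4 \<noteq> 0" by simp
  \<comment> \<open>A point at which the second side condition holds: the preimage of e_4 under
    psi.\<close>
  have v': "(\<psi> *v (transpose R *v vector [0, 0, 0, 1])) $ 4 \<noteq> 0"
    by (simp add: matrix_vector_mul_assoc psiR del: transpose_matrix_vector)
  have al: "\<alpha> (part A) \<noteq> 0" using fac p by (simp add: factorisation_def L10_units_def)
  from proportional_quads[OF eq l l' v v' al] obtain a where a: "a^2 = (- det R / (8 * (coeff f 6)^2)) / \<alpha> (part A)"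
    "\<And>x. quad (S (part A)) x = a * quad (transpose \<psi> ** split_quadric A ** \<psi>) x"
    by blast
  have "S (part A) = msmult a (transpose \<psi> ** split_quadric A ** \<psi>)"
  proof (rule quad_eq_imp_eq)
    show "transpose (S (part A)) = S (part A)" using fac p by (simp add: factorisation_def L10_form_def)
    show "transpose (msmult a (transpose \<psi> ** split_quadric A ** \<psi>)) = msmult a (transpose \<psi> ** split_quadric A ** \<psi>)"
      using sym_S[OF A] by (simp add: transpose_msmult matrix_transpose_mul matrix_mul_assoc)
  qed (simp add: quad_msmult a(2))
  then show thesis using a(1) that by blast
qed

end

context flynn
begin

text \<open>The point is that kappa = -det R / (8 f_6^2) is the same for all partitions, whereas
  each \<open>a A\<close> is a square root chosen separately.\<close>

lemma factorisation_data:
  assumes model: "is_model k f H" and fac: "factorisation k f H \<alpha> S" and psi: "psi_compatible k f H e \<psi>"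
  obtains a \<kappa> where "\<psi> \<in> GL (alg_cl k)" "\<kappa> \<in> alg_cl k" "\<kappa> \<noteq> 0"
    "\<And>A. A \<in> halves \<Longrightarrow> a A \<in> alg_cl k \<and> a A \<noteq> 0 \<and> \<alpha> (part A) * (a A)^2 = \<kappa>"
    "\<And>A. A \<in> halves \<Longrightarrow> S (part A) = msmult (a A) (transpose \<psi> ** split_quadric A ** \<psi>)"
    "\<And>A. A \<in> halves \<Longrightarrow> matrix_inv (S (part A)) = msmult (1 / a A) (matrix_inv \<psi> ** split_coquadric A ** transpose (matrix_inv \<psi>))"
proof -
  obtain R where R: "R \<in> GL (alg_cl k)" "\<And>u. quad H u = H0form f (wedge2 R u) / det R" "\<psi> = transpose (matrix_inv R)"
    using psi by (auto simp: psi_compatible_def)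
  have inv: "invertible R" and over: "mat_over (alg_cl k) R" using R(1) by (auto simp: GL_def)
  have d: "det R \<noteq> 0" "det R \<in> alg_cl k" using inv subfield_det[OF closure over] by (auto simp: invertible_det_nz)
  have "invertible (matrix_inv R)" using matrix_inv_unique_field(1)[of "matrix_inv R" R] matrix_inv_mult[OF inv] by simp
  then have G: "\<psi> \<in> GL (alg_cl k)" and inv_psi: "invertible \<psi>"
    using subfield_matrix_inv[OF closure over inv] by (simp_all add: R(3) GL_def mat_over_transpose invertible_transpose)
  define \<kappa> where "\<kappa> = - det R / (8 * (coeff f 6)^2)"
  have h: "coeff f 6 \<in> alg_cl k" using fk ground_subset by (auto simp: poly_over_def)
  have kap: "\<kappa> \<in> alg_cl k" "\<kappa> \<noteq> 0"
    using d h leading_coeff_nonzero[OF f]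
    by (auto simp: \<kappa>_def intro!: subfield_simps[OF closure] subfield_power[OF closure] subfield_numeral[OF closure])
  have al: "\<alpha> (part A) \<noteq> 0" "\<alpha> (part A) \<in> alg_cl k" if "A \<in> halves" for A
  proof -
    have "part A \<in> partitions f" using part_bij that by (auto simp: bij_betw_def)
    then show "\<alpha> (part A) \<noteq> 0" "\<alpha> (part A) \<in> alg_cl k" using fac by (auto simp: factorisation_def L10_units_def L10_def)
  qed
  have "\<forall>A. \<exists>a. A \<in> halves \<longrightarrow> a^2 = \<kappa> / \<alpha> (part A) \<and> S (part A) = msmult a (transpose \<psi> ** split_quadric A ** \<psi>)"
    using factorisation_scaled[OF model fac inv R(2,3)] unfolding \<kappa>_def by metis
  then obtain a where a: "\<And>A. A \<in> halves \<Longrightarrow> (a A)^2 = \<kappa> / \<alpha> (part A)"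
    "\<And>A. A \<in> halves \<Longrightarrow> S (part A) = msmult (a A) (transpose \<psi> ** split_quadric A ** \<psi>)" by metis
  have a1: "a A \<in> alg_cl k \<and> a A \<noteq> 0 \<and> \<alpha> (part A) * (a A)^2 = \<kappa>" if "A \<in> halves" for A
  proof (intro conjI)
    show "a A \<in> alg_cl k"
      by (rule sqrt_algebraic) (use a(1)[OF that] kap al[OF that] subfield_simps(7)[OF closure] in simp)
    show "a A \<noteq> 0" using a(1)[OF that] kap al[OF that] by auto
    show "\<alpha> (part A) * (a A)^2 = \<kappa>" using a(1)[OF that] al[OF that] by simp
  qed
  have "matrix_inv (S (part A)) = msmult (1 / a A) (matrix_inv \<psi> ** split_coquadric A ** transpose (matrix_inv \<psi>))"
    if "A \<in> halves" for A
  proof (rule matrix_inv_unique_field(2))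
    have t: "transpose \<psi> ** transpose (matrix_inv \<psi>) = mat 1"
      using arg_cong[OF matrix_inv_mult(2)[OF inv_psi], of transpose] by (simp only: matrix_transpose_mul transpose_mat)
    have "transpose \<psi> ** split_quadric A ** \<psi> ** (matrix_inv \<psi> ** split_coquadric A ** transpose (matrix_inv \<psi>)) =
      transpose \<psi> ** (split_quadric A ** (\<psi> ** matrix_inv \<psi>) ** split_coquadric A) ** transpose (matrix_inv \<psi>)"
      by (simp only: matrix_mul_assoc)
    also have "\<dots> = mat 1"
      using split_quadric_inverse halvesD that by (simp add: matrix_inv_mult[OF inv_psi] t)
    finally show "S (part A) ** msmult (1 / a A) (matrix_inv \<psi> ** split_coquadric A ** transpose (matrix_inv \<psi>)) = mat 1"
      using a1[OF that] unfolding a(2)[OF that] msmult_mult msmult_msmult by (simp add: msmult_def vec_eq_iff)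
  qed
  then show thesis using that[OF G kap a1 a(2)] by blast
qed

lemma factorisation_basis:
  assumes psi: "\<psi> \<in> GL (alg_cl k)" and a: "\<And>A. A \<in> halves \<Longrightarrow> a A \<noteq> 0"
    and S: "\<And>A. A \<in> halves \<Longrightarrow> S (part A) = msmult (a A) (transpose \<psi> ** split_quadric A ** \<psi>)"
    and T: "\<And>A. A \<in> halves \<Longrightarrow> matrix_inv (S (part A)) = msmult (1 / a A) (matrix_inv \<psi> ** split_coquadric A ** transpose (matrix_inv \<psi>))"
  shows "apolar_basis (partitions f) S (\<lambda>\<gamma>. matrix_inv (S \<gamma>))"
proof (rule substituted_basis[OF part_bij _ S T a])
  show "matrix_inv \<psi> ** \<psi> = mat 1" using psi by (simp add: GL_def matrix_inv_mult)
qed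

end

section \<open>Galois descent\<close>

text \<open>Fixing rational y and z at which the forms of index b do not vanish reduces the claim to
  independence of the first family.\<close>

lemma triple_independent:
  assumes B: "apolar_basis I S\<^sub>1 T\<^sub>1" "apolar_basis I S\<^sub>2 T\<^sub>2" "apolar_basis I S\<^sub>3 T\<^sub>3"
    and zero: "\<And>x y z. \<forall>i. x $ i \<in> \<rat> \<Longrightarrow> \<forall>i. y $ i \<in> \<rat> \<Longrightarrow> \<forall>i. z $ i \<in> \<rat> \<Longrightarrow>
      (\<Sum>a\<in>I. d a * quad (S\<^sub>1 a) x * quad (S\<^sub>2 a) y * quad (S\<^sub>3 a) z) = 0"
    and b: "b \<in> I"
  shows "d b = 0"
proof -
  obtain y where y: "\<forall>i. y $ i \<in> \<rat>" "quad (S\<^sub>2 b) y \<noteq> 0" by (rule apolar_basis.nonzero_value[OF B(2) b])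
  obtain z where z: "\<forall>i. z $ i \<in> \<rat>" "quad (S\<^sub>3 b) z \<noteq> 0" by (rule apolar_basis.nonzero_value[OF B(3) b])
  have "(\<Sum>a\<in>I. d a * quad (S\<^sub>2 a) y * quad (S\<^sub>3 a) z * quad (S\<^sub>1 a) x) = 0" if "\<forall>i. x $ i \<in> \<rat>" for x
    using zero[OF that y(1) z(1)] by (simp only: mult_ac)
  then have "d b * quad (S\<^sub>2 b) y * quad (S\<^sub>3 b) z = 0"
    by (rule apolar_basis.independent[OF B(1) _ b])
  then show ?thesis using y z by simp
qed

lemma form22_value:
  assumes "is_subfield K" "form22_over K B" "\<And>i. x $ i \<in> K" "\<And>i. y $ i \<in> K"
  shows "B x y \<in> K"
proof -
  obtain C where "\<And>a b c d. C a b c d \<in> K"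
    "B x y = (\<Sum>a\<in>UNIV. \<Sum>b\<in>UNIV. \<Sum>c\<in>UNIV. \<Sum>d\<in>UNIV. C a b c d * x$a * x$b * y$c * y$d)"
    using assms(2) unfolding form22_over_def by blast
  then show ?thesis by (auto intro!: subfield_sum subfield_simps(4) assms)
qed

lemma form222_value:
  assumes "is_subfield K" "form222_over K \<Psi>" "\<And>i. x $ i \<in> K" "\<And>i. y $ i \<in> K" "\<And>i. z $ i \<in> K"
  shows "\<Psi> x y z \<in> K"
proof -
  obtain C where C: "\<And>i j. form22_over K (C i j)"
    "\<Psi> x y z = (\<Sum>i\<in>UNIV. \<Sum>j\<in>UNIV. C i j x y * z$i * z$j)"
    using assms(2) unfolding form222_over_def by blast
  show ?thesis unfolding C(2)
    by (intro subfield_sum subfield_simps(4) assms form22_value[OF assms(1) C(1)])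
qed

text \<open>The denominator 8 collects the factor 1/2 from each of the three forms.\<close>

lemma triple_quad_form222:
  assumes "\<And>a b c d i j. (\<Sum>\<gamma>\<in>P. \<mu> \<gamma> * S\<^sub>1 \<gamma> $ a $ b * S\<^sub>2 \<gamma> $ c $ d * S\<^sub>3 \<gamma> $ i $ j) / 8 \<in> K"
  shows "form222_over K (\<lambda>x y z. \<Sum>\<gamma>\<in>P. \<mu> \<gamma> * quad (S\<^sub>1 \<gamma>) x * quad (S\<^sub>2 \<gamma>) y * quad (S\<^sub>3 \<gamma>) z)"
proof -
  define D where "D i j a b c d = (\<Sum>\<gamma>\<in>P. \<mu> \<gamma> * S\<^sub>1 \<gamma> $ a $ b * S\<^sub>2 \<gamma> $ c $ d * S\<^sub>3 \<gamma> $ i $ j) / 8" for a b c d i j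
  define C where "C i j x y = (\<Sum>a\<in>UNIV. \<Sum>b\<in>UNIV. \<Sum>c\<in>UNIV. \<Sum>d\<in>UNIV. D i j a b c d * x$a * x$b * y$c * y$d)"
    for i j and x y :: "complex^4"
  have "form22_over K (C i j)" for i j
    unfolding form22_over_def C_def using assms by (intro exI[of _ "D i j"]) (simp add: D_def)
  moreover have "(\<Sum>\<gamma>\<in>P. \<mu> \<gamma> * quad (S\<^sub>1 \<gamma>) x * quad (S\<^sub>2 \<gamma>) y * quad (S\<^sub>3 \<gamma>) z) =
      (\<Sum>i\<in>UNIV. \<Sum>j\<in>UNIV. C i j x y * z$i * z$j)" for x y z
  proof -
    define F where "F \<gamma> i j a b c d = S\<^sub>3 \<gamma> $ i $ j * z$i * z$j * (S\<^sub>1 \<gamma> $ a $ b * x$a * x$b * (S\<^sub>2 \<gamma> $ c $ d * y$c * y$d * (\<mu> \<gamma> / 8)))"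
      for \<gamma> and i j a b c d :: 4
    have "(\<Sum>i\<in>UNIV. \<Sum>j\<in>UNIV. C i j x y * z$i * z$j) =
      (\<Sum>i\<in>UNIV. \<Sum>j\<in>UNIV. \<Sum>a\<in>UNIV. \<Sum>b\<in>UNIV. \<Sum>c\<in>UNIV. \<Sum>d\<in>UNIV. \<Sum>\<gamma>\<in>P. F \<gamma> i j a b c d)"
      unfolding C_def D_def F_def sum_distrib_right sum_divide_distrib by (intro sum.cong refl) simp
    also have "\<dots> = (\<Sum>i\<in>UNIV. \<Sum>j\<in>UNIV. \<Sum>a\<in>UNIV. \<Sum>b\<in>UNIV. \<Sum>\<gamma>\<in>P. \<Sum>c\<in>UNIV. \<Sum>d\<in>UNIV. F \<gamma> i j a b c d)"
      by (intro sum.cong refl sum_swap3)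
    also have "\<dots> = (\<Sum>i\<in>UNIV. \<Sum>j\<in>UNIV. \<Sum>\<gamma>\<in>P. \<Sum>a\<in>UNIV. \<Sum>b\<in>UNIV. \<Sum>c\<in>UNIV. \<Sum>d\<in>UNIV. F \<gamma> i j a b c d)"
      by (intro sum.cong refl sum_swap3)
    also have "\<dots> = (\<Sum>\<gamma>\<in>P. \<Sum>i\<in>UNIV. \<Sum>j\<in>UNIV. \<Sum>a\<in>UNIV. \<Sum>b\<in>UNIV. \<Sum>c\<in>UNIV. \<Sum>d\<in>UNIV. F \<gamma> i j a b c d)"
      by (rule sum_swap3)
    also have "\<dots> = (\<Sum>\<gamma>\<in>P. (\<Sum>i\<in>UNIV. \<Sum>j\<in>UNIV. S\<^sub>3 \<gamma> $ i $ j * z$i * z$j) *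
      ((\<Sum>a\<in>UNIV. \<Sum>b\<in>UNIV. S\<^sub>1 \<gamma> $ a $ b * x$a * x$b) * ((\<Sum>c\<in>UNIV. \<Sum>d\<in>UNIV. S\<^sub>2 \<gamma> $ c $ d * y$c * y$d) * (\<mu> \<gamma> / 8))))"
      unfolding F_def by (simp only: sum_distrib_left[symmetric] sum_distrib_right[symmetric])
    finally show ?thesis by (simp add: quad_def mult_ac)
  qed
  ultimately show ?thesis unfolding form222_over_def by (intro exI[of _ C]) simp
qed

context galois
begin

text \<open>A relation rather than an equation, so that membership in the closure, without which
  sigma is not additive or multiplicative, travels along with the value.\<close>

definition conjugate :: "complex \<Rightarrow> complex \<Rightarrow> bool" where
  "conjugate x x' \<longleftrightarrow> x \<in> alg_cl k \<and> \<sigma> x = x'"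

lemma conjugate_add: "conjugate x x' \<Longrightarrow> conjugate y y' \<Longrightarrow> conjugate (x + y) (x' + y')"
  and conjugate_mult: "conjugate x x' \<Longrightarrow> conjugate y y' \<Longrightarrow> conjugate (x * y) (x' * y')"
  and conjugate_divide: "conjugate x x' \<Longrightarrow> conjugate y y' \<Longrightarrow> conjugate (x / y) (x' / y')"
  by (auto simp: conjugate_def gal_add gal_mult gal_divide closure_mem closure_divide)

lemma conjugate_fix: "x \<in> k \<Longrightarrow> conjugate x x"
  by (simp add: conjugate_def gal_fix closure_mem)

lemma conjugate_rat: "x \<in> \<rat> \<Longrightarrow> conjugate x x"
  by (rule conjugate_fix) (rule rat_mem)

lemma conjugate_sum: "(\<And>i. i \<in> I \<Longrightarrow> conjugate (g i) (g' i)) \<Longrightarrow> conjugate (sum g I) (sum g' I)"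
  by (induction I rule: infinite_finite_induct) (auto intro: conjugate_add conjugate_rat)

lemma conjugate_matrix_vector:
  "(\<And>i j. conjugate (A $ i $ j) (A' $ i $ j)) \<Longrightarrow> (\<And>i. conjugate (x $ i) (x' $ i)) \<Longrightarrow> conjugate ((A *v x) $ i) ((A' *v x') $ i)"
  unfolding matrix_vector_mult_def vec_lambda_beta by (intro conjugate_sum conjugate_mult)

lemma conjugate_quad:
  "(\<And>i j. conjugate (A $ i $ j) (A' $ i $ j)) \<Longrightarrow> (\<And>i. conjugate (x $ i) (x' $ i)) \<Longrightarrow> conjugate (quad A x) (quad A' x')"
  unfolding quad_def by (intro conjugate_divide conjugate_sum conjugate_mult conjugate_rat) auto

lemma conjugate_matrix_inv:
  fixes A A' :: "complex^'n^'n"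
  assumes A: "invertible A" "\<And>i j. conjugate (A $ i $ j) (A' $ i $ j)"
  shows "invertible A'" "conjugate (matrix_inv A $ i $ j) (matrix_inv A' $ i $ j)"
proof -
  have over: "mat_over (alg_cl k) A" using A(2) by (simp add: mat_over_def conjugate_def)
  define B' where "B' = (\<chi> i j. \<sigma> (matrix_inv A $ i $ j))"
  have B: "conjugate (matrix_inv A $ i $ j) (B' $ i $ j)" for i j
    using subfield_matrix_inv[OF is_subfield_alg_cl[OF nf] over A(1)] by (simp add: conjugate_def B'_def mat_over_def)
  have "conjugate ((A ** matrix_inv A) $ i $ j) ((A' ** B') $ i $ j)" for i j
    unfolding matrix_matrix_mult_def vec_lambda_beta by (intro conjugate_sum conjugate_mult A(2) B)
  then have "conjugate (mat 1 $ i $ j) ((A' ** B') $ i $ j)" for i j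
    unfolding matrix_inv_mult(1)[OF A(1)] .
  then have "(A' ** B') $ i $ j = \<sigma> (mat 1 $ i $ j)" for i j by (simp add: conjugate_def)
  then have "(A' ** B') $ i $ j = mat 1 $ i $ j" for i j by (simp add: mat_def gal_01)
  then have "A' ** B' = mat 1" by (simp add: vec_eq_iff)
  then have "invertible A'" "matrix_inv A' = B'" by (rule matrix_inv_unique_field)+
  then show "invertible A'" "conjugate (matrix_inv A $ i $ j) (matrix_inv A' $ i $ j)" using B by simp_all
qed

end

locale flynn_galois = flynn f k \<Phi> + genus2_galois f k \<sigma> for f k \<Phi> \<sigma>
begin

lemma conjugate_Phi222:
  assumes "\<And>i. conjugate (x $ i) (x' $ i)" "\<And>i. conjugate (y $ i) (y' $ i)" "\<And>i. conjugate (z $ i) (z' $ i)"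
  shows "conjugate (Phi222 \<Phi> x y z) (Phi222 \<Phi> x' y' z')"
proof -
  have "conjugate (\<Phi> i j x y) (\<Phi> i j x' y')" for i j
  proof -
    have "form22_over (int_coeff_ring f) (\<Phi> i j)" using flynn by (simp add: flynn_forms_def)
    then obtain C where C: "\<And>a b c d. C a b c d \<in> int_coeff_ring f"
      "\<And>x y. \<Phi> i j x y = (\<Sum>a\<in>UNIV. \<Sum>b\<in>UNIV. \<Sum>c\<in>UNIV. \<Sum>d\<in>UNIV. C a b c d * x$a * x$b * y$c * y$d)"
      unfolding form22_over_def by blast
    show ?thesis unfolding C(2)
      by (intro conjugate_sum conjugate_mult conjugate_fix[OF int_coeff_ring_subset[OF C(1)]] assms)
  qed
  then show ?thesis unfolding Phi222_def by (intro conjugate_sum conjugate_mult assms)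
qed

lemma roots_image: "\<sigma> ` roots f = roots f"
proof (rule endo_inj_surj)
  show "finite (roots f)" by (rule finite_R)
  show "\<sigma> ` roots f \<subseteq> roots f"
  proof
    fix y assume "y \<in> \<sigma> ` roots f"
    then obtain x where x: "y = \<sigma> x" "poly f x = 0" "x \<in> alg_cl k" using roots_algebraic by (auto simp: roots_def)
    then show "y \<in> roots f" using gal_poly(1)[OF fk x(3)] by (simp add: roots_def gal_01)
  qed
  show "inj_on \<sigma> (roots f)"
    using roots_algebraic gal_inj by (intro inj_onI) blast
qed

lemma partitions_bij: "bij_betw ((`) ((`) \<sigma>)) (partitions f) (partitions f)"
proof -
  have fin: "finite (partitions f)" using part_bij finite_halves bij_betw_finite by blast
  have inj: "inj_on \<sigma> (roots f)" using roots_algebraic gal_inj by (intro inj_onI) blast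
  have sub: "(`) ((`) \<sigma>) ` partitions f \<subseteq> partitions f"
  proof
    fix \<delta> assume "\<delta> \<in> (`) ((`) \<sigma>) ` partitions f"
    then obtain A B where AB: "\<delta> = {\<sigma> ` A, \<sigma> ` B}" "A \<union> B = roots f" "A \<inter> B = {}" "card A = 3" "card B = 3"
      by (auto simp: partitions_def)
    have "inj_on \<sigma> A" "inj_on \<sigma> B" using inj AB(2) by (auto intro: inj_on_subset)
    then have "card (\<sigma> ` A) = 3" "card (\<sigma> ` B) = 3" using AB by (simp_all add: card_image)
    moreover have "\<sigma> ` A \<union> \<sigma> ` B = roots f" using AB(2) roots_image by (simp flip: image_Un)
    moreover have "\<sigma> ` A \<inter> \<sigma> ` B = {}"
      using inj_on_image_Int[OF inj, of A B] AB by auto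
    ultimately show "\<delta> \<in> partitions f" unfolding partitions_def AB(1) by blast
  qed
  have "inj_on ((`) ((`) \<sigma>)) (partitions f)"
  proof (rule inj_on_subset)
    show "inj_on ((`) ((`) \<sigma>)) (Pow (Pow (roots f)))" by (intro inj_on_image_Pow inj)
    show "partitions f \<subseteq> Pow (Pow (roots f))" by (auto simp: partitions_def)
  qed
  then show ?thesis using endo_inj_surj[OF fin sub] by (simp add: bij_betw_def)
qed

lemma L10_conj:
  assumes "a \<in> L10 k f" "\<gamma> \<in> partitions f"
  shows "conjugate (a \<gamma>) (a ((`) ((`) \<sigma>) \<gamma>))"
  using assms \<sigma> by (auto simp: L10_def conjugate_def)

lemma L10_form_conj:
  assumes "L10_form k f S" "\<gamma> \<in> partitions f"
  shows "conjugate (S \<gamma> $ i $ j) (S ((`) ((`) \<sigma>) \<gamma>) $ i $ j)"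
proof -
  have "(\<lambda>\<gamma>\<in>partitions f. S \<gamma> $ i $ j) \<in> L10 k f" using assms(1) by (simp add: L10_form_def)
  from L10_conj[OF this assms(2)] show ?thesis using assms(2) partitions_bij by (simp add: bij_betw_apply)
qed

text \<open>Since Flynn's forms have coefficients in k, sigma acts at rational arguments only
  through the maps psi. Each conjugate of psi is M psi with M acting as translation by a 2-torsion
  point; Flynn's form and its M-translate have the same expansion up to constants, so the conjugate
  is c1 / c0 times the original.\<close>

lemma twisted_form_conj:
  assumes X: "X \<in> Div0 f (alg_cl k)" "Y \<in> Div0 f (alg_cl k)" "Z \<in> Div0 f (alg_cl k)"
      "Y + Y \<in> principal_divs f" "X + Y - Z \<in> principal_divs f"
    and psi: "\<psi>\<^sub>1 \<in> GL (alg_cl k)" "\<psi>\<^sub>2 \<in> GL (alg_cl k)" "\<psi>\<^sub>3 \<in> GL (alg_cl k)"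
    and M: "acts_as_translation k f (cl X) ((\<chi> i j. \<sigma> (\<psi>\<^sub>1 $ i $ j)) ** matrix_inv \<psi>\<^sub>1)"
      "acts_as_translation k f (cl Y) ((\<chi> i j. \<sigma> (\<psi>\<^sub>2 $ i $ j)) ** matrix_inv \<psi>\<^sub>2)"
      "acts_as_translation k f (cl Z) ((\<chi> i j. \<sigma> (\<psi>\<^sub>3 $ i $ j)) ** matrix_inv \<psi>\<^sub>3)"
  obtains c where "c \<noteq> 0" "\<And>x y z. \<forall>i. x $ i \<in> \<rat> \<Longrightarrow> \<forall>i. y $ i \<in> \<rat> \<Longrightarrow> \<forall>i. z $ i \<in> \<rat> \<Longrightarrow>
    conjugate (Phi222 \<Phi> (\<psi>\<^sub>1 *v x) (\<psi>\<^sub>2 *v y) (transpose (matrix_inv \<psi>\<^sub>3) *v z))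
      (c * Phi222 \<Phi> (\<psi>\<^sub>1 *v x) (\<psi>\<^sub>2 *v y) (transpose (matrix_inv \<psi>\<^sub>3) *v z))"
proof -
  define s where "s \<psi> = (\<chi> i j. \<sigma> (\<psi> $ i $ j))" for \<psi> :: "complex^4^4"
  have inv: "invertible \<psi>\<^sub>1" "invertible \<psi>\<^sub>2" "invertible \<psi>\<^sub>3" using psi by (auto simp: GL_def)
  have cs: "conjugate (\<psi> $ i $ j) (s \<psi> $ i $ j)" if "\<psi> \<in> GL (alg_cl k)" for \<psi> i j
    using that by (simp add: conjugate_def s_def GL_def mat_over_def)
  note inv_s = conjugate_matrix_inv(1)[OF inv(1) cs[OF psi(1)]] conjugate_matrix_inv(1)[OF inv(2) cs[OF psi(2)]]
    conjugate_matrix_inv(1)[OF inv(3) cs[OF psi(3)]]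
  define M\<^sub>3 where "M\<^sub>3 = s \<psi>\<^sub>3 ** matrix_inv \<psi>\<^sub>3"
  have "invertible (matrix_inv \<psi>\<^sub>3)" using matrix_inv_unique_field(1)[of "matrix_inv \<psi>\<^sub>3" \<psi>\<^sub>3] matrix_inv_mult[OF inv(3)] by simp
  then have invM: "invertible M\<^sub>3" unfolding M\<^sub>3_def using inv_s(3) by (simp add: invertible_mult)
  have mult: "s \<psi> = s \<psi> ** matrix_inv \<psi> ** \<psi>" if "invertible \<psi>" for \<psi>
  proof -
    have "s \<psi> ** matrix_inv \<psi> ** \<psi> = s \<psi> ** (matrix_inv \<psi> ** \<psi>)" by (simp only: matrix_mul_assoc)
    then show ?thesis by (simp add: matrix_inv_mult[OF that])
  qed
  have vec: "s \<psi> *v x = (s \<psi> ** matrix_inv \<psi>) *v (\<psi> *v x)" if "invertible \<psi>" for \<psi> x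
    using mult[OF that] by (simp add: matrix_vector_mul_assoc)
  have vec3: "transpose (matrix_inv (s \<psi>\<^sub>3)) *v z = transpose (matrix_inv M\<^sub>3) *v (transpose (matrix_inv \<psi>\<^sub>3) *v z)" for z
  proof -
    have "s \<psi>\<^sub>3 = M\<^sub>3 ** \<psi>\<^sub>3" using mult[OF inv(3)] by (simp add: M\<^sub>3_def)
    then have "transpose (matrix_inv (s \<psi>\<^sub>3)) = transpose (matrix_inv M\<^sub>3) ** transpose (matrix_inv \<psi>\<^sub>3)"
      by (simp only: matrix_inv_product[OF invM inv(3)] matrix_transpose_mul)
    then show ?thesis by (simp only: matrix_vector_mul_assoc)
  qed
  from flynn_translated[OF X M[folded s_def, folded M\<^sub>3_def] invM]
  obtain c1 where c1: "c1 \<noteq> 0" "\<And>x y z. Phi222 \<Phi> (s \<psi>\<^sub>1 ** matrix_inv \<psi>\<^sub>1 *v x) (s \<psi>\<^sub>2 ** matrix_inv \<psi>\<^sub>2 *v y) (transpose (matrix_inv M\<^sub>3) *v z) =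
    c1 * (\<Sum>A\<in>halves. quad (split_quadric A) x * quad (split_quadric A) y * quad (split_coquadric A) z)" by blast
  have "\<exists>c0. c0 \<noteq> 0 \<and> (\<forall>x y z. Phi222 \<Phi> x y z =
    c0 * (\<Sum>A\<in>halves. quad (split_quadric A) x * quad (split_quadric A) y * quad (split_coquadric A) z))"
  proof (rule flynn_expansion, goal_cases)
    case (1 c0)
    then show ?case by (intro exI[of _ c0]) simp
  qed
  then obtain c0 where "c0 \<noteq> 0 \<and> (\<forall>x y z. Phi222 \<Phi> x y z =
    c0 * (\<Sum>A\<in>halves. quad (split_quadric A) x * quad (split_quadric A) y * quad (split_coquadric A) z))" ..
  note c0 = conjunct1[OF this] conjunct2[OF this, rule_format]
  show thesis
  proof (rule that[of "c1 / c0"])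
    show "c1 / c0 \<noteq> 0" using c0 c1 by simp
    fix x y z :: "complex^4"
    assume rat: "\<forall>i. x $ i \<in> \<rat>" "\<forall>i. y $ i \<in> \<rat>" "\<forall>i. z $ i \<in> \<rat>"
    have "conjugate (Phi222 \<Phi> (\<psi>\<^sub>1 *v x) (\<psi>\<^sub>2 *v y) (transpose (matrix_inv \<psi>\<^sub>3) *v z))
      (Phi222 \<Phi> (s \<psi>\<^sub>1 *v x) (s \<psi>\<^sub>2 *v y) (transpose (matrix_inv (s \<psi>\<^sub>3)) *v z))"
    proof (intro conjugate_Phi222 conjugate_matrix_vector cs psi conjugate_rat)
      show "conjugate (transpose (matrix_inv \<psi>\<^sub>3) $ i $ j) (transpose (matrix_inv (s \<psi>\<^sub>3)) $ i $ j)" for i j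
        using conjugate_matrix_inv(2)[OF inv(3) cs[OF psi(3)]] by (simp add: transpose_def)
    qed (use rat in auto)
    also have "Phi222 \<Phi> (s \<psi>\<^sub>1 *v x) (s \<psi>\<^sub>2 *v y) (transpose (matrix_inv (s \<psi>\<^sub>3)) *v z) =
      c1 / c0 * Phi222 \<Phi> (\<psi>\<^sub>1 *v x) (\<psi>\<^sub>2 *v y) (transpose (matrix_inv \<psi>\<^sub>3) *v z)"
      unfolding vec[OF inv(1)] vec[OF inv(2)] vec3 c1(2) unfolding c0(2) using c0(1) by simp
    finally show "conjugate (Phi222 \<Phi> (\<psi>\<^sub>1 *v x) (\<psi>\<^sub>2 *v y) (transpose (matrix_inv \<psi>\<^sub>3) *v z))
      (c1 / c0 * Phi222 \<Phi> (\<psi>\<^sub>1 *v x) (\<psi>\<^sub>2 *v y) (transpose (matrix_inv \<psi>\<^sub>3) *v z))" .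
  qed
qed

end

context flynn
begin

text \<open>Each S carries its scalar a, and the dual of the third carries 1 / a3; the coefficient m
  undoes all three.\<close>

lemma twisted_expansion:
  assumes nz: "\<And>A. A \<in> halves \<Longrightarrow> a\<^sub>1 A \<noteq> 0" "\<And>A. A \<in> halves \<Longrightarrow> a\<^sub>2 A \<noteq> 0" "\<And>A. A \<in> halves \<Longrightarrow> a\<^sub>3 A \<noteq> 0"
    and S: "\<And>A. A \<in> halves \<Longrightarrow> S\<^sub>1 (part A) = msmult (a\<^sub>1 A) (transpose \<psi>\<^sub>1 ** split_quadric A ** \<psi>\<^sub>1)"
      "\<And>A. A \<in> halves \<Longrightarrow> S\<^sub>2 (part A) = msmult (a\<^sub>2 A) (transpose \<psi>\<^sub>2 ** split_quadric A ** \<psi>\<^sub>2)"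
      "\<And>A. A \<in> halves \<Longrightarrow> matrix_inv (S\<^sub>3 (part A)) = msmult (1 / a\<^sub>3 A) (matrix_inv \<psi>\<^sub>3 ** split_coquadric A ** transpose (matrix_inv \<psi>\<^sub>3))"
    and c0: "\<And>x y z. Phi222 \<Phi> x y z =
      c0 * (\<Sum>A\<in>halves. quad (split_quadric A) x * quad (split_quadric A) y * quad (split_coquadric A) z)"
    and m: "\<And>A. A \<in> halves \<Longrightarrow> m (part A) = c0 * a\<^sub>3 A / (a\<^sub>1 A * a\<^sub>2 A)"
  shows "Phi222 \<Phi> (\<psi>\<^sub>1 *v x) (\<psi>\<^sub>2 *v y) (transpose (matrix_inv \<psi>\<^sub>3) *v z) = trace_form f m S\<^sub>1 S\<^sub>2 S\<^sub>3 x y z"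
proof -
  have "trace_form f m S\<^sub>1 S\<^sub>2 S\<^sub>3 x y z =
    (\<Sum>A\<in>halves. m (part A) * quad (S\<^sub>1 (part A)) x * quad (S\<^sub>2 (part A)) y * quad (matrix_inv (S\<^sub>3 (part A))) z)"
    unfolding trace_form_def L10_trace_def by (rule sum.reindex_bij_betw[OF part_bij, symmetric])
  also have "\<dots> = (\<Sum>A\<in>halves. c0 * (quad (split_quadric A) (\<psi>\<^sub>1 *v x) * quad (split_quadric A) (\<psi>\<^sub>2 *v y) *
      quad (split_coquadric A) (transpose (matrix_inv \<psi>\<^sub>3) *v z)))"
  proof (rule sum.cong[OF refl])
    fix A assume A: "A \<in> halves"
    have q: "quad (matrix_inv \<psi>\<^sub>3 ** split_coquadric A ** transpose (matrix_inv \<psi>\<^sub>3)) z = quad (split_coquadric A) (transpose (matrix_inv \<psi>\<^sub>3) *v z)"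
      unfolding quad_substitute[of _ "transpose (matrix_inv \<psi>\<^sub>3)"] transpose_transpose ..
    show "m (part A) * quad (S\<^sub>1 (part A)) x * quad (S\<^sub>2 (part A)) y * quad (matrix_inv (S\<^sub>3 (part A))) z =
      c0 * (quad (split_quadric A) (\<psi>\<^sub>1 *v x) * quad (split_quadric A) (\<psi>\<^sub>2 *v y) *
      quad (split_coquadric A) (transpose (matrix_inv \<psi>\<^sub>3) *v z))"
      unfolding m[OF A] S(1)[OF A] S(2)[OF A] S(3)[OF A] quad_msmult q quad_substitute[symmetric]
      using nz[OF A] by simp
  qed
  finally show ?thesis unfolding c0[of "\<psi>\<^sub>1 *v x"] sum_distrib_left by (rule sym)
qed

end

lemma form22_scale:
  assumes "is_subfield K" "form22_over K B" "c \<in> K"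
  shows "form22_over K (\<lambda>x y. c * B x y)"
proof -
  obtain C where C: "\<And>a b c d. C a b c d \<in> K"
    "\<And>x y. B x y = (\<Sum>a\<in>UNIV. \<Sum>b\<in>UNIV. \<Sum>c\<in>UNIV. \<Sum>d\<in>UNIV. C a b c d * x$a * x$b * y$c * y$d)"
    using assms(2) unfolding form22_over_def by blast
  show ?thesis
    unfolding form22_over_def C(2) sum_distrib_left
    using C(1) assms by (intro exI[of _ "\<lambda>i j l m. c * C i j l m"]) (simp add: subfield_simps(4) mult.assoc)
qed

lemma form222_scale:
  assumes "is_subfield K" "form222_over K \<Psi>" "c \<in> K"
  shows "form222_over K (\<lambda>x y z. c * \<Psi> x y z)"
proof -
  obtain C where C: "\<And>i j. form22_over K (C i j)"
    "\<And>x y z. \<Psi> x y z = (\<Sum>i\<in>UNIV. \<Sum>j\<in>UNIV. C i j x y * z$i * z$j)"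
    using assms(2) unfolding form222_over_def by blast
  show ?thesis
    unfolding form222_over_def C(2) sum_distrib_left
    using form22_scale[OF assms(1) C(1) assms(3)]
    by (intro exI[of _ "\<lambda>i j x y. c * C i j x y"]) (simp add: mult.assoc)
qed

theorem theorem3p20:
  fixes k :: "complex set" and f :: "complex poly"
    and \<epsilon> \<eta> :: "((complex \<Rightarrow> complex) \<Rightarrow> divisor set) set"
    and H\<^sub>1 H\<^sub>2 H\<^sub>3 :: "complex^6^6"
    and \<alpha>\<^sub>1 \<alpha>\<^sub>2 \<alpha>\<^sub>3 :: "complex set set \<Rightarrow> complex"
    and S\<^sub>1 S\<^sub>2 S\<^sub>3 :: "complex set set \<Rightarrow> complex^4^4"
    and \<Phi> :: "4 \<Rightarrow> 4 \<Rightarrow> complex^4 \<Rightarrow> complex^4 \<Rightarrow> complex"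
    and \<psi>\<^sub>1 \<psi>\<^sub>2 \<psi>\<^sub>3 :: "complex^4^4"
  assumes "number_field k"
    and "poly_over k f" and "degree f = 6" and "squarefree f"
    and "\<epsilon> \<in> selmer2 k f" and "\<eta> \<in> selmer2 k f"
    and "model_represents k f H\<^sub>1 \<epsilon>"
    and "model_represents k f H\<^sub>2 \<eta>"
    and "model_represents k f H\<^sub>3 (\<epsilon> \<otimes>\<^bsub>H1 k f\<^esub> \<eta>)"
    and "factorisation k f H\<^sub>1 \<alpha>\<^sub>1 S\<^sub>1"
    and "factorisation k f H\<^sub>2 \<alpha>\<^sub>2 S\<^sub>2"
    and "factorisation k f H\<^sub>3 \<alpha>\<^sub>3 S\<^sub>3"
    and "flynn_forms k f \<Phi>"
    and "compatible_triple k f \<epsilon> \<eta> H\<^sub>1 H\<^sub>2 H\<^sub>3 \<psi>\<^sub>1 \<psi>\<^sub>2 \<psi>\<^sub>3"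
  shows "\<exists>s \<mu>. s \<in> k - {0} \<and> \<mu> \<in> L10_units k f \<and>
     (\<forall>\<gamma>\<in>partitions f. \<alpha>\<^sub>1 \<gamma> * \<alpha>\<^sub>2 \<gamma> / \<alpha>\<^sub>3 \<gamma> = s * (\<mu> \<gamma>)^2) \<and>
     twisted_222_forms k \<Phi> \<psi>\<^sub>1 \<psi>\<^sub>2 \<psi>\<^sub>3 =
       {\<lambda>x y z. c * trace_form f \<mu> S\<^sub>1 S\<^sub>2 S\<^sub>3 x y z | c. c \<in> k - {0}}"
proof -
  interpret flynn f k \<Phi> by unfold_locales (fact assms)+
  have galI: "flynn_galois f k \<Phi> \<sigma>" if "\<sigma> \<in> gal k" for \<sigma>
    using that assms(1,2) by unfold_locales auto
  have H1: "\<epsilon> \<in> carrier (H1 k f)" "\<eta> \<in> carrier (H1 k f)" using assms(5,6) by (auto simp: selmer2_def)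
  have model: "is_model k f H\<^sub>1" "is_model k f H\<^sub>2" "is_model k f H\<^sub>3"
    using assms(7-9) by (simp_all add: model_represents_def)
  obtain e h g where ehg: "e \<in> \<epsilon>" "h \<in> \<eta>" "g \<in> \<epsilon> \<otimes>\<^bsub>H1 k f\<^esub> \<eta>" "twisted_law_rational k f e h g"
    "psi_compatible k f H\<^sub>1 e \<psi>\<^sub>1" "psi_compatible k f H\<^sub>2 h \<psi>\<^sub>2" "psi_compatible k f H\<^sub>3 g \<psi>\<^sub>3"
    using assms(14) unfolding compatible_triple_def by blast
  obtain a\<^sub>1 \<kappa>\<^sub>1 where d1: "\<psi>\<^sub>1 \<in> GL (alg_cl k)" "\<kappa>\<^sub>1 \<in> alg_cl k" "\<kappa>\<^sub>1 \<noteq> 0"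
    "\<And>A. A \<in> halves \<Longrightarrow> a\<^sub>1 A \<in> alg_cl k \<and> a\<^sub>1 A \<noteq> 0 \<and> \<alpha>\<^sub>1 (part A) * (a\<^sub>1 A)^2 = \<kappa>\<^sub>1"
    "\<And>A. A \<in> halves \<Longrightarrow> S\<^sub>1 (part A) = msmult (a\<^sub>1 A) (transpose \<psi>\<^sub>1 ** split_quadric A ** \<psi>\<^sub>1)"
    "\<And>A. A \<in> halves \<Longrightarrow> matrix_inv (S\<^sub>1 (part A)) = msmult (1 / a\<^sub>1 A) (matrix_inv \<psi>\<^sub>1 ** split_coquadric A ** transpose (matrix_inv \<psi>\<^sub>1))"
    by (rule factorisation_data[OF model(1) assms(10) ehg(5)]) (rule that; assumption)
  obtain a\<^sub>2 \<kappa>\<^sub>2 where d2: "\<psi>\<^sub>2 \<in> GL (alg_cl k)" "\<kappa>\<^sub>2 \<in> alg_cl k" "\<kappa>\<^sub>2 \<noteq> 0"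
    "\<And>A. A \<in> halves \<Longrightarrow> a\<^sub>2 A \<in> alg_cl k \<and> a\<^sub>2 A \<noteq> 0 \<and> \<alpha>\<^sub>2 (part A) * (a\<^sub>2 A)^2 = \<kappa>\<^sub>2"
    "\<And>A. A \<in> halves \<Longrightarrow> S\<^sub>2 (part A) = msmult (a\<^sub>2 A) (transpose \<psi>\<^sub>2 ** split_quadric A ** \<psi>\<^sub>2)"
    "\<And>A. A \<in> halves \<Longrightarrow> matrix_inv (S\<^sub>2 (part A)) = msmult (1 / a\<^sub>2 A) (matrix_inv \<psi>\<^sub>2 ** split_coquadric A ** transpose (matrix_inv \<psi>\<^sub>2))"
    by (rule factorisation_data[OF model(2) assms(11) ehg(6)]) (rule that; assumption)
  obtain a\<^sub>3 \<kappa>\<^sub>3 where d3: "\<psi>\<^sub>3 \<in> GL (alg_cl k)" "\<kappa>\<^sub>3 \<in> alg_cl k" "\<kappa>\<^sub>3 \<noteq> 0"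
    "\<And>A. A \<in> halves \<Longrightarrow> a\<^sub>3 A \<in> alg_cl k \<and> a\<^sub>3 A \<noteq> 0 \<and> \<alpha>\<^sub>3 (part A) * (a\<^sub>3 A)^2 = \<kappa>\<^sub>3"
    "\<And>A. A \<in> halves \<Longrightarrow> S\<^sub>3 (part A) = msmult (a\<^sub>3 A) (transpose \<psi>\<^sub>3 ** split_quadric A ** \<psi>\<^sub>3)"
    "\<And>A. A \<in> halves \<Longrightarrow> matrix_inv (S\<^sub>3 (part A)) = msmult (1 / a\<^sub>3 A) (matrix_inv \<psi>\<^sub>3 ** split_coquadric A ** transpose (matrix_inv \<psi>\<^sub>3))"
    by (rule factorisation_data[OF model(3) assms(12) ehg(7)]) (rule that; assumption)
  have nz1: "a\<^sub>1 A \<noteq> 0" and nz2: "a\<^sub>2 A \<noteq> 0" and nz3: "a\<^sub>3 A \<noteq> 0" if "A \<in> halves" for A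
    using d1(4)[OF that] d2(4)[OF that] d3(4)[OF that] by auto
  have bases: "apolar_basis (partitions f) S\<^sub>1 (\<lambda>\<gamma>. matrix_inv (S\<^sub>1 \<gamma>))" "apolar_basis (partitions f) S\<^sub>2 (\<lambda>\<gamma>. matrix_inv (S\<^sub>2 \<gamma>))"
    "apolar_basis (partitions f) (\<lambda>\<gamma>. matrix_inv (S\<^sub>3 \<gamma>)) S\<^sub>3"
    using factorisation_basis[OF d1(1) nz1 d1(5,6)] factorisation_basis[OF d2(1) nz2 d2(5,6)]
      apolar_basis.dual_basis[OF factorisation_basis[OF d3(1) nz3 d3(5,6)]] by auto
  obtain c0 where c0: "c0 \<noteq> 0" "c0 \<in> alg_cl k" "\<And>x y z. Phi222 \<Phi> x y z =
    c0 * (\<Sum>A\<in>halves. quad (split_quadric A) x * quad (split_quadric A) y * quad (split_coquadric A) z)"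
    by (rule flynn_expansion) (rule that; assumption)
  define r where "r = the_inv_into halves part"
  have r: "r (part A) = A" if "A \<in> halves" for A
    unfolding r_def using part_bij that by (simp add: bij_betw_def the_inv_into_f_f)
  have partE: "\<exists>A\<in>halves. \<gamma> = part A" if "\<gamma> \<in> partitions f" for \<gamma>
    using that part_bij by (auto simp: bij_betw_def)
  have part_mem: "part A \<in> partitions f" if "A \<in> halves" for A using that part_bij by (auto simp: bij_betw_def)
  define m where "m \<gamma> = c0 * a\<^sub>3 (r \<gamma>) / (a\<^sub>1 (r \<gamma>) * a\<^sub>2 (r \<gamma>))" for \<gamma>
  have m: "m (part A) = c0 * a\<^sub>3 A / (a\<^sub>1 A * a\<^sub>2 A)" if "A \<in> halves" for A using r[OF that] by (simp add: m_def)
  have m_mem: "m \<gamma> \<in> alg_cl k" and m_nz: "m \<gamma> \<noteq> 0" if \<gamma>: "\<gamma> \<in> partitions f" for \<gamma>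
  proof -
    obtain A where A: "A \<in> halves" "\<gamma> = part A" using partE[OF \<gamma>] by blast
    show "m \<gamma> \<in> alg_cl k" unfolding A(2) m[OF A(1)]
      using d1(4)[OF A(1)] d2(4)[OF A(1)] d3(4)[OF A(1)] c0(2) by (auto intro!: subfield_simps(4,7)[OF closure])
    show "m \<gamma> \<noteq> 0" unfolding A(2) m[OF A(1)] using nz1[OF A(1)] nz2[OF A(1)] nz3[OF A(1)] c0(1) by simp
  qed
  define \<Theta> where "\<Theta> x y z = Phi222 \<Phi> (\<psi>\<^sub>1 *v x) (\<psi>\<^sub>2 *v y) (transpose (matrix_inv \<psi>\<^sub>3) *v z)" for x y z
  have \<Theta>: "\<Theta> x y z = trace_form f m S\<^sub>1 S\<^sub>2 S\<^sub>3 x y z" for x y z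
    unfolding \<Theta>_def by (rule twisted_expansion[OF nz1 nz2 nz3 d1(5) d2(5) d3(6) c0(3) m])
  have S: "L10_form k f S\<^sub>1" "L10_form k f S\<^sub>2" "L10_form k f S\<^sub>3"
    using assms(10-12) by (simp_all add: factorisation_def)
  have invS3: "invertible (S\<^sub>3 \<gamma>)" if \<gamma>: "\<gamma> \<in> partitions f" for \<gamma>
  proof -
    obtain A where A: "A \<in> halves" "\<gamma> = part A" using partE[OF \<gamma>] by blast
    have "det (split_quadric A) \<noteq> 0"
      using matrix_inv_unique_field(1)[OF split_quadric_inverse] halvesD A(1) by (simp add: invertible_det_nz)
    moreover have "det \<psi>\<^sub>3 \<noteq> 0" using d3(1) by (simp add: GL_def invertible_det_nz)
    moreover have "det (msmult c M) = c^4 * det M" for c and M :: "complex^4^4"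
    proof -
      have "msmult c M = mat c ** M" by (simp add: vec_eq_iff msmult_nth matrix_matrix_mult_def mat_def if_distrib[of "\<lambda>x. x * _"] cong: if_cong)
      moreover have "det (mat c :: complex^4^4) = c^4" by (simp add: det_4 mat_def power4_eq_xxxx)
      ultimately show ?thesis by (simp add: det_mul)
    qed
    ultimately show ?thesis unfolding A(2) d3(5)[OF A(1)] using nz3[OF A(1)] by (simp add: invertible_det_nz det_mul)
  qed
  \<comment> \<open>The products of the three families are independent already at rational
    arguments, and no coefficient m vanishes.\<close>
  have "\<exists>x y z. (\<forall>i. x $ i \<in> \<rat>) \<and> (\<forall>i. y $ i \<in> \<rat>) \<and> (\<forall>i. z $ i \<in> \<rat>) \<and> \<Theta> x y z \<noteq> 0"
  proof (rule ccontr)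
    assume "\<not> ?thesis"
    then have "\<Theta> x y z = 0" if "\<forall>i. x $ i \<in> \<rat>" "\<forall>i. y $ i \<in> \<rat>" "\<forall>i. z $ i \<in> \<rat>" for x y z
      using that by blast
    then have "(\<Sum>\<gamma>\<in>partitions f. m \<gamma> * quad (S\<^sub>1 \<gamma>) x * quad (S\<^sub>2 \<gamma>) y * quad (matrix_inv (S\<^sub>3 \<gamma>)) z) = 0"
      if "\<forall>i. x $ i \<in> \<rat>" "\<forall>i. y $ i \<in> \<rat>" "\<forall>i. z $ i \<in> \<rat>" for x y z
      using that \<Theta>[of x y z] by (simp add: trace_form_def L10_trace_def)
    then have "m \<gamma> = 0" if "\<gamma> \<in> partitions f" for \<gamma>
      using triple_independent[OF bases _ that, of m] by blast
    moreover obtain A where "A \<in> halves" using card_halves by fastforce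
    ultimately show False using m_nz part_mem by blast
  qed
  then obtain x0 y0 z0 where pt: "\<forall>i. x0 $ i \<in> \<rat>" "\<forall>i. y0 $ i \<in> \<rat>" "\<forall>i. z0 $ i \<in> \<rat>" "\<Theta> x0 y0 z0 \<noteq> 0" by blast
  \<comment> \<open>Conjugation multiplies the whole form, hence both N and the family m, by the
    same unknown c; the quotient m / N is free of it.\<close>
  define N where "N = \<Theta> x0 y0 z0"
  have N: "N \<noteq> 0" using pt by (simp add: N_def)
  define \<mu> where "\<mu> = (\<lambda>\<gamma>\<in>partitions f. m \<gamma> / N)"
  have \<mu>: "\<mu> \<gamma> = m \<gamma> / N" if "\<gamma> \<in> partitions f" for \<gamma> using that by (simp add: \<mu>_def)
  have tf: "trace_form f \<mu> S\<^sub>1 S\<^sub>2 S\<^sub>3 x y z = \<Theta> x y z / N" for x y z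
    unfolding \<Theta> trace_form_def L10_trace_def sum_divide_distrib by (intro sum.cong refl) (simp add: \<mu>)
  have twist: "\<exists>c. c \<noteq> 0 \<and> galois.conjugate k \<sigma> N (c * N) \<and>
      (\<forall>\<gamma>\<in>partitions f. galois.conjugate k \<sigma> (m \<gamma>) (c * m ((`) ((`) \<sigma>) \<gamma>)))" if \<sigma>: "\<sigma> \<in> gal k" for \<sigma>
  proof -
    interpret G: flynn_galois f k \<Phi> \<sigma> by (rule galI[OF \<sigma>])
    obtain X where X: "X \<in> Div0 f (alg_cl k)" "e \<sigma> = cl X" "X + X \<in> principal_divs f"
      using G.cocycle_class_torsion[OF H1(1) ehg(1)] by blast
    obtain Y where Y: "Y \<in> Div0 f (alg_cl k)" "h \<sigma> = cl Y" "Y + Y \<in> principal_divs f"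
      using G.cocycle_class_torsion[OF H1(2) ehg(2)] by blast
    obtain Z where Z: "Z \<in> Div0 f (alg_cl k)" "g \<sigma> = cl Z" "Z + Z \<in> principal_divs f"
      using G.product_class_torsion[OF H1 ehg(3)] by blast
    have XYZ: "X + Y - Z \<in> principal_divs f"
      by (rule G.twisted_law_sum[OF H1(1) \<sigma> ehg(4) X(1) Y(1) Z(1) X(2) Y(2) Z(2)])
    have M: "acts_as_translation k f (cl X) ((\<chi> i j. \<sigma> (\<psi>\<^sub>1 $ i $ j)) ** matrix_inv \<psi>\<^sub>1)"
      "acts_as_translation k f (cl Y) ((\<chi> i j. \<sigma> (\<psi>\<^sub>2 $ i $ j)) ** matrix_inv \<psi>\<^sub>2)"
      "acts_as_translation k f (cl Z) ((\<chi> i j. \<sigma> (\<psi>\<^sub>3 $ i $ j)) ** matrix_inv \<psi>\<^sub>3)"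
      using ehg(5-7) \<sigma> unfolding psi_compatible_def X(2)[symmetric] Y(2)[symmetric] Z(2)[symmetric] by blast+
    obtain c where c: "c \<noteq> 0" "\<And>x y z. \<forall>i. x $ i \<in> \<rat> \<Longrightarrow> \<forall>i. y $ i \<in> \<rat> \<Longrightarrow> \<forall>i. z $ i \<in> \<rat> \<Longrightarrow>
        G.conjugate (\<Theta> x y z) (c * \<Theta> x y z)"
      unfolding \<Theta>_def
    proof (rule G.twisted_form_conj[OF X(1) Y(1) Z(1) Y(3) XYZ d1(1) d2(1) d3(1) M], goal_cases)
      case (1 c)
      show ?case by (rule 1(1)[OF 1(2)]) (rule 1(3); assumption)
    qed
    define gs where "gs = (`) ((`) \<sigma>)"
    have bij: "bij_betw gs (partitions f) (partitions f)" unfolding gs_def by (rule G.partitions_bij)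
    have gs_mem: "gs \<gamma> \<in> partitions f" if "\<gamma> \<in> partitions f" for \<gamma> using bij that by (rule bij_betw_apply)
    define b where "b = the_inv_into (partitions f) gs"
    have b: "b \<gamma> \<in> partitions f" "gs (b \<gamma>) = \<gamma>" "b (gs \<gamma>) = \<gamma>" if "\<gamma> \<in> partitions f" for \<gamma>
      using bij that unfolding b_def bij_betw_def
      by (auto simp: f_the_inv_into_f the_inv_into_f_f intro: the_inv_into_into[of gs "partitions f"])
    \<comment> \<open>The difference between the coefficients of the conjugated form, re-indexed by
      the permutation of the partitions, and those of c times the form. Independence makes it
      vanish.\<close>
    define d where "d \<gamma> = \<sigma> (m (b \<gamma>)) - c * m \<gamma>" for \<gamma>
    have "d \<gamma> = 0" if \<gamma>: "\<gamma> \<in> partitions f" for \<gamma>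
    proof (rule triple_independent[OF bases _ \<gamma>])
      fix x y z :: "complex^4"
      assume rat: "\<forall>i. x $ i \<in> \<rat>" "\<forall>i. y $ i \<in> \<rat>" "\<forall>i. z $ i \<in> \<rat>"
      define t where "t \<gamma> = quad (S\<^sub>1 \<gamma>) x * quad (S\<^sub>2 \<gamma>) y * quad (matrix_inv (S\<^sub>3 \<gamma>)) z" for \<gamma>
      have t: "G.conjugate (t \<gamma>) (t (gs \<gamma>))" if \<gamma>: "\<gamma> \<in> partitions f" for \<gamma>
        unfolding t_def gs_def
      proof (intro G.conjugate_mult G.conjugate_quad G.L10_form_conj[OF S(1) \<gamma>] G.L10_form_conj[OF S(2) \<gamma>]
          G.conjugate_matrix_inv(2)[OF invS3[OF \<gamma>] G.L10_form_conj[OF S(3) \<gamma>]] G.conjugate_rat)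
      qed (use rat in auto)
      have \<Theta>t: "\<Theta> x y z = (\<Sum>\<gamma>\<in>partitions f. m \<gamma> * t \<gamma>)"
        unfolding \<Theta> trace_form_def L10_trace_def t_def by (simp only: mult.assoc)
      have "G.conjugate (\<Theta> x y z) (\<Sum>\<gamma>\<in>partitions f. \<sigma> (m \<gamma>) * t (gs \<gamma>))"
        unfolding \<Theta>t by (intro G.conjugate_sum G.conjugate_mult t) (auto simp: G.conjugate_def m_mem)
      also have "(\<Sum>\<gamma>\<in>partitions f. \<sigma> (m \<gamma>) * t (gs \<gamma>)) = (\<Sum>\<gamma>\<in>partitions f. \<sigma> (m (b (gs \<gamma>))) * t (gs \<gamma>))"
        by (intro sum.cong refl) (simp add: b)
      also have "\<dots> = (\<Sum>\<gamma>\<in>partitions f. \<sigma> (m (b \<gamma>)) * t \<gamma>)"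
        by (rule sum.reindex_bij_betw[OF bij])
      finally have "(\<Sum>\<gamma>\<in>partitions f. \<sigma> (m (b \<gamma>)) * t \<gamma>) = c * (\<Sum>\<gamma>\<in>partitions f. m \<gamma> * t \<gamma>)"
        using c(2)[OF rat] by (simp add: G.conjugate_def \<Theta>t)
      then have "(\<Sum>\<gamma>\<in>partitions f. d \<gamma> * t \<gamma>) = 0"
        by (simp add: d_def left_diff_distrib sum_subtractf sum_distrib_left mult.assoc)
      then show "(\<Sum>\<gamma>\<in>partitions f. d \<gamma> * quad (S\<^sub>1 \<gamma>) x * quad (S\<^sub>2 \<gamma>) y * quad (matrix_inv (S\<^sub>3 \<gamma>)) z) = 0"
        by (simp only: t_def mult.assoc)
    qed
    then have dz: "\<sigma> (m (b \<gamma>)) = c * m \<gamma>" if "\<gamma> \<in> partitions f" for \<gamma>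
      using that by (simp add: d_def)
    have "\<sigma> (m \<gamma>) = c * m (gs \<gamma>)" if "\<gamma> \<in> partitions f" for \<gamma>
      using dz[OF gs_mem[OF that]] by (simp only: b(3)[OF that])
    then have "\<forall>\<gamma>\<in>partitions f. G.conjugate (m \<gamma>) (c * m (gs \<gamma>))" by (simp add: G.conjugate_def m_mem)
    then show ?thesis using c(1) c(2)[OF pt(1-3)] unfolding N_def gs_def by blast
  qed
  have \<mu>_mem: "\<mu> \<gamma> \<in> alg_cl k" if \<gamma>: "\<gamma> \<in> partitions f" for \<gamma>
  proof -
    \<comment> \<open>The identity automorphism is used only because conjugacy includes membership
      of N in the closure.\<close>
    have "restrict (\<lambda>x. x) (alg_cl k) \<in> gal k"
      using subfield_simps[OF closure] ground_subset by (auto simp: gal_def bij_betw_def inj_on_def)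
    then interpret G: flynn_galois f k \<Phi> "restrict (\<lambda>x. x) (alg_cl k)" by (rule galI)
    have "N \<in> alg_cl k" using twist[OF G.\<sigma>] by (auto simp: G.conjugate_def)
    then show ?thesis using m_mem[OF \<gamma>] subfield_simps(7)[OF closure] by (simp add: \<mu>[OF \<gamma>])
  qed
  have \<mu>_conj: "galois.conjugate k \<sigma> (\<mu> \<gamma>) (\<mu> ((`) ((`) \<sigma>) \<gamma>))" if \<sigma>: "\<sigma> \<in> gal k" and \<gamma>: "\<gamma> \<in> partitions f" for \<sigma> \<gamma>
  proof -
    interpret G: flynn_galois f k \<Phi> \<sigma> by (rule galI[OF \<sigma>])
    obtain c where c: "c \<noteq> 0" "G.conjugate N (c * N)" "G.conjugate (m \<gamma>) (c * m ((`) ((`) \<sigma>) \<gamma>))"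
      using twist[OF \<sigma>] \<gamma> by blast
    have "(`) ((`) \<sigma>) \<gamma> \<in> partitions f" using G.partitions_bij \<gamma> by (rule bij_betw_apply)
    then show ?thesis using G.conjugate_divide[OF c(3,2)] c(1) \<gamma> by (simp add: \<mu>)
  qed
  have \<mu>_units: "\<mu> \<in> L10_units k f"
  proof -
    have "\<mu> ((`) ((`) \<sigma>) \<gamma>) = \<sigma> (\<mu> \<gamma>)" if \<sigma>: "\<sigma> \<in> gal k" and \<gamma>: "\<gamma> \<in> partitions f" for \<sigma> \<gamma>
    proof -
      interpret G: flynn_galois f k \<Phi> \<sigma> by (rule galI[OF \<sigma>])
      show ?thesis using \<mu>_conj[OF \<sigma> \<gamma>] by (simp add: G.conjugate_def)
    qed
    moreover have "\<mu> \<in> partitions f \<rightarrow>\<^sub>E alg_cl k"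
    proof (rule PiE_I)
      show "\<mu> \<gamma> \<in> alg_cl k" if "\<gamma> \<in> partitions f" for \<gamma> by (rule \<mu>_mem[OF that])
    qed (simp add: \<mu>_def)
    moreover have "\<mu> \<gamma> \<noteq> 0" if "\<gamma> \<in> partitions f" for \<gamma> using m_nz[OF that] N by (simp add: \<mu>[OF that])
    ultimately show ?thesis by (simp add: L10_units_def L10_def)
  qed
  \<comment> \<open>Since alpha_i = kappa_i / a_i^2 and a3 / (a1 a2) = N mu / c0, this is the
    constant left in alpha1 alpha2 / alpha3 after dividing by mu^2.\<close>
  define s where "s = \<kappa>\<^sub>1 * \<kappa>\<^sub>2 / \<kappa>\<^sub>3 * (N / c0)^2"
  have s: "\<alpha>\<^sub>1 \<gamma> * \<alpha>\<^sub>2 \<gamma> / \<alpha>\<^sub>3 \<gamma> = s * (\<mu> \<gamma>)^2" if \<gamma>: "\<gamma> \<in> partitions f" for \<gamma>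
  proof -
    obtain A where A: "A \<in> halves" "\<gamma> = part A" using partE[OF \<gamma>] by blast
    have al: "\<alpha>\<^sub>1 \<gamma> = \<kappa>\<^sub>1 / (a\<^sub>1 A)^2" "\<alpha>\<^sub>2 \<gamma> = \<kappa>\<^sub>2 / (a\<^sub>2 A)^2" "\<alpha>\<^sub>3 \<gamma> = \<kappa>\<^sub>3 / (a\<^sub>3 A)^2"
      using d1(4)[OF A(1)] d2(4)[OF A(1)] d3(4)[OF A(1)] by (auto simp: A(2) field_simps)
    have mu: "\<mu> \<gamma> = c0 * a\<^sub>3 A / (a\<^sub>1 A * a\<^sub>2 A) / N" unfolding \<mu>[OF \<gamma>] unfolding A(2) m[OF A(1)] ..
    show ?thesis
      unfolding al mu s_def
      using nz1[OF A(1)] nz2[OF A(1)] nz3[OF A(1)] c0(1) N d3(3) by (simp add: field_simps power2_eq_square)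
  qed
  have s_nz: "s \<noteq> 0" using d1(3) d2(3) d3(3) N c0(1) by (simp add: s_def)
  obtain \<gamma>0 where \<gamma>0: "\<gamma>0 \<in> partitions f"
  proof -
    obtain A where "A \<in> halves" using card_halves by fastforce
    then show thesis using that part_mem by blast
  qed
  have \<alpha>: "\<alpha>\<^sub>1 \<in> L10_units k f" "\<alpha>\<^sub>2 \<in> L10_units k f" "\<alpha>\<^sub>3 \<in> L10_units k f"
    using assms(10-12) by (simp_all add: factorisation_def)
  have s_eq: "s = \<alpha>\<^sub>1 \<gamma> * \<alpha>\<^sub>2 \<gamma> / \<alpha>\<^sub>3 \<gamma> / (\<mu> \<gamma> * \<mu> \<gamma>)" if "\<gamma> \<in> partitions f" for \<gamma>
    using s[OF that] \<mu>_units that by (simp add: L10_units_def power2_eq_square)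
  have s_k: "s \<in> k"
  proof (rule gal_fixed_field[OF nf])
    have "\<alpha>\<^sub>1 \<gamma>0 \<in> alg_cl k" "\<alpha>\<^sub>2 \<gamma>0 \<in> alg_cl k" "\<alpha>\<^sub>3 \<gamma>0 \<in> alg_cl k"
      using \<alpha> \<gamma>0 by (auto simp: L10_units_def L10_def)
    then show "s \<in> alg_cl k"
      unfolding s_eq[OF \<gamma>0] using \<mu>_mem[OF \<gamma>0] by (intro subfield_simps(4,7)[OF closure])
  next
    fix \<sigma> assume \<sigma>: "\<sigma> \<in> gal k"
    interpret G: flynn_galois f k \<Phi> \<sigma> by (rule galI[OF \<sigma>])
    define \<delta> where "\<delta> = (`) ((`) \<sigma>) \<gamma>0"
    have \<delta>: "\<delta> \<in> partitions f" unfolding \<delta>_def using G.partitions_bij \<gamma>0 by (rule bij_betw_apply)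
    have \<alpha>': "\<alpha>\<^sub>1 \<in> L10 k f" "\<alpha>\<^sub>2 \<in> L10 k f" "\<alpha>\<^sub>3 \<in> L10 k f" using \<alpha> by (simp_all add: L10_units_def)
    \<comment> \<open>Sigma moves the partition, but the quotient has the value s at every
      partition; so s is fixed and lies in k.\<close>
    have "G.conjugate (\<alpha>\<^sub>1 \<gamma>0 * \<alpha>\<^sub>2 \<gamma>0 / \<alpha>\<^sub>3 \<gamma>0 / (\<mu> \<gamma>0 * \<mu> \<gamma>0)) (\<alpha>\<^sub>1 \<delta> * \<alpha>\<^sub>2 \<delta> / \<alpha>\<^sub>3 \<delta> / (\<mu> \<delta> * \<mu> \<delta>))"
      unfolding \<delta>_def by (intro G.conjugate_divide G.conjugate_mult G.L10_conj \<alpha>' \<gamma>0 \<mu>_conj \<sigma>)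
    then show "\<sigma> s = s" unfolding s_eq[OF \<gamma>0, symmetric] s_eq[OF \<delta>, symmetric] by (simp add: G.conjugate_def)
  qed
  have form: "form222_over k (trace_form f \<mu> S\<^sub>1 S\<^sub>2 S\<^sub>3)"
  proof -
    have "form222_over k (\<lambda>x y z. \<Sum>\<gamma>\<in>partitions f. \<mu> \<gamma> * quad (S\<^sub>1 \<gamma>) x * quad (S\<^sub>2 \<gamma>) y * quad (matrix_inv (S\<^sub>3 \<gamma>)) z)"
    proof (rule triple_quad_form222, rule gal_fixed_field[OF nf])
      fix a b c d i j :: 4
      define F where "F \<gamma> = \<mu> \<gamma> * S\<^sub>1 \<gamma> $ a $ b * S\<^sub>2 \<gamma> $ c $ d * matrix_inv (S\<^sub>3 \<gamma>) $ i $ j" for \<gamma>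
      have conjugate: "galois.conjugate k \<sigma> ((\<Sum>\<gamma>\<in>partitions f. F \<gamma>) / 8) ((\<Sum>\<gamma>\<in>partitions f. F \<gamma>) / 8)" if \<sigma>: "\<sigma> \<in> gal k" for \<sigma>
      proof -
        interpret G: flynn_galois f k \<Phi> \<sigma> by (rule galI[OF \<sigma>])
        have "G.conjugate (F \<gamma>) (F ((`) ((`) \<sigma>) \<gamma>))" if \<gamma>: "\<gamma> \<in> partitions f" for \<gamma>
          unfolding F_def by (intro G.conjugate_mult \<mu>_conj[OF \<sigma> \<gamma>] G.L10_form_conj[OF S(1) \<gamma>] G.L10_form_conj[OF S(2) \<gamma>]
            G.conjugate_matrix_inv(2)[OF invS3[OF \<gamma>] G.L10_form_conj[OF S(3) \<gamma>]])
        then have "G.conjugate ((\<Sum>\<gamma>\<in>partitions f. F \<gamma>) / 8) ((\<Sum>\<gamma>\<in>partitions f. F ((`) ((`) \<sigma>) \<gamma>)) / 8)"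
          by (intro G.conjugate_divide G.conjugate_sum G.conjugate_rat) auto
        then show ?thesis unfolding sum.reindex_bij_betw[OF G.partitions_bij] .
      qed
      have "restrict (\<lambda>x. x) (alg_cl k) \<in> gal k"
        using subfield_simps[OF closure] ground_subset by (auto simp: gal_def bij_betw_def inj_on_def)
      then interpret G: flynn_galois f k \<Phi> "restrict (\<lambda>x. x) (alg_cl k)" by (rule galI)
      show "(\<Sum>\<gamma>\<in>partitions f. \<mu> \<gamma> * S\<^sub>1 \<gamma> $ a $ b * S\<^sub>2 \<gamma> $ c $ d * matrix_inv (S\<^sub>3 \<gamma>) $ i $ j) / 8 \<in> alg_cl k"
        using conjugate[OF G.\<sigma>] by (simp add: G.conjugate_def F_def)
      show "\<sigma> ((\<Sum>\<gamma>\<in>partitions f. \<mu> \<gamma> * S\<^sub>1 \<gamma> $ a $ b * S\<^sub>2 \<gamma> $ c $ d * matrix_inv (S\<^sub>3 \<gamma>) $ i $ j) / 8) =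
        (\<Sum>\<gamma>\<in>partitions f. \<mu> \<gamma> * S\<^sub>1 \<gamma> $ a $ b * S\<^sub>2 \<gamma> $ c $ d * matrix_inv (S\<^sub>3 \<gamma>) $ i $ j) / 8" if \<sigma>: "\<sigma> \<in> gal k" for \<sigma>
      proof -
        interpret G': flynn_galois f k \<Phi> \<sigma> by (rule galI[OF \<sigma>])
        show ?thesis using conjugate[OF \<sigma>] by (simp add: G'.conjugate_def F_def)
      qed
    qed
    then show ?thesis by (simp add: trace_form_def[abs_def] L10_trace_def)
  qed
  have rat_k: "\<forall>i. x $ i \<in> \<rat> \<Longrightarrow> x $ i \<in> k" for x :: "complex^4" and i using rat_in_number_field[OF ground] by blast
  have "twisted_222_forms k \<Phi> \<psi>\<^sub>1 \<psi>\<^sub>2 \<psi>\<^sub>3 = {\<lambda>x y z. c * trace_form f \<mu> S\<^sub>1 S\<^sub>2 S\<^sub>3 x y z | c. c \<in> k - {0}}"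
  proof (intro equalityI subsetI)
    fix \<Psi> assume "\<Psi> \<in> twisted_222_forms k \<Phi> \<psi>\<^sub>1 \<psi>\<^sub>2 \<psi>\<^sub>3"
    then obtain c where c: "form222_over k \<Psi>" "c \<noteq> 0" "\<And>x y z. \<Psi> x y z = c * \<Theta> x y z"
      unfolding twisted_222_forms_def \<Theta>_def by blast
    \<comment> \<open>A form over k takes a value in k at the rational point, and this value is c N,
      the scalar relative to the normalised trace form.\<close>
    have "\<Psi> x0 y0 z0 \<in> k" using form222_value[OF ground c(1)] rat_k pt by blast
    then have "c * N \<in> k - {0}" using c(2,3) N by (simp add: N_def)
    moreover have "\<Psi> = (\<lambda>x y z. c * N * trace_form f \<mu> S\<^sub>1 S\<^sub>2 S\<^sub>3 x y z)"
      using N by (simp add: fun_eq_iff c(3) tf)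
    ultimately show "\<Psi> \<in> {\<lambda>x y z. c * trace_form f \<mu> S\<^sub>1 S\<^sub>2 S\<^sub>3 x y z | c. c \<in> k - {0}}" by blast
  next
    fix \<Psi> assume "\<Psi> \<in> {\<lambda>x y z. c * trace_form f \<mu> S\<^sub>1 S\<^sub>2 S\<^sub>3 x y z | c. c \<in> k - {0}}"
    then obtain c where c: "c \<in> k" "c \<noteq> 0" "\<Psi> = (\<lambda>x y z. c * trace_form f \<mu> S\<^sub>1 S\<^sub>2 S\<^sub>3 x y z)" by blast
    have "form222_over k \<Psi>" unfolding c(3) by (rule form222_scale[OF ground form c(1)])
    moreover have "\<Psi> x y z = c / N * \<Theta> x y z" for x y z by (simp add: c(3) tf)
    moreover have "c / N \<noteq> 0" using c N by simp
    ultimately show "\<Psi> \<in> twisted_222_forms k \<Phi> \<psi>\<^sub>1 \<psi>\<^sub>2 \<psi>\<^sub>3"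
      unfolding twisted_222_forms_def \<Theta>_def[symmetric] by blast
  qed
  then show ?thesis using s_k s_nz \<mu>_units s by blast
qed

end
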